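(* Let $d',d''\in\mathbb{N}$, $d=d'+d''$, $\gamma=(\gamma',\gamma'')\in[0,\infty)^{d'}\times[0,\infty)^{d''}$ and $z'=(z_1,\dots,z_{d'})\in\mathbf T^{(d')}$. The modified fractional power of the partial Hankel–Clifford transform $\mathcal{J}^{(d')}_{z',\gamma'}$ is a topological isomorphism on $\mathcal{S}(\mathbb{R}^d_+)$. Moreover, $\mathcal{J}^{(d')}_{z',\gamma'}$ extends to an isometry from $L^2(\mathbb{R}^d_+,t^\gamma dt)$ onto itself with inverse $\mathcal{J}^{(d')}_{\bar{z'},\gamma'}$. For all $p=(p',p''),k=(k',k'')\in\mathbb{N}_0^{d'}\times\mathbb{N}_0^{d''}=\mathbb{N}_0^d$ and all $f\in\mathcal{S}(\mathbb{R}^d_+)$, $$\left\|t'^{(p'+k'+\gamma')/2}t''^{(p''+k'')/2}D^p_tf(t)\right\|_2=\left(\prod_{l=1}^{d'}|1-z_l|^{-p_l+k_l}\right)\left\|t'^{(p'+k'+\gamma')/2}t''^{(p''+k'')/2}D^{k'}_{t'}D^{p''}_{t''}\mathcal{J}^{(d')}_{z',\gamma'}f(t)\right\|_2 .$$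
   Context: $\mathbb{R}^d_+=(0,\infty)^d$, $\mathbb{N}_0=\{0,1,2,\dots\}$; $x^t=\prod_lx_l^{t_l}$; $\|\cdot\|_2$ is the norm of $L^2(\mathbb{R}^d_+)$; $L^2(\mathbb{R}^d_+,t^\gamma dt)$ has norm $\left(\int_{\mathbb{R}^d_+}|f(t)|^2t^\gamma dt\right)^{1/2}$. Points $x\in\mathbb{R}^d_+$ are written $x=(x',x'')$ with $x'=(x_1,\dots,x_{d'})$, $x''=(x_{d'+1},\dots,x_d)$. $\mathcal{S}(\mathbb{R}^d_+)$ is the Fréchet space of all $f\in C^\infty(\mathbb{R}^d_+)$ all of whose derivatives extend continuously to $[0,\infty)^d$ and with $\sup_{x\in\mathbb{R}^d_+}x^k|D^pf(x)|<\infty$ for all $k,p\in\mathbb{N}_0^d$ (these are the defining seminorms). $\mathbf T^{(d')}=\{z\in\mathbb{C}^{d'}:\ |z_l|=1,\ z_l\ne1,\ l=1,\dots,d'\}$; $\bar{z'}$ is the componentwise conjugate. $I_\nu$ and $J_\nu$ are the modified Bessel and Bessel functions of the first kind. For $f\in\mathcal{S}(\mathbb{R}^d_+)$, $$\mathcal{J}^{(d')}_{z',\gamma'}f(t)=\left(\prod_{l=1}^{d'}(1-z_l)^{-1}\right)\int_{\mathbb{R}^{d'}_+}f(x',t'')\prod_{l=1}^{d'}(x_lt_lz_l)^{-\gamma_l/2}x_l^{\gamma_l}I_{\gamma_l}\left(\frac{2\sqrt{x_lt_lz_l}}{1-z_l}\right)dx'.$$ Branches: writing $z_l=e^{i\theta_l}$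 with $\theta_l\in(-\pi,\pi]\setminus\{0\}$, $(x_lt_lz_l)^{-\gamma_l/2}I_{\gamma_l}\left(\frac{2\sqrt{x_lt_lz_l}}{1-z_l}\right)=e^{-i\theta_l\gamma_l/2}(x_lt_l)^{-\gamma_l/2}e^{i\gamma_l\pi\,\mathrm{sgn}(\theta_l)/2}J_{\gamma_l}\left(\frac{\sqrt{x_lt_l}}{|\sin(\theta_l/2)|}\right)$. *)

theory Defs
  imports "HOL-Analysis.Analysis"
begin

section \<open>The positive orthant\<close>

text \<open>
  With \<open>d' = CARD('m)\<close> and \<open>d'' = CARD('n)\<close>, the space \<open>\<real>\<^sup>d = \<real>\<^sup>d\<^sup>' \<times> \<real>\<^sup>d\<^sup>'\<^sup>'\<close> is
  \<open>(real ^ 'm) \<times> (real ^ 'n)\<close> and a multi-index \<open>(p', p'')\<close> is an element of \<open>(nat ^ 'm) \<times> (nat ^ 'n)\<close>.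
\<close>

definition pos_orthant :: "(real ^ 'm) set" where
  "pos_orthant = {x. \<forall>i. 0 < x $ i}"

definition closed_orthant :: "(real ^ 'm) set" where
  "closed_orthant = {x. \<forall>i. 0 \<le> x $ i}"

abbreviation orthant2 :: "((real ^ 'm) \<times> (real ^ 'n)) set" where
  "orthant2 \<equiv> pos_orthant \<times> pos_orthant"

definition vpow :: "real ^ 'm \<Rightarrow> real ^ 'm \<Rightarrow> real" where
  "vpow x a = (\<Prod>i\<in>UNIV. (x $ i) powr (a $ i))"

definition mpow :: "(real ^ 'm) \<times> (real ^ 'n) \<Rightarrow> (nat ^ 'm) \<times> (nat ^ 'n) \<Rightarrow> real" where
  "mpow x k = (\<Prod>i\<in>UNIV. (fst x $ i) ^ (fst k $ i)) * (\<Prod>j\<in>UNIV. (snd x $ j) ^ (snd k $ j))"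


section \<open>Partial derivatives\<close>

primrec coord_dir :: "'m + 'n \<Rightarrow> (real ^ 'm) \<times> (real ^ 'n)" where
  "coord_dir (Inl i) = (axis i 1, 0)"
| "coord_dir (Inr j) = (0, axis j 1)"

definition pdiff ::
  "'m + 'n \<Rightarrow> ((real ^ 'm) \<times> (real ^ 'n) \<Rightarrow> complex) \<Rightarrow> (real ^ 'm) \<times> (real ^ 'n) \<Rightarrow> complex" where
  "pdiff c f x = vector_derivative (\<lambda>s. f (x + s *\<^sub>R coord_dir c)) (at 0)"

text \<open>Iterated partial derivatives; the last entry of the list is applied first.\<close>

definition pdiffs ::
  "('m + 'n) list \<Rightarrow> ((real ^ 'm) \<times> (real ^ 'n) \<Rightarrow> complex) \<Rightarrow> (real ^ 'm) \<times> (real ^ 'n) \<Rightarrow> complex" where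
  "pdiffs cs f = foldr pdiff cs f"

text \<open>
  \<open>D\<^sup>p\<close> differentiates \<open>p\<^sub>i\<close> times in the \<open>i\<close>-th coordinate. The index types carry no order, so
  an arbitrary order of differentiation is selected; on \<open>C\<^sup>\<infinity>\<close> functions it is immaterial.
\<close>

definition mdiff ::
  "(nat ^ 'm) \<times> (nat ^ 'n) \<Rightarrow> ((real ^ 'm) \<times> (real ^ 'n) \<Rightarrow> complex)
     \<Rightarrow> (real ^ 'm) \<times> (real ^ 'n) \<Rightarrow> complex" where
  "mdiff p = pdiffs (SOME cs. (\<forall>i. count_list cs (Inl i) = fst p $ i) \<and>
                              (\<forall>j. count_list cs (Inr j) = snd p $ j))"

definition smooth_on_orthant :: "((real ^ 'm) \<times> (real ^ 'n) \<Rightarrow> complex) \<Rightarrow> bool" where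
  "smooth_on_orthant f \<longleftrightarrow>
     (\<forall>cs. continuous_on orthant2 (pdiffs cs f) \<and>
           (\<forall>c. \<forall>x\<in>orthant2. (\<lambda>s. pdiffs cs f (x + s *\<^sub>R coord_dir c)) differentiable (at (0::real))))"


section \<open>The Frechet space of Schwartz functions on the orthant\<close>

text \<open>
  A function on the open orthant is represented by its extension by \<open>0\<close> to the whole space,
  so that equality of functions on the orthant is equality in HOL.
\<close>

definition schwartz :: "((real ^ 'm) \<times> (real ^ 'n) \<Rightarrow> complex) set" where
  "schwartz = {f. (\<forall>x. x \<notin> orthant2 \<longrightarrow> f x = 0) \<and>
     smooth_on_orthant f \<and>
     (\<forall>p. \<exists>g. continuous_on (closed_orthant \<times> closed_orthant) g \<and> (\<forall>x\<in>orthant2. g x = mdiff p f x)) \<and>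
     (\<forall>k p. bdd_above ((\<lambda>x. mpow x k * cmod (mdiff p f x)) ` orthant2))}"

definition schwartz_seminorm ::
  "(nat ^ 'm) \<times> (nat ^ 'n) \<Rightarrow> (nat ^ 'm) \<times> (nat ^ 'n)
     \<Rightarrow> ((real ^ 'm) \<times> (real ^ 'n) \<Rightarrow> complex) \<Rightarrow> real" where
  "schwartz_seminorm k p f = (SUP x\<in>orthant2. mpow x k * cmod (mdiff p f x))"

definition schwartz_topology :: "((real ^ 'm) \<times> (real ^ 'n) \<Rightarrow> complex) topology" where
  "schwartz_topology = topology_generated_by
     {{g \<in> schwartz. schwartz_seminorm k p (\<lambda>x. g x - f x) < e} | k p f e. f \<in> schwartz \<and> 0 < e}"

definition complex_linear_on :: "('a \<Rightarrow> complex) set \<Rightarrow> (('a \<Rightarrow> complex) \<Rightarrow> 'a \<Rightarrow> complex) \<Rightarrow> bool" where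
  "complex_linear_on S F \<longleftrightarrow>
     (\<forall>f\<in>S. \<forall>g\<in>S. \<forall>a b. F (\<lambda>x. a * f x + b * g x) = (\<lambda>x. a * F f x + b * F g x))"

definition schwartz_isomorphism ::
  "(((real ^ 'm) \<times> (real ^ 'n) \<Rightarrow> complex) \<Rightarrow> (real ^ 'm) \<times> (real ^ 'n) \<Rightarrow> complex) \<Rightarrow> bool" where
  "schwartz_isomorphism F \<longleftrightarrow>
     complex_linear_on schwartz F \<and> homeomorphic_map schwartz_topology schwartz_topology F"

lemma pdiffs_zero: "pdiffs cs (\<lambda>x. 0) = (\<lambda>x. 0)"
proof (induction cs)
  case (Cons c cs)
  then have "foldr pdiff cs (\<lambda>x. 0) = (\<lambda>x. 0 :: complex)" by (simp add: pdiffs_def)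
  then show ?case by (simp add: pdiffs_def pdiff_def[abs_def])
qed (simp add: pdiffs_def)

lemma topspace_schwartz_topology:
  "topspace schwartz_topology = (schwartz :: ((real ^ 'm) \<times> (real ^ 'n) \<Rightarrow> complex) set)"
proof -
  have "((\<chi> i. 1), (\<chi> i. 1)) \<in> (orthant2 :: ((real ^ 'm) \<times> (real ^ 'n)) set)"
    by (auto simp: pos_orthant_def)
  then have ne: "(orthant2 :: ((real ^ 'm) \<times> (real ^ 'n)) set) \<noteq> {}" by blast
  have z: "schwartz_seminorm k p (\<lambda>x. f x - f x) = 0"
    for k p and f :: "(real ^ 'm) \<times> (real ^ 'n) \<Rightarrow> complex"
    unfolding schwartz_seminorm_def mdiff_def using cSUP_const[OF ne, of "0::real"]
    by (simp only: diff_self pdiffs_zero norm_zero mult_zero_right)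
  have "f \<in> topspace schwartz_topology" if f: "f \<in> schwartz"
    for f :: "(real ^ 'm) \<times> (real ^ 'n) \<Rightarrow> complex"
  proof -
    have "f \<in> {g \<in> schwartz. schwartz_seminorm 0 0 (\<lambda>x. g x - f x) < 1}"
      using f z[of 0 0 f] by (simp only: mem_Collect_eq) simp
    moreover have "{g \<in> schwartz. schwartz_seminorm 0 0 (\<lambda>x. g x - f x) < 1} \<in>
       {{g \<in> schwartz. schwartz_seminorm k p (\<lambda>x. g x - f x) < e} | k p f e. f \<in> schwartz \<and> 0 < e}"
      using f zero_less_one by blast
    ultimately show ?thesis
      unfolding schwartz_topology_def topology_generated_by_topspace by (rule UnionI[rotated])
  qed
  then show ?thesis
    unfolding schwartz_topology_def topology_generated_by_topspace by auto
qed


section \<open>\<open>L\<^sup>2\<close> spaces\<close>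

text \<open>
  Elements of \<open>L\<^sup>2\<close> are handled through representatives; identities in \<open>L\<^sup>2\<close> are identities
  almost everywhere.
\<close>

definition L2 :: "'a measure \<Rightarrow> ('a \<Rightarrow> complex) set" where
  "L2 M = {f \<in> borel_measurable M. integrable M (\<lambda>x. (cmod (f x))\<^sup>2)}"

definition L2_norm :: "'a measure \<Rightarrow> ('a \<Rightarrow> complex) \<Rightarrow> real" where
  "L2_norm M f = sqrt (\<integral>x. (cmod (f x))\<^sup>2 \<partial>M)"

text \<open>Preservation of distances makes the operator respect equality almost everywhere.\<close>

definition L2_isometry_onto :: "'a measure \<Rightarrow> (('a \<Rightarrow> complex) \<Rightarrow> 'a \<Rightarrow> complex) \<Rightarrow> bool" where
  "L2_isometry_onto M U \<longleftrightarrow>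
     (\<forall>f\<in>L2 M. U f \<in> L2 M) \<and>
     (\<forall>f\<in>L2 M. \<forall>g\<in>L2 M. \<forall>a b.
        AE x in M. U (\<lambda>y. a * f y + b * g y) x = a * U f x + b * U g x) \<and>
     (\<forall>f\<in>L2 M. \<forall>g\<in>L2 M. L2_norm M (\<lambda>x. U f x - U g x) = L2_norm M (\<lambda>x. f x - g x)) \<and>
     (\<forall>g\<in>L2 M. \<exists>f\<in>L2 M. AE x in M. U f x = g x)"

definition L2_extends ::
  "'a measure \<Rightarrow> ('a \<Rightarrow> complex) set \<Rightarrow> (('a \<Rightarrow> complex) \<Rightarrow> 'a \<Rightarrow> complex)
     \<Rightarrow> (('a \<Rightarrow> complex) \<Rightarrow> 'a \<Rightarrow> complex) \<Rightarrow> bool" where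
  "L2_extends M S F U \<longleftrightarrow> S \<subseteq> L2 M \<and> (\<forall>f\<in>S. AE x in M. U f x = F f x)"

definition L2_inverse ::
  "'a measure \<Rightarrow> (('a \<Rightarrow> complex) \<Rightarrow> 'a \<Rightarrow> complex) \<Rightarrow> (('a \<Rightarrow> complex) \<Rightarrow> 'a \<Rightarrow> complex) \<Rightarrow> bool" where
  "L2_inverse M U V \<longleftrightarrow>
     (\<forall>f\<in>L2 M. (AE x in M. V (U f) x = f x) \<and> (AE x in M. U (V f) x = f x))"

definition orthant_measure :: "((real ^ 'm) \<times> (real ^ 'n)) measure" where
  "orthant_measure = restrict_space lborel orthant2"

definition weighted_measure :: "real ^ 'm \<Rightarrow> real ^ 'n \<Rightarrow> ((real ^ 'm) \<times> (real ^ 'n)) measure" where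
  "weighted_measure \<gamma>' \<gamma>'' =
     density orthant_measure (\<lambda>t. ennreal (vpow (fst t) \<gamma>' * vpow (snd t) \<gamma>''))"


section \<open>Bessel functions\<close>

text \<open>
  Principal branches throughout. Since \<open>0 powr 0 = 0\<close> in HOL, the value at \<open>w = 0\<close> is the
  conventional one only for \<open>\<nu> > 0\<close>; the argument \<open>0\<close> never occurs below.
\<close>

definition bessel_I :: "real \<Rightarrow> complex \<Rightarrow> complex" where
  "bessel_I \<nu> w = (w / 2) powr (of_real \<nu>) *
     (\<Sum>m. (w / 2) ^ (2 * m) / (fact m * Gamma (of_nat m + of_real \<nu> + 1)))"

definition bessel_J :: "real \<Rightarrow> complex \<Rightarrow> complex" where
  "bessel_J \<nu> w = (w / 2) powr (of_real \<nu>) *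
     (\<Sum>m. (-1) ^ m * (w / 2) ^ (2 * m) / (fact m * Gamma (of_nat m + of_real \<nu> + 1)))"


section \<open>The modified fractional power of the partial Hankel--Clifford transform\<close>

definition torus :: "(complex ^ 'm) set" where
  "torus = {z. \<forall>l. cmod (z $ l) = 1 \<and> z $ l \<noteq> 1}"

definition vcnj :: "complex ^ 'm \<Rightarrow> complex ^ 'm" where
  "vcnj z = (\<chi> l. cnj (z $ l))"

definition hc_kernel :: "complex \<Rightarrow> real \<Rightarrow> real \<Rightarrow> real \<Rightarrow> complex" where
  "hc_kernel z \<nu> x t =
     (of_real (x * t) * z) powr (- of_real \<nu> / 2) *
     bessel_I \<nu> (2 * csqrt (of_real (x * t) * z) / (1 - z))"

definition hankel_clifford ::
  "complex ^ 'm \<Rightarrow> real ^ 'm \<Rightarrow> ((real ^ 'm) \<times> (real ^ 'n) \<Rightarrow> complex)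
     \<Rightarrow> (real ^ 'm) \<times> (real ^ 'n) \<Rightarrow> complex" where
  "hankel_clifford z \<gamma>' f t =
     (if t \<in> orthant2 then
        (\<Prod>l\<in>UNIV. inverse (1 - z $ l)) *
        (LINT x:pos_orthant|lborel.
           f (x, snd t) *
           (\<Prod>l\<in>UNIV. hc_kernel (z $ l) (\<gamma>' $ l) (x $ l) (fst t $ l) * of_real ((x $ l) powr (\<gamma>' $ l))))
      else 0)"

text \<open>The principal branches in \<open>hc_kernel\<close> are the intended ones:\<close>

lemma hc_kernel_branch:
  assumes x: "0 < x" and t: "0 < t" and th: "- pi < \<theta>" "\<theta> \<le> pi" "\<theta> \<noteq> 0"
  shows "hc_kernel (cis \<theta>) \<nu> x t =
     cis (- \<theta> * \<nu> / 2) * of_real ((x * t) powr (- \<nu> / 2)) * cis (\<nu> * pi * sgn \<theta> / 2) *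
     bessel_J \<nu> (of_real (sqrt (x * t) / \<bar>sin (\<theta> / 2)\<bar>))"
proof -
  define r where "r = x * t"
  have r: "0 < r" using x t by (simp add: r_def)
  define s where "s = sin (\<theta> / 2)"
  have sgn_s: "sgn s = sgn \<theta>"
  proof (cases "\<theta> > 0")
    case True
    then have "s > 0" unfolding s_def using th by (intro sin_gt_zero) auto
    with True show ?thesis by simp
  next
    case False
    then have "sin (- \<theta> / 2) > 0" using th by (intro sin_gt_zero) auto
    then have "s < 0" by (simp add: s_def)
    with False th show ?thesis by simp
  qed
  have s0: "s \<noteq> 0" using sgn_s th by (metis sgn_0_0)
  have Ln1: "Ln (of_real r * cis \<theta>) = of_real (ln r) + \<i> * of_real \<theta>"
  proof (rule Ln_unique)
    show "exp (of_real (ln r) + \<i> * of_real \<theta>) = of_real r * cis \<theta>"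
      using r by (simp add: exp_add cis_conv_exp exp_of_real)
  qed (use th in auto)
  have pw: "(of_real r * cis \<theta>) powr (- of_real \<nu> / 2) =
      cis (- \<theta> * \<nu> / 2) * of_real (r powr (- \<nu> / 2))"
  proof -
    have "of_real r * cis \<theta> \<noteq> 0" using r by simp
    then have "(of_real r * cis \<theta>) powr (- of_real \<nu> / 2) =
        exp (\<i> * of_real (- \<theta> * \<nu> / 2) + of_real (- \<nu> / 2 * ln r))"
      unfolding powr_def Ln1 by (simp add: algebra_simps)
    also have "\<dots> = cis (- \<theta> * \<nu> / 2) * of_real (r powr (- \<nu> / 2))"
      using r unfolding exp_add cis_conv_exp exp_of_real by (simp add: powr_def)
    finally show ?thesis .
  qed
  have csq: "csqrt (of_real r * cis \<theta>) = of_real (sqrt r) * cis (\<theta> / 2)"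
  proof (rule csqrt_unique)
    show "(of_real (sqrt r) * cis (\<theta> / 2))\<^sup>2 = of_real r * cis \<theta>"
      using r by (simp add: power_mult_distrib Complex.DeMoivre flip: of_real_power)
    have "cos (\<theta> / 2) > 0 \<or> \<theta> = pi"
      using th by (cases "\<theta> = pi") (auto intro!: cos_gt_zero_pi)
    then show "0 < Re (of_real (sqrt r) * cis (\<theta> / 2)) \<or>
       Re (of_real (sqrt r) * cis (\<theta> / 2)) = 0 \<and> 0 \<le> Im (of_real (sqrt r) * cis (\<theta> / 2))"
      using r by auto
  qed
  have one_minus: "1 - cis \<theta> = - 2 * \<i> * of_real s * cis (\<theta> / 2)"
    using cos_double_sin[of "\<theta> / 2"] sin_double[of "\<theta> / 2"]
    by (simp add: complex_eq_iff s_def power2_eq_square)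
  define y where "y = sqrt r / \<bar>s\<bar>"
  have y: "0 < y" using r s0 by (simp add: y_def)
  have arg: "2 * csqrt (of_real r * cis \<theta>) / (1 - cis \<theta>) = \<i> * of_real (sgn \<theta> * y)"
  proof -
    have "of_real s * (\<i> * of_real (sgn \<theta> * y)) * (- 2 * \<i>) = (2 * of_real (sqrt r) :: complex)"
    proof -
      have "s * (sgn \<theta> * y) = sqrt r"
        unfolding y_def sgn_s[symmetric] using s0 by (auto simp: sgn_if)
      then have "of_real s * of_real (sgn \<theta> * y) = (of_real (sqrt r) :: complex)"
        by (simp only: flip: of_real_mult)
      then show ?thesis by (simp add: algebra_simps)
    qed
    then have "(1 - cis \<theta>) * (\<i> * of_real (sgn \<theta> * y)) = 2 * csqrt (of_real r * cis \<theta>)"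
      unfolding csq one_minus by (metis (no_types, lifting) mult.assoc mult.commute)
    moreover have "1 - cis \<theta> \<noteq> 0"
      unfolding one_minus using s0 by simp
    ultimately show ?thesis by (metis nonzero_mult_div_cancel_left)
  qed
  have sg: "(sgn \<theta>)\<^sup>2 = 1" using th by (simp add: sgn_if)
  have terms: "(\<i> * of_real (sgn \<theta> * y) / 2) ^ (2 * m) = (-1) ^ m * (of_real y / 2 :: complex) ^ (2 * m)" for m
  proof -
    have "(\<i> * of_real (sgn \<theta> * y) / 2)\<^sup>2 = - ((of_real y / 2 :: complex)\<^sup>2)"
      using sg by (simp add: power_mult_distrib power_divide flip: of_real_power)
    then show ?thesis
      by (simp add: power_mult power_minus[of "(of_real y / 2 :: complex)\<^sup>2"])
  qed
  have Ln2: "Ln (\<i> * of_real (sgn \<theta> * y) / 2) = of_real (ln (y / 2)) + \<i> * of_real (pi * sgn \<theta> / 2)"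
  proof (rule Ln_unique)
    have "exp (\<i> * of_real (pi * sgn \<theta> / 2)) = \<i> * of_real (sgn \<theta>)"
      unfolding cis_conv_exp[symmetric] using th by (auto simp: sgn_if complex_eq_iff)
    moreover have "exp (of_real (ln (y / 2))) = (of_real (y / 2) :: complex)"
      using y by (simp only: exp_of_real) simp
    ultimately show "exp (of_real (ln (y / 2)) + \<i> * of_real (pi * sgn \<theta> / 2)) = \<i> * of_real (sgn \<theta> * y) / 2"
      by (simp add: exp_add)
  qed (auto simp: sgn_if)
  have Ln3: "Ln (of_real y / 2 :: complex) = of_real (ln (y / 2))"
    using y Ln_of_real[of "y / 2"] by simp
  have pw2: "(\<i> * of_real (sgn \<theta> * y) / 2) powr of_real \<nu> =
      cis (\<nu> * pi * sgn \<theta> / 2) * (of_real y / 2) powr of_real \<nu>"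
  proof -
    have "\<i> * of_real (sgn \<theta> * y) / 2 \<noteq> (0::complex)" "of_real y / 2 \<noteq> (0::complex)"
      using y th by (auto simp: sgn_if)
    then show ?thesis
      unfolding powr_def Ln2 Ln3
      by (simp add: cis_conv_exp exp_add[symmetric] algebra_simps)
  qed
  have "bessel_I \<nu> (\<i> * of_real (sgn \<theta> * y)) = cis (\<nu> * pi * sgn \<theta> / 2) * bessel_J \<nu> (of_real y)"
    unfolding bessel_I_def bessel_J_def terms pw2 by simp
  then show ?thesis
    unfolding hc_kernel_def r_def[symmetric] s_def[symmetric] pw arg y_def[symmetric] by simp
qed

end

theory Submission
  imports Defs
begin

text \<open>
  Write \<open>a\<^sub>l = 1 / |1 - z\<^sub>l|\<close>. On the unit circle \<open>z / (1 - z)\<^sup>2 = - a\<^sup>2\<close>, so the argument of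
  \<open>I\<^sub>\<gamma>\<close> is imaginary and, up to a constant of modulus one, the kernel is the real function
  \<open>\<Prod>\<^sub>l a\<^sub>l\<^bsup>\<gamma>+1\<^esup> b\<^sub>\<gamma>(a\<^sub>l\<^sup>2 x\<^sub>l t\<^sub>l)\<close> with the entire function
  \<open>b\<^sub>\<nu>(w) = \<Sum>\<^sub>m (-1)\<^sup>m w\<^sup>m / (m! \<Gamma>(m+\<nu>+1)) = w\<^bsup>-\<nu>/2\<^esup> J\<^sub>\<nu>(2 \<surd>w)\<close> (\<open>hankel_clifford_eq\<close>). The theorem
  is therefore about the real transform \<open>T\<^sub>\<nu>\<close>, called \<open>clifford_transform\<close>, with that kernel and the
  weight \<open>x\<^sup>\<nu>\<close>.

  The identities \<open>b\<^sub>\<nu>' = - b\<^sub>\<nu>\<^sub>+\<^sub>1\<close> and \<open>(w\<^bsup>\<nu>+1\<^esup> b\<^sub>\<nu>\<^sub>+\<^sub>1)' = w\<^sup>\<nu> b\<^sub>\<nu>\<close> let derivatives move between a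
  function and its transform. The first gives \<open>\<partial>\<^sub>l T\<^sub>\<nu> f = - a\<^sub>l T f\<close> with the order raised by one in
  the coordinate \<open>l\<close>, without any derivative on \<open>f\<close>. The second gives, by parts,
  \<open>T\<^sub>\<nu> f = - a\<^sub>l\<^sup>-\<^sup>1 T (\<partial>\<^sub>l f)\<close> with the same raised order. Hence
  \<open>D\<^sup>k T\<^sub>\<nu> f = (-a)\<^sup>k (-1/a)\<^sup>p T\<^sub>\<nu>\<^sub>+\<^sub>k\<^sub>+\<^sub>p (D\<^sup>p f)\<close>, so the weighted identity is just Parseval's formula for
  the order \<open>\<gamma> + k + p\<close> (\<open>mdiff_hankel_clifford\<close>). With \<open>2k\<close> integrations by parts and the
  boundedness of \<open>w\<^sup>k b\<^sub>\<nu>\<^sub>+\<^sub>2\<^sub>k(w)\<close>, the same mechanism bounds every Schwartz seminorm of \<open>T\<^sub>\<nu> f\<close> by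
  finitely many seminorms of \<open>f\<close> (\<open>clifford_transform_seminorm_estimate\<close>).

  Inversion rests on exponentials: \<open>T\<^sub>\<nu>\<close> sends \<open>e\<^bsup>-s\<cdot>x\<^esup>\<close> to a multiple of \<open>e\<^bsup>-s'\<cdot>x\<^esup>\<close> with
  \<open>s'\<^sub>l = a\<^sub>l\<^sup>2 / s\<^sub>l\<close>, and doing so twice gives \<open>e\<^bsup>-s\<cdot>x\<^esup>\<close> back. Since the kernel is symmetric,
  \<open>T\<^sub>\<nu> T\<^sub>\<nu> f\<close> and \<open>f\<close> have the same weighted Laplace transform, and uniqueness of the latter, a
  consequence of the Stone--Weierstrass theorem in the variables \<open>e\<^bsup>-x\<^esup>\<close>, shows
  \<open>T\<^sub>\<nu> T\<^sub>\<nu> f = f\<close> (\<open>clifford_transform_involution\<close>). Symmetry and inversion together give Parseval's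
  formula in the variables \<open>x'\<close> for each fixed \<open>x''\<close>, so any weight in \<open>x''\<close> may be added.
  Finally, exponential sums are dense in the weighted \<open>L\<^sup>2\<close> space, and an isometry of a dense
  subspace onto itself extends to the whole space together with its inverse
  (\<open>dense_isometry_extension\<close>).
\<close>

section \<open>The Bessel--Clifford function\<close>

definition bc_coeff :: "real \<Rightarrow> nat \<Rightarrow> real" where
  "bc_coeff \<nu> m = (-1) ^ m / (fact m * Gamma (real m + \<nu> + 1))"

text \<open>
  For \<open>w > 0\<close> this is \<open>w\<^bsup>-\<nu>/2\<^esup> J\<^sub>\<nu>(2 \<surd>w)\<close>. Unlike the Bessel function itself it is entire in \<open>w\<close>, so
  no branch of a power has to be followed and the point \<open>w = 0\<close> is regular.
\<close>

definition bessel_clifford :: "real \<Rightarrow> real \<Rightarrow> real" where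
  "bessel_clifford \<nu> w = (\<Sum>m. bc_coeff \<nu> m * w ^ m)"

text \<open>
  Each step multiplies \<open>\<Gamma>\<close> by \<open>m + \<nu> + 1 \<ge> 1\<close>.
\<close>

lemma Gamma_le_Gamma_plus_nat:
  assumes "0 \<le> (\<nu>::real)"
  shows "Gamma (\<nu> + 1) \<le> Gamma (real m + \<nu> + 1)"
proof (induction m)
  case (Suc m)
  have pos: "0 < Gamma (real m + \<nu> + 1)" using assms by (intro Gamma_real_pos) auto
  have "real m + \<nu> + 1 \<notin> \<int>\<^sub>\<le>\<^sub>0" using assms by (auto elim!: nonpos_Ints_cases)
  then have "Gamma (real (Suc m) + \<nu> + 1) = (real m + \<nu> + 1) * Gamma (real m + \<nu> + 1)"
    using Gamma_plus1[of "real m + \<nu> + 1"] by (simp add: algebra_simps)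
  moreover have "1 * Gamma (real m + \<nu> + 1) \<le> (real m + \<nu> + 1) * Gamma (real m + \<nu> + 1)"
    using assms pos by (intro mult_right_mono) auto
  ultimately show ?case using Suc.IH by linarith
qed simp

lemma abs_bc_coeff_le:
  assumes "0 \<le> \<nu>"
  shows "\<bar>bc_coeff \<nu> m\<bar> \<le> inverse (Gamma (\<nu> + 1)) / fact m"
proof -
  have pos: "0 < Gamma (\<nu> + 1)" using assms by (intro Gamma_real_pos) auto
  have "inverse (fact m * Gamma (real m + \<nu> + 1)) \<le> inverse (fact m * Gamma (\<nu> + 1))"
    using pos Gamma_le_Gamma_plus_nat[OF assms, of m] by (intro le_imp_inverse_le mult_left_mono) auto
  moreover have "0 < Gamma (real m + \<nu> + 1)"
    using pos Gamma_le_Gamma_plus_nat[OF assms, of m] by linarith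
  ultimately show ?thesis
    by (simp add: bc_coeff_def abs_mult divide_inverse power_abs mult_ac)
qed

lemma summable_abs_bc:
  assumes "0 \<le> \<nu>" shows "summable (\<lambda>m. \<bar>bc_coeff \<nu> m\<bar> * \<bar>w\<bar> ^ m)"
proof (rule summable_comparison_test')
  show "summable (\<lambda>m. inverse (Gamma (\<nu> + 1)) * (inverse (fact m) * \<bar>w\<bar> ^ m))"
    by (intro summable_mult summable_exp)
  show "norm (\<bar>bc_coeff \<nu> m\<bar> * \<bar>w\<bar> ^ m) \<le> inverse (Gamma (\<nu> + 1)) * (inverse (fact m) * \<bar>w\<bar> ^ m)" for m
    using mult_right_mono[OF abs_bc_coeff_le[OF assms, of m], of "\<bar>w\<bar> ^ m"]
    by (simp add: divide_inverse mult_ac)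
qed

lemma summable_bc:
  assumes "0 \<le> \<nu>" shows "summable (\<lambda>m. bc_coeff \<nu> m * w ^ m)"
proof (rule summable_rabs_cancel)
  show "summable (\<lambda>m. \<bar>bc_coeff \<nu> m * w ^ m\<bar>)"
    using summable_abs_bc[OF assms, of w] by (simp only: abs_mult power_abs)
qed

lemma diffs_bc_coeff: "diffs (bc_coeff \<nu>) m = - bc_coeff (\<nu> + 1) m"
proof -
  have e: "real (Suc m) + \<nu> + 1 = real m + (\<nu> + 1) + 1" by simp
  show ?thesis unfolding diffs_def bc_coeff_def e
    by (simp add: divide_simps del: of_nat_Suc)
qed

lemma DERIV_bessel_clifford:
  assumes "0 \<le> \<nu>"
  shows "(bessel_clifford \<nu> has_real_derivative - bessel_clifford (\<nu> + 1) w) (at w)"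
proof -
  have d: "((\<lambda>w. \<Sum>m. bc_coeff \<nu> m * w ^ m) has_real_derivative (\<Sum>m. diffs (bc_coeff \<nu>) m * w ^ m)) (at w)"
    by (intro termdiffs_strong_converges_everywhere summable_bc assms)
  have e1: "(\<Sum>m. diffs (bc_coeff \<nu>) m * w ^ m) = - bessel_clifford (\<nu> + 1) w"
    unfolding bessel_clifford_def diffs_bc_coeff mult_minus_left
    using assms by (intro suminf_minus summable_bc) simp
  have e2: "(\<lambda>w. \<Sum>m. bc_coeff \<nu> m * w ^ m) = bessel_clifford \<nu>"
    by (rule ext) (rule bessel_clifford_def[symmetric])
  show ?thesis using d unfolding e1 e2 .
qed

text \<open>
  This is the differential equation \<open>w b'' + (\<nu>+1) b' + b = 0\<close> with the derivatives of \<open>b = b\<^sub>\<nu>\<close>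
  replaced by functions of higher order. On coefficients it is \<open>\<Gamma>(m+\<nu>+2) = (m+\<nu>+1) \<Gamma>(m+\<nu>+1)\<close>.
\<close>

lemma bessel_clifford_recurrence:
  assumes "0 \<le> \<nu>"
  shows "w * bessel_clifford (\<nu> + 2) w = (\<nu> + 1) * bessel_clifford (\<nu> + 1) w - bessel_clifford \<nu> w"
proof -
  let ?c = "bc_coeff (\<nu> + 1)"
  have s: "summable (\<lambda>m. ?c m * w ^ m)" by (rule summable_bc) (use assms in simp)
  have s2: "summable (\<lambda>m. bc_coeff (\<nu> + 2) m * w ^ m)" by (rule summable_bc) (use assms in simp)
  have "(\<lambda>m. diffs ?c m * w ^ m) = (\<lambda>m. - (bc_coeff (\<nu> + 2) m * w ^ m))"
    using diffs_bc_coeff[of "\<nu> + 1"] by (simp add: add.assoc)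
  then have "summable (\<lambda>m. diffs ?c m * w ^ m)"
    and e: "(\<Sum>m. diffs ?c m * w ^ m) = - bessel_clifford (\<nu> + 2) w"
    using summable_minus[OF s2] suminf_minus[OF s2] by (simp_all only: bessel_clifford_def)
  then have "(\<lambda>m. w * (real m * ?c m * w ^ (m - Suc 0))) sums (w * - bessel_clifford (\<nu> + 2) w)"
    using diffs_equiv[of ?c w] by (intro sums_mult) simp
  moreover have "w * (real m * ?c m * w ^ (m - Suc 0)) = real m * ?c m * w ^ m" for m
    by (cases m) auto
  ultimately have "(\<lambda>m. real m * ?c m * w ^ m) sums (- (w * bessel_clifford (\<nu> + 2) w))" by simp
  from sums_add[OF sums_mult[OF summable_sums[OF s], of "\<nu> + 1"] this]
  have "(\<lambda>m. (\<nu> + 1) * (?c m * w ^ m) + real m * ?c m * w ^ m)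
     sums ((\<nu> + 1) * bessel_clifford (\<nu> + 1) w - w * bessel_clifford (\<nu> + 2) w)"
    by (simp add: bessel_clifford_def)
  moreover have "(\<nu> + 1) * (?c m * w ^ m) + real m * ?c m * w ^ m = bc_coeff \<nu> m * w ^ m" for m
  proof -
    have "real m + \<nu> + 1 \<notin> \<int>\<^sub>\<le>\<^sub>0" using assms by (auto elim!: nonpos_Ints_cases)
    then have "Gamma (real m + (\<nu> + 1) + 1) = (real m + \<nu> + 1) * Gamma (real m + \<nu> + 1)"
      using Gamma_plus1[of "real m + \<nu> + 1"] by (simp add: algebra_simps)
    moreover have "0 < Gamma (real m + \<nu> + 1)" using assms by (intro Gamma_real_pos) auto
    then have "Gamma (real m + \<nu> + 1) \<noteq> 0" by (rule less_imp_neq[THEN not_sym])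
    moreover have "real m + \<nu> + 1 \<noteq> 0" using assms by auto
    ultimately have "(real m + \<nu> + 1) * ?c m = bc_coeff \<nu> m"
      unfolding bc_coeff_def by simp
    then have "(real m + \<nu> + 1) * ?c m * w ^ m = bc_coeff \<nu> m * w ^ m" by simp
    then show ?thesis by (simp add: algebra_simps)
  qed
  ultimately have "(\<lambda>m. bc_coeff \<nu> m * w ^ m)
     sums ((\<nu> + 1) * bessel_clifford (\<nu> + 1) w - w * bessel_clifford (\<nu> + 2) w)" by simp
  then have "bessel_clifford \<nu> w = (\<nu> + 1) * bessel_clifford (\<nu> + 1) w - w * bessel_clifford (\<nu> + 2) w"
    unfolding bessel_clifford_def[of \<nu>] by (rule sums_unique[symmetric])
  then show ?thesis by simp
qed

lemma bessel_clifford_0: "bessel_clifford \<nu> 0 = inverse (Gamma (\<nu> + 1))"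
  unfolding bessel_clifford_def using powser_zero[of "bc_coeff \<nu>"]
  by (simp add: bc_coeff_def divide_inverse)

text \<open>
  The energy \<open>b\<^sub>\<nu>\<^sup>2 + w b\<^sub>\<nu>'\<^sup>2\<close> has derivative \<open>- (2\<nu>+1) b\<^sub>\<nu>'\<^sup>2 \<le> 0\<close> by the differential equation, so
  it is at most its value at \<open>0\<close>.
\<close>

lemma abs_bessel_clifford_le:
  assumes "0 \<le> \<nu>" "0 \<le> w"
  shows "\<bar>bessel_clifford \<nu> w\<bar> \<le> inverse (Gamma (\<nu> + 1))"
proof -
  define E where "E w = (bessel_clifford \<nu> w)\<^sup>2 + w * (bessel_clifford (\<nu> + 1) w)\<^sup>2" for w
  have E': "(E has_real_derivative - (2 * \<nu> + 1) * (bessel_clifford (\<nu> + 1) x)\<^sup>2) (at x)" for x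
  proof -
    let ?b = "bessel_clifford \<nu> x" and ?b1 = "bessel_clifford (\<nu> + 1) x" and ?b2 = "bessel_clifford (\<nu> + 2) x"
    have d: "(bessel_clifford (\<nu> + 1) has_real_derivative - ?b2) (at x)"
      using DERIV_bessel_clifford[of "\<nu> + 1" x] assms by (simp add: add.assoc)
    have d0: "(bessel_clifford \<nu> has_real_derivative - ?b1) (at x)"
      by (rule DERIV_bessel_clifford[OF assms(1)])
    have "(E has_real_derivative 2 * ?b * - ?b1 + (?b1\<^sup>2 + x * (2 * ?b1 * - ?b2))) (at x)"
      unfolding E_def[abs_def] power2_eq_square
      using DERIV_add[OF DERIV_mult[OF d0 d0] DERIV_mult[OF DERIV_ident DERIV_mult[OF d d]]]
      by (simp add: algebra_simps)
    moreover have "2 * ?b * - ?b1 + (?b1\<^sup>2 + x * (2 * ?b1 * - ?b2)) = - (2 * \<nu> + 1) * ?b1\<^sup>2"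
    proof -
      have "x * (2 * ?b1 * - ?b2) = - 2 * ?b1 * (x * ?b2)" by simp
      then show ?thesis unfolding bessel_clifford_recurrence[OF assms(1)]
        by (simp add: algebra_simps power2_eq_square)
    qed
    ultimately show ?thesis by simp
  qed
  have "E w \<le> E 0"
  proof (rule DERIV_nonpos_imp_nonincreasing[OF assms(2)])
    fix x show "\<exists>y. (E has_real_derivative y) (at x) \<and> y \<le> 0"
      using E'[of x] assms by (intro exI[of _ "- (2 * \<nu> + 1) * (bessel_clifford (\<nu> + 1) x)\<^sup>2"] conjI)
        (auto intro!: mult_nonpos_nonneg)
  qed
  then have "(bessel_clifford \<nu> w)\<^sup>2 \<le> (inverse (Gamma (\<nu> + 1)))\<^sup>2"
    using mult_nonneg_nonneg[OF assms(2) zero_le_power2[of "bessel_clifford (\<nu> + 1) w"]]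
    unfolding E_def bessel_clifford_0 by linarith
  moreover have "0 \<le> inverse (Gamma (\<nu> + 1))" using assms Gamma_real_pos[of "\<nu> + 1"] by simp
  ultimately show ?thesis by (metis abs_le_square_iff abs_of_nonneg)
qed

text \<open>
  The recurrence trades one factor \<open>w\<close> for a drop of the order from \<open>\<nu> + 2\<close> to \<open>\<nu> + 1\<close> and \<open>\<nu>\<close>, so
  \<open>k\<close> factors are paid for by raising the order by \<open>2k\<close>.
\<close>

lemma power_mult_bessel_clifford_bounded:
  fixes k :: nat
  assumes "0 \<le> \<nu>"
  shows "\<exists>C. \<forall>w\<ge>0. w ^ k * \<bar>bessel_clifford (\<nu> + 2 * real k) w\<bar> \<le> C"
  using assms
proof (induction k arbitrary: \<nu>)
  case 0
  then show ?case using abs_bessel_clifford_le[OF 0] by auto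
next
  case (Suc k)
  obtain C0 where C0: "\<And>w. 0 \<le> w \<Longrightarrow> w ^ k * \<bar>bessel_clifford (\<nu> + 2 * real k) w\<bar> \<le> C0"
    using Suc.IH[OF Suc.prems] by blast
  obtain C1 where C1: "\<And>w. 0 \<le> w \<Longrightarrow> w ^ k * \<bar>bessel_clifford (\<nu> + 1 + 2 * real k) w\<bar> \<le> C1"
    using Suc.IH[of "\<nu> + 1"] Suc.prems by auto
  let ?n = "\<nu> + 2 * real k"
  have "w ^ Suc k * \<bar>bessel_clifford (\<nu> + 2 * real (Suc k)) w\<bar> \<le> (?n + 1) * C1 + C0" if w: "0 \<le> w" for w
  proof -
    have "w ^ Suc k * \<bar>bessel_clifford (\<nu> + 2 * real (Suc k)) w\<bar> = w ^ k * \<bar>w * bessel_clifford (?n + 2) w\<bar>"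
      using w by (simp add: abs_mult algebra_simps)
    also have "\<dots> = w ^ k * \<bar>(?n + 1) * bessel_clifford (?n + 1) w - bessel_clifford ?n w\<bar>"
      using Suc.prems by (subst bessel_clifford_recurrence) auto
    also have "\<dots> \<le> w ^ k * ((?n + 1) * \<bar>bessel_clifford (?n + 1) w\<bar> + \<bar>bessel_clifford ?n w\<bar>)"
      using w Suc.prems by (intro mult_left_mono order_trans[OF abs_triangle_ineq4]) (auto simp: abs_mult)
    also have "\<dots> = (?n + 1) * (w ^ k * \<bar>bessel_clifford (\<nu> + 1 + 2 * real k) w\<bar>) + w ^ k * \<bar>bessel_clifford ?n w\<bar>"
      by (simp add: algebra_simps)
    also have "\<dots> \<le> (?n + 1) * C1 + C0"
      using C0[OF w] C1[OF w] Suc.prems by (intro add_mono mult_left_mono) auto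
    finally show ?thesis .
  qed
  then show ?case by blast
qed

text \<open>
  The order-lowering formula \<open>(x\<^bsup>\<nu>+1\<^esup> b\<^sub>\<nu>\<^sub>+\<^sub>1(cx))' = x\<^sup>\<nu> b\<^sub>\<nu>(cx)\<close>, which drives the integrations by parts.
\<close>

lemma DERIV_powr_bessel_clifford:
  assumes "0 \<le> \<nu>" "0 < x"
  shows "((\<lambda>x. x powr (\<nu> + 1) * bessel_clifford (\<nu> + 1) (c * x)) has_real_derivative
           x powr \<nu> * bessel_clifford \<nu> (c * x)) (at x)"
proof -
  have d: "((\<lambda>x. bessel_clifford (\<nu> + 1) (c * x)) has_real_derivative - bessel_clifford (\<nu> + 2) (c * x) * c) (at x)"
    using DERIV_chain2[where f="bessel_clifford (\<nu> + 1)" and g="\<lambda>x. c * x" and x=x and s=UNIV,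
        OF DERIV_bessel_clifford[of "\<nu> + 1" "c * x"] DERIV_cmult_Id] assms
    by (simp add: add.assoc)
  have p: "((\<lambda>x. x powr (\<nu> + 1)) has_real_derivative (\<nu> + 1) * x powr \<nu>) (at x)"
    using has_real_derivative_powr[of x "\<nu> + 1"] assms by simp
  have "((\<lambda>x. x powr (\<nu> + 1) * bessel_clifford (\<nu> + 1) (c * x)) has_real_derivative
      (\<nu> + 1) * x powr \<nu> * bessel_clifford (\<nu> + 1) (c * x) +
      - bessel_clifford (\<nu> + 2) (c * x) * c * x powr (\<nu> + 1)) (at x)"
    by (rule DERIV_mult[OF p d])
  moreover have "(\<nu> + 1) * x powr \<nu> * bessel_clifford (\<nu> + 1) (c * x) +
      - bessel_clifford (\<nu> + 2) (c * x) * c * x powr (\<nu> + 1) =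
      x powr \<nu> * ((\<nu> + 1) * bessel_clifford (\<nu> + 1) (c * x) - (c * x) * bessel_clifford (\<nu> + 2) (c * x))"
    using assms by (simp add: powr_add algebra_simps)
  ultimately show ?thesis
    using bessel_clifford_recurrence[OF assms(1), of "c * x"] by simp
qed

lemma borel_measurable_bessel_clifford [measurable]:
  "bessel_clifford \<nu> \<in> borel_measurable borel"
proof -
  have "(\<lambda>w. \<Sum>m. bc_coeff \<nu> m * w ^ m) \<in> borel_measurable borel"
    by (intro borel_measurable_suminf) measurable
  moreover have "(\<lambda>w. \<Sum>m. bc_coeff \<nu> m * w ^ m) = bessel_clifford \<nu>"
    by (rule ext) (simp only: bessel_clifford_def)
  ultimately show ?thesis by (simp only:)
qed

lemma has_bochner_integral_Gamma:
  fixes \<nu> s :: real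
  assumes "0 \<le> \<nu>" "0 < s"
  shows "has_bochner_integral lborel (\<lambda>x. indicator {0<..} x * (x powr \<nu> * exp (- (s * x))))
     (Gamma (\<nu> + 1) * s powr - (\<nu> + 1))"
proof -
  let ?f = "\<lambda>x::real. indicator {0..} x * (x powr \<nu> / exp x) :: real"
  have "((\<lambda>x. x powr \<nu> / exp x) has_integral Gamma (\<nu> + 1)) {0..}"
    using Gamma_integral_real[of "\<nu> + 1"] assms by simp
  moreover have "?f = (\<lambda>x. if x \<in> {0..} then x powr \<nu> / exp x else 0)"
    by (simp add: fun_eq_iff indicator_def)
  ultimately have "(?f has_integral Gamma (\<nu> + 1)) UNIV"
    by (simp only: has_integral_restrict_UNIV)
  then have "(\<integral>\<^sup>+x. ennreal (?f x) \<partial>lborel) = ennreal (Gamma (\<nu> + 1))"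
    by (intro nn_integral_has_integral_lborel) (auto simp: indicator_def)
  then have "has_bochner_integral lborel ?f (Gamma (\<nu> + 1))"
    using assms by (intro has_bochner_integral_nn_integral) (auto simp: indicator_def intro!: less_imp_le Gamma_real_pos)
  then have "has_bochner_integral lborel (\<lambda>x. ?f (0 + s * x)) (Gamma (\<nu> + 1) /\<^sub>R \<bar>s\<bar>)"
    using assms by (subst (asm) lborel_has_bochner_integral_real_affine_iff[where c=s and t=0]) auto
  then have "has_bochner_integral lborel (\<lambda>x. s powr - \<nu> * ?f (0 + s * x)) (s powr - \<nu> * (Gamma (\<nu> + 1) /\<^sub>R \<bar>s\<bar>))"
    by (intro has_bochner_integral_mult_right) auto
  moreover have "s powr - \<nu> * (Gamma (\<nu> + 1) /\<^sub>R \<bar>s\<bar>) = Gamma (\<nu> + 1) * s powr - (\<nu> + 1)"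
    using assms by (simp add: powr_diff powr_minus field_simps)
  moreover have "AE x in lborel. s powr - \<nu> * ?f (0 + s * x) = indicator {0<..} x * (x powr \<nu> * exp (- (s * x)))"
  proof (rule AE_mp[OF AE_lborel_singleton[of 0]], rule AE_I2, rule impI)
    fix x :: real assume "x \<noteq> 0"
    then show "s powr - \<nu> * ?f (0 + s * x) = indicator {0<..} x * (x powr \<nu> * exp (- (s * x)))"
      using assms by (cases "0 < x") (auto simp: indicator_def powr_mult powr_minus exp_minus field_simps zero_le_mult_iff)
  qed
  ultimately have *: "has_bochner_integral lborel (\<lambda>x. s powr - \<nu> * ?f (0 + s * x)) (Gamma (\<nu> + 1) * s powr - (\<nu> + 1))"
    and ae: "AE x in lborel. s powr - \<nu> * ?f (0 + s * x) = indicator {0<..} x * (x powr \<nu> * exp (- (s * x)))"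
    by (simp_all only:)
  show ?thesis
    by (rule has_bochner_integral_cong_AE[THEN iffD1, OF _ _ ae *]) measurable
qed

text \<open>
  Integrating the power series term by term, the factors \<open>\<Gamma>(m+\<nu>+1)\<close> cancel and the exponential
  series of \<open>-c/s\<close> remains. That exponentials go to exponentials is what makes the inversion
  formula accessible.
\<close>

lemma has_bochner_integral_exp_bessel_clifford:
  fixes \<nu> s c :: real
  assumes \<nu>: "0 \<le> \<nu>" and s: "0 < s"
  shows "has_bochner_integral lborel
     (\<lambda>x. indicator {0<..} x * (exp (- (s * x)) * bessel_clifford \<nu> (c * x) * x powr \<nu>))
     (s powr - (\<nu> + 1) * exp (- (c / s)))"
proof -
  define F where "F m x = bc_coeff \<nu> m * c ^ m * (indicator {0<..} x * (x powr (real m + \<nu>) * exp (- (s * x))))"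
    for m :: nat and x :: real
  have F: "has_bochner_integral lborel (F m) (bc_coeff \<nu> m * c ^ m * (Gamma (real m + \<nu> + 1) * s powr - (real m + \<nu> + 1)))" for m
    unfolding F_def using assms by (intro has_bochner_integral_mult_right has_bochner_integral_Gamma) auto
  have val: "bc_coeff \<nu> m * c ^ m * (Gamma (real m + \<nu> + 1) * s powr - (real m + \<nu> + 1)) =
      s powr - (\<nu> + 1) * ((- (c / s)) ^ m /\<^sub>R fact m)" for m
  proof -
    have "0 < Gamma (real m + \<nu> + 1)" using assms by (intro Gamma_real_pos) auto
    then have "Gamma (real m + \<nu> + 1) \<noteq> 0" by (rule less_imp_neq[THEN not_sym])
    moreover have "s powr - (real m + \<nu> + 1) = s powr - (\<nu> + 1) / s ^ m"
      using s by (simp add: powr_diff powr_minus powr_add powr_realpow field_simps)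
    moreover have "(- (c / s)) ^ m = (-1) ^ m * c ^ m / s ^ m"
      by (metis mult_minus1 power_divide power_mult_distrib times_divide_eq_right)
    ultimately show ?thesis by (simp add: bc_coeff_def field_simps)
  qed
  have nF: "norm (F m x) = \<bar>bc_coeff \<nu> m\<bar> * \<bar>c\<bar> ^ m * (indicator {0<..} x * (x powr (real m + \<nu>) * exp (- (s * x))))" for m x
    by (simp add: F_def abs_mult power_abs)
  have nFi: "(\<integral>x. norm (F m x) \<partial>lborel) = s powr - (\<nu> + 1) * ((\<bar>c\<bar> / s) ^ m /\<^sub>R fact m)" for m
  proof -
    have g: "0 < Gamma (real m + \<nu> + 1)" using assms by (intro Gamma_real_pos) auto
    have "(\<integral>x. norm (F m x) \<partial>lborel) = \<bar>bc_coeff \<nu> m\<bar> * \<bar>c\<bar> ^ m * (Gamma (real m + \<nu> + 1) * s powr - (real m + \<nu> + 1))"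
      unfolding nF using assms
      by (intro has_bochner_integral_integral_eq has_bochner_integral_mult_right has_bochner_integral_Gamma) auto
    also have "\<dots> = \<bar>bc_coeff \<nu> m * c ^ m * (Gamma (real m + \<nu> + 1) * s powr - (real m + \<nu> + 1))\<bar>"
      using g s by (simp add: abs_mult power_abs)
    also have "\<dots> = s powr - (\<nu> + 1) * ((\<bar>c\<bar> / s) ^ m /\<^sub>R fact m)"
      unfolding val using s by (simp add: abs_mult power_abs)
    finally show ?thesis .
  qed
  have sumF: "(\<lambda>m. F m x) sums (indicator {0<..} x * (exp (- (s * x)) * bessel_clifford \<nu> (c * x) * x powr \<nu>))" for x
  proof (cases "0 < x")
    case True
    have "(\<lambda>m. exp (- (s * x)) * x powr \<nu> * (bc_coeff \<nu> m * (c * x) ^ m)) sums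
       (exp (- (s * x)) * x powr \<nu> * bessel_clifford \<nu> (c * x))"
      unfolding bessel_clifford_def by (intro sums_mult summable_sums summable_bc \<nu>)
    moreover have "F m x = exp (- (s * x)) * x powr \<nu> * (bc_coeff \<nu> m * (c * x) ^ m)" for m
      using True by (simp add: F_def powr_add powr_realpow power_mult_distrib)
    ultimately show ?thesis using True by (simp add: mult_ac)
  qed (simp add: F_def)
  have snF: "summable (\<lambda>m. norm (F m x))" for x
  proof (cases "0 < x")
    case True
    have "norm (F m x) = exp (- (s * x)) * x powr \<nu> * (\<bar>bc_coeff \<nu> m\<bar> * \<bar>c * x\<bar> ^ m)" for m
      unfolding nF using True by (simp add: powr_add powr_realpow power_mult_distrib abs_mult)
    then show ?thesis by (simp add: summable_mult summable_abs_bc \<nu>)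
  qed (simp add: F_def)
  have snI: "summable (\<lambda>m. \<integral>x. norm (F m x) \<partial>lborel)"
    unfolding nFi by (intro summable_mult summable_exp_generic)
  have int: "integrable lborel (F m)" for m using F by (rule integrable.intros)
  have "integrable lborel (\<lambda>x. \<Sum>m. F m x)"
    by (intro integrable_suminf int AE_I2 snF snI)
  moreover have "(\<integral>x. (\<Sum>m. F m x) \<partial>lborel) = s powr - (\<nu> + 1) * exp (- (c / s))"
  proof -
    have "(\<integral>x. (\<Sum>m. F m x) \<partial>lborel) = (\<Sum>m. \<integral>x. F m x \<partial>lborel)"
      by (rule integral_suminf) (use int snF snI in auto)
    also have "\<dots> = (\<Sum>m. s powr - (\<nu> + 1) * ((- (c / s)) ^ m /\<^sub>R fact m))"
      unfolding has_bochner_integral_integral_eq[OF F] val ..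
    also have "\<dots> = s powr - (\<nu> + 1) * exp (- (c / s))"
      unfolding exp_def by (intro suminf_mult summable_exp_generic)
    finally show ?thesis .
  qed
  moreover have "(\<lambda>x. \<Sum>m. F m x) =
      (\<lambda>x. indicator {0<..} x * (exp (- (s * x)) * bessel_clifford \<nu> (c * x) * x powr \<nu>))"
    by (rule ext) (rule sums_unique[OF sumF, symmetric])
  ultimately show ?thesis
    unfolding has_bochner_integral_iff by (simp only:)
qed

section \<open>Product integrals and the open orthant\<close>

text \<open>
  Lebesgue measure on a Euclidean space is the image of the product measure on coordinates, so
  the product formula for the latter applies.
\<close>

lemma has_bochner_integral_lborel_prod:
  fixes f :: "'a::euclidean_space \<Rightarrow> real \<Rightarrow> real"
  assumes f: "\<And>b. b \<in> Basis \<Longrightarrow> has_bochner_integral lborel (f b) (I b)"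
  shows "has_bochner_integral lborel (\<lambda>x::'a. \<Prod>b\<in>Basis. f b (x \<bullet> b)) (\<Prod>b\<in>Basis. I b)"
proof -
  interpret product_sigma_finite "\<lambda>_::'a. lborel :: real measure" ..
  have int: "integrable lborel (f b)" and val: "(\<integral>x. f b x \<partial>lborel) = I b" if "b \<in> Basis" for b
    using f[OF that] by (auto simp: has_bochner_integral_iff)
  have coord: "(\<Sum>b\<in>Basis. g b *\<^sub>R b) \<bullet> b = g b" if "b \<in> Basis" for g and b :: 'a
    using that by simp
  have m1: "(\<lambda>g. \<Sum>b\<in>Basis. g b *\<^sub>R b) \<in> measurable (\<Pi>\<^sub>M b\<in>(Basis::'a set). lborel) borel" by measurable
  have fm: "f b \<in> borel_measurable borel" if "b \<in> Basis" for b
    using borel_measurable_integrable[OF int[OF that]] by simp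
  have m2: "(\<lambda>x::'a. \<Prod>b\<in>Basis. f b (x \<bullet> b)) \<in> borel_measurable borel"
  proof (rule borel_measurable_prod)
    fix b :: 'a assume "b \<in> Basis"
    from fm[OF this] have [measurable]: "f b \<in> borel_measurable borel" .
    show "(\<lambda>x. f b (x \<bullet> b)) \<in> borel_measurable borel" by measurable
  qed
  show ?thesis
    unfolding has_bochner_integral_iff
  proof
    have "integrable (\<Pi>\<^sub>M b\<in>(Basis::'a set). lborel) (\<lambda>g. \<Prod>b\<in>Basis. f b (g b))"
      by (intro product_integrable_prod int) auto
    then show "integrable lborel (\<lambda>x::'a. \<Prod>b\<in>Basis. f b (x \<bullet> b))"
      by (subst lborel_eq, subst integrable_distr_eq[OF m1]) (simp_all add: coord m2 cong: prod.cong)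
    have "(\<integral>x. (\<Prod>b\<in>Basis. f b (x \<bullet> b)) \<partial>(lborel::'a measure)) =
       (\<integral>g. (\<Prod>b\<in>Basis. f b (g b)) \<partial>(\<Pi>\<^sub>M b\<in>(Basis::'a set). lborel))"
      by (subst lborel_eq, subst integral_distr[OF m1]) (simp_all add: coord m2 cong: prod.cong)
    also have "\<dots> = (\<Prod>b\<in>Basis. I b)"
      by (subst product_integral_prod) (auto simp: int val)
    finally show "(\<integral>x. (\<Prod>b\<in>Basis. f b (x \<bullet> b)) \<partial>(lborel::'a measure)) = (\<Prod>b\<in>Basis. I b)" .
  qed
qed

lemma Basis_vec_eq: "(Basis :: (real ^ 'm) set) = (\<lambda>l. axis l 1) ` UNIV"
  by (auto simp: Basis_vec_def)

lemma has_bochner_integral_vec_prod: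
  fixes f :: "'m::finite \<Rightarrow> real \<Rightarrow> real"
  assumes "\<And>l. has_bochner_integral lborel (f l) (I l)"
  shows "has_bochner_integral lborel (\<lambda>x::real^'m. \<Prod>l\<in>UNIV. f l (x $ l)) (\<Prod>l\<in>UNIV. I l)"
proof -
  have inj: "inj (\<lambda>l::'m. axis l (1::real))" by (auto simp: inj_on_def axis_eq_axis)
  define g where "g = inv (\<lambda>l::'m. axis l (1::real))"
  have g: "g (axis l 1) = l" for l unfolding g_def using inj by (rule inv_f_f)
  have "has_bochner_integral lborel (\<lambda>x::real^'m. \<Prod>b\<in>Basis. f (g b) (x \<bullet> b)) (\<Prod>b\<in>Basis. I (g b))"
    by (intro has_bochner_integral_lborel_prod assms)
  then show ?thesis
    unfolding Basis_vec_eq by (simp add: prod.reindex[OF inj] g inner_axis o_def)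
qed

lemma open_pos_orthant: "open (pos_orthant :: (real^'m) set)"
proof -
  have "pos_orthant = (\<Inter>i\<in>UNIV. {x::real^'m. 0 < x $ i})" by (auto simp: pos_orthant_def)
  moreover have "open (\<Inter>i\<in>UNIV. {x::real^'m. 0 < x $ i})"
    by (intro open_INT ballI open_Collect_less continuous_intros) simp
  ultimately show ?thesis by simp
qed

lemma sets_pos_orthant [measurable]: "pos_orthant \<in> sets borel"
  by (intro borel_open open_pos_orthant)

lemma open_orthant2: "open (orthant2 :: ((real^'m) \<times> (real^'n)) set)"
  by (intro open_Times open_pos_orthant)

lemma sets_orthant2 [measurable]: "orthant2 \<in> sets borel"
  by (intro borel_open open_orthant2)

lemma pos_orthantD: "x \<in> pos_orthant \<Longrightarrow> 0 < x $ l"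
  by (simp add: pos_orthant_def)

lemma measurable_vpow [measurable]: "(\<lambda>x. vpow x a) \<in> borel_measurable borel"
  unfolding vpow_def by measurable

lemma vpow_nonneg [simp]: "0 \<le> vpow x a"
  unfolding vpow_def by (intro prod_nonneg) auto

lemma vpow_pos: "x \<in> pos_orthant \<Longrightarrow> 0 < vpow x a"
  unfolding vpow_def by (intro prod_pos) (metis pos_orthantD powr_gt_zero less_irrefl)

lemma vpow_add: "vpow x (a + b) = vpow x a * vpow x b"
  unfolding vpow_def by (simp add: powr_add prod.distrib)

text \<open>
  An integrable majorant, against which all Schwartz functions are compared.
\<close>

definition decay_weight :: "real ^ 'm \<Rightarrow> real" where
  "decay_weight x = (\<Prod>l\<in>UNIV. indicator {0<..} (x $ l) / (1 + (x $ l)\<^sup>2))"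

lemma integrable_arctan_density: "integrable lborel (\<lambda>x::real. indicator {0<..} x / (1 + x\<^sup>2))"
proof -
  have ind: "0 \<le> (indicator A x :: real)" for A and x :: real by (simp add: indicator_def)
  have den: "0 < 1 + x\<^sup>2" for x :: real by (simp add: add_pos_nonneg)
  have "(\<integral>\<^sup>+x. ennreal (1 / (1 + x\<^sup>2)) * indicator {0 ..} x \<partial>lborel) = pi / 2 - arctan 0"
  proof (rule nn_integral_FTC_atLeast)
    show "DERIV arctan x :> 1 / (1 + x\<^sup>2)" for x
      using DERIV_arctan[of x] by (simp add: divide_inverse)
  qed (use den tendsto_arctan_at_top in \<open>auto intro: less_imp_le\<close>)
  then have fin: "(\<integral>\<^sup>+x. ennreal (1 / (1 + x\<^sup>2)) * indicator {0 ..} x \<partial>lborel) < \<infinity>" by simp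
  have "integrable lborel (\<lambda>x::real. indicator {0..} x / (1 + x\<^sup>2))"
  proof (rule integrableI_bounded)
    have "(\<integral>\<^sup>+x. ennreal (norm (indicator {0..} x / (1 + x\<^sup>2) :: real)) \<partial>lborel) =
        (\<integral>\<^sup>+x. ennreal (1 / (1 + x\<^sup>2)) * indicator {0 ..} x \<partial>lborel)"
      by (intro nn_integral_cong) (auto simp: indicator_def abs_of_pos[OF den])
    then show "(\<integral>\<^sup>+x. ennreal (norm (indicator {0..} x / (1 + x\<^sup>2) :: real)) \<partial>lborel) < \<infinity>"
      using fin by simp
  qed auto
  then show ?thesis
    by (rule Bochner_Integration.integrable_bound) (auto simp: indicator_def)
qed

lemma integrable_decay_weight: "integrable lborel (decay_weight :: real^'m \<Rightarrow> real)"
  unfolding decay_weight_def[abs_def]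
  using has_bochner_integral_vec_prod[where f="\<lambda>(_::'m) x. indicator {0<..} x / (1 + x\<^sup>2)",
      OF has_bochner_integral_integrable[OF integrable_arctan_density]]
  by (rule integrable.intros)

lemma decay_weight_nonneg [simp]: "0 \<le> decay_weight x"
  unfolding decay_weight_def by (intro prod_nonneg) (auto simp: indicator_def add_pos_nonneg)

lemma decay_weight_le_1: "decay_weight x \<le> 1"
  unfolding decay_weight_def by (intro prod_le_1) (auto simp: indicator_def add_pos_nonneg divide_simps)

lemma decay_weight_eq:
  "x \<in> pos_orthant \<Longrightarrow> decay_weight x = inverse (\<Prod>l\<in>UNIV. 1 + (x $ l)\<^sup>2)"
  unfolding decay_weight_def by (simp add: prod_inversef[symmetric] o_def pos_orthant_def divide_inverse)

lemma measurable_decay_weight [measurable]: "decay_weight \<in> borel_measurable borel"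
  using borel_measurable_integrable[OF integrable_decay_weight] by simp

section \<open>Integrals and derivatives\<close>

text \<open>
  The form in which dominated convergence applies to difference quotients.
\<close>

lemma has_vector_derivative_iff_quotient:
  fixes f :: "real \<Rightarrow> 'b::real_normed_vector"
  shows "(f has_vector_derivative D) (at x) \<longleftrightarrow> ((\<lambda>h. (f (x + h) - f x) /\<^sub>R h) \<longlongrightarrow> D) (at 0)"
proof -
  have "norm (f (x + h) - f x - h *\<^sub>R D) / norm h = norm ((f (x + h) - f x) /\<^sub>R h - D)" if "h \<noteq> 0" for h
  proof -
    have "(f (x + h) - f x) /\<^sub>R h - D = (f (x + h) - f x - h *\<^sub>R D) /\<^sub>R h"
      using that by (simp add: scaleR_diff_right)
    then show ?thesis by (simp add: divide_inverse)
  qed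
  then have "((\<lambda>h. norm (f (x + h) - f x - h *\<^sub>R D) / norm h) \<longlongrightarrow> 0) (at 0) \<longleftrightarrow>
     ((\<lambda>h. norm ((f (x + h) - f x) /\<^sub>R h - D)) \<longlongrightarrow> 0) (at 0)"
    by (intro tendsto_cong) (auto simp: eventually_at_filter)
  then show ?thesis
    unfolding has_vector_derivative_def has_derivative_at tendsto_norm_zero_iff
    by (simp add: bounded_linear_scaleR_left LIM_zero_iff)
qed

lemma norm_diff_le_vector_derivative_bound:
  fixes f :: "real \<Rightarrow> 'b::real_normed_vector"
  assumes "\<And>s. s \<in> S \<Longrightarrow> (f has_vector_derivative f' s) (at s)" "convex S"
    and "\<And>s. s \<in> S \<Longrightarrow> norm (f' s) \<le> B" "a \<in> S" "b \<in> S"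
  shows "norm (f b - f a) \<le> B * \<bar>b - a\<bar>"
proof -
  have "norm (f b - f a) \<le> B * norm (b - a)"
  proof (rule differentiable_bound[OF assms(2) _ _ assms(5,4)])
    fix s assume s: "s \<in> S"
    show "(f has_derivative (\<lambda>h. h *\<^sub>R f' s)) (at s within S)"
      using assms(1)[OF s] unfolding has_vector_derivative_def by (rule has_derivative_at_withinI)
    show "onorm (\<lambda>h. h *\<^sub>R f' s) \<le> B"
      using assms(3)[OF s] by (intro onorm_le) (simp add: mult.commute[of B] mult_left_mono)
  qed
  then show ?thesis by simp
qed

text \<open>
  By the mean value bound the difference quotients are dominated by \<open>G\<close>, so dominated convergence
  along every sequence of increments gives the derivative.
\<close>

lemma has_vector_derivative_lebesgue_integral:
  fixes F :: "real \<Rightarrow> 'a \<Rightarrow> 'b::{banach, second_countable_topology}"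
  assumes \<delta>: "0 < \<delta>"
    and int: "\<And>s. \<bar>s\<bar> < \<delta> \<Longrightarrow> integrable M (F s)"
    and deriv: "\<And>s x. \<bar>s\<bar> < \<delta> \<Longrightarrow> x \<in> space M \<Longrightarrow> ((\<lambda>s. F s x) has_vector_derivative F' s x) (at s)"
    and bound: "\<And>s x. \<bar>s\<bar> < \<delta> \<Longrightarrow> x \<in> space M \<Longrightarrow> norm (F' s x) \<le> G x"
    and G: "integrable M G"
  shows "((\<lambda>s. \<integral>x. F s x \<partial>M) has_vector_derivative (\<integral>x. F' 0 x \<partial>M)) (at 0)"
proof -
  have lim: "(\<lambda>n. \<integral>x. (F (Y n) x - F 0 x) /\<^sub>R Y n \<partial>M) \<longlonglongrightarrow> (\<integral>x. F' 0 x \<partial>M)"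
    if Y: "\<And>n. Y n \<noteq> 0" "\<And>n. \<bar>Y n\<bar> < \<delta>" "Y \<longlonglongrightarrow> 0" for Y
  proof (rule integral_dominated_convergence)
    have conv: "(\<lambda>n. (F (Y n) x - F 0 x) /\<^sub>R Y n) \<longlonglongrightarrow> F' 0 x" if "x \<in> space M" for x
    proof -
      have "((\<lambda>h. (F (0 + h) x - F 0 x) /\<^sub>R h) \<longlongrightarrow> F' 0 x) (at 0)"
        using deriv[OF _ that, of 0] \<delta> by (simp add: has_vector_derivative_iff_quotient)
      then show ?thesis using Y(1,3) unfolding tendsto_at_iff_sequentially by (auto simp: o_def)
    qed
    then show "AE x in M. (\<lambda>n. (F (Y n) x - F 0 x) /\<^sub>R Y n) \<longlonglongrightarrow> F' 0 x" by auto
    show m: "(\<lambda>x. (F (Y n) x - F 0 x) /\<^sub>R Y n) \<in> borel_measurable M" for n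
      using int[of "Y n"] int[of 0] Y \<delta> by (auto dest!: borel_measurable_integrable)
    show "F' 0 \<in> borel_measurable M"
      by (rule borel_measurable_LIMSEQ_metric[OF m conv])
    show "AE x in M. norm ((F (Y n) x - F 0 x) /\<^sub>R Y n) \<le> G x" for n
    proof (rule AE_I2)
      fix x assume x: "x \<in> space M"
      have "norm (F (Y n) x - F 0 x) \<le> G x * \<bar>Y n - 0\<bar>"
      proof (rule norm_diff_le_vector_derivative_bound[where S="{s. \<bar>s\<bar> < \<delta>}"])
        show "convex {s. \<bar>s\<bar> < \<delta>}" using convex_ball[of "0::real" \<delta>] by (simp add: ball_def dist_real_def)
      qed (use deriv[OF _ x] bound[OF _ x] Y \<delta> in auto)
      moreover have "norm ((F (Y n) x - F 0 x) /\<^sub>R Y n) = norm (F (Y n) x - F 0 x) / \<bar>Y n\<bar>"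
        unfolding norm_scaleR by (simp add: divide_inverse)
      ultimately show "norm ((F (Y n) x - F 0 x) /\<^sub>R Y n) \<le> G x"
        using Y(1)[of n] by (simp add: pos_divide_le_eq)
    qed
  qed (rule G)
  have "(\<lambda>n. ((\<integral>x. F (0 + X n) x \<partial>M) - (\<integral>x. F 0 x \<partial>M)) /\<^sub>R X n) \<longlonglongrightarrow> (\<integral>x. F' 0 x \<partial>M)"
    if X: "\<And>n. X n \<noteq> 0" "X \<longlonglongrightarrow> 0" for X
  proof -
    define Y where "Y n = (if \<bar>X n\<bar> < \<delta> then X n else \<delta> / 2)" for n
    have ev: "\<forall>\<^sub>F n in sequentially. X n = Y n"
    proof -
      have "\<forall>\<^sub>F n in sequentially. \<bar>X n\<bar> < \<delta>"
        using X(2) \<delta> unfolding tendsto_iff dist_real_def by simp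
      then show ?thesis by eventually_elim (simp add: Y_def)
    qed
    have "Y \<longlonglongrightarrow> 0" using X(2) ev by (rule Lim_transform_eventually)
    then have "(\<lambda>n. \<integral>x. (F (Y n) x - F 0 x) /\<^sub>R Y n \<partial>M) \<longlonglongrightarrow> (\<integral>x. F' 0 x \<partial>M)"
      by (rule lim[rotated 2]) (use X \<delta> in \<open>auto simp: Y_def\<close>)
    moreover have "\<forall>\<^sub>F n in sequentially. (\<integral>x. (F (Y n) x - F 0 x) /\<^sub>R Y n \<partial>M) =
        ((\<integral>x. F (0 + X n) x \<partial>M) - (\<integral>x. F 0 x \<partial>M)) /\<^sub>R X n"
      using ev
    proof eventually_elim
      case (elim n)
      have "\<bar>Y n\<bar> < \<delta>" using \<delta> by (auto simp: Y_def)
      then have "(\<integral>x. (F (Y n) x - F 0 x) /\<^sub>R Y n \<partial>M) = ((\<integral>x. F (Y n) x \<partial>M) - (\<integral>x. F 0 x \<partial>M)) /\<^sub>R Y n"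
        using \<delta> by (simp add: int Bochner_Integration.integral_diff)
      then show ?case using elim by simp
    qed
    ultimately show ?thesis by (rule Lim_transform_eventually)
  qed
  then show ?thesis
    unfolding has_vector_derivative_iff_quotient tendsto_at_iff_sequentially by (auto simp: o_def)
qed

lemma lborel_integral_translate:
  fixes f :: "'a::euclidean_space \<Rightarrow> 'b::{banach, second_countable_topology}"
  assumes [measurable]: "f \<in> borel_measurable borel"
  shows "(\<integral>x. f (x + c) \<partial>lborel) = (\<integral>x. f x \<partial>lborel)"
proof -
  have "(\<integral>x. f x \<partial>lborel) = (\<integral>x. f x \<partial>(distr lborel borel ((+) c)))" by (simp add: lborel_distr_plus)
  also have "\<dots> = (\<integral>x. f (c + x) \<partial>lborel)" by (rule integral_distr) auto
  finally show ?thesis by (simp add: add.commute)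
qed

lemma lborel_nn_integral_translate:
  assumes [measurable]: "f \<in> borel_measurable borel"
  shows "(\<integral>\<^sup>+x. f (x + c::'a::euclidean_space) \<partial>lborel) = (\<integral>\<^sup>+x. f x \<partial>lborel)"
proof -
  have "(\<integral>\<^sup>+x. f x \<partial>lborel) = (\<integral>\<^sup>+x. f x \<partial>(distr lborel borel ((+) c)))" by (simp add: lborel_distr_plus)
  also have "\<dots> = (\<integral>\<^sup>+x. f (c + x) \<partial>lborel)" by (rule nn_integral_distr) auto
  finally show ?thesis by (simp add: add.commute)
qed

text \<open>
  By translation invariance \<open>F(x + e) - F(x)\<close> has integral zero. The fundamental theorem of calculus
  writes this difference as the integral of \<open>F'(x + s e)\<close> over \<open>s\<close> in the unit interval, and
  Fubini's theorem with translation invariance again turns it into the integral of \<open>F'\<close>. The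
  exceptional points \<open>S x\<close> admit functions with a kink, such as extensions by zero across the
  boundary of the orthant. Working on the whole space avoids splitting off one coordinate.
\<close>

lemma integral_directional_derivative_eq_0:
  fixes F F' :: "'a::euclidean_space \<Rightarrow> 'b::euclidean_space"
  assumes F: "integrable lborel F" and F': "integrable lborel F'"
    and cont: "\<And>x. continuous_on {0..1} (\<lambda>s. F (x + s *\<^sub>R e))"
    and fin: "\<And>x. finite (S x)"
    and deriv: "\<And>x s. s \<in> {0<..<1} - S x \<Longrightarrow>
       ((\<lambda>s. F (x + s *\<^sub>R e)) has_vector_derivative F' (x + s *\<^sub>R e)) (at s)"
  shows "(\<integral>x. F' x \<partial>lborel) = 0"
proof -
  have [measurable]: "F \<in> borel_measurable borel" "F' \<in> borel_measurable borel"
    using F F' by (auto dest!: borel_measurable_integrable)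
  let ?H = "\<lambda>(s::real) x. indicator {0..1} s *\<^sub>R F' (x + s *\<^sub>R e)"
  have H: "integrable (lborel \<Otimes>\<^sub>M lborel) (case_prod ?H)"
  proof (rule integrableI_bounded)
    show [measurable]: "case_prod ?H \<in> borel_measurable (lborel \<Otimes>\<^sub>M lborel)" by measurable
    have "(\<integral>\<^sup>+ p. ennreal (norm (case_prod ?H p)) \<partial>(lborel \<Otimes>\<^sub>M lborel)) =
       (\<integral>\<^sup>+ s. \<integral>\<^sup>+ x. ennreal (norm (?H s x)) \<partial>lborel \<partial>lborel)"
      by (subst lborel.nn_integral_fst[symmetric]) auto
    also have "\<dots> = (\<integral>\<^sup>+ s. indicator {0..1} s * (\<integral>\<^sup>+ x. ennreal (norm (F' x)) \<partial>lborel) \<partial>(lborel::real measure))"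
    proof (rule nn_integral_cong)
      fix s :: real
      have "(\<integral>\<^sup>+ x. ennreal (norm (?H s x)) \<partial>lborel) =
          (\<integral>\<^sup>+ x. indicator {0..1} s * ennreal (norm (F' (x + s *\<^sub>R e))) \<partial>lborel)"
        by (intro nn_integral_cong) (auto simp: indicator_def)
      also have "\<dots> = indicator {0..1} s * (\<integral>\<^sup>+ x. ennreal (norm (F' (x + s *\<^sub>R e))) \<partial>lborel)"
        by (rule nn_integral_cmult) measurable
      also have "(\<integral>\<^sup>+ x. ennreal (norm (F' (x + s *\<^sub>R e))) \<partial>lborel) = (\<integral>\<^sup>+ x. ennreal (norm (F' x)) \<partial>lborel)"
        by (rule lborel_nn_integral_translate) measurable
      finally show "(\<integral>\<^sup>+ x. ennreal (norm (?H s x)) \<partial>lborel) = indicator {0..1} s * (\<integral>\<^sup>+ x. ennreal (norm (F' x)) \<partial>lborel)" .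
    qed
    also have "\<dots> = (\<integral>\<^sup>+ x. ennreal (norm (F' x)) \<partial>lborel)"
      by (subst nn_integral_multc) auto
    also have "\<dots> < \<infinity>" using F' by (simp add: integrable_iff_bounded)
    finally show "(\<integral>\<^sup>+ p. ennreal (norm (case_prod ?H p)) \<partial>(lborel \<Otimes>\<^sub>M lborel)) < \<infinity>" .
  qed
  have "(\<integral>x. F' x \<partial>lborel) = (\<integral>s. indicator {0..1} s *\<^sub>R (\<integral>x. F' x \<partial>lborel) \<partial>(lborel::real measure))"
    by simp
  also have "\<dots> = (\<integral>s. (\<integral>x. ?H s x \<partial>lborel) \<partial>lborel)"
    by (intro Bochner_Integration.integral_cong refl) (simp add: lborel_integral_translate)
  also have "\<dots> = (\<integral>x. (\<integral>s. ?H s x \<partial>lborel) \<partial>lborel)"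
    by (rule lborel_pair.Fubini_integral[OF H, symmetric])
  also have "\<dots> = (\<integral>x. F (x + e) - F x \<partial>lborel)"
  proof (rule integral_cong_AE)
    show "(\<lambda>x. \<integral>s. ?H s x \<partial>lborel) \<in> borel_measurable lborel"
      using borel_measurable_integrable[OF lborel_pair.integrable_snd[OF H]] by simp
    show "AE x in lborel. (\<integral>s. ?H s x \<partial>lborel) = F (x + e) - F x"
      using lborel_pair.AE_integrable_snd[OF H]
    proof eventually_elim
      case (elim x)
      then have "set_integrable lborel {0..1} (\<lambda>s. F' (x + s *\<^sub>R e))" by (simp add: set_integrable_def)
      from set_borel_integral_eq_integral[OF this]
      have "(\<integral>s. ?H s x \<partial>lborel) = integral {0..1} (\<lambda>s. F' (x + s *\<^sub>R e))"
        by (simp add: set_lebesgue_integral_def)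
      also have "\<dots> = F (x + 1 *\<^sub>R e) - F (x + 0 *\<^sub>R e)"
        by (intro integral_unique fundamental_theorem_of_calculus_interior_strong[OF fin[of x]] deriv cont) auto
      finally show ?case by simp
    qed
  qed measurable
  also have "\<dots> = 0"
  proof -
    have "integrable lborel (\<lambda>x. F (x + e))"
    proof (rule integrableI_bounded)
      have "(\<integral>\<^sup>+ x. ennreal (norm (F (x + e))) \<partial>lborel) = (\<integral>\<^sup>+ x. ennreal (norm (F x)) \<partial>lborel)"
        by (rule lborel_nn_integral_translate) measurable
      then show "(\<integral>\<^sup>+ x. ennreal (norm (F (x + e))) \<partial>lborel) < \<infinity>" using F by (simp add: integrable_iff_bounded)
    qed measurable
    then show ?thesis using F by (simp add: Bochner_Integration.integral_diff lborel_integral_translate)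
  qed
  finally show ?thesis .
qed

section \<open>Iterated partial derivatives on the orthant\<close>

text \<open>
  Coordinates indexed by the sum type treat the two groups of variables alike.
\<close>

definition coord :: "'m + 'n \<Rightarrow> (real ^ 'm) \<times> (real ^ 'n) \<Rightarrow> real" where
  "coord c x = (case c of Inl i \<Rightarrow> fst x $ i | Inr j \<Rightarrow> snd x $ j)"

lemma coord_simps [simp]: "coord (Inl i) x = fst x $ i" "coord (Inr j) x = snd x $ j"
  by (simp_all add: coord_def)

lemma orthant2_iff: "x \<in> orthant2 \<longleftrightarrow> (\<forall>c. 0 < coord c x)"
  by (cases x) (auto simp: pos_orthant_def split_sum_all)

lemma coord_eqI: "(\<And>c. coord c x = coord c y) \<Longrightarrow> x = y"
proof -
  assume *: "\<And>c. coord c x = coord c y"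
  show "x = y" using *[of "Inl _"] *[of "Inr _"] by (cases x, cases y) (simp add: vec_eq_iff)
qed

lemma coord_move: "coord c (x + s *\<^sub>R coord_dir d) = coord c x + (if c = d then s else 0)"
  by (cases c; cases d) (auto simp: axis_def)

lemma abs_coord_diff_le_dist: "\<bar>coord c x - coord c y\<bar> \<le> dist x y"
proof (cases c)
  case (Inl i)
  have "\<bar>coord c x - coord c y\<bar> \<le> dist (fst x) (fst y)"
    using component_le_norm_cart[of "fst x - fst y" i] Inl by (simp add: dist_norm)
  also have "\<dots> \<le> dist x y" by (rule dist_fst_le)
  finally show ?thesis .
next
  case (Inr j)
  have "\<bar>coord c x - coord c y\<bar> \<le> dist (snd x) (snd y)"
    using component_le_norm_cart[of "snd x - snd y" j] Inr by (simp add: dist_norm)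
  also have "\<dots> \<le> dist x y" by (rule dist_snd_le)
  finally show ?thesis .
qed

lemma eventually_move_in_orthant2:
  assumes "x + s *\<^sub>R coord_dir c \<in> orthant2"
  shows "\<forall>\<^sub>F t in nhds s. x + t *\<^sub>R coord_dir c \<in> orthant2"
proof -
  have "open ((\<lambda>t. x + t *\<^sub>R coord_dir c) -` orthant2)"
    by (intro open_vimage open_orthant2 continuous_intros)
  from eventually_nhds_in_open[OF this, of s] assms show ?thesis by simp
qed

lemma pdiff_cong:
  assumes eq: "\<And>y. y \<in> orthant2 \<Longrightarrow> f y = g y" and x: "x \<in> orthant2"
  shows "pdiff c f x = pdiff c g x"
proof -
  have "\<forall>\<^sub>F t in nhds 0. x + t *\<^sub>R coord_dir c \<in> orthant2"
    using eventually_move_in_orthant2[of x 0 c] x by simp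
  then have "\<forall>\<^sub>F t in nhds 0. f (x + t *\<^sub>R coord_dir c) = g (x + t *\<^sub>R coord_dir c)"
    by eventually_elim (simp add: eq)
  then show ?thesis unfolding pdiff_def by (intro vector_derivative_cong_eq) auto
qed

text \<open>
  The partial derivative followed by extension by zero. Functions on the orthant are represented
  by their extensions by zero, so this operator acts on the representatives and identities between
  such derivatives are equalities of functions.
\<close>

definition pdiff0 :: "'m + 'n \<Rightarrow> ((real ^ 'm) \<times> (real ^ 'n) \<Rightarrow> complex) \<Rightarrow> (real ^ 'm) \<times> (real ^ 'n) \<Rightarrow> complex" where
  "pdiff0 c f x = (if x \<in> orthant2 then pdiff c f x else 0)"

definition pdiffs0 :: "('m + 'n) list \<Rightarrow> ((real ^ 'm) \<times> (real ^ 'n) \<Rightarrow> complex) \<Rightarrow> (real ^ 'm) \<times> (real ^ 'n) \<Rightarrow> complex" where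
  "pdiffs0 cs f = foldr pdiff0 cs f"

lemma pdiffs0_simps [simp]: "pdiffs0 [] f = f" "pdiffs0 (c # cs) f = pdiff0 c (pdiffs0 cs f)"
  by (simp_all add: pdiffs0_def)

lemma pdiffs0_append: "pdiffs0 (cs @ ds) f = pdiffs0 cs (pdiffs0 ds f)"
  by (simp add: pdiffs0_def)

lemma pdiffs_Cons: "pdiffs (c # cs) f = pdiff c (pdiffs cs f)"
  by (simp add: pdiffs_def)

text \<open>
  A partial derivative at a point of the open orthant depends only on nearby values, which lie in
  the orthant, so intermediate restrictions change nothing.
\<close>

lemma pdiffs_eq_pdiffs0: "x \<in> orthant2 \<Longrightarrow> pdiffs cs f x = pdiffs0 cs f x"
proof (induction cs arbitrary: x)
  case (Cons c cs)
  have "pdiff c (pdiffs cs f) x = pdiff c (pdiffs0 cs f) x"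
    by (rule pdiff_cong[OF _ Cons.prems]) (rule Cons.IH)
  then show ?case using Cons.prems by (simp add: pdiffs_Cons pdiff0_def)
qed (simp add: pdiffs_def)

definition smooth0 :: "((real ^ 'm) \<times> (real ^ 'n) \<Rightarrow> complex) \<Rightarrow> bool" where
  "smooth0 f \<longleftrightarrow> (\<forall>x. x \<notin> orthant2 \<longrightarrow> f x = 0) \<and> smooth_on_orthant f"

lemma smooth0_iff:
  "smooth0 f \<longleftrightarrow> (\<forall>x. x \<notin> orthant2 \<longrightarrow> f x = 0) \<and>
     (\<forall>cs. continuous_on orthant2 (pdiffs0 cs f) \<and>
           (\<forall>c. \<forall>x\<in>orthant2. (\<lambda>s. pdiffs0 cs f (x + s *\<^sub>R coord_dir c)) differentiable (at (0::real))))"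
proof -
  have "continuous_on orthant2 (pdiffs cs f) \<longleftrightarrow> continuous_on orthant2 (pdiffs0 cs f)" for cs
    by (intro continuous_on_cong refl pdiffs_eq_pdiffs0)
  moreover have "(\<lambda>s. pdiffs cs f (x + s *\<^sub>R coord_dir c)) differentiable (at 0) \<longleftrightarrow>
      (\<lambda>s. pdiffs0 cs f (x + s *\<^sub>R coord_dir c)) differentiable (at (0::real))" if x: "x \<in> orthant2" for cs c x
  proof -
    have "\<forall>\<^sub>F s in nhds 0. x + s *\<^sub>R coord_dir c \<in> orthant2"
      using eventually_move_in_orthant2[of x 0 c] x by simp
    then have ev: "\<forall>\<^sub>F s in nhds 0. pdiffs cs f (x + s *\<^sub>R coord_dir c) = pdiffs0 cs f (x + s *\<^sub>R coord_dir c)"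
      by eventually_elim (rule pdiffs_eq_pdiffs0)
    have transfer: "u differentiable at 0 \<Longrightarrow> v differentiable at (0::real)"
      if "\<forall>\<^sub>F s in nhds 0. u s = v s" for u v :: "real \<Rightarrow> complex"
      using that unfolding differentiable_def eventually_nhds
      by (metis has_derivative_transform_within_open)
    have ev': "\<forall>\<^sub>F s in nhds 0. pdiffs0 cs f (x + s *\<^sub>R coord_dir c) = pdiffs cs f (x + s *\<^sub>R coord_dir c)"
      using ev by eventually_elim simp
    show ?thesis using transfer[OF ev] transfer[OF ev'] by blast
  qed
  ultimately show ?thesis unfolding smooth0_def smooth_on_orthant_def by blast
qed

lemma smooth0_outside: "smooth0 f \<Longrightarrow> x \<notin> orthant2 \<Longrightarrow> f x = 0"
  unfolding smooth0_def by blast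

lemma smooth0_continuous: "smooth0 f \<Longrightarrow> continuous_on orthant2 f"
  unfolding smooth0_iff using pdiffs0_simps(1) by metis

lemma smooth0_pdiff0: "smooth0 f \<Longrightarrow> smooth0 (pdiff0 c f)"
proof -
  assume f: "smooth0 f"
  have "pdiffs0 cs (pdiff0 c f) = pdiffs0 (cs @ [c]) f" for cs by (simp add: pdiffs0_append)
  with f show "smooth0 (pdiff0 c f)" unfolding smooth0_iff[of f] smooth0_iff[of "pdiff0 c f"]
    by (simp only:) (simp add: pdiff0_def)
qed

lemma smooth0_pdiffs0: "smooth0 f \<Longrightarrow> smooth0 (pdiffs0 cs f)"
  by (induction cs) (auto intro: smooth0_pdiff0)

lemma smooth0_has_derivative:
  assumes f: "smooth0 f" and x: "x + s *\<^sub>R coord_dir c \<in> orthant2"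
  shows "((\<lambda>t. f (x + t *\<^sub>R coord_dir c)) has_vector_derivative pdiff0 c f (x + s *\<^sub>R coord_dir c)) (at s)"
proof -
  let ?y = "x + s *\<^sub>R coord_dir c"
  have "(\<lambda>t. f (?y + t *\<^sub>R coord_dir c)) differentiable (at 0)"
    using f x unfolding smooth0_iff using pdiffs0_simps(1) by metis
  then have "((\<lambda>t. f (?y + t *\<^sub>R coord_dir c)) has_vector_derivative pdiff0 c f ?y) (at 0)"
    using x by (simp add: vector_derivative_works pdiff0_def pdiff_def)
  then show ?thesis
    unfolding has_vector_derivative_iff_quotient by (simp add: scaleR_add_left add.assoc)
qed

text \<open>
  Schwarz's theorem under the hypotheses that are at hand: derivatives exist along the coordinate
  lines only, and just the two mixed derivatives are known to be continuous. The second
  difference over a small square equals, by two applications of the mean value theorem in either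
  order, \<open>h\<^sup>2\<close> times a value of each mixed derivative.
\<close>

lemma mixed_partials_commute_real:
  fixes \<phi> \<phi>s \<phi>t \<phi>st \<phi>ts :: "real \<Rightarrow> real \<Rightarrow> real"
  assumes \<delta>: "0 < \<delta>"
    and d1: "\<And>s t. \<bar>s\<bar> < \<delta> \<Longrightarrow> \<bar>t\<bar> < \<delta> \<Longrightarrow> ((\<lambda>s. \<phi> s t) has_real_derivative \<phi>s s t) (at s)"
    and d2: "\<And>s t. \<bar>s\<bar> < \<delta> \<Longrightarrow> \<bar>t\<bar> < \<delta> \<Longrightarrow> ((\<lambda>t. \<phi> s t) has_real_derivative \<phi>t s t) (at t)"
    and d12: "\<And>s t. \<bar>s\<bar> < \<delta> \<Longrightarrow> \<bar>t\<bar> < \<delta> \<Longrightarrow> ((\<lambda>t. \<phi>s s t) has_real_derivative \<phi>st s t) (at t)"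
    and d21: "\<And>s t. \<bar>s\<bar> < \<delta> \<Longrightarrow> \<bar>t\<bar> < \<delta> \<Longrightarrow> ((\<lambda>s. \<phi>t s t) has_real_derivative \<phi>ts s t) (at s)"
    and c12: "isCont (\<lambda>p. \<phi>st (fst p) (snd p)) (0, 0)"
    and c21: "isCont (\<lambda>p. \<phi>ts (fst p) (snd p)) (0, 0)"
  shows "\<phi>st 0 0 = \<phi>ts 0 0"
proof (rule ccontr)
  assume "\<phi>st 0 0 \<noteq> \<phi>ts 0 0"
  define e where "e = dist (\<phi>st 0 0) (\<phi>ts 0 0) / 2"
  have e: "0 < e" using \<open>\<phi>st 0 0 \<noteq> \<phi>ts 0 0\<close> by (simp add: e_def)
  obtain r1 where r1: "0 < r1" "\<And>p. dist p (0, 0) < r1 \<Longrightarrow> dist (\<phi>st (fst p) (snd p)) (\<phi>st 0 0) < e"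
    using c12 e unfolding continuous_at_eps_delta by (metis fst_conv snd_conv)
  obtain r2 where r2: "0 < r2" "\<And>p. dist p (0, 0) < r2 \<Longrightarrow> dist (\<phi>ts (fst p) (snd p)) (\<phi>ts 0 0) < e"
    using c21 e unfolding continuous_at_eps_delta by (metis fst_conv snd_conv)
  \<comment> \<open>Small enough that the square of side \<open>h\<close> lies in all three neighbourhoods.\<close>
  define h where "h = min \<delta> (min r1 r2) / 3"
  have h: "0 < h" "h < \<delta>" "2 * h < r1" "2 * h < r2" using \<delta> r1(1) r2(1) by (auto simp: h_def)
  have dist: "dist (a, b) (0, 0) < 2 * h" if "0 < a" "a < h" "0 < b" "b < h" for a b :: real
  proof -
    have "dist (a, b) (0, 0) \<le> \<bar>a\<bar> + \<bar>b\<bar>"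
      using norm_Pair_le[of a b] by (simp add: dist_norm)
    then show ?thesis using that by simp
  qed
  have "\<exists>z. 0 < z \<and> z < h \<and> (\<phi> h h - \<phi> h 0) - (\<phi> 0 h - \<phi> 0 0) = (h - 0) * (\<phi>s z h - \<phi>s z 0)"
    by (rule MVT2[OF h(1)]) (use h in \<open>auto intro!: DERIV_diff d1\<close>)
  then obtain a where a: "0 < a" "a < h" "(\<phi> h h - \<phi> h 0) - (\<phi> 0 h - \<phi> 0 0) = h * (\<phi>s a h - \<phi>s a 0)" by auto
  have "\<exists>z. 0 < z \<and> z < h \<and> \<phi>s a h - \<phi>s a 0 = (h - 0) * \<phi>st a z"
    by (rule MVT2[OF h(1)]) (use h a in \<open>auto intro!: d12\<close>)
  then obtain b where b: "0 < b" "b < h" "\<phi>s a h - \<phi>s a 0 = h * \<phi>st a b" by auto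
  have "\<exists>z. 0 < z \<and> z < h \<and> (\<phi> h h - \<phi> 0 h) - (\<phi> h 0 - \<phi> 0 0) = (h - 0) * (\<phi>t h z - \<phi>t 0 z)"
    by (rule MVT2[OF h(1)]) (use h in \<open>auto intro!: DERIV_diff d2\<close>)
  then obtain a' where a': "0 < a'" "a' < h" "(\<phi> h h - \<phi> 0 h) - (\<phi> h 0 - \<phi> 0 0) = h * (\<phi>t h a' - \<phi>t 0 a')" by auto
  have "\<exists>z. 0 < z \<and> z < h \<and> \<phi>t h a' - \<phi>t 0 a' = (h - 0) * \<phi>ts z a'"
    by (rule MVT2[OF h(1)]) (use h a' in \<open>auto intro!: d21\<close>)
  then obtain b' where b': "0 < b'" "b' < h" "\<phi>t h a' - \<phi>t 0 a' = h * \<phi>ts b' a'" by auto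
  have "h * (h * \<phi>st a b) = h * (h * \<phi>ts b' a')"
    using a(3) a'(3) unfolding b(3) b'(3) by linarith
  then have eq: "\<phi>st a b = \<phi>ts b' a'" using h(1) by simp
  have "dist (\<phi>st a b) (\<phi>st 0 0) < e"
    using r1(2)[of "(a, b)"] dist[OF a(1,2) b(1,2)] h by auto
  moreover have "dist (\<phi>ts b' a') (\<phi>ts 0 0) < e"
    using r2(2)[of "(b', a')"] dist[OF b'(1,2) a'(1,2)] h by auto
  ultimately have "dist (\<phi>st 0 0) (\<phi>ts 0 0) < 2 * e"
    using dist_triangle3[of "\<phi>st 0 0" "\<phi>ts 0 0" "\<phi>st a b"] eq by simp
  then show False by (simp add: e_def)
qed

text \<open>
  The real statement is applied to real and imaginary parts in the plane through \<open>x\<close> spanned by the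
  two directions; for \<open>c = d\<close> the plane degenerates and the argument still goes through.
\<close>

lemma mixed_partials_commute:
  fixes f :: "(real ^ 'm) \<times> (real ^ 'n) \<Rightarrow> complex"
  assumes f: "smooth0 f"
  shows "pdiff0 c (pdiff0 d f) = pdiff0 d (pdiff0 c f)"
proof (rule ext)
  fix x :: "(real^'m) \<times> (real^'n)"
  show "pdiff0 c (pdiff0 d f) x = pdiff0 d (pdiff0 c f) x"
  proof (cases "x \<in> orthant2")
    case True
    define P where "P p = x + fst p *\<^sub>R coord_dir c + snd p *\<^sub>R coord_dir d" for p :: "real \<times> real"
    have P_cont: "continuous_on UNIV P" unfolding P_def by (intro continuous_intros)
    then have "open (P -` orthant2)" by (rule open_vimage[OF open_orthant2])
    moreover have "(0, 0) \<in> P -` orthant2" using True by (simp add: P_def)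
    ultimately obtain r where r: "0 < r" "ball (0, 0) r \<subseteq> P -` orthant2"
      using open_contains_ball by blast
    define \<delta> where "\<delta> = r / 2"
    have \<delta>: "0 < \<delta>" using r by (simp add: \<delta>_def)
    have inn: "P (s, t) \<in> orthant2" if "\<bar>s\<bar> < \<delta>" "\<bar>t\<bar> < \<delta>" for s t
    proof -
      have "norm (s, t) < r" using norm_Pair_le[of s t] that by (simp add: \<delta>_def)
      then have "(s, t) \<in> ball (0, 0) r" by (simp add: dist_norm norm_Pair)
      then show ?thesis using r(2) by blast
    qed
    have Pc: "P (s, t) = (x + t *\<^sub>R coord_dir d) + s *\<^sub>R coord_dir c"
      and Pd: "P (s, t) = (x + s *\<^sub>R coord_dir c) + t *\<^sub>R coord_dir d" for s t
      by (simp_all add: P_def)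
    have dc: "((\<lambda>s. g (P (s, t))) has_vector_derivative pdiff0 c g (P (s, t))) (at s)"
      if "\<bar>s\<bar> < \<delta>" "\<bar>t\<bar> < \<delta>" "smooth0 g" for s t g
      unfolding Pc using smooth0_has_derivative[OF that(3), of "x + t *\<^sub>R coord_dir d" s c] inn[OF that(1,2)]
      by (simp add: Pc)
    have dd: "((\<lambda>t. g (P (s, t))) has_vector_derivative pdiff0 d g (P (s, t))) (at t)"
      if "\<bar>s\<bar> < \<delta>" "\<bar>t\<bar> < \<delta>" "smooth0 g" for s t g
      unfolding Pd using smooth0_has_derivative[OF that(3), of "x + s *\<^sub>R coord_dir c" t d] inn[OF that(1,2)]
      by (simp add: Pd)
    have cont: "isCont (\<lambda>p. g (P (fst p, snd p))) (0, 0)" if "smooth0 g" for g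
    proof -
      have "continuous_on (P -` orthant2) (\<lambda>p. g (P p))"
        by (rule continuous_on_compose2[OF smooth0_continuous[OF that] continuous_on_subset[OF P_cont]]) auto
      then show ?thesis
        using \<open>open (P -` orthant2)\<close> \<open>(0, 0) \<in> P -` orthant2\<close> by (simp add: continuous_on_eq_continuous_at)
    qed
    note sm = f smooth0_pdiff0[OF f] smooth0_pdiff0[OF smooth0_pdiff0[OF f]]
    have *: "L (pdiff0 d (pdiff0 c f) (P (0, 0))) = L (pdiff0 c (pdiff0 d f) (P (0, 0)))" if L: "bounded_linear L"
      for L :: "complex \<Rightarrow> real"
    proof (rule mixed_partials_commute_real[OF \<delta>, where \<phi>="\<lambda>s t. L (f (P (s, t)))" and \<phi>s="\<lambda>s t. L (pdiff0 c f (P (s, t)))"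
          and \<phi>t="\<lambda>s t. L (pdiff0 d f (P (s, t)))"
          and \<phi>st="\<lambda>s t. L (pdiff0 d (pdiff0 c f) (P (s, t)))" and \<phi>ts="\<lambda>s t. L (pdiff0 c (pdiff0 d f) (P (s, t)))"])
      show "isCont (\<lambda>p. L (pdiff0 d (pdiff0 c f) (P (fst p, snd p)))) (0, 0)"
        "isCont (\<lambda>p. L (pdiff0 c (pdiff0 d f) (P (fst p, snd p)))) (0, 0)"
        by (intro bounded_linear.isCont[OF L] cont sm)+
    qed (auto simp: has_real_derivative_iff_has_vector_derivative intro!: bounded_linear.has_vector_derivative[OF L] dc dd sm)
    have "P (0, 0) = x" by (simp add: P_def)
    then show ?thesis
      using *[OF bounded_linear_Re] *[OF bounded_linear_Im] by (simp add: complex_eq_iff)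
  qed (simp add: pdiff0_def)
qed

lemma pdiffs0_permute:
  assumes "smooth0 f" "mset cs = mset ds"
  shows "pdiffs0 cs f = pdiffs0 ds f"
  using assms(2)
proof (induction cs arbitrary: ds)
  case (Cons c cs)
  have "c \<in> set ds" using Cons.prems by (metis list.set_intros(1) mset_eq_setD)
  then obtain us vs where ds: "ds = us @ c # vs" by (meson split_list)
  have move: "pdiffs0 (us @ c # vs) f = pdiff0 c (pdiffs0 (us @ vs) f)" for us vs
  proof (induction us)
    case (Cons u us)
    have "pdiffs0 ((u # us) @ c # vs) f = pdiff0 u (pdiff0 c (pdiffs0 (us @ vs) f))" using Cons.IH by simp
    also have "\<dots> = pdiff0 c (pdiff0 u (pdiffs0 (us @ vs) f))"
      by (intro mixed_partials_commute smooth0_pdiffs0 assms)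
    finally show ?case by simp
  qed simp
  have "mset cs = mset (us @ vs)" using Cons.prems ds by simp
  from Cons.IH[OF this] show ?case unfolding ds move pdiffs0_simps by (rule arg_cong)
qed simp

lemma exists_list_count_list:
  fixes n :: "'c::finite \<Rightarrow> nat"
  shows "\<exists>cs. \<forall>c. count_list cs c = n c"
proof -
  obtain cs where "mset cs = (\<Sum>c\<in>UNIV. replicate_mset (n c) c)" using ex_mset by blast
  then have "count (mset cs) c = n c" for c by (simp add: count_sum)
  then show ?thesis by (metis count_mset)
qed

text \<open>
  The order of differentiation selected in \<open>mdiff\<close> is unknown, but by symmetry of mixed derivatives
  any list with the right multiplicities may replace it.
\<close>

lemma mdiff_eq_pdiffs0:
  assumes f: "smooth0 f" and x: "x \<in> orthant2"
    and l: "\<And>i. count_list cs (Inl i) = p' $ i" and r: "\<And>j. count_list cs (Inr j) = p'' $ j"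
  shows "mdiff (p', p'') f x = pdiffs0 cs f x"
proof -
  let ?Q = "\<lambda>ds. (\<forall>i. count_list ds (Inl i) = fst (p', p'') $ i) \<and> (\<forall>j. count_list ds (Inr j) = snd (p', p'') $ j)"
  have "?Q (SOME ds. ?Q ds)" by (rule someI[of ?Q cs]) (simp add: l r)
  then have "count_list (SOME ds. ?Q ds) c = count_list cs c" for c
    by (cases c) (simp_all add: l r)
  then have perm: "mset (SOME ds. ?Q ds) = mset cs" by (intro multiset_eqI) (simp add: count_mset)
  show ?thesis
    unfolding mdiff_def pdiffs_eq_pdiffs0[OF x] pdiffs0_permute[OF f perm] ..
qed

lemma ex_mdiff_list:
  obtains cs :: "('m::finite + 'n::finite) list"
  where "\<And>i. count_list cs (Inl i) = p' $ i" "\<And>j. count_list cs (Inr j) = p'' $ j"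
proof -
  obtain cs :: "('m + 'n) list" where "\<forall>c. count_list cs c = (case c of Inl i \<Rightarrow> p' $ i | Inr j \<Rightarrow> p'' $ j)"
    using exists_list_count_list[of "\<lambda>c. case c of Inl i \<Rightarrow> p' $ i | Inr j \<Rightarrow> p'' $ j"] by blast
  then show ?thesis by (intro that[of cs]) simp_all
qed

text \<open>
  Moving from \<open>x\<close> to \<open>y\<close> one coordinate at a time stays inside the orthant, and each move is
  controlled by one partial derivative.
\<close>

lemma lipschitz_if_partials_bounded:
  fixes f :: "(real ^ 'm) \<times> (real ^ 'n) \<Rightarrow> complex"
  assumes deriv: "\<And>c x. x \<in> orthant2 \<Longrightarrow> ((\<lambda>s. f (x + s *\<^sub>R coord_dir c)) has_vector_derivative g c x) (at 0)"
    and bound: "\<And>c x. x \<in> orthant2 \<Longrightarrow> cmod (g c x) \<le> B"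
    and x: "x \<in> orthant2" and y: "y \<in> orthant2"
  shows "cmod (f x - f y) \<le> B * (\<Sum>c\<in>UNIV. \<bar>coord c x - coord c y\<bar>)"
proof -
  have "cmod (f x - f y) \<le> B * (\<Sum>c\<in>C. \<bar>coord c x - coord c y\<bar>)"
    if "finite C" "x \<in> orthant2" "\<And>c. c \<notin> C \<Longrightarrow> coord c x = coord c y" for C x
    using that
  proof (induction C arbitrary: x rule: finite_induct)
    case empty
    then have "x = y" by (intro coord_eqI) simp
    then show ?case by simp
  next
    case (insert d C)
    define h where "h = coord d y - coord d x"
    \<comment> \<open>\<open>x\<close> with its \<open>d\<close>-th coordinate replaced by that of \<open>y\<close>.\<close>
    define x' where "x' = x + h *\<^sub>R coord_dir d"
    have inn: "x + s *\<^sub>R coord_dir d \<in> orthant2" if "s \<in> closed_segment 0 h" for s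
    proof -
      have "0 < coord d x" "0 < coord d y" using insert.prems(1) y by (auto simp: orthant2_iff)
      then have "0 < coord d x + s"
        using that unfolding h_def closed_segment_eq_real_ivl by (auto split: if_splits)
      then show ?thesis using insert.prems(1) unfolding orthant2_iff coord_move by simp
    qed
    have x': "x' \<in> orthant2" unfolding x'_def by (rule inn) simp
    have cx': "coord c x' = (if c = d then coord d y else coord c x)" for c
      by (simp add: x'_def coord_move h_def)
    have "cmod (f (x + h *\<^sub>R coord_dir d) - f (x + 0 *\<^sub>R coord_dir d)) \<le> B * \<bar>h - 0\<bar>"
    proof (rule norm_diff_le_vector_derivative_bound[where S="closed_segment 0 h" and f="\<lambda>s. f (x + s *\<^sub>R coord_dir d)"])
      fix s assume s: "s \<in> closed_segment 0 h"
      have "((\<lambda>t. f ((x + s *\<^sub>R coord_dir d) + t *\<^sub>R coord_dir d)) has_vector_derivative g d (x + s *\<^sub>R coord_dir d)) (at 0)"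
        by (rule deriv[OF inn[OF s]])
      then show "((\<lambda>s. f (x + s *\<^sub>R coord_dir d)) has_vector_derivative g d (x + s *\<^sub>R coord_dir d)) (at s)"
        unfolding has_vector_derivative_iff_quotient by (simp add: scaleR_add_left add.assoc)
      show "cmod (g d (x + s *\<^sub>R coord_dir d)) \<le> B" by (rule bound[OF inn[OF s]])
    qed simp_all
    then have 1: "cmod (f x' - f x) \<le> B * \<bar>coord d x - coord d y\<bar>"
      by (simp add: x'_def h_def abs_minus_commute)
    have "cmod (f x' - f y) \<le> B * (\<Sum>c\<in>C. \<bar>coord c x' - coord c y\<bar>)"
      by (intro insert.IH x') (use insert.prems(2) in \<open>auto simp: cx'\<close>)
    also have "(\<Sum>c\<in>C. \<bar>coord c x' - coord c y\<bar>) = (\<Sum>c\<in>C. \<bar>coord c x - coord c y\<bar>)"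
      using insert.hyps by (intro sum.cong) (auto simp: cx')
    finally have 2: "cmod (f x' - f y) \<le> B * (\<Sum>c\<in>C. \<bar>coord c x - coord c y\<bar>)" .
    have "cmod (f x - f y) \<le> cmod (f x' - f x) + cmod (f x' - f y)"
      using norm_triangle_ineq4[of "f x' - f y" "f x' - f x"] by simp
    also have "\<dots> \<le> B * (\<Sum>c\<in>insert d C. \<bar>coord c x - coord c y\<bar>)"
      using 1 2 insert.hyps by (simp add: distrib_left)
    finally show ?case .
  qed
  from this[of UNIV x] x show ?thesis by simp
qed

lemma uniformly_continuous_if_partials_bounded:
  fixes f :: "(real ^ 'm) \<times> (real ^ 'n) \<Rightarrow> complex"
  assumes deriv: "\<And>c x. x \<in> orthant2 \<Longrightarrow> ((\<lambda>s. f (x + s *\<^sub>R coord_dir c)) has_vector_derivative g c x) (at 0)"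
    and bound: "\<And>c x. x \<in> orthant2 \<Longrightarrow> cmod (g c x) \<le> B"
  shows "uniformly_continuous_on orthant2 f"
proof (cases "orthant2 = ({} :: ((real ^ 'm) \<times> (real ^ 'n)) set)")
  case False
  then obtain x0 :: "(real ^ 'm) \<times> (real ^ 'n)" where "x0 \<in> orthant2" by blast
  then have B: "0 \<le> B" using order_trans[OF norm_ge_zero bound] by blast
  let ?N = "real (card (UNIV :: ('m + 'n) set))"
  have lip: "dist (f x) (f y) \<le> B * ?N * dist x y" if "x \<in> orthant2" "y \<in> orthant2" for x y
  proof -
    have "dist (f x) (f y) \<le> B * (\<Sum>c\<in>UNIV. \<bar>coord c x - coord c y\<bar>)"
      unfolding dist_norm by (rule lipschitz_if_partials_bounded[OF deriv bound that])
    also have "(\<Sum>c\<in>UNIV. \<bar>coord c x - coord c y\<bar>) \<le> ?N * dist x y"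
      by (rule sum_bounded_above) (rule abs_coord_diff_le_dist)
    finally show ?thesis using B by (simp add: mult_left_mono mult.assoc)
  qed
  show ?thesis unfolding uniformly_continuous_on_def
  proof (intro allI impI)
    fix e :: real assume e: "0 < e"
    have N: "0 \<le> B * ?N" using B by simp
    show "\<exists>d>0. \<forall>x\<in>orthant2. \<forall>x'\<in>orthant2. dist x' x < d \<longrightarrow> dist (f x') (f x) < e"
    proof (intro exI[of _ "e / (B * ?N + 1)"] conjI ballI impI)
      show "0 < e / (B * ?N + 1)" using e N by simp
      fix x x' :: "(real ^ 'm) \<times> (real ^ 'n)" assume xx: "x \<in> orthant2" "x' \<in> orthant2" and d: "dist x' x < e / (B * ?N + 1)"
      have "dist (f x') (f x) \<le> B * ?N * dist x' x" by (rule lip[OF xx(2,1)])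
      also have "\<dots> \<le> (B * ?N + 1) * dist x' x" by (simp add: distrib_right)
      also have "\<dots> < e" using d N by (simp add: pos_less_divide_eq mult.commute)
      finally show "dist (f x') (f x) < e" .
    qed
  qed
qed (auto simp: uniformly_continuous_on_def)

lemma closed_orthant_subset_closure:
  "closed_orthant \<times> closed_orthant \<subseteq> closure (orthant2 :: ((real ^ 'm) \<times> (real ^ 'n)) set)"
proof
  fix x :: "(real ^ 'm) \<times> (real ^ 'n)" assume x: "x \<in> closed_orthant \<times> closed_orthant"
  define u :: "(real ^ 'm) \<times> (real ^ 'n)" where "u = ((\<chi> i. 1), (\<chi> i. 1))"
  have "(\<lambda>n. x + inverse (real (Suc n)) *\<^sub>R u) \<longlonglongrightarrow> x + 0 *\<^sub>R u"
    by (intro tendsto_intros LIMSEQ_inverse_real_of_nat)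
  moreover have "x + inverse (real (Suc n)) *\<^sub>R u \<in> orthant2" for n
    using x by (cases x) (auto simp: u_def pos_orthant_def closed_orthant_def intro!: add_nonneg_pos)
  ultimately show "x \<in> closure orthant2" unfolding closure_sequential by (auto intro!: exI[of _ "\<lambda>n. x + inverse (real (Suc n)) *\<^sub>R u"])
qed

lemma mpow_nonneg: "x \<in> orthant2 \<Longrightarrow> 0 \<le> mpow x k"
  unfolding mpow_def by (intro mult_nonneg_nonneg prod_nonneg) (auto simp: pos_orthant_def less_imp_le)

lemma mpow_0 [simp]: "mpow x 0 = 1"
  by (simp add: mpow_def)

lemma schwartz_smooth0: "f \<in> schwartz \<Longrightarrow> smooth0 f"
  by (auto simp: schwartz_def smooth0_def)

lemma schwartz_bounded:
  fixes f :: "(real ^ 'm) \<times> (real ^ 'n) \<Rightarrow> complex"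
  assumes "f \<in> schwartz"
  shows "\<exists>M. \<forall>x\<in>orthant2. mpow x k * cmod (pdiffs0 cs f x) \<le> M"
proof -
  define p' :: "nat^'m" where "p' = (\<chi> i. count_list cs (Inl i))"
  define p'' :: "nat^'n" where "p'' = (\<chi> j. count_list cs (Inr j))"
  have "mdiff (p', p'') f x = pdiffs0 cs f x" if "x \<in> orthant2" for x
    by (rule mdiff_eq_pdiffs0[OF schwartz_smooth0[OF assms] that]) (simp_all add: p'_def p''_def)
  moreover have "bdd_above ((\<lambda>x. mpow x k * cmod (mdiff (p', p'') f x)) ` orthant2)"
  proof -
    have "\<forall>k p. bdd_above ((\<lambda>x. mpow x k * cmod (mdiff p f x)) ` orthant2)"
      using assms unfolding schwartz_def by (elim CollectE conjE)
    then show ?thesis by (elim allE)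
  qed
  ultimately show ?thesis unfolding bdd_above_def by auto
qed

text \<open>
  The bounds yield the continuous extensions: since all first derivatives of \<open>D\<^sup>p f\<close> are bounded,
  \<open>D\<^sup>p f\<close> is Lipschitz, hence uniformly continuous, and so extends to the closed orthant.
\<close>

lemma schwartzI:
  fixes f :: "(real ^ 'm) \<times> (real ^ 'n) \<Rightarrow> complex"
  assumes f: "smooth0 f" and b: "\<And>k cs. \<exists>M. \<forall>x\<in>orthant2. mpow x k * cmod (pdiffs0 cs f x) \<le> M"
  shows "f \<in> schwartz"
proof -
  have list: "\<exists>cs. \<forall>x\<in>orthant2. mdiff p f x = pdiffs0 cs f x" for p
  proof -
    obtain cs :: "('m + 'n) list" where "\<And>i. count_list cs (Inl i) = fst p $ i" "\<And>j. count_list cs (Inr j) = snd p $ j"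
      using ex_mdiff_list[of "fst p" "snd p"] by blast
    then have "mdiff (fst p, snd p) f x = pdiffs0 cs f x" if "x \<in> orthant2" for x
      by (rule mdiff_eq_pdiffs0[OF f that])
    then show ?thesis by auto
  qed
  have "\<exists>g. continuous_on (closed_orthant \<times> closed_orthant) g \<and> (\<forall>x\<in>orthant2. g x = mdiff p f x)" for p
  proof -
    obtain cs where cs: "\<And>x. x \<in> orthant2 \<Longrightarrow> mdiff p f x = pdiffs0 cs f x" using list by blast
    have "\<exists>M. \<forall>c. \<forall>x\<in>orthant2. cmod (pdiff0 c (pdiffs0 cs f) x) \<le> M"
    proof -
      obtain M where M: "\<And>c. \<forall>x\<in>orthant2. cmod (pdiff0 c (pdiffs0 cs f) x) \<le> M c"
        using b[of 0 "_ # cs"] by (simp only: mpow_0 mult_1_left pdiffs0_simps) metis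
      have "M c \<le> Max (range M)" for c by simp
      then show ?thesis using M by (meson order_trans)
    qed
    then obtain M where "\<And>c x. x \<in> orthant2 \<Longrightarrow> cmod (pdiff0 c (pdiffs0 cs f) x) \<le> M" by blast
    then have "uniformly_continuous_on orthant2 (pdiffs0 cs f)"
      using smooth0_has_derivative[OF smooth0_pdiffs0[OF f], where s=0]
      by (intro uniformly_continuous_if_partials_bounded[where g="\<lambda>c. pdiff0 c (pdiffs0 cs f)" and B=M]) simp_all
    then obtain g
      where g: "uniformly_continuous_on (closure orthant2) g" "\<And>x. x \<in> orthant2 \<Longrightarrow> pdiffs0 cs f x = g x"
      by (rule uniformly_continuous_on_extension_on_closure) (rule that; simp)
    then have "continuous_on (closed_orthant \<times> closed_orthant) g"
      using closed_orthant_subset_closure continuous_on_subset uniformly_continuous_imp_continuous by blast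
    then show ?thesis using g(2) cs by (intro exI[of _ g]) auto
  qed
  moreover have "bdd_above ((\<lambda>x. mpow x k * cmod (mdiff p f x)) ` orthant2)" for k p
  proof -
    obtain cs where cs: "\<And>x. x \<in> orthant2 \<Longrightarrow> mdiff p f x = pdiffs0 cs f x" using list by blast
    obtain M where "\<forall>x\<in>orthant2. mpow x k * cmod (pdiffs0 cs f x) \<le> M" using b by blast
    then show ?thesis using cs unfolding bdd_above_def by auto
  qed
  ultimately show ?thesis using f unfolding schwartz_def smooth0_def by blast
qed

text \<open>
  A class of rapidly decreasing functions that is closed under partial derivatives consists of
  Schwartz functions: all iterated derivatives stay in the class, and continuity comes from the
  boundedness of the next derivative. This reduces membership to a single differentiation.
\<close>

lemma schwartz_coinduct:
  fixes S :: "((real ^ 'm) \<times> (real ^ 'n) \<Rightarrow> complex) set"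
  assumes S: "f \<in> S"
    and zero: "\<And>g x. g \<in> S \<Longrightarrow> x \<notin> orthant2 \<Longrightarrow> g x = 0"
    and deriv: "\<And>g c. g \<in> S \<Longrightarrow> \<exists>h\<in>S. \<forall>x\<in>orthant2. ((\<lambda>s. g (x + s *\<^sub>R coord_dir c)) has_vector_derivative h x) (at 0)"
    and decay: "\<And>g k. g \<in> S \<Longrightarrow> \<exists>M. \<forall>x\<in>orthant2. mpow x k * cmod (g x) \<le> M"
  shows "f \<in> schwartz"
proof -
  have d: "((\<lambda>s. g (x + s *\<^sub>R coord_dir c)) has_vector_derivative pdiff0 c g x) (at 0)"
    and rS: "pdiff0 c g \<in> S" if g: "g \<in> S" and x: "x \<in> orthant2" for g c x
  proof -
    obtain h where h: "h \<in> S" "\<And>x. x\<in>orthant2 \<Longrightarrow> ((\<lambda>s. g (x + s *\<^sub>R coord_dir c)) has_vector_derivative h x) (at 0)"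
      using deriv[OF g] by blast
    have "pdiff0 c g = h"
    proof
      fix x show "pdiff0 c g x = h x"
        using vector_derivative_at[OF h(2)] zero[OF h(1), of x] by (auto simp: pdiff0_def pdiff_def)
    qed
    then show "((\<lambda>s. g (x + s *\<^sub>R coord_dir c)) has_vector_derivative pdiff0 c g x) (at 0)" "pdiff0 c g \<in> S"
      using h x by auto
  qed
  have ne: "((\<chi> i. 1), (\<chi> i. 1)) \<in> (orthant2 :: ((real ^ 'm) \<times> (real ^ 'n)) set)"
    by (auto simp: pos_orthant_def)
  have pdiffs0: "pdiffs0 cs f \<in> S" for cs by (induction cs) (auto intro: S rS[OF _ ne])
  have cont: "continuous_on orthant2 g" if g: "g \<in> S" for g
  proof -
    obtain M where M: "\<And>c. \<forall>x\<in>orthant2. cmod (pdiff0 c g x) \<le> M c"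
      using decay[of _ 0, OF rS[OF g ne]] by (simp only: mpow_0 mult_1_left) metis
    have "M c \<le> Max (range M)" for c by simp
    then have "cmod (pdiff0 c g x) \<le> Max (range M)" if "x \<in> orthant2" for c x
      using M that by (meson order_trans)
    then have "uniformly_continuous_on orthant2 g"
      by (intro uniformly_continuous_if_partials_bounded[where g="\<lambda>c. pdiff0 c g" and B="Max (range M)"] d g)
    then show ?thesis by (rule uniformly_continuous_imp_continuous)
  qed
  have "smooth0 f"
    unfolding smooth0_iff
    by (intro conjI allI impI ballI zero[OF S] cont[OF pdiffs0] differentiableI_vector[OF d[OF pdiffs0]])
  then show ?thesis by (rule schwartzI) (rule decay[OF pdiffs0])
qed

section \<open>Operations and envelopes for Schwartz functions\<close>

lemma schwartz_pdiff0: "f \<in> schwartz \<Longrightarrow> pdiff0 c f \<in> schwartz"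
proof (rule schwartzI)
  assume f: "f \<in> schwartz"
  then show "smooth0 (pdiff0 c f)" by (intro smooth0_pdiff0 schwartz_smooth0)
  show "\<exists>M. \<forall>x\<in>orthant2. mpow x k * cmod (pdiffs0 cs (pdiff0 c f) x) \<le> M" for k cs
    using schwartz_bounded[OF f, of k "cs @ [c]"] by (simp only: pdiffs0_append pdiffs0_simps)
qed

lemma schwartz_pdiffs0: "f \<in> schwartz \<Longrightarrow> pdiffs0 cs f \<in> schwartz"
  by (induction cs) (auto intro: schwartz_pdiff0)

lemma schwartz_outside: "f \<in> schwartz \<Longrightarrow> x \<notin> orthant2 \<Longrightarrow> f x = 0"
  by (rule smooth0_outside[OF schwartz_smooth0])

lemma schwartz_decay: "f \<in> schwartz \<Longrightarrow> \<exists>M. \<forall>x\<in>orthant2. mpow x k * cmod (f x) \<le> M"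
  using schwartz_bounded[of f k "[]"] by simp

lemma schwartz_has_derivative:
  "f \<in> schwartz \<Longrightarrow> x + s *\<^sub>R coord_dir c \<in> orthant2 \<Longrightarrow>
     ((\<lambda>t. f (x + t *\<^sub>R coord_dir c)) has_vector_derivative pdiff0 c f (x + s *\<^sub>R coord_dir c)) (at s)"
  by (rule smooth0_has_derivative[OF schwartz_smooth0])

lemma pdiff0_linear:
  assumes f: "smooth0 f" and g: "smooth0 g"
  shows "pdiff0 c (\<lambda>x. a * f x + b * g x) = (\<lambda>x. a * pdiff0 c f x + b * pdiff0 c g x)"
proof
  fix x show "pdiff0 c (\<lambda>x. a * f x + b * g x) x = a * pdiff0 c f x + b * pdiff0 c g x"
  proof (cases "x \<in> orthant2")
    case True
    have "((\<lambda>s. a * f (x + s *\<^sub>R coord_dir c) + b * g (x + s *\<^sub>R coord_dir c)) has_vector_derivative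
        a * pdiff0 c f (x + 0 *\<^sub>R coord_dir c) + b * pdiff0 c g (x + 0 *\<^sub>R coord_dir c)) (at 0)"
      by (intro has_vector_derivative_add has_vector_derivative_mult_right smooth0_has_derivative f g)
        (use True in simp_all)
    then show ?thesis
      using True by (simp only: pdiff0_def pdiff_def if_True vector_derivative_at scaleR_zero_left add_0_right)
  qed (simp only: pdiff0_def if_False mult_zero_right add_0_right)
qed

lemma schwartz_linear:
  fixes f g :: "(real ^ 'm) \<times> (real ^ 'n) \<Rightarrow> complex"
  assumes f: "f \<in> schwartz" and g: "g \<in> schwartz"
  shows "(\<lambda>x. a * f x + b * g x) \<in> schwartz"
proof (rule schwartz_coinduct[where S="{(\<lambda>x. a * f x + b * g x) | f g. f \<in> schwartz \<and> g \<in> schwartz}"])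
  show "(\<lambda>x. a * f x + b * g x) \<in> {(\<lambda>x. a * f x + b * g x) | f g. f \<in> schwartz \<and> g \<in> schwartz}"
    using f g by blast
next
  fix h :: "(real ^ 'm) \<times> (real ^ 'n) \<Rightarrow> complex"
  assume "h \<in> {(\<lambda>x. a * f x + b * g x) | f g. f \<in> schwartz \<and> g \<in> schwartz}"
  then obtain f g where h: "h = (\<lambda>x. a * f x + b * g x)" and f: "f \<in> schwartz" and g: "g \<in> schwartz" by blast
  show "h x = 0" if "x \<notin> orthant2" for x
    unfolding h schwartz_outside[OF f that] schwartz_outside[OF g that] by simp
  show "\<exists>h'\<in>{(\<lambda>x. a * f x + b * g x) | f g. f \<in> schwartz \<and> g \<in> schwartz}.
     \<forall>x\<in>orthant2. ((\<lambda>s. h (x + s *\<^sub>R coord_dir c)) has_vector_derivative h' x) (at 0)" for c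
  proof (intro bexI[of _ "\<lambda>x. a * pdiff0 c f x + b * pdiff0 c g x"] ballI)
    fix x :: "(real ^ 'm) \<times> (real ^ 'n)" assume x: "x \<in> orthant2"
    then have x0: "x + 0 *\<^sub>R coord_dir c \<in> orthant2" by simp
    show "((\<lambda>s. h (x + s *\<^sub>R coord_dir c)) has_vector_derivative a * pdiff0 c f x + b * pdiff0 c g x) (at 0)"
      unfolding h using schwartz_has_derivative[OF f x0] schwartz_has_derivative[OF g x0]
      by (intro has_vector_derivative_add has_vector_derivative_mult_right) simp_all
  qed (use f g schwartz_pdiff0 in blast)
  show "\<exists>M. \<forall>x\<in>orthant2. mpow x k * cmod (h x) \<le> M" for k
  proof -
    obtain A where A: "\<And>x. x \<in> orthant2 \<Longrightarrow> mpow x k * cmod (f x) \<le> A" using schwartz_decay[OF f] by blast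
    obtain B where B: "\<And>x. x \<in> orthant2 \<Longrightarrow> mpow x k * cmod (g x) \<le> B" using schwartz_decay[OF g] by blast
    have "mpow x k * cmod (h x) \<le> cmod a * A + cmod b * B" if x: "x \<in> orthant2" for x
    proof -
      have "mpow x k * cmod (h x) \<le> mpow x k * (cmod a * cmod (f x) + cmod b * cmod (g x))"
        unfolding h using mpow_nonneg[OF x] by (intro mult_left_mono order_trans[OF norm_triangle_ineq]) (auto simp: norm_mult)
      also have "\<dots> = cmod a * (mpow x k * cmod (f x)) + cmod b * (mpow x k * cmod (g x))"
        by (simp add: algebra_simps)
      also have "\<dots> \<le> cmod a * A + cmod b * B"
        by (intro add_mono mult_left_mono A B x) auto
      finally show ?thesis .
    qed
    then show ?thesis by blast
  qed
qed

definition sup_seminorm :: "(nat ^ 'm) \<times> (nat ^ 'n) \<Rightarrow> ((real ^ 'm) \<times> (real ^ 'n) \<Rightarrow> complex) \<Rightarrow> real" where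
  "sup_seminorm k f = (SUP x\<in>orthant2. mpow x k * cmod (f x))"

lemma mpow_le_sup_seminorm:
  assumes "f \<in> schwartz" "x \<in> orthant2"
  shows "mpow x k * cmod (f x) \<le> sup_seminorm k f"
proof -
  have "bdd_above ((\<lambda>x. mpow x k * cmod (f x)) ` orthant2)"
    using schwartz_decay[OF assms(1), of k] unfolding bdd_above_def by auto
  then show ?thesis unfolding sup_seminorm_def using assms(2) by (rule cSUP_upper[rotated])
qed

lemma sup_seminorm_nonneg:
  fixes f :: "(real ^ 'm) \<times> (real ^ 'n) \<Rightarrow> complex"
  assumes f: "f \<in> schwartz"
  shows "0 \<le> sup_seminorm k f"
proof -
  have ne: "((\<chi> i. 1), (\<chi> i. 1)) \<in> (orthant2 :: ((real ^ 'm) \<times> (real ^ 'n)) set)" by (auto simp: pos_orthant_def)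
  have "0 \<le> mpow ((\<chi> i. 1), (\<chi> i. 1)) k * cmod (f ((\<chi> i. 1), (\<chi> i. 1)))"
    using mpow_nonneg[OF ne] by simp
  also have "\<dots> \<le> sup_seminorm k f" by (rule mpow_le_sup_seminorm[OF f ne])
  finally show ?thesis .
qed

lemma prod_UNIV_sum:
  fixes g :: "'m::finite + 'n::finite \<Rightarrow> real"
  shows "(\<Prod>c\<in>UNIV. g c) = (\<Prod>i\<in>UNIV. g (Inl i)) * (\<Prod>j\<in>UNIV. g (Inr j))"
  using prod.Plus[of "UNIV::'m set" "UNIV::'n set" g] by (simp add: UNIV_Plus_UNIV o_def)

lemma powr_mult_le_max:
  fixes u a :: real
  assumes "0 < u" "0 \<le> a" "a + 2 \<le> real N"
  shows "u powr a \<le> 2 * max 1 (u ^ N) * (1 / (1 + u\<^sup>2))"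
proof -
  have le: "u powr b \<le> max 1 (u ^ N)" if "0 \<le> b" "b \<le> real N" for b
  proof (cases "u \<le> 1")
    case True
    then have "u powr b \<le> 1" using assms that by (intro powr_le1) auto
    then show ?thesis by simp
  next
    case False
    then have "u powr b \<le> u powr real N" using that by (intro powr_mono) auto
    then show ?thesis using assms by (simp add: powr_realpow)
  qed
  have "u powr a * (1 + u\<^sup>2) = u powr a + u powr (a + 2)"
    using assms by (simp add: powr_add powr_numeral algebra_simps)
  also have "\<dots> \<le> 2 * max 1 (u ^ N)"
    using le[of a] le[of "a + 2"] assms by auto
  finally have "u powr a * (1 + u\<^sup>2) \<le> 2 * max 1 (u ^ N)" .
  moreover have "0 < 1 + u\<^sup>2" by (simp add: add_pos_nonneg)
  ultimately show ?thesis by (simp add: pos_le_divide_eq)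
qed

text \<open>
  Real powers of the coordinates times the inverse of the majorant are dominated by monomials:
  each factor \<open>u\<^sup>\<alpha> (1 + u\<^sup>2)\<close> is at most \<open>2 max 1 (u\<^sup>N)\<close> for \<open>N \<ge> \<alpha> + 2\<close>. The finite set of seminorms and
  the constant are chosen before \<open>f\<close>, which is what continuity of the transform needs.
\<close>

lemma schwartz_weighted_bound:
  fixes \<alpha> :: "real ^ 'm" and \<beta> :: "real ^ 'n"
  assumes \<alpha>: "\<forall>l. 0 \<le> \<alpha> $ l" and \<beta>: "\<forall>l. 0 \<le> \<beta> $ l"
  shows "\<exists>I C. finite I \<and> 0 \<le> C \<and> (\<forall>f\<in>schwartz. \<forall>x\<in>orthant2.
     vpow (fst x) \<alpha> * vpow (snd x) \<beta> * cmod (f x) \<le>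
       C * (decay_weight (fst x) * decay_weight (snd x)) * (\<Sum>k\<in>I. sup_seminorm k f))"
proof -
  define \<gamma> where "\<gamma> c = (case c of Inl l \<Rightarrow> \<alpha> $ l | Inr l \<Rightarrow> \<beta> $ l)" for c
  define N where "N c = nat \<lceil>\<gamma> c\<rceil> + 2" for c
  define K :: "('m + 'n) set \<Rightarrow> (nat ^ 'm) \<times> (nat ^ 'n)" where
    "K S = ((\<chi> i. if Inl i \<in> S then N (Inl i) else 0), (\<chi> j. if Inr j \<in> S then N (Inr j) else 0))" for S
  have \<gamma>: "0 \<le> \<gamma> c" for c using \<alpha> \<beta> by (auto simp: \<gamma>_def split: sum.split)
  have N: "\<gamma> c + 2 \<le> real (N c)" for c unfolding N_def by (simp add: real_nat_ceiling_ge)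
  let ?d = "card (UNIV :: ('m + 'n) set)"
  have "vpow (fst x) \<alpha> * vpow (snd x) \<beta> * cmod (f x) \<le>
       2 ^ ?d * (decay_weight (fst x) * decay_weight (snd x)) * (\<Sum>k\<in>range K. sup_seminorm k f)"
    if f: "f \<in> schwartz" and x: "x \<in> orthant2" for f x
  proof -
    have cx: "0 < coord c x" for c using x orthant2_iff by blast
    have xp: "fst x \<in> pos_orthant" "snd x \<in> pos_orthant" using x by auto
    \<comment> \<open>The monomial over these coordinates is the product of all maxima.\<close>
    let ?S = "{c. 1 < coord c x}"
    have "vpow (fst x) \<alpha> * vpow (snd x) \<beta> = (\<Prod>c\<in>UNIV. coord c x powr \<gamma> c)"
      unfolding prod_UNIV_sum vpow_def by (simp add: \<gamma>_def)
    also have "\<dots> \<le> (\<Prod>c\<in>UNIV. 2 * max 1 (coord c x ^ N c) * (1 / (1 + (coord c x)\<^sup>2)))"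
      by (intro prod_mono conjI powr_ge_zero powr_mult_le_max cx \<gamma> N)
    also have "\<dots> = 2 ^ ?d * (\<Prod>c\<in>UNIV. max 1 (coord c x ^ N c)) * (\<Prod>c\<in>UNIV. 1 / (1 + (coord c x)\<^sup>2))"
      unfolding prod.distrib prod_constant ..
    also have "(\<Prod>c\<in>UNIV. 1 / (1 + (coord c x)\<^sup>2)) = decay_weight (fst x) * decay_weight (snd x)"
      unfolding prod_UNIV_sum decay_weight_eq[OF xp(1)] decay_weight_eq[OF xp(2)]
      by (simp add: prod_inversef[symmetric] o_def divide_inverse)
    also have "(\<Prod>c\<in>UNIV. max 1 (coord c x ^ N c)) = (\<Prod>c\<in>UNIV. coord c x ^ (if c \<in> ?S then N c else 0))"
    proof (rule prod.cong[OF refl])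
      fix c show "max 1 (coord c x ^ N c) = coord c x ^ (if c \<in> ?S then N c else 0)"
        using cx[of c] one_le_power[of "coord c x" "N c"] power_le_one[of "coord c x" "N c"]
        by (cases "1 < coord c x") (auto simp: max_def intro: antisym)
    qed
    also have "(\<Prod>c\<in>UNIV. coord c x ^ (if c \<in> ?S then N c else 0)) = mpow x (K ?S)"
      unfolding prod_UNIV_sum mpow_def by (simp add: K_def)
    finally have "vpow (fst x) \<alpha> * vpow (snd x) \<beta> * cmod (f x) \<le>
       2 ^ ?d * mpow x (K ?S) * (decay_weight (fst x) * decay_weight (snd x)) * cmod (f x)"
      by (rule mult_right_mono) simp
    also have "\<dots> = 2 ^ ?d * (decay_weight (fst x) * decay_weight (snd x)) * (mpow x (K ?S) * cmod (f x))"
      by simp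
    also have "\<dots> \<le> 2 ^ ?d * (decay_weight (fst x) * decay_weight (snd x)) * (\<Sum>k\<in>range K. sup_seminorm k f)"
    proof (rule mult_left_mono)
      have "mpow x (K ?S) * cmod (f x) \<le> sup_seminorm (K ?S) f" by (rule mpow_le_sup_seminorm[OF f x])
      also have "\<dots> \<le> (\<Sum>k\<in>range K. sup_seminorm k f)"
        by (intro member_le_sum sup_seminorm_nonneg f) auto
      finally show "mpow x (K ?S) * cmod (f x) \<le> (\<Sum>k\<in>range K. sup_seminorm k f)" .
    qed simp
    finally show ?thesis .
  qed
  then show ?thesis by (intro exI[of _ "range K"] exI[of _ "2 ^ ?d"]) auto
qed

lemma schwartz_envelope2:
  fixes f :: "(real ^ 'm) \<times> (real ^ 'n) \<Rightarrow> complex"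
  assumes f: "f \<in> schwartz" and \<alpha>: "\<forall>l. 0 \<le> \<alpha> $ l" and \<beta>: "\<forall>l. 0 \<le> \<beta> $ l"
  shows "\<exists>C\<ge>0. \<forall>x\<in>orthant2. vpow (fst x) \<alpha> * vpow (snd x) \<beta> * cmod (f x) \<le> C * (decay_weight (fst x) * decay_weight (snd x))"
proof -
  obtain I C where IC: "0 \<le> C" "\<And>f x. f \<in> schwartz \<Longrightarrow> x \<in> orthant2 \<Longrightarrow> vpow (fst x) \<alpha> * vpow (snd x) \<beta> * cmod (f x) \<le>
       C * (decay_weight (fst x) * decay_weight (snd x)) * (\<Sum>k\<in>I. sup_seminorm k f)"
    using schwartz_weighted_bound[OF \<alpha> \<beta>] by blast
  have "0 \<le> (\<Sum>k\<in>I. sup_seminorm k f)" by (intro sum_nonneg sup_seminorm_nonneg f)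
  with IC f show ?thesis
    by (intro exI[of _ "C * (\<Sum>k\<in>I. sup_seminorm k f)"]) (auto simp: mult_ac)
qed

lemma vpow_0: "x \<in> pos_orthant \<Longrightarrow> vpow x 0 = 1"
  by (auto simp: vpow_def pos_orthant_def powr_zero_eq_one intro!: prod.neutral less_imp_neq[THEN not_sym])

text \<open>
  The majorant is uniform in the variables \<open>y\<close>, so it dominates sections under the integral sign
  while \<open>y\<close> varies.
\<close>

lemma schwartz_envelope:
  fixes f :: "(real ^ 'm) \<times> (real ^ 'n) \<Rightarrow> complex"
  assumes f: "f \<in> schwartz" and \<alpha>: "\<forall>l. 0 \<le> \<alpha> $ l"
  shows "\<exists>C\<ge>0. \<forall>x y. y \<in> pos_orthant \<longrightarrow> cmod (f (x, y)) * vpow x \<alpha> \<le> C * decay_weight x"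
proof -
  have "\<forall>l. 0 \<le> (0 :: real ^ 'n) $ l" by simp
  from schwartz_envelope2[OF f \<alpha> this] obtain C where C: "0 \<le> C"
    "\<And>x. x \<in> orthant2 \<Longrightarrow> vpow (fst x) \<alpha> * vpow (snd x) 0 * cmod (f x) \<le> C * (decay_weight (fst x) * decay_weight (snd x))"
    by blast
  have "cmod (f (x, y)) * vpow x \<alpha> \<le> C * decay_weight x" if y: "y \<in> pos_orthant" for x y
  proof (cases "x \<in> pos_orthant")
    case True
    then have "cmod (f (x, y)) * vpow x \<alpha> \<le> C * (decay_weight x * decay_weight y)"
      using C(2)[of "(x, y)"] y by (simp add: vpow_0 mult.commute)
    also have "\<dots> \<le> C * (decay_weight x * 1)"
      using C(1) decay_weight_le_1[of y] by (intro mult_left_mono) auto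
    finally show ?thesis by simp
  next
    case False
    then have "f (x, y) = 0" by (intro schwartz_outside[OF f]) auto
    then show ?thesis using C(1) by simp
  qed
  then show ?thesis using C(1) by blast
qed

lemma schwartz_measurable [measurable]:
  assumes "f \<in> schwartz" shows "f \<in> borel_measurable borel"
proof -
  have "(\<lambda>x. indicator orthant2 x *\<^sub>R f x) \<in> borel_measurable borel"
    by (intro borel_measurable_continuous_on_indicator sets_orthant2 smooth0_continuous schwartz_smooth0 assms)
  moreover have "(\<lambda>x. indicator orthant2 x *\<^sub>R f x) = f"
    using schwartz_outside[OF assms] by (intro ext) (auto simp: indicator_def)
  ultimately show ?thesis by simp
qed

lemma measurable_section:
  assumes f: "f \<in> borel_measurable borel" shows "(\<lambda>x. f (x, y)) \<in> borel_measurable borel"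
  by (rule measurable_compose[OF _ f]) (intro borel_measurable_continuous_onI continuous_intros)

section \<open>The real Hankel--Clifford transform\<close>

text \<open>
  The \<open>\<nu>\<close>-th powers of the argument are absorbed into the entire function \<open>bessel_clifford\<close>, and the
  normalisation \<open>a\<^bsup>\<nu>+1\<^esup>\<close> makes the transform its own inverse for every dilation \<open>a\<close>.
\<close>

definition clifford_kernel :: "real ^ 'm \<Rightarrow> real ^ 'm \<Rightarrow> real ^ 'm \<Rightarrow> real ^ 'm \<Rightarrow> real" where
  "clifford_kernel \<nu> a x t = (\<Prod>l\<in>UNIV. a $ l powr (\<nu> $ l + 1) * bessel_clifford (\<nu> $ l) ((a $ l)\<^sup>2 * (x $ l * t $ l)))"

text \<open>
  Functions to be transformed vanish outside the orthant, so the integral extends over the whole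
  space.
\<close>

definition clifford_integral :: "real ^ 'm \<Rightarrow> real ^ 'm \<Rightarrow> (real ^ 'm \<Rightarrow> complex) \<Rightarrow> real ^ 'm \<Rightarrow> complex" where
  "clifford_integral \<nu> a g t = (\<integral>x. g x * of_real (clifford_kernel \<nu> a x t * vpow x \<nu>) \<partial>lborel)"

definition clifford_transform :: "real ^ 'm \<Rightarrow> real ^ 'm \<Rightarrow> ((real ^ 'm) \<times> (real ^ 'n) \<Rightarrow> complex) \<Rightarrow> (real ^ 'm) \<times> (real ^ 'n) \<Rightarrow> complex" where
  "clifford_transform \<nu> a f t = (if t \<in> orthant2 then clifford_integral \<nu> a (\<lambda>x. f (x, snd t)) (fst t) else 0)"

lemma clifford_kernel_sym: "clifford_kernel \<nu> a x t = clifford_kernel \<nu> a t x"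
  by (simp add: clifford_kernel_def mult.commute[of "x $ _"])

lemma clifford_kernel_measurable [measurable]:
  assumes [measurable]: "f \<in> borel_measurable M" "g \<in> borel_measurable M"
  shows "(\<lambda>w. clifford_kernel \<nu> a (f w) (g w)) \<in> borel_measurable M"
proof -
  have nth [measurable]: "(\<lambda>x::real^'m. x $ l) \<in> borel_measurable borel" for l
    by (intro borel_measurable_continuous_onI continuous_intros)
  show ?thesis unfolding clifford_kernel_def by measurable
qed

definition clifford_kernel_bound :: "real ^ 'm \<Rightarrow> real ^ 'm \<Rightarrow> real" where
  "clifford_kernel_bound \<nu> a = (\<Prod>l\<in>UNIV. a $ l powr (\<nu> $ l + 1) * inverse (Gamma (\<nu> $ l + 1)))"

lemma abs_clifford_kernel_le:
  assumes \<nu>: "\<forall>l. 0 \<le> \<nu> $ l" and "x \<in> pos_orthant" "t \<in> pos_orthant"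
  shows "\<bar>clifford_kernel \<nu> a x t\<bar> \<le> clifford_kernel_bound \<nu> a"
proof -
  have "0 \<le> (a $ l)\<^sup>2 * (x $ l * t $ l)" for l
    using assms by (auto simp: pos_orthant_def less_imp_le)
  then show ?thesis
    unfolding clifford_kernel_def clifford_kernel_bound_def abs_prod using \<nu>
    by (intro prod_mono) (auto simp: abs_mult intro!: mult_left_mono abs_bessel_clifford_le)
qed

lemma clifford_kernel_bound_nonneg: "\<forall>l. 0 \<le> \<nu> $ l \<Longrightarrow> 0 \<le> clifford_kernel_bound \<nu> a"
  unfolding clifford_kernel_bound_def by (intro prod_nonneg) (auto intro!: mult_nonneg_nonneg less_imp_le[OF Gamma_real_pos] add_nonneg_pos)

text \<open>
  Only the \<open>l\<close>-th factor of the product depends on \<open>s\<close>; differentiating it raises its order by one.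
\<close>

lemma clifford_kernel_has_derivative:
  assumes \<nu>: "\<forall>l. 0 \<le> \<nu> $ l" and a: "\<forall>l. 0 < a $ l"
  shows "((\<lambda>s. clifford_kernel \<nu> a x (t + s *\<^sub>R axis l 1)) has_real_derivative
           - (a $ l * x $ l * clifford_kernel (\<nu> + axis l 1) a x (t + s *\<^sub>R axis l 1))) (at s)"
proof -
  define k where "k \<nu> x t j = a $ j powr (\<nu> $ j + 1) * bessel_clifford (\<nu> $ j) ((a $ j)\<^sup>2 * (x $ j * t $ j))" for \<nu> x t j
  define R where "R = (\<Prod>j\<in>UNIV - {l}. k \<nu> x t j)"
  have split: "clifford_kernel \<nu>' a x (t + s *\<^sub>R axis l 1) = k \<nu>' x (t + s *\<^sub>R axis l 1) l * R"
    if "\<And>j. j \<noteq> l \<Longrightarrow> \<nu>' $ j = \<nu> $ j" for s \<nu>'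
  proof -
    have "clifford_kernel \<nu>' a x (t + s *\<^sub>R axis l 1) = k \<nu>' x (t + s *\<^sub>R axis l 1) l * (\<Prod>j\<in>UNIV - {l}. k \<nu>' x (t + s *\<^sub>R axis l 1) j)"
      unfolding clifford_kernel_def k_def by (rule prod.remove) auto
    also have "(\<Prod>j\<in>UNIV - {l}. k \<nu>' x (t + s *\<^sub>R axis l 1) j) = R"
      unfolding R_def by (rule prod.cong) (auto simp: k_def that axis_def)
    finally show ?thesis .
  qed
  let ?u = "\<lambda>s. (a $ l)\<^sup>2 * (x $ l * (t $ l + s))"
  have "((\<lambda>s. bessel_clifford (\<nu> $ l) (?u s)) has_real_derivative
      - bessel_clifford (\<nu> $ l + 1) (?u s) * ((a $ l)\<^sup>2 * x $ l)) (at s)"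
    by (rule DERIV_chain2[OF DERIV_bessel_clifford]) (use \<nu> in \<open>auto intro!: derivative_eq_intros\<close>)
  then have "((\<lambda>s. a $ l powr (\<nu> $ l + 1) * bessel_clifford (\<nu> $ l) (?u s) * R) has_real_derivative
      a $ l powr (\<nu> $ l + 1) * (- bessel_clifford (\<nu> $ l + 1) (?u s) * ((a $ l)\<^sup>2 * x $ l)) * R) (at s)"
    by (intro DERIV_cmult_right DERIV_cmult)
  moreover have "a $ l powr (\<nu> $ l + 1) * (- bessel_clifford (\<nu> $ l + 1) (?u s) * ((a $ l)\<^sup>2 * x $ l)) * R =
      - (a $ l * x $ l * clifford_kernel (\<nu> + axis l 1) a x (t + s *\<^sub>R axis l 1))"
  proof -
    have "a $ l powr (\<nu> $ l + 1) * (a $ l)\<^sup>2 = a $ l * a $ l powr (\<nu> $ l + 1 + 1)"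
      using a[rule_format, of l] by (simp add: powr_add power2_eq_square)
    then show ?thesis
      by (subst split) (auto simp: k_def axis_def power2_eq_square)
  qed
  moreover have "clifford_kernel \<nu> a x (t + s *\<^sub>R axis l 1) = a $ l powr (\<nu> $ l + 1) * bessel_clifford (\<nu> $ l) (?u s) * R" for s
    by (subst split) (auto simp: k_def axis_def)
  ultimately show ?thesis by (simp only:)
qed

text \<open>
  The counterpart in the variable of integration: with its weight, the kernel of order
  \<open>\<nu> + e\<^sub>l\<close> is an antiderivative of the kernel of order \<open>\<nu>\<close>.
\<close>

lemma clifford_kernel_vpow_has_derivative:
  assumes \<nu>: "\<forall>l. 0 \<le> \<nu> $ l" and a: "\<forall>l. 0 < a $ l" and x: "0 < x $ l + s"
  shows "((\<lambda>s. clifford_kernel (\<nu> + axis l 1) a (x + s *\<^sub>R axis l 1) t * vpow (x + s *\<^sub>R axis l 1) (\<nu> + axis l 1)) has_real_derivative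
           a $ l * (clifford_kernel \<nu> a (x + s *\<^sub>R axis l 1) t * vpow (x + s *\<^sub>R axis l 1) \<nu>)) (at s)"
proof -
  define k where "k \<nu> x t j = a $ j powr (\<nu> $ j + 1) * bessel_clifford (\<nu> $ j) ((a $ j)\<^sup>2 * (x $ j * t $ j)) * x $ j powr \<nu> $ j" for \<nu> x t j
  define R where "R = (\<Prod>j\<in>UNIV - {l}. k \<nu> x t j)"
  have split: "clifford_kernel \<nu>' a (x + s *\<^sub>R axis l 1) t * vpow (x + s *\<^sub>R axis l 1) \<nu>' = k \<nu>' (x + s *\<^sub>R axis l 1) t l * R"
    if "\<And>j. j \<noteq> l \<Longrightarrow> \<nu>' $ j = \<nu> $ j" for s \<nu>'
  proof -
    have "clifford_kernel \<nu>' a (x + s *\<^sub>R axis l 1) t * vpow (x + s *\<^sub>R axis l 1) \<nu>' =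
        k \<nu>' (x + s *\<^sub>R axis l 1) t l * (\<Prod>j\<in>UNIV - {l}. k \<nu>' (x + s *\<^sub>R axis l 1) t j)"
      unfolding clifford_kernel_def vpow_def k_def prod.distrib[symmetric] by (rule prod.remove) auto
    also have "(\<Prod>j\<in>UNIV - {l}. k \<nu>' (x + s *\<^sub>R axis l 1) t j) = R"
      unfolding R_def by (rule prod.cong) (auto simp: k_def that axis_def)
    finally show ?thesis .
  qed
  let ?c = "(a $ l)\<^sup>2 * t $ l"
  have "((\<lambda>s. (x $ l + s) powr (\<nu> $ l + 1) * bessel_clifford (\<nu> $ l + 1) (?c * (x $ l + s))) has_real_derivative
      ((x $ l + s) powr \<nu> $ l * bessel_clifford (\<nu> $ l) (?c * (x $ l + s))) * 1) (at s)"
    by (rule DERIV_chain2[OF DERIV_powr_bessel_clifford]) (use \<nu> x in \<open>auto intro!: derivative_eq_intros\<close>)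
  then have "((\<lambda>s. a $ l powr (\<nu> $ l + 2) * ((x $ l + s) powr (\<nu> $ l + 1) * bessel_clifford (\<nu> $ l + 1) (?c * (x $ l + s))) * R) has_real_derivative
      a $ l powr (\<nu> $ l + 2) * (((x $ l + s) powr \<nu> $ l * bessel_clifford (\<nu> $ l) (?c * (x $ l + s))) * 1) * R) (at s)"
    by (intro DERIV_cmult_right DERIV_cmult)
  moreover have "a $ l powr (\<nu> $ l + 2) * (((x $ l + s) powr \<nu> $ l * bessel_clifford (\<nu> $ l) (?c * (x $ l + s))) * 1) * R =
      a $ l * (clifford_kernel \<nu> a (x + s *\<^sub>R axis l 1) t * vpow (x + s *\<^sub>R axis l 1) \<nu>)"
  proof -
    have "a $ l powr (\<nu> $ l + 2) = a $ l * a $ l powr (\<nu> $ l + 1)"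
      using a[rule_format, of l] powr_add[of "a $ l" "\<nu> $ l + 1" 1] by (simp add: add.assoc)
    then show ?thesis
      by (subst split) (auto simp: k_def axis_def mult_ac)
  qed
  moreover have "clifford_kernel (\<nu> + axis l 1) a (x + s *\<^sub>R axis l 1) t * vpow (x + s *\<^sub>R axis l 1) (\<nu> + axis l 1) =
      a $ l powr (\<nu> $ l + 2) * ((x $ l + s) powr (\<nu> $ l + 1) * bessel_clifford (\<nu> $ l + 1) (?c * (x $ l + s))) * R" for s
    by (subst split) (auto simp: k_def axis_def mult_ac add_ac)
  ultimately show ?thesis by (simp only:)
qed

lemma vpow_add_axis: "x \<in> pos_orthant \<Longrightarrow> vpow x (\<nu> + axis l 1) = x $ l * vpow x \<nu>"
proof -
  assume x: "x \<in> pos_orthant"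
  have "vpow x (axis l 1) = (\<Prod>i\<in>UNIV. if i = l then x $ l else 1)"
    unfolding vpow_def using x by (intro prod.cong) (auto simp: axis_def pos_orthant_def less_imp_neq[THEN not_sym] less_imp_le)
  also have "\<dots> = x $ l" by simp
  finally show ?thesis by (simp add: vpow_add)
qed

lemma nonneg_add_axis: "\<forall>l. 0 \<le> (\<nu> :: real^'m) $ l \<Longrightarrow> \<forall>j. 0 \<le> (\<nu> + axis l 1) $ j"
  by (auto simp: axis_def)

lemma clifford_section_bound:
  assumes f: "f \<in> schwartz" and \<nu>: "\<forall>l. 0 \<le> \<nu> $ l" and \<alpha>: "\<forall>l. 0 \<le> \<alpha> $ l"
  shows "\<exists>C\<ge>0. \<forall>x. \<forall>y\<in>pos_orthant. \<forall>t\<in>pos_orthant.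
     cmod (f (x, y) * of_real (clifford_kernel \<nu> a x t * vpow x \<alpha>)) \<le> C * decay_weight x"
proof -
  obtain C where C: "0 \<le> C" "\<And>x y. y \<in> pos_orthant \<Longrightarrow> cmod (f (x, y)) * vpow x \<alpha> \<le> C * decay_weight x"
    using schwartz_envelope[OF f \<alpha>] by blast
  have "cmod (f (x, y) * of_real (clifford_kernel \<nu> a x t * vpow x \<alpha>)) \<le> (clifford_kernel_bound \<nu> a * C) * decay_weight x"
    if y: "y \<in> pos_orthant" and t: "t \<in> pos_orthant" for x y t
  proof (cases "x \<in> pos_orthant")
    case True
    have "cmod (f (x, y) * of_real (clifford_kernel \<nu> a x t * vpow x \<alpha>)) = \<bar>clifford_kernel \<nu> a x t\<bar> * (cmod (f (x, y)) * vpow x \<alpha>)"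
      by (simp add: norm_mult abs_mult)
    also have "\<dots> \<le> clifford_kernel_bound \<nu> a * (C * decay_weight x)"
      by (intro mult_mono abs_clifford_kernel_le \<nu> True t C(2) y clifford_kernel_bound_nonneg) auto
    finally show ?thesis by (simp add: mult.assoc)
  next
    case False
    then have "f (x, y) = 0" by (intro schwartz_outside[OF f]) auto
    then show ?thesis using C(1) clifford_kernel_bound_nonneg[OF \<nu>, of a] by simp
  qed
  then show ?thesis using C(1) clifford_kernel_bound_nonneg[OF \<nu>, of a] by (intro exI[of _ "clifford_kernel_bound \<nu> a * C"]) auto
qed

lemma clifford_section_integrable:
  assumes f: "f \<in> schwartz" and \<nu>: "\<forall>l. 0 \<le> \<nu> $ l" and \<alpha>: "\<forall>l. 0 \<le> \<alpha> $ l"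
    and y: "y \<in> pos_orthant" and t: "t \<in> pos_orthant"
  shows "integrable lborel (\<lambda>x. f (x, y) * of_real (clifford_kernel \<nu> a x t * vpow x \<alpha>))"
proof -
  obtain C where C: "0 \<le> C" "\<And>x. cmod (f (x, y) * of_real (clifford_kernel \<nu> a x t * vpow x \<alpha>)) \<le> C * decay_weight x"
    using clifford_section_bound[OF f \<nu> \<alpha>, of a] y t by blast
  have [measurable]: "(\<lambda>x. f (x, y)) \<in> borel_measurable borel"
    by (intro measurable_section schwartz_measurable f)
  show ?thesis
    by (rule Bochner_Integration.integrable_bound[of lborel "\<lambda>x. C * decay_weight x"])
      (use C in \<open>auto intro!: integrable_decay_weight\<close>)
qed

lemma pos_orthant_move:
  assumes "t \<in> pos_orthant" "\<bar>s\<bar> < t $ l" shows "t + s *\<^sub>R axis l 1 \<in> pos_orthant"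
  using assms by (auto simp: pos_orthant_def axis_def)

lemma has_vector_derivative_transform_near_0:
  assumes "(f has_vector_derivative D) (at (0::real))" "0 < \<delta>" "\<And>s. \<bar>s\<bar> < \<delta> \<Longrightarrow> f s = g s"
  shows "(g has_vector_derivative D) (at 0)"
  by (rule has_vector_derivative_transform_within_open[OF assms(1), of "ball 0 \<delta>"])
    (use assms in \<open>auto simp: dist_real_def\<close>)

text \<open>
  The factor \<open>x\<^sub>l\<close> produced by differentiating the kernel completes \<open>x\<^sup>\<nu>\<close> to the weight of the next
  order, so the derivative is again a transform of the same \<open>f\<close>.
\<close>

lemma clifford_transform_deriv_Inl:
  assumes f: "f \<in> schwartz" and \<nu>: "\<forall>l. 0 \<le> \<nu> $ l" and a: "\<forall>l. 0 < a $ l" and t: "t \<in> orthant2"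
  shows "((\<lambda>s. clifford_transform \<nu> a f (t + s *\<^sub>R coord_dir (Inl l))) has_vector_derivative
      - of_real (a $ l) * clifford_transform (\<nu> + axis l 1) a f t) (at 0)"
proof -
  obtain u y where t_eq: "t = (u, y)" by (cases t)
  have u: "u \<in> pos_orthant" and y: "y \<in> pos_orthant" using t t_eq by auto
  note \<nu>1 = nonneg_add_axis[OF \<nu>, of l]
  let ?u = "\<lambda>s. u + s *\<^sub>R axis l 1"
  define F where "F s x = f (x, y) * of_real (clifford_kernel \<nu> a x (?u s) * vpow x \<nu>)" for s x
  define F' where "F' s x = - of_real (a $ l) * (f (x, y) * of_real (clifford_kernel (\<nu> + axis l 1) a x (?u s) * vpow x (\<nu> + axis l 1)))" for s x
  have us: "?u s \<in> pos_orthant" if "\<bar>s\<bar> < u $ l" for s using pos_orthant_move[OF u that] .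
  obtain C where C: "0 \<le> C" "\<And>x s. \<bar>s\<bar> < u $ l \<Longrightarrow>
      cmod (f (x, y) * of_real (clifford_kernel (\<nu> + axis l 1) a x (?u s) * vpow x (\<nu> + axis l 1))) \<le> C * decay_weight x"
    using clifford_section_bound[OF f \<nu>1 \<nu>1, of a] y us by blast
  have "((\<lambda>s. \<integral>x. F s x \<partial>lborel) has_vector_derivative (\<integral>x. F' 0 x \<partial>lborel)) (at 0)"
  proof (rule has_vector_derivative_lebesgue_integral[where \<delta>="u $ l" and G="\<lambda>x. a $ l * (C * decay_weight x)"])
    show "0 < u $ l" using u by (rule pos_orthantD)
    show "integrable lborel (F s)" if "\<bar>s\<bar> < u $ l" for s
      unfolding F_def by (rule clifford_section_integrable[OF f \<nu> \<nu> y us[OF that]])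
    show "integrable lborel (\<lambda>x. a $ l * (C * decay_weight x))"
      by (intro integrable_mult_right integrable_decay_weight)
    show "cmod (F' s x) \<le> a $ l * (C * decay_weight x)" if "\<bar>s\<bar> < u $ l" for s x
      unfolding F'_def norm_mult[of "- of_real (a $ l)"] using a[rule_format, of l] C(2)[OF that] by (auto intro!: mult_mono)
    show "((\<lambda>s. F s x) has_vector_derivative F' s x) (at s)" for s x
    proof (cases "x \<in> pos_orthant")
      case True
      have "((\<lambda>s. of_real (clifford_kernel \<nu> a x (?u s)) :: complex) has_vector_derivative
          of_real (- (a $ l * x $ l * clifford_kernel (\<nu> + axis l 1) a x (?u s)))) (at s)"
        using clifford_kernel_has_derivative[OF \<nu> a] by (intro has_vector_derivative_of_real) (simp add: has_real_derivative_iff_has_vector_derivative)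
      from has_vector_derivative_mult_right[OF this, of "f (x, y) * of_real (vpow x \<nu>)"]
      show ?thesis unfolding F_def F'_def vpow_add_axis[OF True] by (simp add: mult_ac)
    next
      case False
      then have "f (x, y) = 0" by (intro schwartz_outside[OF f]) auto
      then show ?thesis by (simp add: F_def F'_def)
    qed
  qed
  then have "((\<lambda>s. clifford_transform \<nu> a f (t + s *\<^sub>R coord_dir (Inl l))) has_vector_derivative (\<integral>x. F' 0 x \<partial>lborel)) (at 0)"
    by (rule has_vector_derivative_transform_near_0[of _ _ "u $ l"])
      (use us y pos_orthantD[OF u] in \<open>auto simp: clifford_transform_def clifford_integral_def F_def t_eq\<close>)
  moreover have "(\<integral>x. F' 0 x \<partial>lborel) = - of_real (a $ l) * clifford_transform (\<nu> + axis l 1) a f t"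
    using u y unfolding F'_def by (simp add: clifford_transform_def clifford_integral_def t_eq)
  ultimately show ?thesis by simp
qed

lemma clifford_transform_deriv_Inr:
  assumes f: "f \<in> schwartz" and \<nu>: "\<forall>l. 0 \<le> \<nu> $ l" and t: "t \<in> orthant2"
  shows "((\<lambda>s. clifford_transform \<nu> a f (t + s *\<^sub>R coord_dir (Inr j))) has_vector_derivative clifford_transform \<nu> a (pdiff0 (Inr j) f) t) (at 0)"
proof -
  obtain u y where t_eq: "t = (u, y)" by (cases t)
  have u: "u \<in> pos_orthant" and y: "y \<in> pos_orthant" using t t_eq by auto
  let ?y = "\<lambda>s. y + s *\<^sub>R axis j 1"
  define F where "F s x = f (x, ?y s) * of_real (clifford_kernel \<nu> a x u * vpow x \<nu>)" for s x
  define F' where "F' s x = pdiff0 (Inr j) f (x, ?y s) * of_real (clifford_kernel \<nu> a x u * vpow x \<nu>)" for s x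
  have ys: "?y s \<in> pos_orthant" if "\<bar>s\<bar> < y $ j" for s using pos_orthant_move[OF y that] .
  obtain C where C: "0 \<le> C" "\<And>x s. \<bar>s\<bar> < y $ j \<Longrightarrow> cmod (F' s x) \<le> C * decay_weight x"
    using clifford_section_bound[OF schwartz_pdiff0[OF f, of "Inr j"] \<nu> \<nu>, of a] u ys unfolding F'_def by blast
  have "((\<lambda>s. \<integral>x. F s x \<partial>lborel) has_vector_derivative (\<integral>x. F' 0 x \<partial>lborel)) (at 0)"
  proof (rule has_vector_derivative_lebesgue_integral[where \<delta>="y $ j" and G="\<lambda>x. C * decay_weight x"])
    show "0 < y $ j" using y by (rule pos_orthantD)
    show "integrable lborel (F s)" if "\<bar>s\<bar> < y $ j" for s
      unfolding F_def by (rule clifford_section_integrable[OF f \<nu> \<nu> ys[OF that] u])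
    show "integrable lborel (\<lambda>x. C * decay_weight x)"
      by (intro integrable_mult_right integrable_decay_weight)
    show "cmod (F' s x) \<le> C * decay_weight x" if "\<bar>s\<bar> < y $ j" for s x by (rule C(2)[OF that])
    show "((\<lambda>s. F s x) has_vector_derivative F' s x) (at s)" if s: "\<bar>s\<bar> < y $ j" for s x
    proof (cases "x \<in> pos_orthant")
      case True
      then have "(x, y) + s *\<^sub>R coord_dir (Inr j) \<in> orthant2" using ys[OF s] by simp
      from schwartz_has_derivative[OF f this]
      have "((\<lambda>s. f (x, ?y s)) has_vector_derivative pdiff0 (Inr j) f (x, ?y s)) (at s)" by simp
      then show ?thesis unfolding F_def F'_def by (rule has_vector_derivative_mult_left)
    next
      case False
      then have "f (x, y) = 0" "pdiff0 (Inr j) f (x, y) = 0" for y by (auto simp: pdiff0_def intro: schwartz_outside[OF f])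
      then show ?thesis by (simp add: F_def F'_def)
    qed
  qed
  then have "((\<lambda>s. clifford_transform \<nu> a f (t + s *\<^sub>R coord_dir (Inr j))) has_vector_derivative (\<integral>x. F' 0 x \<partial>lborel)) (at 0)"
    by (rule has_vector_derivative_transform_near_0[of _ _ "y $ j"])
      (use ys u pos_orthantD[OF y] in \<open>auto simp: clifford_transform_def clifford_integral_def F_def t_eq\<close>)
  moreover have "(\<integral>x. F' 0 x \<partial>lborel) = clifford_transform \<nu> a (pdiff0 (Inr j) f) t"
    using u y unfolding F'_def by (simp add: clifford_transform_def clifford_integral_def t_eq)
  ultimately show ?thesis by simp
qed

text \<open>
  Integration by parts in \<open>x\<^sub>l\<close>. The product of \<open>f\<close> with the weighted kernel of order \<open>\<nu> + e\<^sub>l\<close>, extended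
  by zero, is continuous along lines parallel to the \<open>l\<close>-th axis, since the weight contains a
  positive power of \<open>x\<^sub>l\<close>. Therefore no boundary term appears.
\<close>

lemma clifford_transform_by_parts:
  assumes f: "f \<in> schwartz" and \<nu>: "\<forall>l. 0 \<le> \<nu> $ l" and a: "\<forall>l. 0 < a $ l"
  shows "clifford_transform \<nu> a f t = - of_real (inverse (a $ l)) * clifford_transform (\<nu> + axis l 1) a (pdiff0 (Inl l) f) t"
proof (cases "t \<in> orthant2")
  case True
  obtain u y where t_eq: "t = (u, y)" by (cases t)
  have u: "u \<in> pos_orthant" and y: "y \<in> pos_orthant" using True t_eq by auto
  note \<nu>1 = nonneg_add_axis[OF \<nu>, of l]
  let ?e = "axis l 1 :: real ^ 'a"
  let ?k = "\<lambda>x. clifford_kernel (\<nu> + ?e) a x u * vpow x (\<nu> + ?e)"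
  let ?h = "\<lambda>x. clifford_kernel \<nu> a x u * vpow x \<nu>"
  define F where "F x = f (x, y) * of_real (?k x)" for x
  define A where "A x = pdiff0 (Inl l) f (x, y) * of_real (?k x)" for x
  define B where "B x = f (x, y) * of_real (?h x)" for x
  define F' where "F' x = A x + of_real (a $ l) * B x" for x
  have f0: "f (x, y) = 0" "pdiff0 (Inl l) f (x, y) = 0" if "x \<notin> pos_orthant" for x
    using that by (auto simp: pdiff0_def intro: schwartz_outside[OF f])
  have intA: "integrable lborel A" unfolding A_def by (rule clifford_section_integrable[OF schwartz_pdiff0[OF f] \<nu>1 \<nu>1 y u])
  have intB: "integrable lborel B" unfolding B_def by (rule clifford_section_integrable[OF f \<nu> \<nu> y u])
  have deriv: "((\<lambda>s. F (x + s *\<^sub>R ?e)) has_vector_derivative F' (x + s *\<^sub>R ?e)) (at s)" if s: "s \<noteq> - (x $ l)" for x s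
  proof (cases "x + s *\<^sub>R ?e \<in> pos_orthant")
    case True
    then have "(x, y) + s *\<^sub>R coord_dir (Inl l) \<in> orthant2" using y by simp
    from schwartz_has_derivative[OF f this]
    have df: "((\<lambda>s. f (x + s *\<^sub>R ?e, y)) has_vector_derivative pdiff0 (Inl l) f (x + s *\<^sub>R ?e, y)) (at s)" by simp
    have "0 < x $ l + s" using pos_orthantD[OF True, of l] by simp
    then have dk: "((\<lambda>s. of_real (?k (x + s *\<^sub>R ?e)) :: complex) has_vector_derivative of_real (a $ l * ?h (x + s *\<^sub>R ?e))) (at s)"
      using clifford_kernel_vpow_has_derivative[OF \<nu> a, of x l s u]
      by (intro has_vector_derivative_of_real) (simp add: has_real_derivative_iff_has_vector_derivative)
    show ?thesis using has_vector_derivative_mult[OF df dk]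
      unfolding F_def F'_def A_def B_def by (simp add: algebra_simps)
  next
    case False
    then obtain i where i: "x $ i + s * ?e $ i \<le> 0" by (auto simp: pos_orthant_def not_less)
    have "\<forall>\<^sub>F s' in nhds s. F (x + s' *\<^sub>R ?e) = 0"
    proof (cases "i = l")
      case True
      then have "s < - (x $ l)" using i s by auto
      then have "\<forall>\<^sub>F s' in nhds s. s' < - (x $ l)"
        by (intro eventually_nhds_in_open[of "{..< - (x $ l)}", simplified])
      then show ?thesis
      proof eventually_elim
        case (elim s')
        then have "x + s' *\<^sub>R ?e \<notin> pos_orthant" using pos_orthantD[of "x + s' *\<^sub>R ?e" l] by auto
        then show ?case by (simp add: F_def f0)
      qed
    next
      case False
      then have "x $ i \<le> 0" using i by (simp add: axis_def)
      then have "x + s' *\<^sub>R ?e \<notin> pos_orthant" for s' using pos_orthantD[of "x + s' *\<^sub>R ?e" i] False by (auto simp: axis_def)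
      then show ?thesis by (simp add: F_def f0)
    qed
    then have "\<forall>\<^sub>F s' in nhds s. 0 = F (x + s' *\<^sub>R ?e)" by eventually_elim simp
    then obtain U where U: "open U" "s \<in> U" "\<And>s'. s' \<in> U \<Longrightarrow> 0 = F (x + s' *\<^sub>R ?e)"
      unfolding eventually_nhds by blast
    have "((\<lambda>s. F (x + s *\<^sub>R ?e)) has_vector_derivative 0) (at s)"
      by (rule has_vector_derivative_transform_within_open[OF has_vector_derivative_const U])
    moreover have "F' (x + s *\<^sub>R ?e) = 0" using False by (simp add: F'_def A_def B_def f0)
    ultimately show ?thesis by simp
  qed
  obtain C where C: "0 \<le> C" "\<And>x. cmod (f (x, y) * of_real (clifford_kernel (\<nu> + ?e) a x u * vpow x \<nu>)) \<le> C * decay_weight x"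
    using clifford_section_bound[OF f \<nu>1 \<nu>, of a] y u by blast
  \<comment> \<open>This bound gives continuity at the point where the line enters the orthant.\<close>
  have Fb: "cmod (F x) \<le> C * \<bar>x $ l\<bar>" for x
  proof (cases "x \<in> pos_orthant")
    case True
    have "F x = of_real (x $ l) * (f (x, y) * of_real (clifford_kernel (\<nu> + ?e) a x u * vpow x \<nu>))"
      unfolding F_def vpow_add_axis[OF True] by simp
    then have "cmod (F x) = \<bar>x $ l\<bar> * cmod (f (x, y) * of_real (clifford_kernel (\<nu> + ?e) a x u * vpow x \<nu>))"
      by (simp only: norm_mult norm_of_real)
    also have "\<dots> \<le> \<bar>x $ l\<bar> * (C * decay_weight x)"
      by (intro mult_left_mono C(2)) simp
    also have "\<dots> \<le> \<bar>x $ l\<bar> * (C * 1)" by (intro mult_left_mono decay_weight_le_1 C(1)) simp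
    finally show ?thesis by (simp add: mult.commute)
  qed (use C(1) in \<open>simp add: F_def f0\<close>)
  have cont: "isCont (\<lambda>s. F (x + s *\<^sub>R ?e)) s" for x s
  proof (cases "s = - (x $ l)")
    case True
    have F0: "F (x + s *\<^sub>R ?e) = 0" using Fb[of "x + s *\<^sub>R ?e"] True by simp
    have "((\<lambda>s'. F (x + s' *\<^sub>R ?e)) \<longlongrightarrow> 0) (at s)"
    proof (rule Lim_null_comparison)
      show "\<forall>\<^sub>F s' in at s. cmod (F (x + s' *\<^sub>R ?e)) \<le> C * \<bar>x $ l + s'\<bar>"
        using Fb[of "x + _ *\<^sub>R ?e"] by (intro always_eventually allI) simp
      have "((\<lambda>s'. C * \<bar>x $ l + s'\<bar>) \<longlongrightarrow> C * \<bar>x $ l + s\<bar>) (at s)" by (intro tendsto_intros)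
      then show "((\<lambda>s'. C * \<bar>x $ l + s'\<bar>) \<longlongrightarrow> 0) (at s)" using True by simp
    qed
    then show ?thesis unfolding isCont_def F0 .
  next
    case False
    show ?thesis by (rule has_vector_derivative_continuous[OF deriv[OF False]])
  qed
  have "(\<integral>x. F' x \<partial>lborel) = 0"
  proof (rule integral_directional_derivative_eq_0[where F=F and e="?e" and S="\<lambda>x. {- (x $ l)}"])
    show "integrable lborel F" unfolding F_def by (rule clifford_section_integrable[OF f \<nu>1 \<nu>1 y u])
    show "integrable lborel F'" unfolding F'_def by (intro Bochner_Integration.integrable_add integrable_mult_right intA intB)
    show "continuous_on {0..1} (\<lambda>s. F (x + s *\<^sub>R ?e))" for x
      by (intro continuous_at_imp_continuous_on ballI cont)
  qed (use deriv in auto)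
  moreover have "(\<integral>x. F' x \<partial>lborel) = (\<integral>x. A x \<partial>lborel) + of_real (a $ l) * (\<integral>x. B x \<partial>lborel)"
    unfolding F'_def using intA intB by simp
  moreover have "clifford_transform \<nu> a f t = (\<integral>x. B x \<partial>lborel)" "clifford_transform (\<nu> + ?e) a (pdiff0 (Inl l) f) t = (\<integral>x. A x \<partial>lborel)"
    using u y by (simp_all add: clifford_transform_def clifford_integral_def t_eq A_def B_def)
  moreover have "a $ l \<noteq> 0" using a by (metis less_irrefl)
  ultimately show ?thesis
    by (simp add: field_simps eq_neg_iff_add_eq_0)
qed (auto simp: clifford_transform_def)

section \<open>Exchange of derivatives and decay\<close>

text \<open>
  Lists of coordinates stand for multi-indices, because derivatives are taken one at a time.
\<close>

definition count_vec :: "'m list \<Rightarrow> real ^ 'm" where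
  "count_vec ds = (\<chi> l. real (count_list ds l))"

lemma count_vec_simps: "count_vec [] = 0" "count_vec (d # ds) = count_vec ds + axis d 1"
  by (auto simp: count_vec_def vec_eq_iff axis_def)

lemma count_vec_nonneg: "\<forall>l. 0 \<le> (\<nu> :: real ^ 'm) $ l \<Longrightarrow> \<forall>l. 0 \<le> (\<nu> + count_vec ds) $ l"
  by (simp add: count_vec_def)

lemma prod_power_count_Cons:
  fixes c :: "'m::finite \<Rightarrow> 'b::comm_monoid_mult"
  shows "(\<Prod>l\<in>UNIV. c l ^ count_list (d # ds) l) = c d * (\<Prod>l\<in>UNIV. c l ^ count_list ds l)"
proof -
  have "(\<Prod>l\<in>UNIV. c l ^ count_list (d # ds) l) = (\<Prod>l\<in>UNIV. (if l = d then c l else 1) * c l ^ count_list ds l)"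
    by (intro prod.cong) auto
  then show ?thesis by (simp add: prod.distrib)
qed

lemma clifford_transform_by_parts_iterated:
  assumes f: "f \<in> schwartz" and \<nu>: "\<forall>l. 0 \<le> \<nu> $ l" and a: "\<forall>l. 0 < a $ l"
  shows "clifford_transform \<nu> a f t = (\<Prod>l\<in>UNIV. (- of_real (inverse (a $ l))) ^ count_list ds l) *
     clifford_transform (\<nu> + count_vec ds) a (pdiffs0 (map Inl ds) f) t"
proof (induction ds)
  case (Cons d ds)
  have "clifford_transform (\<nu> + count_vec ds) a (pdiffs0 (map Inl ds) f) t =
      - of_real (inverse (a $ d)) * clifford_transform (\<nu> + count_vec ds + axis d 1) a (pdiff0 (Inl d) (pdiffs0 (map Inl ds) f)) t"
    by (intro clifford_transform_by_parts schwartz_pdiffs0 f a count_vec_nonneg \<nu>)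
  then show ?case
    unfolding Cons.IH prod_power_count_Cons list.map pdiffs0_simps count_vec_simps
    by (simp only: add.assoc mult_ac)
qed (simp add: count_vec_simps)

text \<open>
  The factors \<open>(x t)\<^sup>k\<close> are compensated by the raised order; afterwards they supply the decay in \<open>t\<close> at
  the cost of a power of \<open>x\<close>, which a Schwartz function absorbs.
\<close>

lemma clifford_kernel_decay:
  fixes \<nu> a :: "real ^ 'm" and k :: "nat ^ 'm"
  assumes \<nu>: "\<forall>l. 0 \<le> \<nu> $ l" and a: "\<forall>l. 0 < a $ l"
  shows "\<exists>D\<ge>0. \<forall>x\<in>pos_orthant. \<forall>t\<in>pos_orthant.
     (\<Prod>l\<in>UNIV. (x $ l * t $ l) ^ (k $ l)) * \<bar>clifford_kernel (\<nu> + (\<chi> l. 2 * real (k $ l))) a x t\<bar> \<le> D"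
proof -
  obtain C where C: "\<And>l w. 0 \<le> w \<Longrightarrow> w ^ (k $ l) * \<bar>bessel_clifford (\<nu> $ l + 2 * real (k $ l)) w\<bar> \<le> C l"
  proof -
    have "\<forall>l. \<exists>C. \<forall>w\<ge>0. w ^ (k $ l) * \<bar>bessel_clifford (\<nu> $ l + 2 * real (k $ l)) w\<bar> \<le> C"
      by (intro allI power_mult_bessel_clifford_bounded \<nu>[rule_format])
    from choice[OF this] show ?thesis using that by blast
  qed
  define D where "D = (\<Prod>l\<in>UNIV. a $ l powr (\<nu> $ l + 2 * real (k $ l) + 1) * (C l / ((a $ l)\<^sup>2) ^ (k $ l)))"
  have C0: "0 \<le> C l" for l using C[of 0 l] by (rule order_trans[rotated]) auto
  have a0: "a $ l \<noteq> 0" for l using a by (metis less_irrefl)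
  have "(\<Prod>l\<in>UNIV. (x $ l * t $ l) ^ (k $ l)) * \<bar>clifford_kernel (\<nu> + (\<chi> l. 2 * real (k $ l))) a x t\<bar> \<le> D"
    if x: "x \<in> pos_orthant" and t: "t \<in> pos_orthant" for x t
  proof -
    have "(\<Prod>l\<in>UNIV. (x $ l * t $ l) ^ (k $ l)) * \<bar>clifford_kernel (\<nu> + (\<chi> l. 2 * real (k $ l))) a x t\<bar> =
      (\<Prod>l\<in>UNIV. a $ l powr (\<nu> $ l + 2 * real (k $ l) + 1) *
         ((x $ l * t $ l) ^ (k $ l) * \<bar>bessel_clifford (\<nu> $ l + 2 * real (k $ l)) ((a $ l)\<^sup>2 * (x $ l * t $ l))\<bar>))"
      unfolding clifford_kernel_def abs_prod prod.distrib[symmetric] by (intro prod.cong) (auto simp: abs_mult)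
    also have "\<dots> \<le> D" unfolding D_def
    proof (intro prod_mono conjI mult_left_mono mult_nonneg_nonneg)
      fix l
      have xt: "0 \<le> x $ l * t $ l" using pos_orthantD[OF x, of l] pos_orthantD[OF t, of l] by simp
      then show "0 \<le> (x $ l * t $ l) ^ (k $ l)" by simp
      let ?w = "(a $ l)\<^sup>2 * (x $ l * t $ l)"
      have "?w ^ (k $ l) * \<bar>bessel_clifford (\<nu> $ l + 2 * real (k $ l)) ?w\<bar> \<le> C l"
        using xt by (intro C) simp
      then have "((x $ l * t $ l) ^ (k $ l) * \<bar>bessel_clifford (\<nu> $ l + 2 * real (k $ l)) ?w\<bar>) * ((a $ l)\<^sup>2) ^ (k $ l) \<le> C l"
        by (simp add: power_mult_distrib mult_ac)
      moreover have "0 < ((a $ l)\<^sup>2) ^ (k $ l)" using a0[of l] by simp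
      ultimately show "(x $ l * t $ l) ^ (k $ l) * \<bar>bessel_clifford (\<nu> $ l + 2 * real (k $ l)) ?w\<bar> \<le> C l / ((a $ l)\<^sup>2) ^ (k $ l)"
        by (simp only: pos_le_divide_eq)
    qed auto
    finally show ?thesis .
  qed
  moreover have "0 \<le> D" unfolding D_def using C0 by (intro prod_nonneg mult_nonneg_nonneg) auto
  ultimately show ?thesis by blast
qed

lemma vpow_of_nat: "x \<in> pos_orthant \<Longrightarrow> vpow x (\<chi> l. real (k $ l)) = (\<Prod>l\<in>UNIV. x $ l ^ (k $ l))"
  unfolding vpow_def by (intro prod.cong) (auto simp: powr_realpow pos_orthantD)

text \<open>
  After \<open>2k'\<close> integrations by parts the kernel has order \<open>\<nu> + 2k'\<close> and weight \<open>x\<^bsup>\<nu>+2k'\<^esup>\<close>. Its decay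
  cancels \<open>t\<^bsup>k'\<^esup>\<close> and leaves the weight \<open>x\<^bsup>\<nu>+k'\<^esup>\<close>.
\<close>

lemma clifford_transform_decay:
  fixes \<nu> a :: "real ^ 'm" and k' :: "nat ^ 'm" and k'' :: "nat ^ 'n"
  assumes \<nu>: "\<forall>l. 0 \<le> \<nu> $ l" and a: "\<forall>l. 0 < a $ l"
    and ds: "\<And>l. count_list ds l = 2 * k' $ l"
  shows "\<exists>I C. finite I \<and> 0 \<le> C \<and> (\<forall>f\<in>schwartz. \<forall>t\<in>orthant2.
     mpow t (k', k'') * cmod (clifford_transform \<nu> a f t) \<le> C * (\<Sum>\<kappa>\<in>I. sup_seminorm \<kappa> (pdiffs0 (map Inl ds) f)))"
proof -
  let ?k = "\<chi> l. real (k' $ l) :: real ^ 'm"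
  let ?q = "\<chi> j. real (k'' $ j) :: real ^ 'n"
  have \<nu>k: "\<forall>l. 0 \<le> (\<nu> + ?k) $ l" using \<nu> by simp
  have q: "\<forall>j. 0 \<le> ?q $ j" by simp
  obtain I C where IC: "finite I" "0 \<le> C" and bound: "\<And>g x. g \<in> schwartz \<Longrightarrow> x \<in> orthant2 \<Longrightarrow>
     vpow (fst x) (\<nu> + ?k) * vpow (snd x) ?q * cmod (g x) \<le> C * (decay_weight (fst x) * decay_weight (snd x)) * (\<Sum>\<kappa>\<in>I. sup_seminorm \<kappa> g)"
    using schwartz_weighted_bound[OF \<nu>k q] by blast
  have cv: "count_vec ds = (\<chi> l. 2 * real (k' $ l))" by (simp add: count_vec_def ds vec_eq_iff)
  obtain D where D: "0 \<le> D" "\<And>x t. x \<in> pos_orthant \<Longrightarrow> t \<in> pos_orthant \<Longrightarrow>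
     (\<Prod>l\<in>UNIV. (x $ l * t $ l) ^ (k' $ l)) * \<bar>clifford_kernel (\<nu> + count_vec ds) a x t\<bar> \<le> D"
    using clifford_kernel_decay[OF \<nu> a, of k'] unfolding cv by blast
  define E where "E = \<bar>\<Prod>l\<in>UNIV. (- inverse (a $ l)) ^ count_list ds l\<bar>"
  define W where "W = (\<integral>x. decay_weight x \<partial>(lborel :: (real ^ 'm) measure))"
  have W: "0 \<le> W" unfolding W_def by simp
  have "mpow t (k', k'') * cmod (clifford_transform \<nu> a f t) \<le> (E * (D * C) * W) * (\<Sum>\<kappa>\<in>I. sup_seminorm \<kappa> (pdiffs0 (map Inl ds) f))"
    if f: "f \<in> schwartz" and t: "t \<in> orthant2" for f t
  proof -
    obtain u y where t_eq: "t = (u, y)" by (cases t)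
    have u: "u \<in> pos_orthant" and y: "y \<in> pos_orthant" using t t_eq by auto
    define g where "g = pdiffs0 (map Inl ds) f"
    have g: "g \<in> schwartz" unfolding g_def by (rule schwartz_pdiffs0[OF f])
    define S where "S = (\<Sum>\<kappa>\<in>I. sup_seminorm \<kappa> g)"
    have S: "0 \<le> S" unfolding S_def by (intro sum_nonneg sup_seminorm_nonneg g)
    have \<nu>2: "\<forall>l. 0 \<le> (\<nu> + count_vec ds) $ l" by (rule count_vec_nonneg[OF \<nu>])
    define F where "F x = g (x, y) * of_real (clifford_kernel (\<nu> + count_vec ds) a x u * vpow x (\<nu> + count_vec ds))" for x
    have intF: "integrable lborel F" unfolding F_def by (rule clifford_section_integrable[OF g \<nu>2 \<nu>2 y u])
    let ?M = "mpow t (k', k'')"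
    have M0: "0 \<le> ?M" by (rule mpow_nonneg[OF t])
    have M: "?M = (\<Prod>l\<in>UNIV. u $ l ^ (k' $ l)) * vpow y ?q"
      unfolding vpow_of_nat[OF y] by (simp add: mpow_def t_eq)
    have ptw: "cmod (of_real ?M * F x) \<le> D * C * S * decay_weight x" for x
    proof (cases "x \<in> pos_orthant")
      case True
      have v: "(\<Prod>l\<in>UNIV. u $ l ^ (k' $ l)) * vpow x (\<nu> + count_vec ds) =
          vpow x (\<nu> + ?k) * (\<Prod>l\<in>UNIV. (x $ l * u $ l) ^ (k' $ l))"
      proof -
        have "\<nu> + count_vec ds = (\<nu> + ?k) + ?k" by (simp add: cv vec_eq_iff)
        then show ?thesis
          by (simp only: vpow_add[of x "\<nu> + ?k" ?k] vpow_of_nat[OF True]) (simp add: power_mult_distrib prod.distrib mult_ac)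
      qed
      have "cmod (of_real ?M * F x) = ?M * (cmod (g (x, y)) * (\<bar>clifford_kernel (\<nu> + count_vec ds) a x u\<bar> * vpow x (\<nu> + count_vec ds)))"
        unfolding F_def norm_mult norm_of_real abs_mult using M0 by simp
      also have "\<dots> = vpow y ?q * cmod (g (x, y)) * \<bar>clifford_kernel (\<nu> + count_vec ds) a x u\<bar> *
          ((\<Prod>l\<in>UNIV. u $ l ^ (k' $ l)) * vpow x (\<nu> + count_vec ds))"
        unfolding M by (simp only: mult_ac)
      also have "\<dots> = (vpow x (\<nu> + ?k) * vpow y ?q * cmod (g (x, y))) *
         ((\<Prod>l\<in>UNIV. (x $ l * u $ l) ^ (k' $ l)) * \<bar>clifford_kernel (\<nu> + count_vec ds) a x u\<bar>)"
        unfolding v by (simp only: mult_ac)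
      also have "\<dots> \<le> (C * (decay_weight x * decay_weight y) * S) * D"
      proof (rule mult_mono)
        show "vpow x (\<nu> + ?k) * vpow y ?q * cmod (g (x, y)) \<le> C * (decay_weight x * decay_weight y) * S"
          using bound[OF g, of "(x, y)"] True y unfolding S_def by simp
        show "(\<Prod>l\<in>UNIV. (x $ l * u $ l) ^ (k' $ l)) * \<bar>clifford_kernel (\<nu> + count_vec ds) a x u\<bar> \<le> D"
          by (rule D(2)[OF True u])
        show "0 \<le> (\<Prod>l\<in>UNIV. (x $ l * u $ l) ^ (k' $ l)) * \<bar>clifford_kernel (\<nu> + count_vec ds) a x u\<bar>"
          by (intro mult_nonneg_nonneg prod_nonneg) (auto intro!: zero_le_power mult_nonneg_nonneg simp: less_imp_le pos_orthantD[OF True] pos_orthantD[OF u])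
      qed (use IC(2) S in auto)
      also have "\<dots> = (D * C * S * decay_weight x) * decay_weight y" by simp
      also have "\<dots> \<le> (D * C * S * decay_weight x) * 1"
        using IC(2) S D(1) by (intro mult_left_mono decay_weight_le_1) auto
      finally show ?thesis by simp
    next
      case False
      then have "g (x, y) = 0" by (intro schwartz_outside[OF g]) auto
      then show ?thesis using IC(2) S D(1) by (simp add: F_def)
    qed
    have "?M * cmod (clifford_transform \<nu> a f t) = E * cmod (of_real ?M * (\<integral>x. F x \<partial>lborel))"
    proof -
      have "clifford_transform \<nu> a f t = of_real (\<Prod>l\<in>UNIV. (- inverse (a $ l)) ^ count_list ds l) * (\<integral>x. F x \<partial>lborel)"
        unfolding clifford_transform_by_parts_iterated[OF f \<nu> a, of t ds] using u y
        by (simp add: clifford_transform_def clifford_integral_def F_def g_def t_eq)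
      then show ?thesis unfolding E_def by (simp only: norm_mult norm_of_real abs_of_nonneg[OF M0] mult_ac)
    qed
    also have "cmod (of_real ?M * (\<integral>x. F x \<partial>lborel)) \<le> (\<integral>x. D * C * S * decay_weight x \<partial>(lborel :: (real ^ 'm) measure))"
    proof -
      have "of_real ?M * (\<integral>x. F x \<partial>lborel) = (\<integral>x. of_real ?M * F x \<partial>lborel)" by simp
      also have "cmod \<dots> \<le> (\<integral>x. D * C * S * decay_weight x \<partial>(lborel :: (real ^ 'm) measure))"
        by (rule Bochner_Integration.integral_norm_bound_integral) (use ptw intF in \<open>auto intro!: integrable_decay_weight\<close>)
      finally show ?thesis .
    qed
    also have "\<dots> = D * C * S * W" by (simp add: W_def)
    also have "E * \<dots> = (E * (D * C) * W) * S" by simp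
    finally show ?thesis unfolding S_def g_def by (simp add: E_def mult_left_mono)
  qed
  then show ?thesis using IC(1,2) D(1) W by (intro exI[of _ I] exI[of _ "E * (D * C) * W"]) (auto simp: E_def)
qed

lemma exists_list_count_vec:
  fixes p :: "nat ^ 'm"
  obtains ds where "\<And>l. count_list ds l = p $ l"
  using exists_list_count_list[of "\<lambda>l. p $ l"] by blast

lemma clifford_transform_outside: "t \<notin> orthant2 \<Longrightarrow> clifford_transform \<nu> a f t = 0"
  by (simp only: clifford_transform_def if_False)

text \<open>
  The multiples of transforms of all orders form a class that is closed under differentiation.
\<close>

lemma clifford_transform_schwartz:
  fixes f :: "(real ^ 'm) \<times> (real ^ 'n) \<Rightarrow> complex"
  assumes f: "f \<in> schwartz" and \<nu>: "\<forall>l. 0 \<le> \<nu> $ l" and a: "\<forall>l. 0 < a $ l"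
  shows "clifford_transform \<nu> a f \<in> schwartz"
proof (rule schwartz_coinduct[where S="{(\<lambda>t. b * clifford_transform \<mu> a f t) | b \<mu> f. f \<in> schwartz \<and> (\<forall>l. 0 \<le> \<mu> $ l)}"])
  show "clifford_transform \<nu> a f \<in> {(\<lambda>t. b * clifford_transform \<mu> a f t) | b \<mu> f. f \<in> schwartz \<and> (\<forall>l. 0 \<le> \<mu> $ l)}"
    using f \<nu> by (auto intro!: exI[of _ 1] exI[of _ \<nu>] exI[of _ f])
next
  fix g :: "(real ^ 'm) \<times> (real ^ 'n) \<Rightarrow> complex"
  assume "g \<in> {(\<lambda>t. b * clifford_transform \<mu> a f t) | b \<mu> f. f \<in> schwartz \<and> (\<forall>l. 0 \<le> \<mu> $ l)}"
  then obtain b \<mu> f where g: "g = (\<lambda>t. b * clifford_transform \<mu> a f t)" and f: "f \<in> schwartz" and \<mu>: "\<forall>l. 0 \<le> \<mu> $ l" by blast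
  show "g x = 0" if "x \<notin> orthant2" for x unfolding g clifford_transform_outside[OF that] by simp
  show "\<exists>h\<in>{(\<lambda>t. b * clifford_transform \<mu> a f t) | b \<mu> f. f \<in> schwartz \<and> (\<forall>l. 0 \<le> \<mu> $ l)}.
     \<forall>x\<in>orthant2. ((\<lambda>s. g (x + s *\<^sub>R coord_dir c)) has_vector_derivative h x) (at 0)" for c
  proof (cases c)
    case (Inl l)
    have "((\<lambda>s. g (x + s *\<^sub>R coord_dir c)) has_vector_derivative (b * - of_real (a $ l)) * clifford_transform (\<mu> + axis l 1) a f x) (at 0)"
      if "x \<in> orthant2" for x
      using has_vector_derivative_mult_right[OF clifford_transform_deriv_Inl[OF f \<mu> a that, of l], of b]
      unfolding g Inl by (simp only: mult.assoc)
    then show ?thesis using f nonneg_add_axis[OF \<mu>, of l]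
      by (intro bexI[of _ "\<lambda>x. (b * - of_real (a $ l)) * clifford_transform (\<mu> + axis l 1) a f x"]) blast+
  next
    case (Inr j)
    have "((\<lambda>s. g (x + s *\<^sub>R coord_dir c)) has_vector_derivative b * clifford_transform \<mu> a (pdiff0 (Inr j) f) x) (at 0)"
      if "x \<in> orthant2" for x
      using has_vector_derivative_mult_right[OF clifford_transform_deriv_Inr[OF f \<mu> that, of a j], of b]
      unfolding g Inr by (simp only: mult.assoc)
    then show ?thesis using schwartz_pdiff0[OF f] \<mu>
      by (intro bexI[of _ "\<lambda>x. b * clifford_transform \<mu> a (pdiff0 (Inr j) f) x"]) blast+
  qed
  show "\<exists>M. \<forall>x\<in>orthant2. mpow x k * cmod (g x) \<le> M" for k
  proof -
    obtain ds where ds: "\<And>l. count_list ds l = 2 * fst k $ l"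
      using exists_list_count_vec[of "\<chi> l. 2 * fst k $ l"] by auto
    obtain I C where "\<And>t. t \<in> orthant2 \<Longrightarrow> mpow t (fst k, snd k) * cmod (clifford_transform \<mu> a f t) \<le> C * (\<Sum>\<kappa>\<in>I. sup_seminorm \<kappa> (pdiffs0 (map Inl ds) f))"
      using clifford_transform_decay[OF \<mu> a ds, of "snd k"] f by blast
    then have "mpow t k * cmod (g t) \<le> cmod b * (C * (\<Sum>\<kappa>\<in>I. sup_seminorm \<kappa> (pdiffs0 (map Inl ds) f)))" if "t \<in> orthant2" for t
    proof -
      have "mpow t k * cmod (clifford_transform \<mu> a f t) \<le> C * (\<Sum>\<kappa>\<in>I. sup_seminorm \<kappa> (pdiffs0 (map Inl ds) f))"
        using \<open>\<And>t. t \<in> orthant2 \<Longrightarrow> _\<close>[OF that] by simp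
      from mult_left_mono[OF this norm_ge_zero[of b]] show ?thesis
        unfolding g norm_mult by (simp only: mult_ac)
    qed
    then show ?thesis by blast
  qed
qed

lemma pdiff0_eqI:
  assumes "\<And>x. x \<in> orthant2 \<Longrightarrow> ((\<lambda>s. g (x + s *\<^sub>R coord_dir c)) has_vector_derivative h x) (at 0)"
    and "\<And>x. x \<notin> orthant2 \<Longrightarrow> h x = 0"
  shows "pdiff0 c g = h"
proof
  fix x show "pdiff0 c g x = h x"
    using vector_derivative_at[OF assms(1)] assms(2) unfolding pdiff0_def pdiff_def by simp
qed

lemma pdiff0_cmult: "smooth0 f \<Longrightarrow> pdiff0 c (\<lambda>x. b * f x) = (\<lambda>x. b * pdiff0 c f x)"
  using pdiff0_linear[of f f c b 0] by simp

lemma pdiffs0_Inr_clifford_transform: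
  assumes f: "f \<in> schwartz" and \<nu>: "\<forall>l. 0 \<le> \<nu> $ l"
  shows "pdiffs0 (map Inr js) (clifford_transform \<nu> a f) = clifford_transform \<nu> a (pdiffs0 (map Inr js) f)"
proof (induction js)
  case (Cons j js)
  show ?case unfolding list.map pdiffs0_simps Cons.IH
    by (intro pdiff0_eqI clifford_transform_deriv_Inr schwartz_pdiffs0 f \<nu> clifford_transform_outside)
qed simp

lemma pdiffs0_Inl_clifford_transform:
  assumes f: "f \<in> schwartz" and \<nu>: "\<forall>l. 0 \<le> \<nu> $ l" and a: "\<forall>l. 0 < a $ l"
  shows "pdiffs0 (map Inl ls) (clifford_transform \<nu> a f) =
    (\<lambda>t. (\<Prod>l\<in>UNIV. (- of_real (a $ l)) ^ count_list ls l) * clifford_transform (\<nu> + count_vec ls) a f t)"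
proof (induction ls)
  case (Cons d ls)
  note \<nu>' = count_vec_nonneg[OF \<nu>, of ls]
  let ?c = "\<Prod>l\<in>UNIV. (- complex_of_real (a $ l)) ^ count_list ls l"
  have "pdiffs0 (map Inl (d # ls)) (clifford_transform \<nu> a f) = pdiff0 (Inl d) (\<lambda>t. ?c * clifford_transform (\<nu> + count_vec ls) a f t)"
    by (simp only: list.map pdiffs0_simps Cons.IH)
  also have "\<dots> = (\<lambda>t. ?c * pdiff0 (Inl d) (clifford_transform (\<nu> + count_vec ls) a f) t)"
    by (intro pdiff0_cmult schwartz_smooth0 clifford_transform_schwartz f \<nu>' a)
  also have "pdiff0 (Inl d) (clifford_transform (\<nu> + count_vec ls) a f) = (\<lambda>t. - of_real (a $ d) * clifford_transform (\<nu> + count_vec ls + axis d 1) a f t)"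
    by (intro pdiff0_eqI clifford_transform_deriv_Inl f \<nu>' a) (simp_all only: clifford_transform_outside mult_zero_right not_False_eq_True)
  finally show ?case
    unfolding prod_power_count_Cons count_vec_simps by (simp only: add.assoc mult_ac)
qed (simp add: count_vec_simps)

lemma schwartz_seminorm_eq:
  assumes f: "smooth0 f" and l: "\<And>i. count_list cs (Inl i) = p' $ i" and r: "\<And>j. count_list cs (Inr j) = p'' $ j"
  shows "schwartz_seminorm k (p', p'') f = sup_seminorm k (pdiffs0 cs f)"
  unfolding schwartz_seminorm_def sup_seminorm_def
  by (intro SUP_cong refl) (simp only: mdiff_eq_pdiffs0[OF f _ l r])

lemma count_list_map_Inl: "count_list (map Inl ls @ map Inr js) (Inl l) = count_list ls l"
  and count_list_map_Inr: "count_list (map Inl ls @ map Inr js) (Inr j) = count_list js j"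
proof -
  have "count_list (map Inl ls) (Inl l :: 'a + 'b) = count_list ls l" "count_list (map Inl ls) (Inr j :: 'a + 'b) = 0" by (induction ls) auto
  moreover have "count_list (map Inr js) (Inr j :: 'a + 'b) = count_list js j" "count_list (map Inr js) (Inl l :: 'a + 'b) = 0" by (induction js) auto
  ultimately show "count_list (map Inl ls @ map Inr js) (Inl l :: 'a + 'b) = count_list ls l"
    "count_list (map Inl ls @ map Inr js) (Inr j :: 'a + 'b) = count_list js j" by simp_all
qed

lemma clifford_transform_seminorm_estimate:
  fixes \<nu> a :: "real ^ 'm" and k p :: "(nat ^ 'm) \<times> (nat ^ 'n)"
  assumes \<nu>: "\<forall>l. 0 \<le> \<nu> $ l" and a: "\<forall>l. 0 < a $ l"
  shows "\<exists>I q C. finite I \<and> 0 \<le> C \<and> (\<forall>f\<in>schwartz. schwartz_seminorm k p (clifford_transform \<nu> a f) \<le> C * (\<Sum>\<kappa>\<in>I. schwartz_seminorm \<kappa> q f))"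
proof -
  obtain ls where ls: "\<And>l. count_list ls l = fst p $ l" using exists_list_count_vec by blast
  obtain js where js: "\<And>j. count_list js j = snd p $ j" using exists_list_count_vec by blast
  obtain ds where ds: "\<And>l. count_list ds l = 2 * fst k $ l"
    using exists_list_count_vec[of "\<chi> l. 2 * fst k $ l"] by auto
  define q where "q = ((\<chi> l. 2 * fst k $ l) :: nat ^ 'm, snd p)"
  obtain I C where IC: "finite I" "0 \<le> C" and est: "\<And>f t. f \<in> schwartz \<Longrightarrow> t \<in> orthant2 \<Longrightarrow>
      mpow t (fst k, snd k) * cmod (clifford_transform (\<nu> + count_vec ls) a f t) \<le> C * (\<Sum>\<kappa>\<in>I. sup_seminorm \<kappa> (pdiffs0 (map Inl ds) f))"
    using clifford_transform_decay[OF count_vec_nonneg[OF \<nu>, of ls] a ds, of "snd k"] by blast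
  define E where "E = cmod (\<Prod>l\<in>UNIV. (- of_real (a $ l)) ^ count_list ls l)"
  have "schwartz_seminorm k p (clifford_transform \<nu> a f) \<le> (E * C) * (\<Sum>\<kappa>\<in>I. schwartz_seminorm \<kappa> q f)" if f: "f \<in> schwartz" for f
  proof -
    let ?g = "pdiffs0 (map Inr js) f"
    have g: "?g \<in> schwartz" by (rule schwartz_pdiffs0[OF f])
    have "schwartz_seminorm k p (clifford_transform \<nu> a f) = sup_seminorm k (pdiffs0 (map Inl ls @ map Inr js) (clifford_transform \<nu> a f))"
      using schwartz_seminorm_eq[OF schwartz_smooth0[OF clifford_transform_schwartz[OF f \<nu> a]], of "map Inl ls @ map Inr js" "fst p" "snd p" k]
      by (simp only: count_list_map_Inl count_list_map_Inr ls js prod.collapse)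
    also have "pdiffs0 (map Inl ls @ map Inr js) (clifford_transform \<nu> a f) =
       (\<lambda>t. (\<Prod>l\<in>UNIV. (- of_real (a $ l)) ^ count_list ls l) * clifford_transform (\<nu> + count_vec ls) a ?g t)"
      unfolding pdiffs0_append pdiffs0_Inr_clifford_transform[OF f \<nu>] by (rule pdiffs0_Inl_clifford_transform[OF g \<nu> a])
    also have "sup_seminorm k \<dots> \<le> E * (C * (\<Sum>\<kappa>\<in>I. sup_seminorm \<kappa> (pdiffs0 (map Inl ds) ?g)))"
      unfolding sup_seminorm_def[of k]
    proof (rule cSUP_least)
      have "((\<chi> i. 1), (\<chi> i. 1)) \<in> (orthant2 :: ((real ^ 'm) \<times> (real ^ 'n)) set)" by (auto simp: pos_orthant_def)
      then show "orthant2 \<noteq> ({} :: ((real ^ 'm) \<times> (real ^ 'n)) set)" by blast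
      fix t :: "(real ^ 'm) \<times> (real ^ 'n)" assume t: "t \<in> orthant2"
      have "mpow t k * cmod ((\<Prod>l\<in>UNIV. (- of_real (a $ l)) ^ count_list ls l) * clifford_transform (\<nu> + count_vec ls) a ?g t) =
          E * (mpow t (fst k, snd k) * cmod (clifford_transform (\<nu> + count_vec ls) a ?g t))"
        by (simp add: norm_mult E_def)
      also have "\<dots> \<le> E * (C * (\<Sum>\<kappa>\<in>I. sup_seminorm \<kappa> (pdiffs0 (map Inl ds) ?g)))"
        by (intro mult_left_mono est g t) (simp add: E_def)
      finally show "mpow t k * cmod ((\<Prod>l\<in>UNIV. (- of_real (a $ l)) ^ count_list ls l) * clifford_transform (\<nu> + count_vec ls) a ?g t) \<le>
        E * (C * (\<Sum>\<kappa>\<in>I. sup_seminorm \<kappa> (pdiffs0 (map Inl ds) ?g)))" .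
    qed
    also have "(\<Sum>\<kappa>\<in>I. sup_seminorm \<kappa> (pdiffs0 (map Inl ds) ?g)) = (\<Sum>\<kappa>\<in>I. schwartz_seminorm \<kappa> q f)"
    proof (rule sum.cong[OF refl])
      fix \<kappa>
      have "schwartz_seminorm \<kappa> q f = sup_seminorm \<kappa> (pdiffs0 (map Inl ds @ map Inr js) f)"
        unfolding q_def by (rule schwartz_seminorm_eq[OF schwartz_smooth0[OF f]])
          (simp_all only: count_list_map_Inl count_list_map_Inr js ds vec_lambda_beta)
      then show "sup_seminorm \<kappa> (pdiffs0 (map Inl ds) ?g) = schwartz_seminorm \<kappa> q f" by (simp only: pdiffs0_append)
    qed
    finally show ?thesis by (simp only: mult.assoc)
  qed
  moreover have "0 \<le> E * C" using IC(2) by (simp add: E_def)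
  ultimately show ?thesis using IC(1) by blast
qed

section \<open>Exponential sums\<close>

text \<open>
  The orthant in an arbitrary Euclidean space, so that the approximation result below serves both
  for the variables \<open>x'\<close> alone and for all variables.
\<close>

definition eorthant :: "'a::euclidean_space set" where
  "eorthant = {x. \<forall>b\<in>Basis. 0 < x \<bullet> b}"

inductive_set exp_sums :: "('a::euclidean_space \<Rightarrow> complex) set" where
  base: "s \<in> eorthant \<Longrightarrow> (\<lambda>x. of_real (exp (- (s \<bullet> x)))) \<in> exp_sums"
| add: "\<phi> \<in> exp_sums \<Longrightarrow> \<psi> \<in> exp_sums \<Longrightarrow> (\<lambda>x. \<phi> x + \<psi> x) \<in> exp_sums"
| scale: "\<phi> \<in> exp_sums \<Longrightarrow> (\<lambda>x. c * \<phi> x) \<in> exp_sums"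

lemma One_in_eorthant: "One \<in> eorthant"
  by (auto simp: eorthant_def)

lemma exp_sums_sum:
  assumes "finite I" "\<And>i. i \<in> I \<Longrightarrow> \<phi> i \<in> exp_sums"
  shows "(\<lambda>x::'a::euclidean_space. \<Sum>i\<in>I. \<phi> i x) \<in> exp_sums"
  using assms
proof (induction I rule: finite_induct)
  case empty
  have "(\<lambda>x::'a. 0 * of_real (exp (- (One \<bullet> x)))) \<in> (exp_sums :: ('a \<Rightarrow> complex) set)"
    by (intro exp_sums.scale exp_sums.base One_in_eorthant)
  then show ?case by simp
qed (auto intro: exp_sums.add)

text \<open>
  Multiplication by \<open>e\<^bsup>-x\<^sub>b\<^esup>\<close> only shifts the exponents. Iterating it yields the products with polynomials
  in these variables.
\<close>

lemma exp_sums_mult_exp_coord: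
  assumes "\<phi> \<in> exp_sums" and b: "b \<in> Basis"
  shows "(\<lambda>x. of_real (exp (- (x \<bullet> b))) * \<phi> x) \<in> exp_sums"
  using assms(1)
proof induction
  case (base s)
  have "s + b \<in> eorthant" using base b by (auto simp: eorthant_def inner_add_left inner_Basis)
  from exp_sums.base[OF this] show ?case
    by (simp add: inner_add_left inner_commute[of b] exp_add[symmetric] add.commute flip: of_real_mult)
next
  case (add \<phi> \<psi>)
  then show ?case using exp_sums.add[OF add.IH] by (simp add: distrib_left)
next
  case (scale \<phi> c)
  then show ?case using exp_sums.scale[OF scale.IH, of c] by (simp add: mult_ac)
qed

definition exp_coords :: "'a::euclidean_space \<Rightarrow> 'a" where
  "exp_coords x = (\<Sum>b\<in>Basis. exp (- (x \<bullet> b)) *\<^sub>R b)"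

lemma exp_coords_inner: "b \<in> Basis \<Longrightarrow> exp_coords x \<bullet> b = exp (- (x \<bullet> b))"
  by (simp add: exp_coords_def)

lemma exp_sums_mult_polynomial:
  assumes "real_polynomial_function P" "\<phi> \<in> exp_sums"
  shows "(\<lambda>x. of_real (P (exp_coords x)) * \<phi> x) \<in> exp_sums"
  using assms
proof (induction P arbitrary: \<phi> rule: real_polynomial_function.induct)
  case (linear h)
  have "(\<lambda>x. \<Sum>b\<in>Basis. of_real (h b) * (of_real (exp (- (x \<bullet> b))) * \<phi> x)) \<in> exp_sums"
    by (intro exp_sums_sum exp_sums.scale exp_sums_mult_exp_coord linear.prems) auto
  moreover have "h (exp_coords x) = (\<Sum>b\<in>Basis. exp (- (x \<bullet> b)) * h b)" for x
    unfolding exp_coords_def using linear.hyps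
    by (simp add: linear_sum[OF bounded_linear.linear] linear_scale[OF bounded_linear.linear])
  ultimately show ?case by (simp add: sum_distrib_left sum_distrib_right mult_ac)
next
  case (const c)
  then show ?case by (rule exp_sums.scale)
next
  case (add P Q)
  then show ?case using exp_sums.add[OF add.IH(1)[OF add.prems] add.IH(2)[OF add.prems]] by (simp add: distrib_right)
next
  case (mult P Q)
  then show ?case using mult.IH(1)[OF mult.IH(2)[OF mult.prems]] by (simp add: mult.assoc)
qed

text \<open>
  In the variables \<open>u = e\<^bsup>-x\<^esup>\<close> this is \<open>\<Prod> u\<^sub>b (1 - u\<^sub>b)\<close>. It vanishes on the whole boundary of the unit
  cube, at the faces \<open>u\<^sub>b = 0\<close> at infinity as well as at the faces \<open>u\<^sub>b = 1\<close> where \<open>x\<close> leaves the orthant.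
\<close>

definition edge_weight :: "'a::euclidean_space \<Rightarrow> real" where
  "edge_weight x = (\<Prod>b\<in>Basis. exp (- (x \<bullet> b)) * (1 - exp (- (x \<bullet> b))))"

lemma edge_weight_pos: "x \<in> eorthant \<Longrightarrow> 0 < edge_weight x"
  unfolding edge_weight_def by (intro prod_pos) (auto simp: eorthant_def)

lemma edge_weight_le_1: "x \<in> eorthant \<Longrightarrow> edge_weight x \<le> 1"
  unfolding edge_weight_def by (intro prod_le_1) (auto simp: eorthant_def less_imp_le intro!: mult_le_one)

text \<open>
  The substitution \<open>u = e\<^bsup>-x\<^esup>\<close> maps the orthant to the open unit cube. Multiplied by \<open>edge_weight\<close>, a
  bounded continuous function extends continuously by zero to the closed cube, where the
  Stone--Weierstrass theorem provides polynomials in \<open>u\<close>. The extra factor \<open>e\<^bsup>-x\<^sub>1-\<dots>-x\<^sub>d\<^esup>\<close> turns these into sums of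
  exponentials with positive exponents and makes the error integrable.
\<close>

lemma exp_sums_approximation:
  fixes c :: "'a::euclidean_space \<Rightarrow> complex"
  assumes cont: "continuous_on eorthant c" and bound: "\<And>x. x \<in> eorthant \<Longrightarrow> cmod (c x) \<le> B" and e: "0 < e"
  shows "\<exists>\<phi>\<in>exp_sums. \<forall>x\<in>eorthant.
     cmod (c x * of_real (edge_weight x * exp (- (One \<bullet> x))) - \<phi> x) \<le> e * exp (- (One \<bullet> x))"
proof -
  define V :: "'a \<Rightarrow> 'a" where "V u = (\<Sum>b\<in>Basis. (- ln (u \<bullet> b)) *\<^sub>R b)" for u
  define w where "w u = (\<Prod>b\<in>Basis. (u \<bullet> b) * (1 - u \<bullet> b))" for u :: 'a
  define h where "h u = (if u \<in> box 0 One then c (V u) * of_real (w u) else 0)" for u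
  have V_inner: "V u \<bullet> b = - ln (u \<bullet> b)" if "b \<in> Basis" for u b using that unfolding V_def by (simp only: inner_sum_left_Basis)
  have VU: "V (exp_coords x) = x" for x
    by (rule euclidean_eqI) (simp add: V_inner exp_coords_inner)
  have in_box: "u \<in> box 0 One \<longleftrightarrow> (\<forall>b\<in>Basis. 0 < u \<bullet> b \<and> u \<bullet> b < 1)" for u :: 'a by (auto simp: mem_box)
  have V_in: "V u \<in> eorthant" if "u \<in> box 0 One" for u
    using that unfolding eorthant_def by (auto simp: in_box V_inner)
  have U_in: "exp_coords x \<in> box 0 One" if "x \<in> eorthant" for x :: 'a
    using that by (auto simp: in_box exp_coords_inner eorthant_def)
  have w_cont: "continuous_on S w" for S unfolding w_def by (intro continuous_intros)
  have B0: "0 \<le> B" using order_trans[OF norm_ge_zero bound[OF One_in_eorthant]] .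
  have hB: "cmod (h v) \<le> B * \<bar>w v\<bar>" for v
    using bound[OF V_in, of v] B0 by (auto simp: h_def norm_mult intro: mult_right_mono)
  have h_box: "continuous_on (box 0 One) h"
  proof -
    have "continuous_on (box 0 One) V" unfolding V_def
      by (intro continuous_intros) (auto simp: in_box less_imp_neq[THEN not_sym])
    then have "continuous_on (box 0 One) (\<lambda>u. c (V u) * of_real (w u))"
      by (intro continuous_intros continuous_on_compose2[OF cont] w_cont) (auto intro: V_in)
    then show ?thesis by (rule continuous_on_eq) (simp add: h_def)
  qed
  have "continuous_on (cbox 0 One) h"
    unfolding continuous_on_eq_continuous_within
  proof
    fix u :: 'a assume u: "u \<in> cbox 0 One"
    show "continuous (at u within cbox 0 One) h"
    proof (cases "u \<in> box 0 One")
      case True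
      then have "continuous (at u) h" using h_box continuous_on_eq_continuous_at[OF open_box] by blast
      then show ?thesis by (rule continuous_at_imp_continuous_at_within)
    next
      case False
      then obtain b where b: "b \<in> Basis" "u \<bullet> b = 0 \<or> u \<bullet> b = 1"
        using u unfolding in_box mem_box by (auto simp: not_less)
      then have wu: "w u = 0" unfolding w_def by (intro prod_zero) auto
      have "(h \<longlongrightarrow> 0) (at u within cbox 0 One)"
      proof (rule Lim_null_comparison)
        show "\<forall>\<^sub>F v in at u within cbox 0 One. cmod (h v) \<le> B * \<bar>w v\<bar>"
          by (intro always_eventually allI hB)
        have "(w \<longlongrightarrow> w u) (at u within cbox 0 One)" using w_cont u unfolding continuous_on_def by blast
        then have "((\<lambda>v. B * \<bar>w v\<bar>) \<longlongrightarrow> B * \<bar>w u\<bar>) (at u within cbox 0 One)" by (intro tendsto_intros)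
        then show "((\<lambda>v. B * \<bar>w v\<bar>) \<longlongrightarrow> 0) (at u within cbox 0 One)" using wu by simp
      qed
      moreover have "h u = 0" using False by (simp add: h_def)
      ultimately show ?thesis by (simp add: continuous_within)
    qed
  qed
  from Stone_Weierstrass_polynomial_function[OF compact_cbox this e]
  obtain g where g: "polynomial_function g" "\<And>u. u \<in> cbox 0 One \<Longrightarrow> cmod (h u - g u) < e" by blast
  have Re: "real_polynomial_function (\<lambda>u. Re (g u))" and Im: "real_polynomial_function (\<lambda>u. Im (g u))"
    using g(1) bounded_linear_Re bounded_linear_Im unfolding polynomial_function_def by (auto simp: o_def)
  let ?E = "\<lambda>x::'a. complex_of_real (exp (- (One \<bullet> x)))"
  define \<phi> where "\<phi> x = of_real (Re (g (exp_coords x))) * ?E x + \<i> * (of_real (Im (g (exp_coords x))) * ?E x)" for x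
  have "\<phi> \<in> exp_sums" unfolding \<phi>_def[abs_def]
    by (intro exp_sums.add exp_sums.scale exp_sums_mult_polynomial[OF Re] exp_sums_mult_polynomial[OF Im] exp_sums.base One_in_eorthant)
  moreover have "cmod (c x * of_real (edge_weight x * exp (- (One \<bullet> x))) - \<phi> x) \<le> e * exp (- (One \<bullet> x))" if x: "x \<in> eorthant" for x
  proof -
    have "\<phi> x = g (exp_coords x) * ?E x"
      unfolding \<phi>_def by (subst (5) complex_eq) (simp add: algebra_simps)
    moreover have "c x * of_real (edge_weight x) = h (exp_coords x)"
      using U_in[OF x] by (simp add: h_def VU edge_weight_def w_def exp_coords_inner cong: prod.cong)
    ultimately have "c x * of_real (edge_weight x * exp (- (One \<bullet> x))) - \<phi> x = (h (exp_coords x) - g (exp_coords x)) * ?E x"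
      by (simp add: algebra_simps)
    moreover have "cmod (h (exp_coords x) - g (exp_coords x)) \<le> e"
      using U_in[OF x] box_subset_cbox[of 0 "One::'a"] by (intro less_imp_le g(2)) blast
    ultimately show ?thesis by (simp add: norm_mult mult_right_mono)
  qed
  ultimately show ?thesis by blast
qed

lemma eorthant_vec: "(eorthant :: (real^'m) set) = pos_orthant"
  by (auto simp: eorthant_def pos_orthant_def Basis_vec_eq inner_axis)

lemma open_null_imp_empty:
  fixes U :: "'a::euclidean_space set"
  assumes "open U" "AE x in lborel. x \<notin> U"
  shows "U = {}"
proof (rule ccontr)
  assume "U \<noteq> {}"
  have "U \<in> null_sets lborel"
    using assms AE_iff_null_sets[of U lborel] by simp
  then have "negligible U" unfolding negligible_iff_null_sets by (rule null_sets_completionI)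
  then show False using open_not_negligible[OF assms(1) \<open>U \<noteq> {}\<close>] by contradiction
qed

section \<open>Uniqueness of the Laplace transform\<close>

text \<open>
  All exponential sums are orthogonal to \<open>G\<close>. Approximating the conjugate of \<open>G\<close> by them shows that
  \<open>|G|\<^sup>2\<close> has integral zero against a positive weight, so \<open>G\<close> vanishes almost everywhere and, being
  continuous, everywhere.
\<close>

lemma laplace_transform_unique:
  fixes G :: "real ^ 'm \<Rightarrow> complex"
  assumes cont: "continuous_on pos_orthant G" and bound: "\<And>x. x \<in> pos_orthant \<Longrightarrow> cmod (G x) \<le> B"
    and zero: "\<And>x. x \<notin> pos_orthant \<Longrightarrow> G x = 0"
    and int: "integrable lborel (\<lambda>x. G x * of_real (vpow x \<nu>))"
    and lap: "\<And>s. s \<in> pos_orthant \<Longrightarrow> (\<integral>x. G x * of_real (exp (- (s \<bullet> x)) * vpow x \<nu>) \<partial>lborel) = 0"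
  shows "G x = 0"
proof -
  have ip: "0 \<le> s \<bullet> x" if "s \<in> pos_orthant" "x \<in> pos_orthant" for s x :: "real^'m"
    using that unfolding inner_vec_def by (intro sum_nonneg) (auto simp: pos_orthant_def less_imp_le)
  have Gm: "G \<in> borel_measurable borel"
  proof -
    have "(\<lambda>x. indicator pos_orthant x *\<^sub>R G x) \<in> borel_measurable borel"
      by (intro borel_measurable_continuous_on_indicator sets_pos_orthant cont)
    moreover have "(\<lambda>x. indicator pos_orthant x *\<^sub>R G x) = G"
      using zero by (intro ext) (auto simp: indicator_def)
    ultimately show ?thesis by simp
  qed
  note [measurable] = Gm
  have key: "integrable lborel (\<lambda>x. G x * \<phi> x * of_real (vpow x \<nu>)) \<and> (\<integral>x. G x * \<phi> x * of_real (vpow x \<nu>) \<partial>lborel) = 0"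
    if "\<phi> \<in> exp_sums" for \<phi>
    using that
  proof induction
    case (base s)
    then have s: "s \<in> pos_orthant" by (simp add: eorthant_vec)
    have "integrable lborel (\<lambda>x. G x * of_real (exp (- (s \<bullet> x))) * of_real (vpow x \<nu>))"
    proof (rule Bochner_Integration.integrable_bound[OF int])
      show "AE x in lborel. cmod (G x * of_real (exp (- (s \<bullet> x))) * of_real (vpow x \<nu>)) \<le> cmod (G x * of_real (vpow x \<nu>))"
      proof (rule AE_I2)
        fix x :: "real^'m"
        show "cmod (G x * of_real (exp (- (s \<bullet> x))) * of_real (vpow x \<nu>)) \<le> cmod (G x * of_real (vpow x \<nu>))"
          using ip[OF s, of x] zero[of x] by (cases "x \<in> pos_orthant") (auto simp: norm_mult intro!: mult_right_mono mult_left_le)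
      qed
    qed measurable
    then show ?case using lap[OF s] by (simp add: mult.assoc)
  next
    case (add \<phi> \<psi>)
    then show ?case by (simp add: distrib_left distrib_right)
  next
    case (scale \<phi> c)
    have "(\<lambda>x. G x * (c * \<phi> x) * of_real (vpow x \<nu>)) = (\<lambda>x. c * (G x * \<phi> x * of_real (vpow x \<nu>)))"
      by (simp add: mult_ac)
    then show ?case using scale.IH by simp
  qed
  define E where "E x = exp (- (One \<bullet> x))" for x :: "real^'m"
  have E1: "E x \<le> 1" if "x \<in> pos_orthant" for x
    using ip[OF One_in_eorthant[where 'a="real^'m", unfolded eorthant_vec] that] unfolding E_def by simp
  have E0: "0 < E x" for x by (simp add: E_def)
  have [measurable]: "E \<in> borel_measurable borel" "edge_weight \<in> borel_measurable (borel :: (real^'m) measure)"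
    unfolding E_def[abs_def] edge_weight_def[abs_def] by measurable
  define A where "A = (\<integral>x. cmod (G x * of_real (vpow x \<nu>)) \<partial>lborel)"
  define q where "q x = (cmod (G x))\<^sup>2 * (edge_weight x * E x) * vpow x \<nu>" for x
  have q0: "0 \<le> q x" for x
    unfolding q_def using E0[of x] edge_weight_pos[of x] zero[of x]
    by (cases "x \<in> pos_orthant") (auto simp: eorthant_vec intro!: mult_nonneg_nonneg less_imp_le)
  have qint: "integrable lborel q"
  proof (rule Bochner_Integration.integrable_bound[OF integrable_mult_right[OF int, of "of_real B"]])
    show "q \<in> borel_measurable lborel" unfolding q_def[abs_def] by measurable
    show "AE x in lborel. norm (q x) \<le> norm (of_real B * (G x * of_real (vpow x \<nu>)))"
    proof (rule AE_I2)
      fix x :: "real^'m"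
      show "norm (q x) \<le> norm (of_real B * (G x * of_real (vpow x \<nu>)))"
      proof (cases "x \<in> pos_orthant")
        case True
        have "norm (q x) = cmod (G x) * (edge_weight x * E x) * (cmod (G x) * vpow x \<nu>)"
          using q0[of x] by (simp add: q_def power2_eq_square)
        also have "\<dots> \<le> (B * (1 * 1)) * (cmod (G x) * vpow x \<nu>)"
          using True E0[of x] E1[of x] edge_weight_pos[of x] edge_weight_le_1[of x] order_trans[OF norm_ge_zero bound[OF True]]
          by (intro mult_right_mono mult_mono bound) (auto simp: eorthant_vec less_imp_le)
        also have "\<dots> = norm (of_real B * (G x * of_real (vpow x \<nu>)))"
          using order_trans[OF norm_ge_zero bound[OF True]] by (simp add: norm_mult)
        finally show ?thesis .
      qed (simp add: q_def zero)
    qed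
  qed
  have small: "(\<integral>x. q x \<partial>lborel) \<le> e * A" if e: "0 < e" for e
  proof -
    have "continuous_on eorthant (\<lambda>x. cnj (G x))" unfolding eorthant_vec by (intro continuous_intros cont)
    moreover have "cmod (cnj (G x)) \<le> B" if "x \<in> eorthant" for x using that bound by (simp add: eorthant_vec)
    ultimately obtain \<phi> where \<phi>: "\<phi> \<in> exp_sums" "\<And>x. x \<in> pos_orthant \<Longrightarrow>
        cmod (cnj (G x) * of_real (edge_weight x * E x) - \<phi> x) \<le> e * E x"
      using exp_sums_approximation[of "\<lambda>x. cnj (G x)" B e] e unfolding E_def eorthant_vec by blast
    have c: "of_real (q x) = G x * (cnj (G x) * of_real (edge_weight x * E x)) * of_real (vpow x \<nu>)" for x
      unfolding q_def of_real_mult complex_norm_square by (simp add: mult_ac)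
    have i1: "integrable lborel (\<lambda>x. G x * (cnj (G x) * of_real (edge_weight x * E x)) * of_real (vpow x \<nu>))"
      unfolding c[symmetric] using qint by (rule integrable_of_real)
    have "complex_of_real (\<integral>x. q x \<partial>lborel) = (\<integral>x. of_real (q x) \<partial>lborel)" by simp
    also have "\<dots> = (\<integral>x. G x * (cnj (G x) * of_real (edge_weight x * E x)) * of_real (vpow x \<nu>) \<partial>lborel) - (\<integral>x. G x * \<phi> x * of_real (vpow x \<nu>) \<partial>lborel)"
      using key[OF \<phi>(1)] unfolding c by simp
    also have "\<dots> = (\<integral>x. G x * (cnj (G x) * of_real (edge_weight x * E x)) * of_real (vpow x \<nu>) - G x * \<phi> x * of_real (vpow x \<nu>) \<partial>lborel)"
      using key[OF \<phi>(1)] i1 by (intro Bochner_Integration.integral_diff[symmetric]) auto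
    also have "cmod \<dots> \<le> (\<integral>x. e * cmod (G x * of_real (vpow x \<nu>)) \<partial>lborel)"
    proof (rule Bochner_Integration.integral_norm_bound_integral)
      show "integrable lborel (\<lambda>x. G x * (cnj (G x) * of_real (edge_weight x * E x)) * of_real (vpow x \<nu>) - G x * \<phi> x * of_real (vpow x \<nu>))"
        using key[OF \<phi>(1)] i1 by (intro Bochner_Integration.integrable_diff) auto
      show "integrable lborel (\<lambda>x. e * cmod (G x * of_real (vpow x \<nu>)))"
        using int by (intro integrable_mult_right integrable_norm)
      fix x :: "real^'m"
      show "cmod (G x * (cnj (G x) * of_real (edge_weight x * E x)) * of_real (vpow x \<nu>) - G x * \<phi> x * of_real (vpow x \<nu>)) \<le> e * cmod (G x * of_real (vpow x \<nu>))"
      proof (cases "x \<in> pos_orthant")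
        case True
        have "G x * (cnj (G x) * of_real (edge_weight x * E x)) * of_real (vpow x \<nu>) - G x * \<phi> x * of_real (vpow x \<nu>) =
          (cnj (G x) * of_real (edge_weight x * E x) - \<phi> x) * (G x * of_real (vpow x \<nu>))" by (simp add: algebra_simps)
        also have "cmod \<dots> \<le> (e * E x) * cmod (G x * of_real (vpow x \<nu>))"
          unfolding norm_mult[of "_ - _"] by (intro mult_right_mono \<phi>(2) True) simp
        also have "\<dots> \<le> (e * 1) * cmod (G x * of_real (vpow x \<nu>))"
          using e E1[OF True] by (intro mult_right_mono mult_left_mono) auto
        finally show ?thesis by simp
      qed (simp add: zero)
    qed
    also have "\<dots> = e * A" by (simp add: A_def)
    finally have "cmod (complex_of_real (\<integral>x. q x \<partial>lborel)) \<le> e * A" .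
    then show ?thesis by simp
  qed
  have "(\<integral>x. q x \<partial>lborel) = 0"
  proof (rule antisym)
    have A0: "0 \<le> A" by (simp add: A_def)
    show "(\<integral>x. q x \<partial>lborel) \<le> 0"
    proof (rule field_le_epsilon)
      fix e :: real assume e: "0 < e"
      have "(\<integral>x. q x \<partial>lborel) \<le> (e / (A + 1)) * A" using e A0 by (intro small) simp
      also have "\<dots> \<le> e" using e A0 by (simp add: field_simps)
      finally show "(\<integral>x. q x \<partial>lborel) \<le> 0 + e" by simp
    qed
    show "0 \<le> (\<integral>x. q x \<partial>lborel)" using q0 by (rule Bochner_Integration.integral_nonneg)
  qed
  then have "AE x in lborel. q x = 0"
    using integral_nonneg_eq_0_iff_AE[OF qint] q0 by simp
  then have "AE x in lborel. x \<notin> {x \<in> pos_orthant. G x \<noteq> 0}"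
  proof eventually_elim
    case (elim x)
    then show ?case using E0[of x] edge_weight_pos[of x] vpow_pos[of x \<nu>] by (auto simp: q_def eorthant_vec)
  qed
  moreover have "open {x \<in> pos_orthant. G x \<noteq> 0}"
    using continuous_open_preimage[OF cont open_pos_orthant open_Compl[OF closed_singleton[of 0]]]
    by (simp add: vimage_def Int_def)
  ultimately have "{x \<in> pos_orthant. G x \<noteq> 0} = {}" by (intro open_null_imp_empty)
  then show "G x = 0" using zero by blast
qed

section \<open>Inversion and Parseval\<close>

definition cut_exp :: "real ^ 'm \<Rightarrow> real ^ 'm \<Rightarrow> complex" where
  "cut_exp s x = of_real (indicator pos_orthant x * exp (- (s \<bullet> x)))"

lemma indicator_pos_orthant: "indicator pos_orthant x = (\<Prod>l\<in>UNIV. indicator {0<..} (x $ l) :: real)"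
  by (auto simp: indicator_def pos_orthant_def)

text \<open>
  The kernel, the weight and the exponential all factor over the coordinates, which reduces the
  formula to dimension one.
\<close>

lemma clifford_integral_cut_exp:
  fixes s t :: "real ^ 'm"
  assumes \<nu>: "\<forall>l. 0 \<le> \<nu> $ l" and s: "s \<in> pos_orthant"
  shows "clifford_integral \<nu> a (cut_exp s) t =
    of_real ((\<Prod>l\<in>UNIV. a $ l powr (\<nu> $ l + 1) * s $ l powr - (\<nu> $ l + 1)) * exp (- (\<Sum>l\<in>UNIV. (a $ l)\<^sup>2 * t $ l / s $ l)))"
    and "integrable lborel (\<lambda>x. cut_exp s x * of_real (vpow x \<nu>))"
proof -
  let ?f = "\<lambda>l x. a $ l powr (\<nu> $ l + 1) * (indicator {0<..} x * (exp (- (s $ l * x)) * bessel_clifford (\<nu> $ l) ((a $ l)\<^sup>2 * t $ l * x) * x powr \<nu> $ l))"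
  have "has_bochner_integral lborel (\<lambda>x::real^'m. \<Prod>l\<in>UNIV. ?f l (x $ l))
     (\<Prod>l\<in>UNIV. a $ l powr (\<nu> $ l + 1) * (s $ l powr - (\<nu> $ l + 1) * exp (- ((a $ l)\<^sup>2 * t $ l / s $ l))))"
    using \<nu> pos_orthantD[OF s]
    by (intro has_bochner_integral_vec_prod has_bochner_integral_mult_right has_bochner_integral_exp_bessel_clifford) auto
  moreover have "(\<Prod>l\<in>UNIV. a $ l powr (\<nu> $ l + 1) * (s $ l powr - (\<nu> $ l + 1) * exp (- ((a $ l)\<^sup>2 * t $ l / s $ l)))) =
     (\<Prod>l\<in>UNIV. a $ l powr (\<nu> $ l + 1) * s $ l powr - (\<nu> $ l + 1)) * exp (- (\<Sum>l\<in>UNIV. (a $ l)\<^sup>2 * t $ l / s $ l))"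
    by (simp only: sum_negf[symmetric] exp_sum[OF finite] prod.distrib[symmetric] mult.assoc)
  moreover have eqf: "(\<Prod>l\<in>UNIV. ?f l (x $ l)) = indicator pos_orthant x * exp (- (s \<bullet> x)) * (clifford_kernel \<nu> a x t * vpow x \<nu>)" for x :: "real^'m"
    unfolding indicator_pos_orthant inner_vec_def clifford_kernel_def vpow_def sum_negf[symmetric] exp_sum[OF finite] prod.distrib[symmetric]
    by (intro prod.cong) (auto simp: mult_ac)
  ultimately have "has_bochner_integral lborel (\<lambda>x. of_real (indicator pos_orthant x * exp (- (s \<bullet> x)) * (clifford_kernel \<nu> a x t * vpow x \<nu>)) :: complex)
     (of_real ((\<Prod>l\<in>UNIV. a $ l powr (\<nu> $ l + 1) * s $ l powr - (\<nu> $ l + 1)) * exp (- (\<Sum>l\<in>UNIV. (a $ l)\<^sup>2 * t $ l / s $ l))))"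
    by (intro has_bochner_integral_of_real) (simp only:)
  then show "clifford_integral \<nu> a (cut_exp s) t =
    of_real ((\<Prod>l\<in>UNIV. a $ l powr (\<nu> $ l + 1) * s $ l powr - (\<nu> $ l + 1)) * exp (- (\<Sum>l\<in>UNIV. (a $ l)\<^sup>2 * t $ l / s $ l)))"
    unfolding clifford_integral_def cut_exp_def of_real_mult[symmetric] by (rule has_bochner_integral_integral_eq)
  have "has_bochner_integral lborel (\<lambda>x::real^'m. \<Prod>l\<in>UNIV. indicator {0<..} (x $ l) * (x $ l powr \<nu> $ l * exp (- (s $ l * x $ l))))
     (\<Prod>l\<in>UNIV. Gamma (\<nu> $ l + 1) * s $ l powr - (\<nu> $ l + 1))"
    using \<nu> pos_orthantD[OF s]
    by (intro has_bochner_integral_vec_prod[where f="\<lambda>l x. indicator {0<..} x * (x powr \<nu> $ l * exp (- (s $ l * x)))"]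
        has_bochner_integral_Gamma) auto
  moreover have "(\<Prod>l\<in>UNIV. indicator {0<..} (x $ l) * (x $ l powr \<nu> $ l * exp (- (s $ l * x $ l)))) = indicator pos_orthant x * exp (- (s \<bullet> x)) * vpow x \<nu>" for x :: "real^'m"
    unfolding indicator_pos_orthant inner_vec_def vpow_def sum_negf[symmetric] exp_sum[OF finite] prod.distrib[symmetric]
    by (intro prod.cong) (auto simp: mult_ac)
  ultimately have "integrable lborel (\<lambda>x. indicator pos_orthant x * exp (- (s \<bullet> x)) * vpow x \<nu>)"
    by (simp only: has_bochner_integral_iff)
  then have "integrable lborel (\<lambda>x. of_real (indicator pos_orthant x * exp (- (s \<bullet> x)) * vpow x \<nu>) :: complex)"
    by (rule integrable_of_real)
  then show "integrable lborel (\<lambda>x. cut_exp s x * of_real (vpow x \<nu>))"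
    by (simp only: cut_exp_def of_real_mult)
qed

text \<open>
  Fubini's theorem for the symmetric bounded kernel.
\<close>

lemma clifford_integral_adjoint:
  fixes g h :: "real ^ 'm \<Rightarrow> complex"
  assumes \<nu>: "\<forall>l. 0 \<le> \<nu> $ l"
    and g0: "\<And>x. x \<notin> pos_orthant \<Longrightarrow> g x = 0" and h0: "\<And>x. x \<notin> pos_orthant \<Longrightarrow> h x = 0"
    and [measurable]: "g \<in> borel_measurable borel" "h \<in> borel_measurable borel"
    and gi: "integrable lborel (\<lambda>x. g x * of_real (vpow x \<nu>))" and hi: "integrable lborel (\<lambda>x. h x * of_real (vpow x \<nu>))"
  shows "(\<integral>t. clifford_integral \<nu> a g t * h t * of_real (vpow t \<nu>) \<partial>lborel) = (\<integral>x. g x * clifford_integral \<nu> a h x * of_real (vpow x \<nu>) \<partial>lborel)"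
proof -
  let ?g = "\<lambda>x. g x * of_real (vpow x \<nu>)" and ?h = "\<lambda>t. h t * of_real (vpow t \<nu>)"
  define H where "H x t = ?g x * of_real (clifford_kernel \<nu> a x t) * ?h t" for x t
  have b: "cmod (H x t) \<le> clifford_kernel_bound \<nu> a * cmod (?g x) * cmod (?h t)" for x t
  proof (cases "x \<in> pos_orthant \<and> t \<in> pos_orthant")
    case True
    then have "cmod (?g x) * \<bar>clifford_kernel \<nu> a x t\<bar> * cmod (?h t) \<le> cmod (?g x) * clifford_kernel_bound \<nu> a * cmod (?h t)"
      by (intro mult_right_mono mult_left_mono abs_clifford_kernel_le \<nu>) auto
    then show ?thesis unfolding H_def norm_mult[of "_ * of_real (clifford_kernel _ _ _ _)"] norm_mult[of _ "of_real (clifford_kernel _ _ _ _)"] by (simp add: mult_ac)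
  next
    case False
    then have "H x t = 0" using g0[of x] h0[of t] by (auto simp: H_def)
    then show ?thesis using clifford_kernel_bound_nonneg[OF \<nu>, of a] by simp
  qed
  have Hm [measurable]: "case_prod H \<in> borel_measurable (lborel \<Otimes>\<^sub>M lborel)"
    unfolding H_def[abs_def] by measurable
  have "integrable (lborel \<Otimes>\<^sub>M lborel) (case_prod H)"
  proof (rule integrableI_bounded)
    have "(\<integral>\<^sup>+ p. ennreal (norm (case_prod H p)) \<partial>(lborel \<Otimes>\<^sub>M lborel)) = (\<integral>\<^sup>+ x. \<integral>\<^sup>+ t. ennreal (norm (H x t)) \<partial>lborel \<partial>lborel)"
      by (subst lborel.nn_integral_fst[symmetric]) auto
    also have "\<dots> \<le> (\<integral>\<^sup>+ x. \<integral>\<^sup>+ t. ennreal (clifford_kernel_bound \<nu> a * cmod (?g x)) * ennreal (cmod (?h t)) \<partial>lborel \<partial>lborel)"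
      using b clifford_kernel_bound_nonneg[OF \<nu>, of a] by (intro nn_integral_mono) (auto simp: ennreal_mult''[symmetric] intro!: ennreal_leI)
    also have "\<dots> = (\<integral>\<^sup>+ x. ennreal (clifford_kernel_bound \<nu> a * cmod (?g x)) * (\<integral>\<^sup>+ t. ennreal (cmod (?h t)) \<partial>lborel) \<partial>lborel)"
      by (intro nn_integral_cong nn_integral_cmult) measurable
    also have "\<dots> = (\<integral>\<^sup>+ x. ennreal (clifford_kernel_bound \<nu> a * cmod (?g x)) \<partial>lborel) * (\<integral>\<^sup>+ t. ennreal (cmod (?h t)) \<partial>lborel)"
      by (intro nn_integral_multc) measurable
    also have "\<dots> < \<infinity>"
    proof -
      have "integrable lborel (\<lambda>x. clifford_kernel_bound \<nu> a * cmod (?g x))" using gi by (intro integrable_mult_right integrable_norm)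
      then have "(\<integral>\<^sup>+ x. ennreal (norm (clifford_kernel_bound \<nu> a * cmod (?g x))) \<partial>lborel) < \<infinity>" by (simp only: integrable_iff_bounded)
      moreover have "norm (clifford_kernel_bound \<nu> a * cmod (?g x)) = clifford_kernel_bound \<nu> a * cmod (?g x)" for x
        using clifford_kernel_bound_nonneg[OF \<nu>, of a] by (simp add: abs_mult)
      moreover have "(\<integral>\<^sup>+ t. ennreal (cmod (?h t)) \<partial>lborel) < \<infinity>" using hi by (simp only: integrable_iff_bounded)
      ultimately show ?thesis by (simp only: ennreal_mult_less_top infinity_ennreal_def) simp
    qed
    finally show "(\<integral>\<^sup>+ p. ennreal (norm (case_prod H p)) \<partial>(lborel \<Otimes>\<^sub>M lborel)) < \<infinity>" .
  qed (rule Hm)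
  from lborel_pair.Fubini_integral[OF this]
  have "(\<integral>t. (\<integral>x. H x t \<partial>lborel) \<partial>lborel) = (\<integral>x. (\<integral>t. H x t \<partial>lborel) \<partial>lborel)" .
  moreover have "(\<integral>x. H x t \<partial>lborel) = clifford_integral \<nu> a g t * h t * of_real (vpow t \<nu>)" for t
  proof -
    have "(\<integral>x. H x t \<partial>lborel) = (\<integral>x. g x * of_real (clifford_kernel \<nu> a x t * vpow x \<nu>) * ?h t \<partial>lborel)"
      unfolding H_def by (intro Bochner_Integration.integral_cong) (auto simp: mult_ac)
    also have "\<dots> = (\<integral>x. g x * of_real (clifford_kernel \<nu> a x t * vpow x \<nu>) \<partial>lborel) * ?h t"
      by (rule integral_mult_left_zero)
    finally show ?thesis by (simp only: clifford_integral_def mult.assoc)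
  qed
  moreover have "(\<integral>t. H x t \<partial>lborel) = g x * clifford_integral \<nu> a h x * of_real (vpow x \<nu>)" for x
  proof -
    have "(\<integral>t. H x t \<partial>lborel) = (\<integral>t. ?g x * (h t * of_real (clifford_kernel \<nu> a t x * vpow t \<nu>)) \<partial>lborel)"
      unfolding H_def clifford_kernel_sym[of \<nu> a x] by (intro Bochner_Integration.integral_cong) (auto simp: mult_ac)
    also have "\<dots> = ?g x * (\<integral>t. h t * of_real (clifford_kernel \<nu> a t x * vpow t \<nu>) \<partial>lborel)"
      by (rule integral_mult_right_zero)
    finally show ?thesis by (simp only: clifford_integral_def mult_ac)
  qed
  ultimately show ?thesis by simp
qed

lemma schwartz_section:
  fixes f :: "(real ^ 'm) \<times> (real ^ 'n) \<Rightarrow> complex"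
  assumes f: "f \<in> schwartz" and y: "y \<in> pos_orthant" and \<alpha>: "\<forall>l. 0 \<le> \<alpha> $ l"
  shows "continuous_on pos_orthant (\<lambda>x. f (x, y))"
    and "\<exists>B. \<forall>x\<in>pos_orthant. cmod (f (x, y)) \<le> B"
    and "x \<notin> pos_orthant \<Longrightarrow> f (x, y) = 0"
    and "integrable lborel (\<lambda>x. f (x, y) * of_real (vpow x \<alpha>))"
    and "(\<lambda>x. f (x, y)) \<in> borel_measurable borel"
proof -
  show "continuous_on pos_orthant (\<lambda>x. f (x, y))"
    by (rule continuous_on_compose2[OF smooth0_continuous[OF schwartz_smooth0[OF f]]])
      (use y in \<open>auto intro!: continuous_intros\<close>)
  show "\<exists>B. \<forall>x\<in>pos_orthant. cmod (f (x, y)) \<le> B"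
  proof -
    obtain M where "\<And>x. x \<in> orthant2 \<Longrightarrow> mpow x 0 * cmod (f x) \<le> M" using schwartz_decay[OF f] by blast
    then show ?thesis using y by (intro exI[of _ M]) auto
  qed
  show "f (x, y) = 0" if "x \<notin> pos_orthant" using that by (intro schwartz_outside[OF f]) auto
  show m: "(\<lambda>x. f (x, y)) \<in> borel_measurable borel" by (intro measurable_section schwartz_measurable f)
  obtain C where C: "0 \<le> C" "\<And>x. cmod (f (x, y)) * vpow x \<alpha> \<le> C * decay_weight x"
    using schwartz_envelope[OF f \<alpha>] y by blast
  note [measurable] = m
  show "integrable lborel (\<lambda>x. f (x, y) * of_real (vpow x \<alpha>))"
    by (rule Bochner_Integration.integrable_bound[of lborel "\<lambda>x. C * decay_weight x"])
      (use C in \<open>auto simp: norm_mult intro!: integrable_decay_weight\<close>)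
qed

lemma clifford_transform_section: "y \<in> pos_orthant \<Longrightarrow> t \<in> pos_orthant \<Longrightarrow> clifford_transform \<nu> a f (t, y) = clifford_integral \<nu> a (\<lambda>x. f (x, y)) t"
  by (simp add: clifford_transform_def)

text \<open>
  On exponentials \<open>e\<^bsup>-s\<cdot>x\<^esup>\<close> the double transform is the identity. Moving both transforms onto the
  exponential shows that \<open>T\<^sub>\<nu> T\<^sub>\<nu> f\<close> and \<open>f\<close> have the same weighted Laplace transform in the variables
  \<open>x'\<close>.
\<close>

lemma clifford_transform_involution:
  fixes f :: "(real ^ 'm) \<times> (real ^ 'n) \<Rightarrow> complex"
  assumes f: "f \<in> schwartz" and \<nu>: "\<forall>l. 0 \<le> \<nu> $ l" and a: "\<forall>l. 0 < a $ l"
  shows "clifford_transform \<nu> a (clifford_transform \<nu> a f) = f"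
proof
  fix p :: "(real ^ 'm) \<times> (real ^ 'n)"
  obtain u y where p: "p = (u, y)" by (cases p)
  let ?T = "clifford_transform \<nu> a f" and ?TT = "clifford_transform \<nu> a (clifford_transform \<nu> a f)"
  have T: "?T \<in> schwartz" by (rule clifford_transform_schwartz[OF f \<nu> a])
  have TT: "?TT \<in> schwartz" by (rule clifford_transform_schwartz[OF T \<nu> a])
  have G: "(\<lambda>x. 1 * ?TT x + (-1) * f x) \<in> schwartz" by (rule schwartz_linear[OF TT f])
  show "?TT p = f p"
  proof (cases "p \<in> orthant2")
    case True
    then have y: "y \<in> pos_orthant" using p by simp
    note sG = schwartz_section[OF G y \<nu>]
    have lap: "(\<integral>x. ?TT (x, y) * of_real (exp (- (s \<bullet> x)) * vpow x \<nu>) \<partial>lborel) =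
        (\<integral>x. f (x, y) * of_real (exp (- (s \<bullet> x)) * vpow x \<nu>) \<partial>lborel)" if s: "s \<in> pos_orthant" for s
    proof -
      \<comment> \<open>The exponents of the transformed exponential; applying the rule twice returns to \<open>s\<close>.\<close>
      define s' where "s' = (\<chi> l. (a $ l)\<^sup>2 / s $ l)"
      have "0 < (a $ l)\<^sup>2 / s $ l" for l using a[rule_format, of l] pos_orthantD[OF s, of l] by simp
      then have s': "s' \<in> pos_orthant" by (simp add: s'_def pos_orthant_def)
      define \<kappa> where "\<kappa> s = (\<Prod>l\<in>UNIV. a $ l powr (\<nu> $ l + 1) * s $ l powr - (\<nu> $ l + 1))" for s :: "real ^ 'm"
      have k1: "clifford_integral \<nu> a (cut_exp s) t = of_real (\<kappa> s) * of_real (exp (- (s' \<bullet> t)))" for t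
        unfolding clifford_integral_cut_exp(1)[OF \<nu> s] \<kappa>_def s'_def inner_vec_def by (simp add: mult.commute)
      have k2: "clifford_integral \<nu> a (cut_exp s') t = of_real (\<kappa> s') * of_real (exp (- (s \<bullet> t)))" for t
      proof -
        have "(a $ l)\<^sup>2 * t $ l / s' $ l = s $ l * t $ l" for l
          using a[rule_format, of l] pos_orthantD[OF s, of l] by (simp add: s'_def)
        then show ?thesis
          unfolding clifford_integral_cut_exp(1)[OF \<nu> s'] \<kappa>_def inner_vec_def by simp
      qed
      have kk: "\<kappa> s * \<kappa> s' = 1"
      proof -
        have "a $ l powr (\<nu> $ l + 1) * s $ l powr - (\<nu> $ l + 1) * (a $ l powr (\<nu> $ l + 1) * s' $ l powr - (\<nu> $ l + 1)) = 1" for l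
        proof -
          have al: "0 < a $ l" and sl: "0 < s $ l" using a pos_orthantD[OF s] by auto
          have "s $ l * s' $ l = a $ l * a $ l" using sl by (simp add: s'_def power2_eq_square)
          then have "s $ l powr - (\<nu> $ l + 1) * s' $ l powr - (\<nu> $ l + 1) = a $ l powr - (\<nu> $ l + 1) * a $ l powr - (\<nu> $ l + 1)"
            using al sl pos_orthantD[OF s', of l] by (simp only: powr_mult[symmetric] less_imp_le)
          then have "a $ l powr (\<nu> $ l + 1) * s $ l powr - (\<nu> $ l + 1) * (a $ l powr (\<nu> $ l + 1) * s' $ l powr - (\<nu> $ l + 1)) =
             (a $ l powr (\<nu> $ l + 1) * a $ l powr - (\<nu> $ l + 1)) * (a $ l powr (\<nu> $ l + 1) * a $ l powr - (\<nu> $ l + 1))"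
            by (simp only: mult_ac)
          also have "\<dots> = 1" unfolding powr_add[symmetric] using al by simp
          finally show ?thesis .
        qed
        then show ?thesis unfolding \<kappa>_def prod.distrib[symmetric] by simp
      qed
      have m: "cut_exp s \<in> borel_measurable borel" for s :: "real^'m" unfolding cut_exp_def[abs_def] by measurable
      have z: "x \<notin> pos_orthant \<Longrightarrow> cut_exp s x = 0" for s x :: "real^'m" by (simp add: cut_exp_def)
      have step: "(\<integral>x. clifford_transform \<nu> a F (x, y) * of_real (exp (- (r \<bullet> x)) * vpow x \<nu>) \<partial>lborel) =
         (\<integral>x. F (x, y) * clifford_integral \<nu> a (cut_exp r) x * of_real (vpow x \<nu>) \<partial>lborel)"
        if F: "F \<in> schwartz" and r: "r \<in> pos_orthant" for F r
      proof -
        note s = schwartz_section[OF F y \<nu>]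
        have "(\<integral>x. clifford_transform \<nu> a F (x, y) * of_real (exp (- (r \<bullet> x)) * vpow x \<nu>) \<partial>lborel) =
          (\<integral>x. clifford_integral \<nu> a (\<lambda>x. F (x, y)) x * cut_exp r x * of_real (vpow x \<nu>) \<partial>lborel)"
        proof (rule Bochner_Integration.integral_cong[OF refl])
          fix x :: "real^'m"
          show "clifford_transform \<nu> a F (x, y) * of_real (exp (- (r \<bullet> x)) * vpow x \<nu>) = clifford_integral \<nu> a (\<lambda>x. F (x, y)) x * cut_exp r x * of_real (vpow x \<nu>)"
            using y by (cases "x \<in> pos_orthant") (auto simp: clifford_transform_def cut_exp_def)
        qed
        also have "\<dots> = (\<integral>x. F (x, y) * clifford_integral \<nu> a (cut_exp r) x * of_real (vpow x \<nu>) \<partial>lborel)"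
          by (rule clifford_integral_adjoint[OF \<nu> s(3) z s(5) m s(4) clifford_integral_cut_exp(2)[OF \<nu> r]])
        finally show ?thesis .
      qed
      have "(\<integral>x. ?TT (x, y) * of_real (exp (- (s \<bullet> x)) * vpow x \<nu>) \<partial>lborel) =
         (\<integral>x. of_real (\<kappa> s) * (?T (x, y) * of_real (exp (- (s' \<bullet> x)) * vpow x \<nu>)) \<partial>lborel)"
        unfolding step[OF T s] k1 by (simp only: of_real_mult mult_ac)
      also have "\<dots> = of_real (\<kappa> s) * (\<integral>x. ?T (x, y) * of_real (exp (- (s' \<bullet> x)) * vpow x \<nu>) \<partial>lborel)" by simp
      also have "\<dots> = of_real (\<kappa> s) * (\<integral>x. of_real (\<kappa> s') * (f (x, y) * of_real (exp (- (s \<bullet> x)) * vpow x \<nu>)) \<partial>lborel)"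
        unfolding step[OF f s'] k2 by (simp only: of_real_mult mult_ac)
      also have "\<dots> = of_real (\<kappa> s * \<kappa> s') * (\<integral>x. f (x, y) * of_real (exp (- (s \<bullet> x)) * vpow x \<nu>) \<partial>lborel)" by simp
      finally show ?thesis unfolding kk by simp
    qed
    obtain B where B: "\<And>x. x \<in> pos_orthant \<Longrightarrow> cmod (1 * ?TT (x, y) + (-1) * f (x, y)) \<le> B" using sG(2) by blast
    have "1 * ?TT (u, y) + (-1) * f (u, y) = 0"
    proof (rule laplace_transform_unique[OF sG(1) B sG(3) sG(4)])
      fix s :: "real^'m" assume s: "s \<in> pos_orthant"
      have i: "integrable lborel (\<lambda>x. F (x, y) * of_real (exp (- (s \<bullet> x)) * vpow x \<nu>))" if F: "F \<in> schwartz" for F :: "(real ^ 'm) \<times> (real ^ 'n) \<Rightarrow> complex"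
      proof (rule Bochner_Integration.integrable_bound[OF schwartz_section(4)[OF F y \<nu>]])
        note [measurable] = schwartz_section(5)[OF F y \<nu>]
        show "(\<lambda>x. F (x, y) * of_real (exp (- (s \<bullet> x)) * vpow x \<nu>)) \<in> borel_measurable lborel" by measurable
        show "AE x in lborel. cmod (F (x, y) * of_real (exp (- (s \<bullet> x)) * vpow x \<nu>)) \<le> cmod (F (x, y) * of_real (vpow x \<nu>))"
        proof (rule AE_I2)
          fix x :: "real^'m"
          show "cmod (F (x, y) * of_real (exp (- (s \<bullet> x)) * vpow x \<nu>)) \<le> cmod (F (x, y) * of_real (vpow x \<nu>))"
          proof (cases "x \<in> pos_orthant")
            case True
            have "0 \<le> s \<bullet> x" unfolding inner_vec_def using pos_orthantD[OF s] pos_orthantD[OF True]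
              by (intro sum_nonneg) (auto simp: less_imp_le)
            then show ?thesis by (auto simp: norm_mult abs_mult intro!: mult_left_mono mult_left_le_one_le)
          qed (simp add: schwartz_section(3)[OF F y \<nu>])
        qed
      qed
      have "(\<integral>x. (1 * ?TT (x, y) + (-1) * f (x, y)) * of_real (exp (- (s \<bullet> x)) * vpow x \<nu>) \<partial>lborel) =
        (\<integral>x. ?TT (x, y) * of_real (exp (- (s \<bullet> x)) * vpow x \<nu>) - f (x, y) * of_real (exp (- (s \<bullet> x)) * vpow x \<nu>) \<partial>lborel)"
        by (intro Bochner_Integration.integral_cong refl) (simp add: algebra_simps)
      also have "\<dots> = 0" unfolding Bochner_Integration.integral_diff[OF i[OF TT] i[OF f]] lap[OF s] by simp
      finally show "(\<integral>x. (1 * ?TT (x, y) + (-1) * f (x, y)) * of_real (exp (- (s \<bullet> x)) * vpow x \<nu>) \<partial>lborel) = 0" .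
    qed auto
    then show ?thesis by (simp add: p)
  next
    case False
    then show ?thesis using schwartz_outside[OF TT False] schwartz_outside[OF f False] by simp
  qed
qed

text \<open>
  Symmetry moves one transform of \<open>\<integral> T\<^sub>\<nu> f \<cdot> cnj (T\<^sub>\<nu> f) x\<^sup>\<nu>\<close> to the other factor, where it undoes the first.
\<close>

lemma clifford_transform_parseval_section:
  fixes f :: "(real ^ 'm) \<times> (real ^ 'n) \<Rightarrow> complex"
  assumes f: "f \<in> schwartz" and \<nu>: "\<forall>l. 0 \<le> \<nu> $ l" and a: "\<forall>l. 0 < a $ l" and y: "y \<in> pos_orthant"
  shows "(\<integral>\<^sup>+ t. ennreal ((cmod (clifford_transform \<nu> a f (t, y)))\<^sup>2 * vpow t \<nu>) \<partial>lborel) =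
         (\<integral>\<^sup>+ x. ennreal ((cmod (f (x, y)))\<^sup>2 * vpow x \<nu>) \<partial>lborel)"
proof -
  let ?T = "clifford_transform \<nu> a f"
  have T: "?T \<in> schwartz" by (rule clifford_transform_schwartz[OF f \<nu> a])
  have sq: "integrable lborel (\<lambda>x. (cmod (F (x, y)))\<^sup>2 * vpow x \<nu>)" if F: "F \<in> schwartz" for F :: "(real ^ 'm) \<times> (real ^ 'n) \<Rightarrow> complex"
  proof -
    note s = schwartz_section[OF F y \<nu>]
    note [measurable] = s(5)
    obtain B where B: "\<And>x. x \<in> pos_orthant \<Longrightarrow> cmod (F (x, y)) \<le> B" using s(2) by blast
    show ?thesis
    proof (rule Bochner_Integration.integrable_bound[OF integrable_mult_right[OF s(4), of "of_real B"]])
      show "AE x in lborel. norm ((cmod (F (x, y)))\<^sup>2 * vpow x \<nu>) \<le> cmod (of_real B * (F (x, y) * of_real (vpow x \<nu>)))"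
      proof (rule AE_I2)
        fix x :: "real^'m"
        show "norm ((cmod (F (x, y)))\<^sup>2 * vpow x \<nu>) \<le> cmod (of_real B * (F (x, y) * of_real (vpow x \<nu>)))"
        proof (cases "x \<in> pos_orthant")
          case True
          then have "cmod (F (x, y)) * (cmod (F (x, y)) * vpow x \<nu>) \<le> \<bar>B\<bar> * (cmod (F (x, y)) * vpow x \<nu>)"
            by (intro mult_right_mono order_trans[OF B abs_ge_self]) auto
          then show ?thesis by (simp add: power2_eq_square norm_mult abs_mult mult_ac)
        qed (simp add: s(3))
      qed
    qed measurable
  qed
  note sf = schwartz_section[OF f y \<nu>] and sT = schwartz_section[OF T y \<nu>]
  have sTc: "integrable lborel (\<lambda>x. cnj (?T (x, y)) * of_real (vpow x \<nu>))"
    using integrable_cnj[of lborel "\<lambda>x. ?T (x, y) * of_real (vpow x \<nu>)"] sT(4) by simp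
  have sTm: "(\<lambda>x. cnj (?T (x, y))) \<in> borel_measurable borel"
    by (rule borel_measurable_continuous_on[OF _ sT(5)]) (intro continuous_intros)
  have "of_real (\<integral>t. (cmod (?T (t, y)))\<^sup>2 * vpow t \<nu> \<partial>lborel) = (\<integral>t. complex_of_real ((cmod (?T (t, y)))\<^sup>2 * vpow t \<nu>) \<partial>lborel)"
    by (rule integral_complex_of_real[symmetric])
  also have "\<dots> = (\<integral>t. clifford_integral \<nu> a (\<lambda>x. f (x, y)) t * cnj (?T (t, y)) * of_real (vpow t \<nu>) \<partial>lborel)"
  proof (rule Bochner_Integration.integral_cong[OF refl])
    fix t :: "real^'m"
    have "complex_of_real ((cmod (?T (t, y)))\<^sup>2 * vpow t \<nu>) = ?T (t, y) * cnj (?T (t, y)) * of_real (vpow t \<nu>)"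
      by (simp only: of_real_mult complex_norm_square)
    then show "complex_of_real ((cmod (?T (t, y)))\<^sup>2 * vpow t \<nu>) = clifford_integral \<nu> a (\<lambda>x. f (x, y)) t * cnj (?T (t, y)) * of_real (vpow t \<nu>)"
      using y sT(3)[of t] by (cases "t \<in> pos_orthant") (simp_all add: clifford_transform_section)
  qed
  also have "\<dots> = (\<integral>x. f (x, y) * clifford_integral \<nu> a (\<lambda>x. cnj (?T (x, y))) x * of_real (vpow x \<nu>) \<partial>lborel)"
    by (rule clifford_integral_adjoint[OF \<nu> sf(3) _ sf(5) sTm sf(4) sTc]) (simp_all add: sT(3))
  also have "\<dots> = (\<integral>x. complex_of_real ((cmod (f (x, y)))\<^sup>2 * vpow x \<nu>) \<partial>lborel)"
  proof (rule Bochner_Integration.integral_cong[OF refl])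
    fix x :: "real^'m"
    show "f (x, y) * clifford_integral \<nu> a (\<lambda>x. cnj (?T (x, y))) x * of_real (vpow x \<nu>) = complex_of_real ((cmod (f (x, y)))\<^sup>2 * vpow x \<nu>)"
    proof (cases "x \<in> pos_orthant")
      case True
      have "clifford_integral \<nu> a (\<lambda>x. cnj (?T (x, y))) x = cnj (clifford_integral \<nu> a (\<lambda>x. ?T (x, y)) x)"
        using Bochner_Integration.integral_cnj[of lborel "\<lambda>v. ?T (v, y) * of_real (clifford_kernel \<nu> a v x * vpow v \<nu>)"]
        by (simp only: clifford_integral_def complex_cnj_mult complex_cnj_complex_of_real)
      also have "clifford_integral \<nu> a (\<lambda>x. ?T (x, y)) x = f (x, y)"
        unfolding clifford_transform_section[OF y True, symmetric] clifford_transform_involution[OF f \<nu> a] ..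
      finally show ?thesis by (simp only: of_real_mult complex_norm_square)
    qed (simp add: sf(3))
  qed
  also have "\<dots> = of_real (\<integral>x. (cmod (f (x, y)))\<^sup>2 * vpow x \<nu> \<partial>lborel)"
    by (rule integral_complex_of_real)
  finally have "(\<integral>t. (cmod (?T (t, y)))\<^sup>2 * vpow t \<nu> \<partial>lborel) = (\<integral>x. (cmod (f (x, y)))\<^sup>2 * vpow x \<nu> \<partial>lborel)"
    by (simp only: of_real_eq_iff)
  then show ?thesis using sq[OF T] sq[OF f] by (subst (1 2) nn_integral_eq_integral) auto
qed

section \<open>The space \<open>L2\<close>\<close>

lemma L2_measurable: "f \<in> L2 M \<Longrightarrow> f \<in> borel_measurable M"
  by (simp add: L2_def)

lemma L2_norm_nonneg [simp]: "0 \<le> L2_norm M f"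
  by (simp add: L2_norm_def)

lemma L2_norm_power2: "(L2_norm M f)\<^sup>2 = (\<integral>x. (cmod (f x))\<^sup>2 \<partial>M)"
  by (simp add: L2_norm_def)

lemma L2_iff: "f \<in> L2 M \<longleftrightarrow> f \<in> borel_measurable M \<and> (\<integral>\<^sup>+x. ennreal ((cmod (f x))\<^sup>2) \<partial>M) < \<infinity>"
  unfolding L2_def by (auto simp: integrable_iff_bounded)

lemma L2_nn_integral: "f \<in> L2 M \<Longrightarrow> (\<integral>\<^sup>+x. ennreal ((cmod (f x))\<^sup>2) \<partial>M) = ennreal ((L2_norm M f)\<^sup>2)"
  unfolding L2_norm_power2 by (rule nn_integral_eq_integral) (auto simp: L2_def)

lemma L2_norm_le_iff:
  assumes "f \<in> L2 M" "0 \<le> c"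
  shows "L2_norm M f \<le> c \<longleftrightarrow> (\<integral>\<^sup>+x. ennreal ((cmod (f x))\<^sup>2) \<partial>M) \<le> ennreal (c\<^sup>2)"
  unfolding L2_nn_integral[OF assms(1)] using assms(2) by (simp add: abs_le_square_iff[symmetric])

text \<open>
  With \<open>s\<close> chosen as the quotient of the two norms this yields the triangle inequality in \<open>L2\<close>.
\<close>

lemma norm_add_power2_le:
  fixes u v :: complex
  assumes "0 < s"
  shows "(cmod (u + v))\<^sup>2 \<le> (1 + s) * (cmod u)\<^sup>2 + (1 + 1 / s) * (cmod v)\<^sup>2"
proof -
  have "(cmod (u + v))\<^sup>2 \<le> (cmod u + cmod v)\<^sup>2" by (intro power_mono norm_triangle_ineq) simp
  also have "\<dots> = (cmod u)\<^sup>2 + (cmod v)\<^sup>2 + 2 * (cmod u * cmod v)" by (simp add: power2_sum)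
  also have "2 * (cmod u * cmod v) \<le> s * (cmod u)\<^sup>2 + (1 / s) * (cmod v)\<^sup>2"
  proof -
    have "0 \<le> (s * cmod u - cmod v)\<^sup>2 / s" using assms by simp
    also have "\<dots> = s * (cmod u)\<^sup>2 + (1 / s) * (cmod v)\<^sup>2 - 2 * (cmod u * cmod v)"
      using assms by (simp add: power2_diff power2_eq_square field_simps)
    finally show ?thesis by simp
  qed
  finally show ?thesis by (simp add: algebra_simps)
qed

lemma L2_add: assumes "f \<in> L2 M" "g \<in> L2 M" shows "(\<lambda>x. f x + g x) \<in> L2 M"
  unfolding L2_def
proof (intro CollectI conjI)
  have [measurable]: "f \<in> borel_measurable M" "g \<in> borel_measurable M" using assms by (auto dest: L2_measurable)
  show "(\<lambda>x. f x + g x) \<in> borel_measurable M" by measurable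
  have "integrable M (\<lambda>x. (1 + 1) * (cmod (f x))\<^sup>2 + (1 + 1 / 1) * (cmod (g x))\<^sup>2)"
    using assms by (intro Bochner_Integration.integrable_add integrable_mult_right) (auto simp: L2_def)
  then show "integrable M (\<lambda>x. (cmod (f x + g x))\<^sup>2)"
  proof (rule Bochner_Integration.integrable_bound)
    show "AE x in M. norm ((cmod (f x + g x))\<^sup>2) \<le> norm ((1 + 1) * (cmod (f x))\<^sup>2 + (1 + 1 / 1) * (cmod (g x))\<^sup>2)"
      using norm_add_power2_le[of 1 "f _" "g _"] by (intro AE_I2) simp
  qed measurable
qed

lemma L2_cmult: "f \<in> L2 M \<Longrightarrow> (\<lambda>x. c * f x) \<in> L2 M"
  unfolding L2_def by (auto simp: norm_mult power_mult_distrib)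

lemma L2_norm_cmult: "L2_norm M (\<lambda>x. c * f x) = cmod c * L2_norm M f"
  unfolding L2_norm_def by (simp add: norm_mult power_mult_distrib real_sqrt_mult)

lemma L2_linear: "f \<in> L2 M \<Longrightarrow> g \<in> L2 M \<Longrightarrow> (\<lambda>x. a * f x + b * g x) \<in> L2 M"
  by (intro L2_add L2_cmult)

lemma L2_diff: "f \<in> L2 M \<Longrightarrow> g \<in> L2 M \<Longrightarrow> (\<lambda>x. f x - g x) \<in> L2 M"
  using L2_linear[of f M g 1 "-1"] by simp

lemma L2_norm_triangle:
  assumes f: "f \<in> L2 M" and g: "g \<in> L2 M"
  shows "L2_norm M (\<lambda>x. f x + g x) \<le> L2_norm M f + L2_norm M g"
proof (rule field_le_epsilon)
  fix e :: real assume e: "0 < e"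
  define F where "F = L2_norm M f + e / 2"
  define G where "G = L2_norm M g + e / 2"
  have FG: "0 < F" "0 < G" "L2_norm M f \<le> F" "L2_norm M g \<le> G" using e by (auto simp: F_def G_def add_nonneg_pos)
  have if2: "integrable M (\<lambda>x. (cmod (f x))\<^sup>2)" and ig2: "integrable M (\<lambda>x. (cmod (g x))\<^sup>2)" using f g by (auto simp: L2_def)
  have "(L2_norm M (\<lambda>x. f x + g x))\<^sup>2 \<le> (\<integral>x. (1 + G / F) * (cmod (f x))\<^sup>2 + (1 + 1 / (G / F)) * (cmod (g x))\<^sup>2 \<partial>M)"
    unfolding L2_norm_power2
  proof (rule integral_mono)
    show "integrable M (\<lambda>x. (cmod (f x + g x))\<^sup>2)" using L2_add[OF f g] by (simp add: L2_def)
    show "(cmod (f x + g x))\<^sup>2 \<le> (1 + G / F) * (cmod (f x))\<^sup>2 + (1 + 1 / (G / F)) * (cmod (g x))\<^sup>2" for x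
      by (rule norm_add_power2_le) (use FG in simp)
  qed (intro Bochner_Integration.integrable_add integrable_mult_right if2 ig2)
  also have "\<dots> = (1 + G / F) * (L2_norm M f)\<^sup>2 + (1 + F / G) * (L2_norm M g)\<^sup>2"
    unfolding L2_norm_power2 using if2 ig2 by simp
  also have "\<dots> \<le> (1 + G / F) * F\<^sup>2 + (1 + F / G) * G\<^sup>2"
    using FG by (intro add_mono mult_left_mono power_mono) auto
  also have "\<dots> = (F + G)\<^sup>2" using FG by (simp add: power2_eq_square field_simps)
  finally have "L2_norm M (\<lambda>x. f x + g x) \<le> F + G" using FG by (simp add: abs_le_square_iff[symmetric])
  then show "L2_norm M (\<lambda>x. f x + g x) \<le> L2_norm M f + L2_norm M g + e" by (simp add: F_def G_def)
qed

lemma L2_norm_triangle_diff: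
  assumes "f \<in> L2 M" "g \<in> L2 M" "h \<in> L2 M"
  shows "L2_norm M (\<lambda>x. f x - h x) \<le> L2_norm M (\<lambda>x. f x - g x) + L2_norm M (\<lambda>x. g x - h x)"
  using L2_norm_triangle[OF L2_diff[OF assms(1,2)] L2_diff[OF assms(2,3)]] by simp

lemma L2_norm_minus_commute: "L2_norm M (\<lambda>x. f x - g x) = L2_norm M (\<lambda>x. g x - f x)"
  unfolding L2_norm_def by (simp add: norm_minus_commute)

lemma L2_norm_0_imp_AE:
  assumes "f \<in> L2 M" "L2_norm M f = 0" shows "AE x in M. f x = 0"
proof -
  have "(\<integral>x. (cmod (f x))\<^sup>2 \<partial>M) = 0" using assms(2) L2_norm_power2[of M f] by simp
  then have "AE x in M. (cmod (f x))\<^sup>2 = 0"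
    using assms(1) by (subst (asm) integral_nonneg_eq_0_iff_AE) (auto simp: L2_def)
  then show ?thesis by simp
qed

lemma L2_norm_cong_AE:
  assumes "AE x in M. f x = g x" "f \<in> borel_measurable M" "g \<in> borel_measurable M"
  shows "L2_norm M f = L2_norm M g"
proof -
  note [measurable] = assms(2,3)
  have "(\<integral>x. (cmod (f x))\<^sup>2 \<partial>M) = (\<integral>x. (cmod (g x))\<^sup>2 \<partial>M)"
    by (rule integral_cong_AE) (use assms(1) in auto)
  then show ?thesis by (simp add: L2_norm_def)
qed

text \<open>
  Completeness in the form of Riesz and Fischer. The series \<open>\<Sum>\<^sub>n 2\<^sup>n |f\<^sub>n\<^sub>+\<^sub>1 - f\<^sub>n|\<^sup>2\<close> has finite integral, so
  almost everywhere the increments decrease geometrically and \<open>f\<^sub>n\<close> converges; Fatou's lemma bounds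
  the distance to the limit.
\<close>

lemma L2_complete_fast:
  fixes f :: "nat \<Rightarrow> 'a \<Rightarrow> complex"
  assumes f: "\<And>n. f n \<in> L2 M" and fast: "\<And>n. L2_norm M (\<lambda>x. f (Suc n) x - f n x) \<le> (1 / 4) ^ n"
  shows "\<exists>g\<in>L2 M. \<forall>n. L2_norm M (\<lambda>x. g x - f n x) \<le> 2 * (1 / 4) ^ n"
proof -
  have fm [measurable]: "f n \<in> borel_measurable M" for n using f by (rule L2_measurable)
  define d where "d n = (\<lambda>x. f (Suc n) x - f n x)" for n
  have d: "d n \<in> L2 M" for n unfolding d_def by (intro L2_diff f)
  have dm [measurable]: "d n \<in> borel_measurable M" for n using d by (rule L2_measurable)
  have "(\<integral>\<^sup>+x. (\<Sum>n. ennreal (2 ^ n * (cmod (d n x))\<^sup>2)) \<partial>M) = (\<Sum>n. \<integral>\<^sup>+x. ennreal (2 ^ n * (cmod (d n x))\<^sup>2) \<partial>M)"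
    by (rule nn_integral_suminf) measurable
  also have "\<dots> \<le> (\<Sum>n. ennreal ((1 / 8) ^ n))"
  proof (rule suminf_le)
    fix n
    have "(\<integral>\<^sup>+x. ennreal (2 ^ n * (cmod (d n x))\<^sup>2) \<partial>M) = ennreal (2 ^ n) * (\<integral>\<^sup>+x. ennreal ((cmod (d n x))\<^sup>2) \<partial>M)"
      by (subst nn_integral_cmult[symmetric]) (auto simp: ennreal_mult)
    also have "\<dots> \<le> ennreal (2 ^ n) * ennreal (((1 / 4) ^ n)\<^sup>2)"
      unfolding L2_nn_integral[OF d] using fast[of n] by (intro mult_left_mono ennreal_leI power_mono) (auto simp: d_def)
    also have "\<dots> = ennreal (2 ^ n * ((1 / 4) ^ n)\<^sup>2)" by (simp add: ennreal_mult)
    also have "2 ^ n * ((1 / 4) ^ n)\<^sup>2 = (1 / 8 :: real) ^ n"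
    proof -
      have "((1 / 4 :: real) ^ n)\<^sup>2 = (1 / 16) ^ n" by (simp add: power2_eq_square flip: power_mult_distrib)
      then show ?thesis by (simp flip: power_mult_distrib)
    qed
    finally show "(\<integral>\<^sup>+x. ennreal (2 ^ n * (cmod (d n x))\<^sup>2) \<partial>M) \<le> ennreal ((1 / 8) ^ n)" .
  qed auto
  also have "\<dots> < \<infinity>"
    by (subst suminf_ennreal2) (auto intro!: summable_geometric)
  finally have "AE x in M. (\<Sum>n. ennreal (2 ^ n * (cmod (d n x))\<^sup>2)) \<noteq> \<infinity>"
    by (intro nn_integral_PInf_AE) auto
  then have conv: "AE x in M. convergent (\<lambda>n. f n x)"
  proof eventually_elim
    case (elim x)
    have s: "summable (\<lambda>n. 2 ^ n * (cmod (d n x))\<^sup>2)"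
      using elim by (intro summable_suminf_not_top) auto
    define B where "B = (\<Sum>n. 2 ^ n * (cmod (d n x))\<^sup>2)"
    have B0: "0 \<le> B" unfolding B_def by (intro suminf_nonneg s) auto
    have dB: "cmod (d n x) \<le> sqrt B * (1 / sqrt 2) ^ n" for n
    proof -
      have "2 ^ n * (cmod (d n x))\<^sup>2 \<le> B" unfolding B_def
        using sum_le_suminf[OF s, of "{n}"] by simp
      then have "(cmod (d n x))\<^sup>2 \<le> B / 2 ^ n" by (simp add: field_simps)
      then have "cmod (d n x) \<le> sqrt (B / 2 ^ n)" by (intro real_le_rsqrt)
      also have "\<dots> = sqrt B * (1 / sqrt 2) ^ n"
        by (simp add: real_sqrt_mult real_sqrt_inverse real_sqrt_power divide_inverse power_inverse)
      finally show ?thesis .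
    qed
    have "summable (\<lambda>n. sqrt B * (1 / sqrt 2) ^ n)"
      by (intro summable_mult summable_geometric) simp
    then have "summable (\<lambda>n. d n x)"
      by (rule summable_comparison_test'[where N=0]) (rule dB)
    then have "convergent (\<lambda>n. \<Sum>i<n. d i x)" by (simp add: summable_iff_convergent)
    moreover have "(\<Sum>i<n. d i x) = f n x - f 0 x" for n
      unfolding d_def by (rule sum_lessThan_telescope)
    ultimately have "convergent (\<lambda>n. (f n x - f 0 x) + f 0 x)"
      by (intro convergent_add convergent_const) simp
    then show ?case by simp
  qed
  define g where "g x = lim (\<lambda>n. f n x)" for x
  have gm [measurable]: "g \<in> borel_measurable M" unfolding g_def[abs_def] by measurable
  have tail: "L2_norm M (\<lambda>x. f (n + k) x - f n x) \<le> 2 * (1 / 4) ^ n - 2 * (1 / 4) ^ (n + k)" for n k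
  proof (induction k)
    case 0
    then show ?case by (simp add: L2_norm_def)
  next
    case (Suc k)
    have "L2_norm M (\<lambda>x. f (n + Suc k) x - f n x) \<le> L2_norm M (\<lambda>x. f (n + Suc k) x - f (n + k) x) + L2_norm M (\<lambda>x. f (n + k) x - f n x)"
      by (intro L2_norm_triangle_diff f)
    also have "\<dots> \<le> (1 / 4) ^ (n + k) + (2 * (1 / 4) ^ n - 2 * (1 / 4) ^ (n + k))"
      using fast[of "n + k"] Suc.IH by (intro add_mono) simp_all
    also have "\<dots> \<le> 2 * (1 / 4) ^ n - 2 * (1 / 4) ^ (n + Suc k)" by simp
    finally show ?case .
  qed
  have close: "(\<integral>\<^sup>+x. ennreal ((cmod (g x - f n x))\<^sup>2) \<partial>M) \<le> ennreal ((2 * (1 / 4) ^ n)\<^sup>2)" for n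
  proof -
    have "(\<integral>\<^sup>+x. ennreal ((cmod (g x - f n x))\<^sup>2) \<partial>M) = (\<integral>\<^sup>+x. liminf (\<lambda>k. ennreal ((cmod (f (n + k) x - f n x))\<^sup>2)) \<partial>M)"
    proof (rule nn_integral_cong_AE, use conv in eventually_elim)
      case (elim x)
      then have "(\<lambda>k. f k x) \<longlonglongrightarrow> g x" unfolding g_def by (simp add: convergent_LIMSEQ_iff)
      then have "(\<lambda>k. f (k + n) x) \<longlonglongrightarrow> g x" by (rule LIMSEQ_ignore_initial_segment)
      then have "(\<lambda>k. f (n + k) x) \<longlonglongrightarrow> g x" by (simp only: add.commute)
      then have "(\<lambda>k. ennreal ((cmod (f (n + k) x - f n x))\<^sup>2)) \<longlonglongrightarrow> ennreal ((cmod (g x - f n x))\<^sup>2)"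
        by (intro tendsto_ennrealI tendsto_intros)
      then show ?case using lim_imp_Liminf[OF trivial_limit_sequentially] by metis
    qed
    also have "\<dots> \<le> liminf (\<lambda>k. \<integral>\<^sup>+x. ennreal ((cmod (f (n + k) x - f n x))\<^sup>2) \<partial>M)"
      by (rule nn_integral_liminf) measurable
    also have "\<dots> \<le> liminf (\<lambda>k. ennreal ((2 * (1 / 4) ^ n)\<^sup>2))"
    proof (rule Liminf_mono, rule always_eventually, rule allI)
      fix k
      have "L2_norm M (\<lambda>x. f (n + k) x - f n x) \<le> 2 * (1 / 4) ^ n"
        using tail[of n k] by (rule order_trans) simp
      then show "(\<integral>\<^sup>+x. ennreal ((cmod (f (n + k) x - f n x))\<^sup>2) \<partial>M) \<le> ennreal ((2 * (1 / 4) ^ n)\<^sup>2)"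
        by (subst (asm) L2_norm_le_iff) (auto intro: L2_diff f)
    qed
    also have "\<dots> = ennreal ((2 * (1 / 4) ^ n)\<^sup>2)" by (simp add: Liminf_const)
    finally show ?thesis .
  qed
  have gf: "(\<lambda>x. g x - f n x) \<in> L2 M" for n
    unfolding L2_iff using close[of n] by (auto intro: le_less_trans)
  have "(\<lambda>x. (g x - f 0 x) + f 0 x) \<in> L2 M" by (intro L2_add gf f)
  then have "g \<in> L2 M" by simp
  moreover have "L2_norm M (\<lambda>x. g x - f n x) \<le> 2 * (1 / 4) ^ n" for n
    by (rule L2_norm_le_iff[OF gf, THEN iffD2, OF _ close]) simp
  ultimately show ?thesis by blast
qed

definition dense_isometry :: "'a measure \<Rightarrow> ('a \<Rightarrow> complex) set \<Rightarrow> (('a \<Rightarrow> complex) \<Rightarrow> 'a \<Rightarrow> complex) \<Rightarrow> bool" where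
  "dense_isometry M S F \<longleftrightarrow> S \<subseteq> L2 M \<and>
     (\<forall>f\<in>S. \<forall>g\<in>S. \<forall>a b. (\<lambda>x. a * f x + b * g x) \<in> S) \<and>
     (\<forall>f\<in>L2 M. \<forall>e>0. \<exists>\<phi>\<in>S. L2_norm M (\<lambda>x. f x - \<phi> x) < e) \<and>
     (\<forall>f\<in>S. F f \<in> S) \<and> complex_linear_on S F \<and> (\<forall>f\<in>S. L2_norm M (F f) = L2_norm M f)"

text \<open>
  The closure of the graph of \<open>F\<close>. Using a relation instead of a function makes the roles of an
  operator and of its inverse interchangeable.
\<close>

definition approx_image :: "'a measure \<Rightarrow> ('a \<Rightarrow> complex) set \<Rightarrow> (('a \<Rightarrow> complex) \<Rightarrow> 'a \<Rightarrow> complex) \<Rightarrow> ('a \<Rightarrow> complex) \<Rightarrow> ('a \<Rightarrow> complex) \<Rightarrow> bool" where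
  "approx_image M S F f h \<longleftrightarrow> f \<in> L2 M \<and> h \<in> L2 M \<and>
     (\<forall>e>0. \<exists>\<phi>\<in>S. L2_norm M (\<lambda>x. f x - \<phi> x) < e \<and> L2_norm M (\<lambda>x. h x - F \<phi> x) < e)"

lemma dense_isometryD:
  assumes "dense_isometry M S F"
  shows "f \<in> S \<Longrightarrow> f \<in> L2 M" "f \<in> S \<Longrightarrow> g \<in> S \<Longrightarrow> (\<lambda>x. a * f x + b * g x) \<in> S"
    "f \<in> L2 M \<Longrightarrow> 0 < e \<Longrightarrow> \<exists>\<phi>\<in>S. L2_norm M (\<lambda>x. f x - \<phi> x) < e"
    "f \<in> S \<Longrightarrow> F f \<in> S" "f \<in> S \<Longrightarrow> g \<in> S \<Longrightarrow> F (\<lambda>x. a * f x + b * g x) = (\<lambda>x. a * F f x + b * F g x)"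
    "f \<in> S \<Longrightarrow> L2_norm M (F f) = L2_norm M f"
  using assms unfolding dense_isometry_def complex_linear_on_def by blast+

lemma dense_isometry_dist:
  assumes "dense_isometry M S F" "f \<in> S" "g \<in> S"
  shows "L2_norm M (\<lambda>x. F f x - F g x) = L2_norm M (\<lambda>x. f x - g x)"
proof -
  note D = dense_isometryD[OF assms(1)]
  have "(\<lambda>x. F f x - F g x) = F (\<lambda>x. 1 * f x + (-1) * g x)" unfolding D(5)[OF assms(2,3)] by simp
  then show ?thesis using D(6)[OF D(2)[OF assms(2,3), of 1 "-1"]] by simp
qed

lemma approx_image_exists:
  assumes I: "dense_isometry M S F" and f: "f \<in> L2 M"
  shows "\<exists>h. approx_image M S F f h"
proof -
  note D = dense_isometryD[OF I]
  have "\<forall>n. \<exists>\<phi>\<in>S. L2_norm M (\<lambda>x. f x - \<phi> x) < (1 / 4) ^ n / 2"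
    by (intro allI D(3) f) simp
  then obtain \<phi> where \<phi>: "\<And>n. \<phi> n \<in> S" "\<And>n. L2_norm M (\<lambda>x. f x - \<phi> n x) < (1 / 4) ^ n / 2" by metis
  have \<phi>L: "\<phi> n \<in> L2 M" for n by (intro D(1) \<phi>(1))
  have FL: "F (\<phi> n) \<in> L2 M" for n by (intro D(1) D(4) \<phi>(1))
  have "L2_norm M (\<lambda>x. F (\<phi> (Suc n)) x - F (\<phi> n) x) \<le> (1 / 4) ^ n" for n
  proof -
    have "L2_norm M (\<lambda>x. F (\<phi> (Suc n)) x - F (\<phi> n) x) = L2_norm M (\<lambda>x. \<phi> (Suc n) x - \<phi> n x)"
      by (intro dense_isometry_dist[OF I] \<phi>(1))
    also have "\<dots> \<le> L2_norm M (\<lambda>x. \<phi> (Suc n) x - f x) + L2_norm M (\<lambda>x. f x - \<phi> n x)"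
      by (intro L2_norm_triangle_diff \<phi>L f)
    also have "\<dots> \<le> (1 / 4) ^ Suc n / 2 + (1 / 4) ^ n / 2"
      using \<phi>(2)[of "Suc n"] \<phi>(2)[of n] by (subst L2_norm_minus_commute) simp
    also have "\<dots> \<le> (1 / 4) ^ n" by simp
    finally show ?thesis .
  qed
  from L2_complete_fast[where f="\<lambda>n. F (\<phi> n)", OF FL this] obtain h
    where h: "h \<in> L2 M" "\<And>n. L2_norm M (\<lambda>x. h x - F (\<phi> n) x) \<le> 2 * (1 / 4) ^ n" by blast
  have "\<exists>\<psi>\<in>S. L2_norm M (\<lambda>x. f x - \<psi> x) < e \<and> L2_norm M (\<lambda>x. h x - F \<psi> x) < e" if e: "0 < e" for e
  proof -
    obtain n where n: "(1 / 4 :: real) ^ n < e / 2" using real_arch_pow_inv[of "e / 2" "1 / 4"] e by auto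
    have "0 < (1 / 4 :: real) ^ n" by simp
    then show ?thesis using n \<phi>(2)[of n] h(2)[of n] by (intro bexI[OF _ \<phi>(1)[of n]] conjI) linarith+
  qed
  then show ?thesis using f h(1) unfolding approx_image_def by blast
qed

lemma approx_image_linear:
  assumes I: "dense_isometry M S F" and 1: "approx_image M S F f h" and 2: "approx_image M S F g k"
  shows "approx_image M S F (\<lambda>x. a * f x + b * g x) (\<lambda>x. a * h x + b * k x)"
  unfolding approx_image_def
proof (intro conjI allI impI)
  note D = dense_isometryD[OF I]
  have L: "f \<in> L2 M" "h \<in> L2 M" "g \<in> L2 M" "k \<in> L2 M" using 1 2 by (auto simp: approx_image_def)
  show "(\<lambda>x. a * f x + b * g x) \<in> L2 M" "(\<lambda>x. a * h x + b * k x) \<in> L2 M" by (intro L2_linear L)+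
  fix e :: real assume e: "0 < e"
  define r where "r = e / (cmod a + cmod b + 1)"
  have pos: "0 < cmod a + cmod b + 1" by (simp add: add_nonneg_pos)
  have r: "0 < r" unfolding r_def using e pos by simp
  have rb: "cmod a * r + cmod b * r < e"
  proof -
    have "cmod a * r + cmod b * r < (cmod a + cmod b + 1) * r" using r by (simp add: algebra_simps)
    also have "\<dots> = e" using pos by (simp add: r_def)
    finally show ?thesis .
  qed
  obtain \<phi> where \<phi>: "\<phi> \<in> S" "L2_norm M (\<lambda>x. f x - \<phi> x) < r" "L2_norm M (\<lambda>x. h x - F \<phi> x) < r"
    using 1 r unfolding approx_image_def by blast
  obtain \<psi> where \<psi>: "\<psi> \<in> S" "L2_norm M (\<lambda>x. g x - \<psi> x) < r" "L2_norm M (\<lambda>x. k x - F \<psi> x) < r"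
    using 2 r unfolding approx_image_def by blast
  have est: "L2_norm M (\<lambda>x. (a * u x + b * v x) - (a * u' x + b * v' x)) < e"
    if "L2_norm M (\<lambda>x. u x - u' x) < r" "L2_norm M (\<lambda>x. v x - v' x) < r"
      "u \<in> L2 M" "u' \<in> L2 M" "v \<in> L2 M" "v' \<in> L2 M" for u u' v v'
  proof -
    have "L2_norm M (\<lambda>x. (a * u x + b * v x) - (a * u' x + b * v' x)) = L2_norm M (\<lambda>x. a * (u x - u' x) + b * (v x - v' x))"
      by (simp add: algebra_simps)
    also have "\<dots> \<le> L2_norm M (\<lambda>x. a * (u x - u' x)) + L2_norm M (\<lambda>x. b * (v x - v' x))"
      by (intro L2_norm_triangle L2_cmult L2_diff that)
    also have "\<dots> \<le> cmod a * r + cmod b * r"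
      unfolding L2_norm_cmult using that by (intro add_mono mult_left_mono) auto
    also note rb
    finally show ?thesis .
  qed
  show "\<exists>\<theta>\<in>S. L2_norm M (\<lambda>x. (a * f x + b * g x) - \<theta> x) < e \<and> L2_norm M (\<lambda>x. (a * h x + b * k x) - F \<theta> x) < e"
  proof (intro bexI[of _ "\<lambda>x. a * \<phi> x + b * \<psi> x"] conjI)
    show "(\<lambda>x. a * \<phi> x + b * \<psi> x) \<in> S" by (intro D(2) \<phi>(1) \<psi>(1))
    show "L2_norm M (\<lambda>x. (a * f x + b * g x) - (a * \<phi> x + b * \<psi> x)) < e"
      by (intro est \<phi>(2) \<psi>(2) L D(1) \<phi>(1) \<psi>(1))
    show "L2_norm M (\<lambda>x. (a * h x + b * k x) - F (\<lambda>x. a * \<phi> x + b * \<psi> x) x) < e"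
      unfolding D(5)[OF \<phi>(1) \<psi>(1)] by (intro est \<phi>(3) \<psi>(3) L D(1) D(4) \<phi>(1) \<psi>(1))
  qed
qed

lemma approx_image_norm:
  assumes I: "dense_isometry M S F" and a: "approx_image M S F f h"
  shows "L2_norm M h = L2_norm M f"
proof -
  note D = dense_isometryD[OF I]
  have L: "f \<in> L2 M" "h \<in> L2 M" using a by (auto simp: approx_image_def)
  have le: "L2_norm M u \<le> L2_norm M (\<lambda>x. u x - v x) + L2_norm M v" if "u \<in> L2 M" "v \<in> L2 M" for u v
    using L2_norm_triangle[OF L2_diff[OF that] that(2)] by simp
  have "L2_norm M h \<le> L2_norm M f + e \<and> L2_norm M f \<le> L2_norm M h + e" if e: "0 < e" for e
  proof -
    from e a obtain \<phi> where \<phi>: "\<phi> \<in> S" "L2_norm M (\<lambda>x. f x - \<phi> x) < e / 2" "L2_norm M (\<lambda>x. h x - F \<phi> x) < e / 2"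
      unfolding approx_image_def by (meson half_gt_zero)
    have "\<phi> \<in> L2 M" "F \<phi> \<in> L2 M" by (auto intro: D(1) D(4) \<phi>(1))
    then show ?thesis
      using \<phi>(2,3) D(6)[OF \<phi>(1)] le[of h "F \<phi>"] le[of "F \<phi>" h] le[of f \<phi>] le[of \<phi> f] L
        L2_norm_minus_commute[of M f \<phi>] L2_norm_minus_commute[of M h "F \<phi>"] by linarith
  qed
  then have "L2_norm M h \<le> L2_norm M f" "L2_norm M f \<le> L2_norm M h" by (auto intro: field_le_epsilon)
  then show ?thesis by simp
qed

lemma approx_image_unique:
  assumes I: "dense_isometry M S F" and 1: "approx_image M S F f h" and 2: "approx_image M S F g k"
    and fg: "AE x in M. f x = g x"
  shows "AE x in M. h x = k x"
proof -
  have L: "f \<in> L2 M" "h \<in> L2 M" "g \<in> L2 M" "k \<in> L2 M" using 1 2 by (auto simp: approx_image_def)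
  have "L2_norm M (\<lambda>x. 1 * h x + (-1) * k x) = L2_norm M (\<lambda>x. 1 * f x + (-1) * g x)"
    by (intro approx_image_norm[OF I] approx_image_linear[OF I] 1 2)
  also have "\<dots> = L2_norm M (\<lambda>x. 0)"
  proof (rule L2_norm_cong_AE)
    show "(\<lambda>x. 1 * f x + (-1) * g x) \<in> borel_measurable M" by (intro L2_measurable L2_linear L)
  qed (use fg in auto)
  also have "\<dots> = 0" by (simp add: L2_norm_def)
  finally have "AE x in M. 1 * h x + (-1) * k x = 0" by (intro L2_norm_0_imp_AE L2_linear L)
  then show ?thesis by simp
qed

lemma approx_image_converse:
  assumes I: "dense_isometry M S F" and GF: "\<And>f. f \<in> S \<Longrightarrow> G (F f) = f" and a: "approx_image M S F f h"
  shows "approx_image M S G h f"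
  unfolding approx_image_def
proof (intro conjI allI impI)
  show "h \<in> L2 M" "f \<in> L2 M" using a by (auto simp: approx_image_def)
  fix e :: real assume "0 < e"
  with a obtain \<phi> where "\<phi> \<in> S" "L2_norm M (\<lambda>x. f x - \<phi> x) < e" "L2_norm M (\<lambda>x. h x - F \<phi> x) < e"
    unfolding approx_image_def by blast
  then show "\<exists>\<phi>\<in>S. L2_norm M (\<lambda>x. h x - \<phi> x) < e \<and> L2_norm M (\<lambda>x. f x - G \<phi> x) < e"
    using dense_isometryD(4)[OF I] GF by (intro bexI[of _ "F \<phi>"]) auto
qed

lemma approx_image_self:
  assumes I: "dense_isometry M S F" and f: "f \<in> S"
  shows "approx_image M S F f (F f)"
proof -
  note D = dense_isometryD[OF I]
  have "L2_norm M (\<lambda>x. u x - u x) = 0" for u by (simp add: L2_norm_def)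
  then show ?thesis using f D(1) D(4) unfolding approx_image_def by (metis)
qed

text \<open>
  The closures of the graphs of \<open>F\<close> and of its inverse \<open>G\<close> are converse to each other, are
  functional up to null sets, and have the whole space as domain. Any choice of representatives
  is therefore an isometry with the stated inverse.
\<close>

theorem dense_isometry_extension:
  assumes F: "dense_isometry M S F" and G: "dense_isometry M S G"
    and GF: "\<And>f. f \<in> S \<Longrightarrow> G (F f) = f" and FG: "\<And>f. f \<in> S \<Longrightarrow> F (G f) = f"
  shows "\<exists>U V. L2_isometry_onto M U \<and> L2_extends M S F U \<and> L2_isometry_onto M V \<and> L2_extends M S G V \<and> L2_inverse M U V"
proof -
  define ext where "ext F f = (SOME h. approx_image M S F f h)" for F f
  have ext: "approx_image M S F f (ext F f)" if "dense_isometry M S F" "f \<in> L2 M" for F f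
    unfolding ext_def using approx_image_exists[OF that] by (rule someI_ex)
  have extL: "ext F f \<in> L2 M" if "dense_isometry M S F" "f \<in> L2 M" for F f
    using ext[OF that] by (simp add: approx_image_def)
  have inv: "AE x in M. ext G (ext F f) x = f x"
    if F: "dense_isometry M S F" and G: "dense_isometry M S G" and GF: "\<And>f. f \<in> S \<Longrightarrow> G (F f) = f" and f: "f \<in> L2 M" for F G f
    by (rule approx_image_unique[OF G ext[OF G extL[OF F f]] approx_image_converse[OF F GF ext[OF F f]]]) auto
  have onto: "L2_isometry_onto M (ext F)"
    if F: "dense_isometry M S F" and G: "dense_isometry M S G" and FG: "\<And>f. f \<in> S \<Longrightarrow> F (G f) = f" for F G
    unfolding L2_isometry_onto_def
  proof (intro conjI ballI allI)
    fix f g :: "'a \<Rightarrow> complex" and a b :: complex assume f: "f \<in> L2 M" and g: "g \<in> L2 M"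
    show "AE x in M. ext F (\<lambda>y. a * f y + b * g y) x = a * ext F f x + b * ext F g x"
      by (rule approx_image_unique[OF F ext[OF F L2_linear[OF f g]] approx_image_linear[OF F ext[OF F f] ext[OF F g]]]) simp
    show "L2_norm M (\<lambda>x. ext F f x - ext F g x) = L2_norm M (\<lambda>x. f x - g x)"
      using approx_image_norm[OF F approx_image_linear[OF F ext[OF F f] ext[OF F g], of 1 "-1"]] by simp
  next
    fix g assume g: "g \<in> L2 M"
    then show "\<exists>f\<in>L2 M. AE x in M. ext F f x = g x"
      using extL[OF G g] inv[OF G F FG g] by blast
  qed (rule extL[OF F])
  have extends: "L2_extends M S F (ext F)" if F: "dense_isometry M S F" for F
    unfolding L2_extends_def
  proof (intro conjI ballI)
    show "S \<subseteq> L2 M" using dense_isometryD(1)[OF F] by blast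
    fix f assume f: "f \<in> S"
    show "AE x in M. ext F f x = F f x"
      by (rule approx_image_unique[OF F ext[OF F dense_isometryD(1)[OF F f]] approx_image_self[OF F f]]) simp
  qed
  show ?thesis
    by (intro exI[of _ "ext F"] exI[of _ "ext G"] conjI onto[OF F G FG] onto[OF G F GF] extends F G)
      (use inv[OF F G GF] inv[OF G F FG] in \<open>auto simp: L2_inverse_def\<close>)
qed

section \<open>Integrals over the orthant\<close>

lemma nn_integral_product_lborel:
  fixes g :: "(real ^ 'm) \<times> (real ^ 'n) \<Rightarrow> ennreal"
  assumes g: "g \<in> borel_measurable borel"
  shows "(\<integral>\<^sup>+p. g p \<partial>lborel) = (\<integral>\<^sup>+y. (\<integral>\<^sup>+x. g (x, y) \<partial>lborel) \<partial>lborel)"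
proof -
  have "g \<in> borel_measurable (lborel \<Otimes>\<^sub>M lborel)"
    using g unfolding lborel_prod by simp
  then show ?thesis
    using lborel_pair.nn_integral_snd[of g] by (simp add: lborel_prod)
qed

lemma measurable_fst_snd_weight [measurable]:
  "(\<lambda>x :: (real ^ 'm) \<times> (real ^ 'n). vpow (fst x) \<alpha>) \<in> borel_measurable borel"
  "(\<lambda>x :: (real ^ 'm) \<times> (real ^ 'n). vpow (snd x) \<beta>) \<in> borel_measurable borel"
  by (rule measurable_compose[OF _ measurable_vpow], intro borel_measurable_continuous_onI continuous_intros)+

text \<open>
  The formula holds for each fixed \<open>x''\<close>, so any weight in \<open>x''\<close> can be integrated against it.
\<close>

lemma clifford_transform_parseval:
  fixes f :: "(real ^ 'm) \<times> (real ^ 'n) \<Rightarrow> complex"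
  assumes f: "f \<in> schwartz" and \<nu>: "\<forall>l. 0 \<le> \<nu> $ l" and a: "\<forall>l. 0 < a $ l"
  shows "(\<integral>\<^sup>+x. ennreal ((cmod (clifford_transform \<nu> a f x))\<^sup>2 * (vpow (fst x) \<nu> * vpow (snd x) \<beta>)) \<partial>lborel) =
         (\<integral>\<^sup>+x. ennreal ((cmod (f x))\<^sup>2 * (vpow (fst x) \<nu> * vpow (snd x) \<beta>)) \<partial>lborel)"
proof -
  let ?w = "\<lambda>g x. ennreal ((cmod (g x))\<^sup>2 * (vpow (fst x) \<nu> * vpow (snd x) \<beta>))"
  have T: "clifford_transform \<nu> a f \<in> schwartz" by (rule clifford_transform_schwartz[OF f \<nu> a])
  have split: "(\<integral>\<^sup>+x. ?w g x \<partial>lborel) = (\<integral>\<^sup>+y. ennreal (vpow y \<beta>) * (\<integral>\<^sup>+x. ennreal ((cmod (g (x, y)))\<^sup>2 * vpow x \<nu>) \<partial>lborel) \<partial>lborel)"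
    if g: "g \<in> schwartz" for g :: "(real ^ 'm) \<times> (real ^ 'n) \<Rightarrow> complex"
  proof -
    note [measurable] = schwartz_measurable[OF g]
    have "(\<integral>\<^sup>+x. ?w g x \<partial>lborel) = (\<integral>\<^sup>+y. (\<integral>\<^sup>+x. ?w g (x, y) \<partial>lborel) \<partial>lborel)"
      by (rule nn_integral_product_lborel) measurable
    also have "\<dots> = (\<integral>\<^sup>+y. ennreal (vpow y \<beta>) * (\<integral>\<^sup>+x. ennreal ((cmod (g (x, y)))\<^sup>2 * vpow x \<nu>) \<partial>lborel) \<partial>lborel)"
    proof (rule nn_integral_cong)
      fix y :: "real ^ 'n"
      have [measurable]: "(\<lambda>x. g (x, y)) \<in> borel_measurable borel" by (intro measurable_section schwartz_measurable g)
      have "(\<integral>\<^sup>+x. ?w g (x, y) \<partial>lborel) = (\<integral>\<^sup>+x. ennreal (vpow y \<beta>) * ennreal ((cmod (g (x, y)))\<^sup>2 * vpow x \<nu>) \<partial>lborel)"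
        by (intro nn_integral_cong) (simp add: ennreal_mult[symmetric] mult_ac)
      also have "\<dots> = ennreal (vpow y \<beta>) * (\<integral>\<^sup>+x. ennreal ((cmod (g (x, y)))\<^sup>2 * vpow x \<nu>) \<partial>lborel)"
        by (rule nn_integral_cmult) measurable
      finally show "(\<integral>\<^sup>+x. ?w g (x, y) \<partial>lborel) = ennreal (vpow y \<beta>) * (\<integral>\<^sup>+x. ennreal ((cmod (g (x, y)))\<^sup>2 * vpow x \<nu>) \<partial>lborel)" .
    qed
    finally show ?thesis .
  qed
  show ?thesis unfolding split[OF T] split[OF f]
  proof (rule nn_integral_cong)
    fix y :: "real ^ 'n"
    show "ennreal (vpow y \<beta>) * (\<integral>\<^sup>+x. ennreal ((cmod (clifford_transform \<nu> a f (x, y)))\<^sup>2 * vpow x \<nu>) \<partial>lborel) =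
        ennreal (vpow y \<beta>) * (\<integral>\<^sup>+x. ennreal ((cmod (f (x, y)))\<^sup>2 * vpow x \<nu>) \<partial>lborel)"
    proof (cases "y \<in> pos_orthant")
      case True
      show ?thesis by (simp only: clifford_transform_parseval_section[OF f \<nu> a True])
    next
      case False
      then have "clifford_transform \<nu> a f (x, y) = 0" "f (x, y) = 0" for x
        by (auto intro!: schwartz_outside[OF f] schwartz_outside[OF T])
      then show ?thesis by simp
    qed
  qed
qed

lemma schwartz_square_weighted_finite:
  fixes f :: "(real ^ 'm) \<times> (real ^ 'n) \<Rightarrow> complex"
  assumes f: "f \<in> schwartz" and \<alpha>: "\<forall>l. 0 \<le> \<alpha> $ l" and \<beta>: "\<forall>l. 0 \<le> \<beta> $ l"
  shows "(\<integral>\<^sup>+x. ennreal ((cmod (f x))\<^sup>2 * (vpow (fst x) \<alpha> * vpow (snd x) \<beta>)) \<partial>lborel) < \<infinity>"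
proof -
  obtain C where C: "0 \<le> C" "\<And>x. x \<in> orthant2 \<Longrightarrow> vpow (fst x) \<alpha> * vpow (snd x) \<beta> * cmod (f x) \<le> C * (decay_weight (fst x) * decay_weight (snd x))"
    using schwartz_envelope2[OF f \<alpha> \<beta>] by blast
  obtain B where B: "\<And>x. x \<in> orthant2 \<Longrightarrow> cmod (f x) \<le> B" using schwartz_decay[OF f, of 0] by auto
  have le: "(cmod (f x))\<^sup>2 * (vpow (fst x) \<alpha> * vpow (snd x) \<beta>) \<le> \<bar>B\<bar> * C * (decay_weight (fst x) * decay_weight (snd x))" for x
  proof (cases "x \<in> orthant2")
    case True
    have "(cmod (f x))\<^sup>2 * (vpow (fst x) \<alpha> * vpow (snd x) \<beta>) = cmod (f x) * (vpow (fst x) \<alpha> * vpow (snd x) \<beta> * cmod (f x))"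
      by (simp add: power2_eq_square)
    also have "\<dots> \<le> \<bar>B\<bar> * (C * (decay_weight (fst x) * decay_weight (snd x)))"
      by (rule mult_mono) (use C(2)[OF True] B[OF True] in \<open>auto\<close>)
    finally show ?thesis by (simp only: mult.assoc)
  next
    case False
    then show ?thesis using schwartz_outside[OF f False] C(1) by simp
  qed
  have dec: "(\<integral>\<^sup>+x. ennreal (decay_weight x) \<partial>(lborel :: (real ^ 'm) measure)) < \<infinity>"
    using integrable_decay_weight by (simp add: integrable_iff_bounded)
  have dec': "(\<integral>\<^sup>+x. ennreal (decay_weight x) \<partial>(lborel :: (real ^ 'n) measure)) < \<infinity>"
    using integrable_decay_weight by (simp add: integrable_iff_bounded)
  have dm [measurable]: "(\<lambda>x :: (real ^ 'm) \<times> (real ^ 'n). decay_weight (fst x)) \<in> borel_measurable borel"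
    "(\<lambda>x :: (real ^ 'm) \<times> (real ^ 'n). decay_weight (snd x)) \<in> borel_measurable borel"
    by (rule measurable_compose[OF _ measurable_decay_weight], intro borel_measurable_continuous_onI continuous_intros)+
  have "(\<integral>\<^sup>+x. ennreal ((cmod (f x))\<^sup>2 * (vpow (fst x) \<alpha> * vpow (snd x) \<beta>)) \<partial>lborel) \<le>
     (\<integral>\<^sup>+x. ennreal (\<bar>B\<bar> * C * (decay_weight (fst x) * decay_weight (snd x))) \<partial>(lborel :: ((real ^ 'm) \<times> (real ^ 'n)) measure))"
    by (intro nn_integral_mono ennreal_leI le)
  also have "\<dots> = (\<integral>\<^sup>+y. (\<integral>\<^sup>+x. ennreal (\<bar>B\<bar> * C * (decay_weight (x :: real ^ 'm) * decay_weight (y :: real ^ 'n))) \<partial>lborel) \<partial>lborel)"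
    by (subst nn_integral_product_lborel) auto
  also have "\<dots> = (\<integral>\<^sup>+y. (\<integral>\<^sup>+x. (ennreal (\<bar>B\<bar> * C) * ennreal (decay_weight (y :: real ^ 'n))) * ennreal (decay_weight (x :: real ^ 'm)) \<partial>lborel) \<partial>lborel)"
    using C(1) by (intro nn_integral_cong) (simp add: ennreal_mult[symmetric] mult_ac)
  also have "\<dots> = (\<integral>\<^sup>+y. ennreal (\<bar>B\<bar> * C) * ennreal (decay_weight (y :: real ^ 'n)) * (\<integral>\<^sup>+x. ennreal (decay_weight (x :: real ^ 'm)) \<partial>lborel) \<partial>lborel)"
    by (intro nn_integral_cong nn_integral_cmult) auto
  also have "\<dots> = ennreal (\<bar>B\<bar> * C) * (\<integral>\<^sup>+y. ennreal (decay_weight (y :: real ^ 'n)) \<partial>lborel) * (\<integral>\<^sup>+x. ennreal (decay_weight (x :: real ^ 'm)) \<partial>lborel)"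
    by (simp add: nn_integral_multc nn_integral_cmult)
  also have "\<dots> < \<infinity>" using dec dec' by (simp add: ennreal_mult_less_top)
  finally show ?thesis .
qed

lemma nn_integral_orthant_measure:
  fixes g :: "(real ^ 'm) \<times> (real ^ 'n) \<Rightarrow> ennreal"
  shows "(\<integral>\<^sup>+x. g x \<partial>orthant_measure) = (\<integral>\<^sup>+x. g x * indicator orthant2 x \<partial>lborel)"
  unfolding orthant_measure_def by (rule nn_integral_restrict_space) (simp add: sets_orthant2)

lemma borel_measurable_orthant_measure:
  "f \<in> borel_measurable borel \<Longrightarrow> f \<in> borel_measurable orthant_measure"
  unfolding orthant_measure_def by (intro measurable_restrict_space1) simp

lemma borel_measurable_weighted_measure:
  "f \<in> borel_measurable (weighted_measure \<gamma>' \<gamma>'') \<longleftrightarrow> f \<in> borel_measurable orthant_measure"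
  unfolding weighted_measure_def by simp

lemma nn_integral_weighted_measure:
  fixes g :: "(real ^ 'm) \<times> (real ^ 'n) \<Rightarrow> complex"
  assumes "g \<in> borel_measurable orthant_measure"
  shows "(\<integral>\<^sup>+x. ennreal ((cmod (g x))\<^sup>2) \<partial>weighted_measure \<gamma>' \<gamma>'') =
    (\<integral>\<^sup>+x. ennreal ((cmod (g x))\<^sup>2 * (vpow (fst x) \<gamma>' * vpow (snd x) \<gamma>'')) * indicator orthant2 x \<partial>lborel)"
proof -
  note [measurable] = assms borel_measurable_orthant_measure[OF measurable_fst_snd_weight(1)] borel_measurable_orthant_measure[OF measurable_fst_snd_weight(2)]
  have "(\<integral>\<^sup>+x. ennreal ((cmod (g x))\<^sup>2) \<partial>weighted_measure \<gamma>' \<gamma>'') =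
     (\<integral>\<^sup>+x. ennreal (vpow (fst x) \<gamma>' * vpow (snd x) \<gamma>'') * ennreal ((cmod (g x))\<^sup>2) \<partial>orthant_measure)"
    unfolding weighted_measure_def by (rule nn_integral_density) measurable
  also have "\<dots> = (\<integral>\<^sup>+x. ennreal ((cmod (g x))\<^sup>2 * (vpow (fst x) \<gamma>' * vpow (snd x) \<gamma>'')) \<partial>orthant_measure)"
    by (intro nn_integral_cong) (simp add: ennreal_mult[symmetric] mult.commute)
  finally show ?thesis unfolding nn_integral_orthant_measure .
qed

lemma nn_integral_weighted_schwartz:
  assumes "g \<in> schwartz"
  shows "(\<integral>\<^sup>+x. ennreal ((cmod (g x))\<^sup>2) \<partial>weighted_measure \<gamma>' \<gamma>'') =
    (\<integral>\<^sup>+x. ennreal ((cmod (g x))\<^sup>2 * (vpow (fst x) \<gamma>' * vpow (snd x) \<gamma>'')) \<partial>lborel)"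
  unfolding nn_integral_weighted_measure[OF borel_measurable_orthant_measure[OF schwartz_measurable[OF assms]]]
  using schwartz_outside[OF assms] by (intro nn_integral_cong) (auto simp: indicator_def)

lemma schwartz_L2_weighted:
  assumes f: "f \<in> schwartz" and "\<forall>l. 0 \<le> \<gamma>' $ l" "\<forall>l. 0 \<le> \<gamma>'' $ l"
  shows "f \<in> L2 (weighted_measure \<gamma>' \<gamma>'')"
  unfolding L2_iff borel_measurable_weighted_measure nn_integral_weighted_schwartz[OF f]
  by (intro conjI borel_measurable_orthant_measure schwartz_measurable schwartz_square_weighted_finite assms)

section \<open>Exponential sums are dense\<close>

text \<open>
  A single term of the exponential series is at most its sum.
\<close>

lemma power_mult_exp_minus_le:
  fixes u s :: real
  assumes "0 \<le> u" "0 < s"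
  shows "u ^ k * exp (- (s * u)) \<le> fact k / s ^ k"
proof -
  have "(s * u) ^ k /\<^sub>R fact k \<le> exp (s * u)"
    unfolding exp_def using assms sum_le_suminf[OF summable_exp_generic[of "s * u"], of "{k}"] by simp
  then have "u ^ k * s ^ k \<le> fact k * exp (s * u)"
    by (simp add: power_mult_distrib divide_simps mult_ac)
  then have "u ^ k * s ^ k * exp (- (s * u)) \<le> fact k * exp (s * u) * exp (- (s * u))"
    by (rule mult_right_mono) simp
  also have "\<dots> = fact k" by (simp add: exp_minus)
  finally show ?thesis using assms by (simp add: pos_le_divide_eq mult_ac)
qed

lemma inner_eq_sum_coord: "s \<bullet> x = (\<Sum>c\<in>UNIV. coord c s * coord c x)"
  for s x :: "(real ^ 'm) \<times> (real ^ 'n)"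
proof -
  have "(\<Sum>c\<in>UNIV. coord c s * coord c x) = (\<Sum>i\<in>UNIV. coord (Inl i) s * coord (Inl i) x) + (\<Sum>j\<in>UNIV. coord (Inr j) s * coord (Inr j) x)"
    using sum.Plus[of "UNIV::'m set" "UNIV::'n set" "\<lambda>c. coord c s * coord c x"] by (simp add: UNIV_Plus_UNIV o_def)
  then show ?thesis by (cases s, cases x) (simp add: inner_Pair inner_vec_def)
qed

lemma mpow_eq_prod_coord: "mpow x k = (\<Prod>c\<in>UNIV. coord c x ^ (case c of Inl i \<Rightarrow> fst k $ i | Inr j \<Rightarrow> snd k $ j))"
  unfolding prod_UNIV_sum mpow_def by simp

lemma eorthant_prod: "(eorthant :: ((real ^ 'm) \<times> (real ^ 'n)) set) = orthant2"
proof (rule set_eqI)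
  fix p :: "(real ^ 'm) \<times> (real ^ 'n)"
  show "p \<in> eorthant \<longleftrightarrow> p \<in> orthant2"
    by (cases p) (simp add: eorthant_def Basis_prod_def Basis_vec_eq ball_Un inner_axis pos_orthant_def)
qed

definition cut_exp2 :: "(real ^ 'm) \<times> (real ^ 'n) \<Rightarrow> (real ^ 'm) \<times> (real ^ 'n) \<Rightarrow> complex" where
  "cut_exp2 s x = (if x \<in> orthant2 then of_real (exp (- (s \<bullet> x))) else 0)"

text \<open>
  The multiples of one exponential form a class that is closed under differentiation.
\<close>

lemma cut_exp2_schwartz:
  fixes s :: "(real ^ 'm) \<times> (real ^ 'n)"
  assumes s: "s \<in> orthant2"
  shows "cut_exp2 s \<in> schwartz"
proof (rule schwartz_coinduct[where S="range (\<lambda>b x. b * cut_exp2 s x)"])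
  show "cut_exp2 s \<in> range (\<lambda>b x. b * cut_exp2 s x)" by (rule image_eqI[of _ _ 1]) auto
next
  fix g assume "g \<in> range (\<lambda>b x. b * cut_exp2 s x)"
  then obtain b where g: "g = (\<lambda>x. b * cut_exp2 s x)" by blast
  show "g x = 0" if "x \<notin> orthant2" for x unfolding g cut_exp2_def using that by (simp only: if_False mult_zero_right)
  show "\<exists>h\<in>range (\<lambda>b x. b * cut_exp2 s x). \<forall>x\<in>orthant2. ((\<lambda>r. g (x + r *\<^sub>R coord_dir c)) has_vector_derivative h x) (at 0)" for c
  proof (intro bexI[of _ "\<lambda>x. (b * - of_real (s \<bullet> coord_dir c)) * cut_exp2 s x"] ballI)
    fix x :: "(real ^ 'm) \<times> (real ^ 'n)" assume x: "x \<in> orthant2"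
    have "((\<lambda>r. exp (- (s \<bullet> (x + r *\<^sub>R coord_dir c)))) has_real_derivative - (s \<bullet> coord_dir c) * exp (- (s \<bullet> x))) (at 0)"
      by (auto intro!: derivative_eq_intros simp: inner_add_right)
    then have "((\<lambda>r. complex_of_real (exp (- (s \<bullet> (x + r *\<^sub>R coord_dir c))))) has_vector_derivative of_real (- (s \<bullet> coord_dir c) * exp (- (s \<bullet> x)))) (at 0)"
      by (intro has_vector_derivative_of_real) (simp add: has_real_derivative_iff_has_vector_derivative)
    from has_vector_derivative_mult_right[OF this, of b]
    have d: "((\<lambda>r. b * complex_of_real (exp (- (s \<bullet> (x + r *\<^sub>R coord_dir c))))) has_vector_derivative (b * - of_real (s \<bullet> coord_dir c)) * cut_exp2 s x) (at 0)"
      using x unfolding cut_exp2_def by (simp add: mult_ac)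
    have "\<forall>\<^sub>F r in nhds 0. x + r *\<^sub>R coord_dir c \<in> orthant2"
      using eventually_move_in_orthant2[of x 0 c] x by simp
    then obtain U where U: "open U" "0 \<in> U" "\<And>r. r \<in> U \<Longrightarrow> x + r *\<^sub>R coord_dir c \<in> orthant2"
      unfolding eventually_nhds by blast
    show "((\<lambda>r. g (x + r *\<^sub>R coord_dir c)) has_vector_derivative (b * - of_real (s \<bullet> coord_dir c)) * cut_exp2 s x) (at 0)"
      by (rule has_vector_derivative_transform_within_open[OF d U(1,2)]) (simp only: g cut_exp2_def U(3) if_True)
  qed blast
  show "\<exists>M. \<forall>x\<in>orthant2. mpow x k * cmod (g x) \<le> M" for k
  proof -
    let ?k = "\<lambda>c. case c of Inl i \<Rightarrow> fst k $ i | Inr j \<Rightarrow> snd k $ j"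
    have "mpow x k * cmod (g x) \<le> (\<Prod>c\<in>UNIV. fact (?k c) / coord c s ^ ?k c) * cmod b" if x: "x \<in> orthant2" for x
    proof -
      have "mpow x k * exp (- (s \<bullet> x)) = (\<Prod>c\<in>UNIV. coord c x ^ ?k c * exp (- (coord c s * coord c x)))"
        unfolding mpow_eq_prod_coord inner_eq_sum_coord sum_negf[symmetric] exp_sum[OF finite] prod.distrib ..
      also have "\<dots> \<le> (\<Prod>c\<in>UNIV. fact (?k c) / coord c s ^ ?k c)"
      proof (intro prod_mono conjI power_mult_exp_minus_le)
        fix c
        have "0 < coord c x" "0 < coord c s" using x s orthant2_iff by blast+
        then show "0 \<le> coord c x" "0 < coord c s" "0 \<le> coord c x ^ ?k c * exp (- (coord c s * coord c x))" by auto
      qed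
      finally have "mpow x k * exp (- (s \<bullet> x)) * cmod b \<le> (\<Prod>c\<in>UNIV. fact (?k c) / coord c s ^ ?k c) * cmod b"
        by (rule mult_right_mono) simp
      moreover have "cmod (g x) = exp (- (s \<bullet> x)) * cmod b" using x unfolding g cut_exp2_def by (simp add: norm_mult)
      ultimately show ?thesis by (simp only: mult.assoc)
    qed
    then show ?thesis by blast
  qed
qed

lemma exp_sums_cut_schwartz:
  fixes \<phi> :: "(real ^ 'm) \<times> (real ^ 'n) \<Rightarrow> complex"
  assumes "\<phi> \<in> exp_sums"
  shows "(\<lambda>x. if x \<in> orthant2 then \<phi> x else 0) \<in> schwartz"
  using assms
proof induction
  case (base s)
  then have "s \<in> orthant2" by (simp only: eorthant_prod)
  from cut_exp2_schwartz[OF this] show ?case unfolding cut_exp2_def[abs_def] .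
next
  case (add \<phi> \<psi>)
  have "(\<lambda>x. if x \<in> orthant2 then \<phi> x + \<psi> x else 0) =
     (\<lambda>x. 1 * (if x \<in> orthant2 then \<phi> x else 0) + 1 * (if x \<in> orthant2 then \<psi> x else 0))" by auto
  then show ?case using schwartz_linear[OF add.IH, of 1 1] by (simp only:)
next
  case (scale \<phi> c)
  have "(\<lambda>x. if x \<in> orthant2 then c * \<phi> x else 0) =
     (\<lambda>x. c * (if x \<in> orthant2 then \<phi> x else 0) + 0 * (if x \<in> orthant2 then \<phi> x else 0))" by auto
  then show ?case using schwartz_linear[OF scale.IH scale.IH, of c 0] by (simp only:)
qed

lemma L2_dominated_convergence:
  fixes F :: "nat \<Rightarrow> 'a \<Rightarrow> complex"
  assumes [measurable]: "\<And>n. F n \<in> borel_measurable M" "f \<in> borel_measurable M"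
    and lim: "AE x in M. (\<lambda>n. F n x) \<longlonglongrightarrow> f x"
    and dom: "\<And>n. AE x in M. cmod (F n x) \<le> H x" "AE x in M. cmod (f x) \<le> H x"
    and H: "integrable M (\<lambda>x. (H x)\<^sup>2)"
  shows "(\<lambda>n. L2_norm M (\<lambda>x. F n x - f x)) \<longlonglongrightarrow> 0"
proof -
  have "(\<lambda>n. \<integral>x. (cmod (F n x - f x))\<^sup>2 \<partial>M) \<longlonglongrightarrow> (\<integral>x. 0 \<partial>M)"
  proof (rule integral_dominated_convergence)
    show "integrable M (\<lambda>x. 4 * (H x)\<^sup>2)" using H by simp
    show "AE x in M. (\<lambda>n. (cmod (F n x - f x))\<^sup>2) \<longlonglongrightarrow> 0"
      using lim
    proof eventually_elim
      case (elim x)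
      have "(\<lambda>n. (cmod (F n x - f x))\<^sup>2) \<longlonglongrightarrow> (cmod (f x - f x))\<^sup>2" by (intro tendsto_intros elim)
      then show ?case by simp
    qed
    show "AE x in M. norm ((cmod (F n x - f x))\<^sup>2) \<le> 4 * (H x)\<^sup>2" for n
      using dom(1)[of n] dom(2)
    proof eventually_elim
      case (elim x)
      have "cmod (F n x - f x) \<le> 2 * H x" using norm_triangle_ineq4[of "F n x" "f x"] elim by linarith
      then have "(cmod (F n x - f x))\<^sup>2 \<le> (2 * H x)\<^sup>2" by (intro power_mono) auto
      then show ?case by simp
    qed
  qed auto
  then have "(\<lambda>n. sqrt (\<integral>x. (cmod (F n x - f x))\<^sup>2 \<partial>M)) \<longlonglongrightarrow> sqrt 0" by (intro tendsto_real_sqrt) simp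
  then show ?thesis by (simp add: L2_norm_def)
qed

lemma AE_weighted_measure:
  assumes "AE x in lborel. x \<in> orthant2 \<longrightarrow> P x"
  shows "AE x in weighted_measure \<gamma>' \<gamma>''. P (x :: (real ^ 'm) \<times> (real ^ 'n))"
proof -
  have "AE x in orthant_measure. P x"
    using assms unfolding orthant_measure_def by (subst AE_restrict_space_iff) (auto simp: sets_orthant2)
  moreover have "(\<lambda>x. ennreal (vpow (fst x) \<gamma>' * vpow (snd x) \<gamma>'')) \<in> borel_measurable (orthant_measure :: ((real ^ 'm) \<times> (real ^ 'n)) measure)"
    by (intro borel_measurable_orthant_measure) measurable
  ultimately show ?thesis unfolding weighted_measure_def by (subst AE_density) auto
qed

text \<open>
  The retraction of the plane onto the disc of radius \<open>N\<close>, used to truncate continuous functions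
  without losing continuity.
\<close>

definition clamp_norm :: "real \<Rightarrow> complex \<Rightarrow> complex" where
  "clamp_norm N z = of_real (N / max N (cmod z)) * z"

lemma clamp_norm:
  assumes "0 < N"
  shows "cmod (clamp_norm N z) \<le> N" "cmod z \<le> N \<Longrightarrow> clamp_norm N z = z" "continuous_on UNIV (clamp_norm N)"
proof -
  have "N * cmod z \<le> N * max N (cmod z)" using assms by (intro mult_left_mono) auto
  then show "cmod (clamp_norm N z) \<le> N"
    using assms by (simp add: clamp_norm_def norm_mult norm_divide divide_simps max_def)
  show "cmod z \<le> N \<Longrightarrow> clamp_norm N z = z" using assms by (simp add: clamp_norm_def max_def)
  show "continuous_on UNIV (clamp_norm N)"
    unfolding clamp_norm_def using assms by (intro continuous_intros) (auto simp: max_def)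
qed

text \<open>
  With \<open>W\<close> the product of \<open>edge_weight\<close> and \<open>e\<^bsup>-x\<^sub>1-\<dots>-x\<^sub>d\<^esup>\<close>, three approximations are combined. First
  \<open>f / W\<close> is truncated to a bounded function. A bounded measurable function is then an almost
  everywhere limit of continuous ones with the same bound. Finally the product of \<open>W\<close> with a bounded
  continuous function is a limit of exponential sums.
\<close>

lemma schwartz_dense:
  fixes f :: "(real ^ 'm) \<times> (real ^ 'n) \<Rightarrow> complex"
  assumes \<gamma>': "\<forall>l. 0 \<le> \<gamma>' $ l" and \<gamma>'': "\<forall>l. 0 \<le> \<gamma>'' $ l"
    and f: "f \<in> L2 (weighted_measure \<gamma>' \<gamma>'')" and e: "0 < e"
  shows "\<exists>\<phi>\<in>schwartz. L2_norm (weighted_measure \<gamma>' \<gamma>'') (\<lambda>x. f x - \<phi> x) < e"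
proof -
  let ?M = "weighted_measure \<gamma>' \<gamma>''"
  have bm: "g \<in> borel_measurable borel \<Longrightarrow> g \<in> borel_measurable ?M" for g :: "(real ^ 'm) \<times> (real ^ 'n) \<Rightarrow> complex"
    unfolding borel_measurable_weighted_measure by (rule borel_measurable_orthant_measure)
  define E where "E x = exp (- (One \<bullet> x))" for x :: "(real ^ 'm) \<times> (real ^ 'n)"
  define W where "W x = edge_weight x * E x" for x :: "(real ^ 'm) \<times> (real ^ 'n)"
  have Wpos: "0 < W x" if "x \<in> orthant2" for x using edge_weight_pos[of x] that unfolding W_def E_def eorthant_prod by simp
  have WE: "W x \<le> E x" if "x \<in> orthant2" for x
    using edge_weight_le_1[of x] that unfolding W_def E_def eorthant_prod by simp
  have [measurable]: "E \<in> borel_measurable borel" "W \<in> borel_measurable borel"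
    unfolding W_def[abs_def] E_def[abs_def] edge_weight_def[abs_def] by measurable
  have One: "One \<in> (orthant2 :: ((real ^ 'm) \<times> (real ^ 'n)) set)" by (rule One_in_eorthant[where 'a="(real ^ 'm) \<times> (real ^ 'n)", unfolded eorthant_prod])
  have EL: "cut_exp2 One \<in> L2 ?M" by (intro schwartz_L2_weighted cut_exp2_schwartz One \<gamma>' \<gamma>'')
  have Eint: "integrable ?M (\<lambda>x. (cmod (cut_exp2 One x))\<^sup>2)" using EL by (simp add: L2_def)
  have cutE: "cmod (cut_exp2 One x) = E x" if "x \<in> orthant2" for x
    using that unfolding cut_exp2_def E_def by (simp only: if_True norm_of_real abs_exp_cancel)
  define f0 where "f0 x = indicator orthant2 x *\<^sub>R f x" for x
  have f0m [measurable]: "f0 \<in> borel_measurable borel"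
    using L2_measurable[OF f] unfolding borel_measurable_weighted_measure orthant_measure_def f0_def[abs_def]
    by (subst (asm) borel_measurable_restrict_space_iff) (auto simp: sets_orthant2)
  have f0f: "AE x in ?M. f0 x = f x" by (rule AE_weighted_measure) (auto simp: f0_def)
  have f0L: "f0 \<in> L2 ?M"
  proof -
    have "(\<integral>\<^sup>+x. ennreal ((cmod (f0 x))\<^sup>2) \<partial>?M) = (\<integral>\<^sup>+x. ennreal ((cmod (f x))\<^sup>2) \<partial>?M)"
      using f0f by (intro nn_integral_cong_AE) auto
    then show ?thesis using f bm[OF f0m] unfolding L2_iff by simp
  qed
  define u where "u x = f0 x / of_real (W x)" for x
  have um [measurable]: "u \<in> borel_measurable borel" unfolding u_def[abs_def] by measurable
  define cut where "cut N x = (if cmod (u x) \<le> real N then u x else 0)" for N x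
  have cutm [measurable]: "cut N \<in> borel_measurable borel" for N unfolding cut_def[abs_def] by measurable
  have uW: "u x * of_real (W x) = f0 x" for x
    using Wpos[of x] by (cases "x \<in> orthant2") (auto simp: u_def f0_def)
  have "(\<lambda>N. L2_norm ?M (\<lambda>x. cut N x * of_real (W x) - f0 x)) \<longlonglongrightarrow> 0"
  proof (rule L2_dominated_convergence[where H="\<lambda>x. cmod (f0 x)"])
    show "integrable ?M (\<lambda>x. (cmod (f0 x))\<^sup>2)" using f0L by (simp add: L2_def)
    show "AE x in ?M. cmod (cut N x * of_real (W x)) \<le> cmod (f0 x)" for N
      by (intro AE_I2) (auto simp: cut_def uW)
    show "AE x in ?M. (\<lambda>N. cut N x * of_real (W x)) \<longlonglongrightarrow> f0 x"
    proof (rule AE_I2)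
      fix x
      obtain N0 where N0: "cmod (u x) \<le> real N0" using real_arch_simple by blast
      have "\<forall>\<^sub>F N in sequentially. cut N x * of_real (W x) = f0 x"
        using eventually_ge_at_top[of N0]
      proof eventually_elim
        case (elim N)
        then have "cmod (u x) \<le> real N" using N0 by linarith
        then show ?case by (simp add: cut_def uW)
      qed
      then show "(\<lambda>N. cut N x * of_real (W x)) \<longlonglongrightarrow> f0 x" by (rule tendsto_eventually)
    qed
    show "(\<lambda>x. cut N x * of_real (W x)) \<in> borel_measurable ?M" for N by (rule bm) measurable
    show "f0 \<in> borel_measurable ?M" by (rule bm) measurable
  qed auto
  then have "\<forall>\<^sub>F N in sequentially. L2_norm ?M (\<lambda>x. cut N x * of_real (W x) - f0 x) < e / 3"
    using e by (intro order_tendstoD(2)) auto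
  from eventually_conj[OF this eventually_gt_at_top[of 0]]
  obtain N where N: "L2_norm ?M (\<lambda>x. cut N x * of_real (W x) - f0 x) < e / 3" "0 < N"
    unfolding eventually_sequentially by blast
  have U: "UNIV \<in> sets (lebesgue :: ((real ^ 'm) \<times> (real ^ 'n)) measure)" by simp
  have "cut N measurable_on UNIV"
    unfolding measurable_on_iff_borel_measurable[OF U]
    using cutm[of N] by (simp add: measurable_completion lebesgue_on_UNIV_eq)
  then obtain Z c where Z: "negligible Z" and c: "\<And>n. continuous_on UNIV (c n)" "\<And>x. x \<notin> Z \<Longrightarrow> (\<lambda>n. c n x) \<longlonglongrightarrow> cut N x"
    unfolding measurable_on_def by auto
  \<comment> \<open>Clamping keeps the limit, since the limit is already bounded by \<open>N\<close>.\<close>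
  define c' where "c' n x = clamp_norm (real N) (c n x)" for n x
  have N0: "0 < real N" using N(2) by simp
  have c'c: "continuous_on UNIV (c' n)" for n
    unfolding c'_def by (rule continuous_on_compose2[OF clamp_norm(3)[OF N0] c(1)]) simp
  have c'm [measurable]: "c' n \<in> borel_measurable borel" for n by (rule borel_measurable_continuous_onI[OF c'c])
  have c'b: "cmod (c' n x) \<le> real N" for n x unfolding c'_def by (rule clamp_norm(1)[OF N0])
  have Zae: "AE x in lborel. x \<notin> Z"
  proof -
    have "AE x in lebesgue. x \<notin> Z" using Z unfolding negligible_iff_null_sets by (rule AE_not_in)
    then show ?thesis by (simp add: AE_completion_iff)
  qed
  have cb: "cmod (cut N x) \<le> real N" for x by (simp add: cut_def)
  have "(\<lambda>n. L2_norm ?M (\<lambda>x. c' n x * of_real (W x) - cut N x * of_real (W x))) \<longlonglongrightarrow> 0"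
  proof (rule L2_dominated_convergence[where H="\<lambda>x. real N * cmod (cut_exp2 One x)"])
    show "integrable ?M (\<lambda>x. (real N * cmod (cut_exp2 One x))\<^sup>2)"
      using integrable_mult_right[OF Eint, of "(real N)\<^sup>2"] by (simp only: power_mult_distrib)
    have dom: "AE x in ?M. cmod (v x * of_real (W x)) \<le> real N * cmod (cut_exp2 One x)" if "\<And>x. cmod (v x) \<le> real N" for v
    proof (intro AE_weighted_measure AE_I2 impI)
      fix x :: "(real ^ 'm) \<times> (real ^ 'n)" assume x: "x \<in> orthant2"
      have "cmod (v x * of_real (W x)) = cmod (v x) * W x" using Wpos[OF x] by (simp add: norm_mult)
      also have "\<dots> \<le> real N * E x" using that[of x] WE[OF x] Wpos[OF x] by (intro mult_mono) auto
      finally show "cmod (v x * of_real (W x)) \<le> real N * cmod (cut_exp2 One x)" by (simp only: cutE[OF x])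
    qed
    show "AE x in ?M. cmod (c' n x * of_real (W x)) \<le> real N * cmod (cut_exp2 One x)" for n by (rule dom) (rule c'b)
    show "AE x in ?M. cmod (cut N x * of_real (W x)) \<le> real N * cmod (cut_exp2 One x)" by (rule dom) (rule cb)
    show "AE x in ?M. (\<lambda>n. c' n x * of_real (W x)) \<longlonglongrightarrow> cut N x * of_real (W x)"
    proof (rule AE_weighted_measure, use Zae in eventually_elim, rule impI)
      fix x assume "x \<notin> Z"
      have "continuous (at (cut N x)) (clamp_norm (real N))"
        using clamp_norm(3)[OF N0] by (simp add: continuous_on_eq_continuous_at)
      then have "(\<lambda>n. clamp_norm (real N) (c n x)) \<longlonglongrightarrow> clamp_norm (real N) (cut N x)"
        by (rule isCont_tendsto_compose) (rule c(2)[OF \<open>x \<notin> Z\<close>])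
      then have "(\<lambda>n. c' n x) \<longlonglongrightarrow> cut N x" unfolding c'_def clamp_norm(2)[OF N0 cb] .
      then show "(\<lambda>n. c' n x * of_real (W x)) \<longlonglongrightarrow> cut N x * of_real (W x)" by (intro tendsto_intros)
    qed
    show "(\<lambda>x. c' n x * of_real (W x)) \<in> borel_measurable ?M" for n by (rule bm) measurable
    show "(\<lambda>x. cut N x * of_real (W x)) \<in> borel_measurable ?M" by (rule bm) measurable
  qed
  then have "\<forall>\<^sub>F n in sequentially. L2_norm ?M (\<lambda>x. c' n x * of_real (W x) - cut N x * of_real (W x)) < e / 3"
    using e by (intro order_tendstoD(2)) auto
  then obtain n where n: "L2_norm ?M (\<lambda>x. c' n x * of_real (W x) - cut N x * of_real (W x)) < e / 3"
    unfolding eventually_sequentially by blast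
  define A where "A = L2_norm ?M (cut_exp2 One)"
  define \<delta> where "\<delta> = e / (3 * (A + 1))"
  have A0: "0 \<le> A" by (simp add: A_def)
  have \<delta>: "0 < \<delta>" unfolding \<delta>_def using e A0 by simp
  obtain \<phi> where \<phi>: "\<phi> \<in> exp_sums" "\<And>x. x \<in> orthant2 \<Longrightarrow> cmod (c' n x * of_real (W x) - \<phi> x) \<le> \<delta> * E x"
    using exp_sums_approximation[of "c' n" "real N" \<delta>] continuous_on_subset[OF c'c] c'b \<delta> unfolding E_def W_def eorthant_prod by blast
  define \<psi> where "\<psi> x = (if x \<in> orthant2 then \<phi> x else 0)" for x
  have \<psi>: "\<psi> \<in> schwartz" unfolding \<psi>_def[abs_def] by (rule exp_sums_cut_schwartz[OF \<phi>(1)])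
  have \<psi>L: "\<psi> \<in> L2 ?M" by (intro schwartz_L2_weighted \<psi> \<gamma>' \<gamma>'')
  have inL: "(\<lambda>x. v x * of_real (W x)) \<in> L2 ?M" if v: "v \<in> borel_measurable borel" "\<And>x. cmod (v x) \<le> real N" for v
    unfolding L2_def
  proof (intro CollectI conjI)
    note [measurable] = v(1)
    show m: "(\<lambda>x. v x * of_real (W x)) \<in> borel_measurable ?M" by (rule bm) measurable
    show "integrable ?M (\<lambda>x. (cmod (v x * of_real (W x)))\<^sup>2)"
    proof (rule Bochner_Integration.integrable_bound[OF integrable_mult_right[OF Eint, of "(real N)\<^sup>2"]])
      show "(\<lambda>x. (cmod (v x * of_real (W x)))\<^sup>2) \<in> borel_measurable ?M" using m by measurable
      show "AE x in ?M. norm ((cmod (v x * of_real (W x)))\<^sup>2) \<le> norm ((real N)\<^sup>2 * (cmod (cut_exp2 One x))\<^sup>2)"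
      proof (intro AE_weighted_measure AE_I2 impI)
        fix x :: "(real ^ 'm) \<times> (real ^ 'n)" assume x: "x \<in> orthant2"
        have "cmod (v x * of_real (W x)) = cmod (v x) * W x" using Wpos[OF x] by (simp add: norm_mult)
        also have "\<dots> \<le> real N * E x" using v(2)[of x] WE[OF x] Wpos[OF x] by (intro mult_mono) auto
        finally have "(cmod (v x * of_real (W x)))\<^sup>2 \<le> (real N * E x)\<^sup>2" by (intro power_mono) auto
        then show "norm ((cmod (v x * of_real (W x)))\<^sup>2) \<le> norm ((real N)\<^sup>2 * (cmod (cut_exp2 One x))\<^sup>2)"
          by (simp add: cutE[OF x] power_mult_distrib)
      qed
    qed
  qed
  have cL: "(\<lambda>x. c' n x * of_real (W x)) \<in> L2 ?M" by (intro inL c'm c'b)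
  have cutL: "(\<lambda>x. cut N x * of_real (W x)) \<in> L2 ?M" by (intro inL cutm cb)
  have "L2_norm ?M (\<lambda>x. c' n x * of_real (W x) - \<psi> x) \<le> L2_norm ?M (\<lambda>x. of_real \<delta> * cut_exp2 One x)"
  proof -
    have "(\<integral>\<^sup>+x. ennreal ((cmod (c' n x * of_real (W x) - \<psi> x))\<^sup>2) \<partial>?M) \<le> (\<integral>\<^sup>+x. ennreal ((cmod (of_real \<delta> * cut_exp2 One x))\<^sup>2) \<partial>?M)"
    proof (intro nn_integral_mono_AE AE_weighted_measure AE_I2 impI ennreal_leI power_mono)
      fix x :: "(real ^ 'm) \<times> (real ^ 'n)" assume x: "x \<in> orthant2"
      have "\<psi> x = \<phi> x" using x unfolding \<psi>_def by (simp only: if_True)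
      then show "cmod (c' n x * of_real (W x) - \<psi> x) \<le> cmod (of_real \<delta> * cut_exp2 One x)"
        using \<phi>(2)[OF x] \<delta> by (simp only: norm_mult norm_of_real cutE[OF x] abs_of_pos)
    qed simp
    also have "\<dots> = ennreal ((L2_norm ?M (\<lambda>x. of_real \<delta> * cut_exp2 One x))\<^sup>2)"
      by (rule L2_nn_integral[OF L2_cmult[OF EL]])
    finally show ?thesis by (rule L2_norm_le_iff[OF L2_diff[OF cL \<psi>L] L2_norm_nonneg, THEN iffD2])
  qed
  also have "\<dots> = \<delta> * A" unfolding L2_norm_cmult A_def using \<delta> by simp
  also have "\<dots> < e / 3" unfolding \<delta>_def using e A0 by (simp add: field_simps)
  finally have last: "L2_norm ?M (\<lambda>x. c' n x * of_real (W x) - \<psi> x) < e / 3" .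
  have "L2_norm ?M (\<lambda>x. f x - \<psi> x) = L2_norm ?M (\<lambda>x. f0 x - \<psi> x)"
  proof (rule L2_norm_cong_AE)
    show "AE x in ?M. f x - \<psi> x = f0 x - \<psi> x" using f0f by eventually_elim simp
  qed (intro L2_measurable L2_diff f f0L \<psi>L)+
  also have "\<dots> \<le> L2_norm ?M (\<lambda>x. f0 x - cut N x * of_real (W x)) + L2_norm ?M (\<lambda>x. cut N x * of_real (W x) - \<psi> x)"
    by (intro L2_norm_triangle_diff f0L cutL \<psi>L)
  also have "L2_norm ?M (\<lambda>x. cut N x * of_real (W x) - \<psi> x) \<le>
     L2_norm ?M (\<lambda>x. cut N x * of_real (W x) - c' n x * of_real (W x)) + L2_norm ?M (\<lambda>x. c' n x * of_real (W x) - \<psi> x)"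
    by (intro L2_norm_triangle_diff cL cutL \<psi>L)
  finally have "L2_norm ?M (\<lambda>x. f x - \<psi> x) < e"
    using N(1) n last L2_norm_minus_commute[of ?M f0 "\<lambda>x. cut N x * of_real (W x)"]
      L2_norm_minus_commute[of ?M "\<lambda>x. cut N x * of_real (W x)" "\<lambda>x. c' n x * of_real (W x)"] by linarith
  then show ?thesis using \<psi> by blast
qed

section \<open>From the kernel of the fractional power to the real kernel\<close>

text \<open>
  The constant of modulus one by which the complex kernel differs from the real one.
\<close>

definition kernel_phase :: "complex \<Rightarrow> real \<Rightarrow> complex" where
  "kernel_phase z \<nu> = of_real (cmod (1 - z)) * inverse (1 - z) *
     (cis (- Arg z * \<nu> / 2) * cis (\<nu> * pi * sgn (Arg z) / 2))"

lemma bessel_J_eq_bessel_clifford: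
  fixes y \<nu> :: real
  assumes y: "0 < y" and \<nu>: "0 \<le> \<nu>"
  shows "bessel_J \<nu> (of_real y) = of_real ((y / 2) powr \<nu> * bessel_clifford \<nu> ((y / 2)\<^sup>2))"
proof -
  have summand: "(-1) ^ m * (of_real y / 2) ^ (2 * m) / (fact m * Gamma (of_nat m + of_real \<nu> + 1)) =
      (of_real (bc_coeff \<nu> m * ((y / 2)\<^sup>2) ^ m) :: complex)" for m
  proof -
    have "(of_nat m + of_real \<nu> + 1 :: complex) = of_real (real m + \<nu> + 1)" by simp
    then have "Gamma (of_nat m + of_real \<nu> + 1 :: complex) = of_real (Gamma (real m + \<nu> + 1))"
      by (simp only: Gamma_complex_of_real)
    then show ?thesis by (simp add: bc_coeff_def power_mult)
  qed
  have "(of_real y / 2 :: complex) powr of_real \<nu> = of_real ((y / 2) powr \<nu>)"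
    using powr_of_real[of "y / 2" \<nu>] y by simp
  then show ?thesis
    unfolding bessel_J_def summand bessel_clifford_def
    using suminf_of_real[OF summable_bc[OF \<nu>, of "(y / 2)\<^sup>2"], where ?'a=complex] by simp
qed

text \<open>
  With \<open>a = 1 / |1 - z|\<close>, half the argument of the Bessel function \<open>J\<^sub>\<nu>\<close> is \<open>a \<surd>(x t)\<close>, because
  \<open>|1 - z| = 2 |sin (\<theta>/2)|\<close>. The power \<open>(x t)\<^bsup>-\<nu>/2\<^esup>\<close> in the kernel cancels the one in \<open>J\<^sub>\<nu>\<close>.
\<close>

lemma hc_kernel_eq_bessel_clifford:
  assumes z: "cmod z = 1" "z \<noteq> 1" and x: "0 < x" and t: "0 < t" and \<nu>: "0 \<le> \<nu>"
  shows "inverse (1 - z) * hc_kernel z \<nu> x t =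
    kernel_phase z \<nu> * of_real (inverse (cmod (1 - z)) powr (\<nu> + 1) * bessel_clifford \<nu> ((inverse (cmod (1 - z)))\<^sup>2 * (x * t)))"
proof -
  define \<theta> where "\<theta> = Arg z"
  define a where "a = inverse (cmod (1 - z))"
  have th: "- pi < \<theta>" "\<theta> \<le> pi" using Arg_bounded[of z] by (auto simp: \<theta>_def)
  have "z \<noteq> 0" using z by auto
  from Arg_eq[OF this] have z_eq: "z = cis \<theta>" using z by (simp add: \<theta>_def cis_conv_exp)
  then have th0: "\<theta> \<noteq> 0" using z by auto
  have n: "cmod (1 - z) = 2 * \<bar>sin (\<theta> / 2)\<bar>"
  proof -
    have "1 - z = Complex (1 - cos \<theta>) (- sin \<theta>)"
      by (subst z_eq) (simp add: complex_eq_iff)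
    then have "(cmod (1 - z))\<^sup>2 = (1 - cos \<theta>)\<^sup>2 + (sin \<theta>)\<^sup>2" by (simp add: cmod_power2)
    also have "\<dots> = 2 - 2 * cos \<theta>" using sin_cos_squared_add[of \<theta>] by algebra
    also have "\<dots> = (2 * \<bar>sin (\<theta> / 2)\<bar>)\<^sup>2"
      using cos_double_sin[of "\<theta> / 2"] by (simp add: power_mult_distrib)
    finally show ?thesis by (rule power2_eq_imp_eq) auto
  qed
  have a: "0 < a" using z by (simp add: a_def)
  have y: "sqrt (x * t) / \<bar>sin (\<theta> / 2)\<bar> / 2 = a * sqrt (x * t)"
    unfolding a_def n by (simp add: field_simps)
  have xt: "0 < x * t" using x t by simp
  have y0: "0 < sqrt (x * t) / \<bar>sin (\<theta> / 2)\<bar>"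
  proof -
    have "0 < cmod (1 - z)" using z by simp
    then have "0 < \<bar>sin (\<theta> / 2)\<bar>" unfolding n by simp
    then show ?thesis using xt by simp
  qed
  have p: "(x * t) powr (- \<nu> / 2) * (a * sqrt (x * t)) powr \<nu> = a powr \<nu>"
  proof -
    have "(a * sqrt (x * t)) powr \<nu> = a powr \<nu> * (x * t) powr (\<nu> / 2)"
      using a xt by (simp add: powr_mult powr_half_sqrt[symmetric] powr_powr)
    then have "(x * t) powr (- \<nu> / 2) * (a * sqrt (x * t)) powr \<nu> = a powr \<nu> * ((x * t) powr (- \<nu> / 2) * (x * t) powr (\<nu> / 2))"
      by simp
    also have "(x * t) powr (- \<nu> / 2) * (x * t) powr (\<nu> / 2) = 1"
      unfolding powr_add[symmetric] using x t by simp
    finally show ?thesis by simp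
  qed
  have "hc_kernel z \<nu> x t = cis (- \<theta> * \<nu> / 2) * of_real ((x * t) powr (- \<nu> / 2)) * cis (\<nu> * pi * sgn \<theta> / 2) *
     of_real ((a * sqrt (x * t)) powr \<nu> * bessel_clifford \<nu> (a\<^sup>2 * (x * t)))"
    using hc_kernel_branch[OF x t th th0, of \<nu>] xt
    unfolding z_eq[symmetric] bessel_J_eq_bessel_clifford[OF y0 \<nu>] y by (simp add: power_mult_distrib)
  also have "\<dots> = cis (- \<theta> * \<nu> / 2) * cis (\<nu> * pi * sgn \<theta> / 2) *
     of_real (((x * t) powr (- \<nu> / 2) * (a * sqrt (x * t)) powr \<nu>) * bessel_clifford \<nu> (a\<^sup>2 * (x * t)))"
    by (simp only: of_real_mult mult_ac)
  finally have h: "hc_kernel z \<nu> x t = cis (- \<theta> * \<nu> / 2) * cis (\<nu> * pi * sgn \<theta> / 2) * of_real (a powr \<nu> * bessel_clifford \<nu> (a\<^sup>2 * (x * t)))"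
    unfolding p .
  have "complex_of_real (a powr \<nu>) = of_real (cmod (1 - z)) * of_real (a powr (\<nu> + 1))"
  proof -
    have "a powr \<nu> = cmod (1 - z) * a powr (\<nu> + 1)" using a z by (simp add: powr_add a_def)
    then show ?thesis by (simp only: of_real_mult)
  qed
  then show ?thesis
    unfolding h kernel_phase_def \<theta>_def[symmetric] a_def[symmetric] by (simp add: mult_ac)
qed

lemma cmod_kernel_phase: "z \<noteq> 1 \<Longrightarrow> cmod (kernel_phase z \<nu>) = 1"
  by (simp add: kernel_phase_def norm_mult norm_inverse)

text \<open>
  Conjugation changes the sign of the angle, and hence of all exponents. The exception is
  \<open>z = -1\<close>, where the principal angle \<open>\<pi>\<close> is kept; there the two exponents cancel and the phase is \<open>1\<close>.
\<close>

lemma kernel_phase_cnj: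
  assumes z: "cmod z = 1" "z \<noteq> 1"
  shows "kernel_phase (cnj z) \<nu> * kernel_phase z \<nu> = 1"
proof -
  let ?e = "\<lambda>\<theta>. cis (- \<theta> * \<nu> / 2) * cis (\<nu> * pi * sgn \<theta> / 2)"
  have e: "?e (Arg (cnj z)) * ?e (Arg z) = 1"
  proof (cases "z \<in> \<real>")
    case True
    then obtain r where r: "z = of_real r" by (elim Reals_cases)
    with z have "r = -1" by (auto simp: abs_if split: if_splits)
    then have "Arg z = pi" "cnj z = z" using r by (auto simp: Arg_eq_pi)
    moreover have "?e pi = 1" by (simp add: cis_mult mult.commute)
    ultimately show ?thesis by simp
  next
    case False
    then have "Arg (cnj z) = - Arg z" by (simp add: Arg_cnj)
    then show ?thesis by (simp add: cis_mult sgn_minus)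
  qed
  have "1 - cnj z = cnj (1 - z)" by simp
  then have n: "cmod (1 - cnj z) = cmod (1 - z)" by (simp only: complex_mod_cnj)
  have gen: "r * r = u * v \<Longrightarrow> u \<noteq> 0 \<Longrightarrow> v \<noteq> 0 \<Longrightarrow> r * inverse v * (r * inverse u) = 1" for r u v :: complex
    by (simp add: field_simps)
  have "of_real (cmod (1 - z)) * inverse (1 - cnj z) * (of_real (cmod (1 - z)) * inverse (1 - z)) = 1"
  proof (rule gen)
    show "of_real (cmod (1 - z)) * of_real (cmod (1 - z)) = (1 - z) * (1 - cnj z)"
      using complex_norm_square[of "1 - z"] by (simp add: power2_eq_square)
    show "1 - z \<noteq> 0" "1 - cnj z \<noteq> 0" using z complex_cnj_one_iff[of z] by auto
  qed
  then have "(of_real (cmod (1 - z)) * inverse (1 - cnj z) * (of_real (cmod (1 - z)) * inverse (1 - z))) *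
      (?e (Arg (cnj z)) * ?e (Arg z)) = 1" unfolding e by simp
  then show ?thesis unfolding kernel_phase_def n by (simp only: mult_ac)
qed

definition total_phase :: "complex ^ 'm \<Rightarrow> real ^ 'm \<Rightarrow> complex" where
  "total_phase z \<nu> = (\<Prod>l\<in>UNIV. kernel_phase (z $ l) (\<nu> $ l))"

definition dilation :: "complex ^ 'm \<Rightarrow> real ^ 'm" where
  "dilation z = (\<chi> l. inverse (cmod (1 - z $ l)))"

lemma torusD: "z \<in> torus \<Longrightarrow> cmod (z $ l) = 1" "z \<in> torus \<Longrightarrow> z $ l \<noteq> 1"
  by (simp_all add: torus_def)

lemma vcnj_torus: "z \<in> torus \<Longrightarrow> vcnj z \<in> torus"
  by (simp add: torus_def vcnj_def)

lemma dilation_vcnj: "dilation (vcnj z) = dilation z"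
proof -
  have "cmod (1 - cnj w) = cmod (1 - w)" for w
    using complex_mod_cnj[of "1 - w"] by simp
  then show ?thesis by (simp add: dilation_def vcnj_def)
qed

lemma dilation_pos: "z \<in> torus \<Longrightarrow> \<forall>l. 0 < dilation z $ l"
  by (simp add: dilation_def torusD)

lemma cmod_total_phase: "z \<in> torus \<Longrightarrow> cmod (total_phase z \<nu>) = 1"
  unfolding total_phase_def prod_norm[symmetric] by (simp add: cmod_kernel_phase torusD)

lemma total_phase_vcnj: "z \<in> torus \<Longrightarrow> total_phase (vcnj z) \<nu> * total_phase z \<nu> = 1"
  unfolding total_phase_def prod.distrib[symmetric] by (simp add: kernel_phase_cnj torusD vcnj_def)

lemma vcnj_vcnj: "vcnj (vcnj z) = z"
  by (simp add: vcnj_def vec_eq_iff)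

lemma hankel_clifford_eq:
  fixes f :: "(real ^ 'm) \<times> (real ^ 'n) \<Rightarrow> complex"
  assumes z: "z \<in> torus" and \<nu>: "\<forall>l. 0 \<le> \<nu> $ l" and f: "f \<in> schwartz"
  shows "hankel_clifford z \<nu> f = (\<lambda>t. total_phase z \<nu> * clifford_transform \<nu> (dilation z) f t)"
proof
  fix t :: "(real ^ 'm) \<times> (real ^ 'n)"
  show "hankel_clifford z \<nu> f t = total_phase z \<nu> * clifford_transform \<nu> (dilation z) f t"
  proof (cases "t \<in> orthant2")
    case True
    then have t: "fst t \<in> pos_orthant" by auto
    let ?c = "\<Prod>l\<in>UNIV. inverse (1 - z $ l)"
    have "?c * (LINT x:pos_orthant|lborel. f (x, snd t) *
           (\<Prod>l\<in>UNIV. hc_kernel (z $ l) (\<nu> $ l) (x $ l) (fst t $ l) * of_real ((x $ l) powr (\<nu> $ l)))) =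
        (\<integral>x. ?c * (indicator pos_orthant x *\<^sub>R (f (x, snd t) *
           (\<Prod>l\<in>UNIV. hc_kernel (z $ l) (\<nu> $ l) (x $ l) (fst t $ l) * of_real ((x $ l) powr (\<nu> $ l))))) \<partial>lborel)"
      unfolding set_lebesgue_integral_def by (rule integral_mult_right_zero[symmetric])
    also have "\<dots> = (\<integral>x. total_phase z \<nu> * (f (x, snd t) * of_real (clifford_kernel \<nu> (dilation z) x (fst t) * vpow x \<nu>)) \<partial>lborel)"
    proof (rule Bochner_Integration.integral_cong[OF refl])
      fix x :: "real ^ 'm"
      show "?c * (indicator pos_orthant x *\<^sub>R (f (x, snd t) *
           (\<Prod>l\<in>UNIV. hc_kernel (z $ l) (\<nu> $ l) (x $ l) (fst t $ l) * of_real ((x $ l) powr (\<nu> $ l))))) =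
         total_phase z \<nu> * (f (x, snd t) * of_real (clifford_kernel \<nu> (dilation z) x (fst t) * vpow x \<nu>))"
      proof (cases "x \<in> pos_orthant")
        case True
        have "?c * (\<Prod>l\<in>UNIV. hc_kernel (z $ l) (\<nu> $ l) (x $ l) (fst t $ l) * of_real ((x $ l) powr (\<nu> $ l))) =
          (\<Prod>l\<in>UNIV. (inverse (1 - z $ l) * hc_kernel (z $ l) (\<nu> $ l) (x $ l) (fst t $ l)) * of_real ((x $ l) powr (\<nu> $ l)))"
          unfolding prod.distrib[symmetric] by (simp only: mult.assoc)
        also have "\<dots> = (\<Prod>l\<in>UNIV. (kernel_phase (z $ l) (\<nu> $ l) * of_real (dilation z $ l powr (\<nu> $ l + 1) *
             bessel_clifford (\<nu> $ l) ((dilation z $ l)\<^sup>2 * (x $ l * fst t $ l)))) * of_real ((x $ l) powr (\<nu> $ l)))"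
          by (intro prod.cong refl) (simp only: hc_kernel_eq_bessel_clifford[OF torusD[OF z] pos_orthantD[OF True] pos_orthantD[OF t] \<nu>[rule_format]] dilation_def vec_lambda_beta)
        also have "\<dots> = total_phase z \<nu> * of_real (clifford_kernel \<nu> (dilation z) x (fst t) * vpow x \<nu>)"
          unfolding total_phase_def clifford_kernel_def vpow_def of_real_mult of_real_prod prod.distrib by (simp only: mult.assoc)
        finally have "?c * (\<Prod>l\<in>UNIV. hc_kernel (z $ l) (\<nu> $ l) (x $ l) (fst t $ l) * of_real ((x $ l) powr (\<nu> $ l))) =
           total_phase z \<nu> * of_real (clifford_kernel \<nu> (dilation z) x (fst t) * vpow x \<nu>)" .
        then have "f (x, snd t) * (?c * (\<Prod>l\<in>UNIV. hc_kernel (z $ l) (\<nu> $ l) (x $ l) (fst t $ l) * of_real ((x $ l) powr (\<nu> $ l)))) =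
           f (x, snd t) * (total_phase z \<nu> * of_real (clifford_kernel \<nu> (dilation z) x (fst t) * vpow x \<nu>))" by (rule arg_cong)
        then show ?thesis using True by (simp only: indicator_simps scaleR_one mult_ac)
      next
        case False
        then have "f (x, snd t) = 0" by (intro schwartz_outside[OF f]) auto
        then show ?thesis by simp
      qed
    qed
    also have "\<dots> = total_phase z \<nu> * (\<integral>x. f (x, snd t) * of_real (clifford_kernel \<nu> (dilation z) x (fst t) * vpow x \<nu>) \<partial>lborel)"
      by (rule integral_mult_right_zero)
    finally show ?thesis
      using True unfolding hankel_clifford_def clifford_transform_def clifford_integral_def by (simp only: if_True)
  next
    case False
    then show ?thesis unfolding hankel_clifford_def clifford_transform_def by (simp only: if_False mult_zero_right)
  qed
qed

section \<open>The isomorphism of the Schwartz space\<close>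

lemma clifford_transform_linear:
  fixes f g :: "(real ^ 'm) \<times> (real ^ 'n) \<Rightarrow> complex"
  assumes f: "f \<in> schwartz" and g: "g \<in> schwartz" and \<nu>: "\<forall>l. 0 \<le> \<nu> $ l"
  shows "clifford_transform \<nu> d (\<lambda>x. a * f x + b * g x) = (\<lambda>t. a * clifford_transform \<nu> d f t + b * clifford_transform \<nu> d g t)"
proof
  fix t :: "(real ^ 'm) \<times> (real ^ 'n)"
  show "clifford_transform \<nu> d (\<lambda>x. a * f x + b * g x) t = a * clifford_transform \<nu> d f t + b * clifford_transform \<nu> d g t"
  proof (cases "t \<in> orthant2")
    case True
    then have t: "fst t \<in> pos_orthant" "snd t \<in> pos_orthant" by auto
    let ?k = "\<lambda>x. complex_of_real (clifford_kernel \<nu> d x (fst t) * vpow x \<nu>)"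
    have i: "integrable lborel (\<lambda>x. h (x, snd t) * ?k x)" if "h \<in> schwartz" for h :: "(real ^ 'm) \<times> (real ^ 'n) \<Rightarrow> complex"
      by (rule clifford_section_integrable[OF that \<nu> \<nu> t(2,1)])
    have "(\<integral>x. (a * f (x, snd t) + b * g (x, snd t)) * ?k x \<partial>lborel) =
       (\<integral>x. a * (f (x, snd t) * ?k x) + b * (g (x, snd t) * ?k x) \<partial>lborel)"
      by (simp only: distrib_right mult.assoc)
    also have "\<dots> = a * (\<integral>x. f (x, snd t) * ?k x \<partial>lborel) + b * (\<integral>x. g (x, snd t) * ?k x \<partial>lborel)"
      by (subst Bochner_Integration.integral_add) (use i[OF f] i[OF g] in \<open>auto simp del: of_real_mult\<close>)
    finally show ?thesis using True unfolding clifford_transform_def clifford_integral_def by (simp only: if_True)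
  qed (simp only: clifford_transform_outside mult_zero_right add_0_right not_False_eq_True)
qed

lemma hankel_clifford_schwartz:
  assumes z: "z \<in> torus" and \<nu>: "\<forall>l. 0 \<le> \<nu> $ l" and f: "f \<in> schwartz"
  shows "hankel_clifford z \<nu> f \<in> schwartz"
  using schwartz_linear[OF clifford_transform_schwartz[OF f \<nu> dilation_pos[OF z]] clifford_transform_schwartz[OF f \<nu> dilation_pos[OF z]], of "total_phase z \<nu>" 0]
  unfolding hankel_clifford_eq[OF z \<nu> f] by simp

lemma hankel_clifford_linear:
  assumes z: "z \<in> torus" and \<nu>: "\<forall>l. 0 \<le> \<nu> $ l"
  shows "complex_linear_on schwartz (hankel_clifford z \<nu>)"
  unfolding complex_linear_on_def
proof (intro ballI allI)
  fix f g :: "(real ^ 'a) \<times> (real ^ 'b) \<Rightarrow> complex" and a b :: complex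
  assume f: "f \<in> schwartz" and g: "g \<in> schwartz"
  show "hankel_clifford z \<nu> (\<lambda>x. a * f x + b * g x) = (\<lambda>x. a * hankel_clifford z \<nu> f x + b * hankel_clifford z \<nu> g x)"
    unfolding hankel_clifford_eq[OF z \<nu> f] hankel_clifford_eq[OF z \<nu> g] hankel_clifford_eq[OF z \<nu> schwartz_linear[OF f g]] clifford_transform_linear[OF f g \<nu>]
    by (simp add: algebra_simps)
qed

lemma hankel_clifford_inverse:
  assumes z: "z \<in> torus" and \<nu>: "\<forall>l. 0 \<le> \<nu> $ l" and f: "f \<in> schwartz"
  shows "hankel_clifford (vcnj z) \<nu> (hankel_clifford z \<nu> f) = f"
proof -
  note T = clifford_transform_schwartz[OF f \<nu> dilation_pos[OF z]]
  have "hankel_clifford (vcnj z) \<nu> (hankel_clifford z \<nu> f) =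
     (\<lambda>t. total_phase (vcnj z) \<nu> * clifford_transform \<nu> (dilation z) (hankel_clifford z \<nu> f) t)"
    unfolding hankel_clifford_eq[OF vcnj_torus[OF z] \<nu> hankel_clifford_schwartz[OF z \<nu> f]] dilation_vcnj ..
  also have "clifford_transform \<nu> (dilation z) (hankel_clifford z \<nu> f) = (\<lambda>t. total_phase z \<nu> * f t)"
    using clifford_transform_linear[OF T T \<nu>, of "dilation z" "total_phase z \<nu>" 0]
    unfolding hankel_clifford_eq[OF z \<nu> f] clifford_transform_involution[OF f \<nu> dilation_pos[OF z]] by simp
  finally show ?thesis using total_phase_vcnj[OF z, of \<nu>] by (simp add: mult.assoc[symmetric])
qed

lemma pdiffs0_linear:
  assumes f: "smooth0 f" and g: "smooth0 g"
  shows "pdiffs0 cs (\<lambda>x. a * f x + b * g x) = (\<lambda>x. a * pdiffs0 cs f x + b * pdiffs0 cs g x)"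
proof (induction cs)
  case (Cons c cs)
  show ?case unfolding pdiffs0_simps Cons.IH by (rule pdiff0_linear[OF smooth0_pdiffs0[OF f] smooth0_pdiffs0[OF g]])
qed simp

lemma schwartz_seminorm_triangle:
  fixes f g :: "(real ^ 'm) \<times> (real ^ 'n) \<Rightarrow> complex"
  assumes f: "f \<in> schwartz" and g: "g \<in> schwartz"
  shows "schwartz_seminorm k p (\<lambda>x. a * f x + b * g x) \<le> cmod a * schwartz_seminorm k p f + cmod b * schwartz_seminorm k p g"
proof -
  obtain cs :: "('m + 'n) list" where cs: "\<And>i. count_list cs (Inl i) = fst p $ i" "\<And>j. count_list cs (Inr j) = snd p $ j"
    using ex_mdiff_list[of "fst p" "snd p"] by blast
  have e: "schwartz_seminorm k p h = sup_seminorm k (pdiffs0 cs h)" if "h \<in> schwartz" for h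
    using schwartz_seminorm_eq[OF schwartz_smooth0[OF that] cs, of k] by simp
  have "sup_seminorm k (\<lambda>x. a * pdiffs0 cs f x + b * pdiffs0 cs g x) \<le> cmod a * sup_seminorm k (pdiffs0 cs f) + cmod b * sup_seminorm k (pdiffs0 cs g)"
    unfolding sup_seminorm_def[of k "\<lambda>x. a * pdiffs0 cs f x + b * pdiffs0 cs g x"]
  proof (rule cSUP_least)
    have "((\<chi> i. 1), (\<chi> i. 1)) \<in> (orthant2 :: ((real ^ 'm) \<times> (real ^ 'n)) set)" by (auto simp: pos_orthant_def)
    then show "orthant2 \<noteq> ({} :: ((real ^ 'm) \<times> (real ^ 'n)) set)" by blast
    fix x :: "(real ^ 'm) \<times> (real ^ 'n)" assume x: "x \<in> orthant2"
    have "mpow x k * cmod (a * pdiffs0 cs f x + b * pdiffs0 cs g x) \<le> mpow x k * (cmod a * cmod (pdiffs0 cs f x) + cmod b * cmod (pdiffs0 cs g x))"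
      using mpow_nonneg[OF x] by (intro mult_left_mono order_trans[OF norm_triangle_ineq]) (auto simp: norm_mult)
    also have "\<dots> = cmod a * (mpow x k * cmod (pdiffs0 cs f x)) + cmod b * (mpow x k * cmod (pdiffs0 cs g x))"
      by (simp add: algebra_simps)
    also have "\<dots> \<le> cmod a * sup_seminorm k (pdiffs0 cs f) + cmod b * sup_seminorm k (pdiffs0 cs g)"
      by (intro add_mono mult_left_mono mpow_le_sup_seminorm schwartz_pdiffs0 f g x) auto
    finally show "mpow x k * cmod (a * pdiffs0 cs f x + b * pdiffs0 cs g x) \<le> cmod a * sup_seminorm k (pdiffs0 cs f) + cmod b * sup_seminorm k (pdiffs0 cs g)" .
  qed
  then show ?thesis
    unfolding e[OF f] e[OF g] e[OF schwartz_linear[OF f g]] pdiffs0_linear[OF schwartz_smooth0[OF f] schwartz_smooth0[OF g]] .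
qed

lemma schwartz_diff: "f \<in> schwartz \<Longrightarrow> g \<in> schwartz \<Longrightarrow> (\<lambda>x. f x - g x) \<in> schwartz"
  using schwartz_linear[of f g 1 "-1"] by simp

lemma schwartz_seminorm_0: "schwartz_seminorm k p (\<lambda>x :: (real ^ 'm) \<times> (real ^ 'n). 0) = 0"
proof -
  have "((\<chi> i. 1), (\<chi> i. 1)) \<in> (orthant2 :: ((real ^ 'm) \<times> (real ^ 'n)) set)" by (auto simp: pos_orthant_def)
  then have "(orthant2 :: ((real ^ 'm) \<times> (real ^ 'n)) set) \<noteq> {}" by blast
  then show ?thesis unfolding schwartz_seminorm_def mdiff_def by (simp add: pdiffs_zero del: Times_empty)
qed

text \<open>
  For a linear map, continuity at every point follows from bounds on seminorms: the preimage of a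
  subbasic set contains, around each of its points, a finite intersection of seminorm balls.
\<close>

lemma schwartz_continuous_map:
  fixes F :: "((real ^ 'm) \<times> (real ^ 'n) \<Rightarrow> complex) \<Rightarrow> (real ^ 'm) \<times> (real ^ 'n) \<Rightarrow> complex"
  assumes F: "\<And>f. f \<in> schwartz \<Longrightarrow> F f \<in> schwartz" and lin: "complex_linear_on schwartz F"
    and est: "\<And>k p. \<exists>I q C. finite I \<and> 0 \<le> C \<and> (\<forall>f\<in>schwartz. schwartz_seminorm k p (F f) \<le> C * (\<Sum>\<kappa>\<in>I. schwartz_seminorm \<kappa> q f))"
  shows "continuous_map schwartz_topology schwartz_topology F"
proof -
  let ?B = "\<lambda>k p f e. {g \<in> schwartz. schwartz_seminorm k p (\<lambda>x. g x - f x) < e} :: ((real ^ 'm) \<times> (real ^ 'n) \<Rightarrow> complex) set"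
  let ?S = "{?B k p f e | k p f e. f \<in> schwartz \<and> 0 < e}"
  have basic: "openin schwartz_topology (?B k p f e)" if "f \<in> schwartz" "0 < e" for k p f e
    unfolding schwartz_topology_def by (rule topology_generated_by_Basis) (use that in blast)
  have ts: "topspace schwartz_topology = \<Union>?S"
    unfolding schwartz_topology_def by (rule topology_generated_by_topspace)
  have "continuous_map schwartz_topology (topology_generated_by ?S) F"
  proof (rule continuous_on_generated_topo)
    show "F ` topspace schwartz_topology \<subseteq> \<Union>?S"
      unfolding ts[symmetric] topspace_schwartz_topology using F by blast
    fix U assume "U \<in> ?S"
    then obtain k p h e where U: "U = ?B k p h e" and h: "h \<in> schwartz" and e: "0 < e" by blast
    obtain I q C where I: "finite I" "0 \<le> C" and est': "\<And>f. f \<in> schwartz \<Longrightarrow> schwartz_seminorm k p (F f) \<le> C * (\<Sum>\<kappa>\<in>I. schwartz_seminorm \<kappa> q f)"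
      using est[of k p] by blast
    show "openin schwartz_topology (F -` U \<inter> topspace schwartz_topology)"
    proof (subst openin_subopen, intro ballI)
      fix f assume "f \<in> F -` U \<inter> topspace schwartz_topology"
      then have f: "f \<in> schwartz" and fe: "schwartz_seminorm k p (\<lambda>x. F f x - h x) < e"
        unfolding U topspace_schwartz_topology by auto
      define \<eta> where "\<eta> = (e - schwartz_seminorm k p (\<lambda>x. F f x - h x)) / (C * real (card I) + 1)"
      have den: "0 < C * real (card I) + 1" using I by (simp add: add_nonneg_pos)
      have \<eta>: "0 < \<eta>" unfolding \<eta>_def using fe den by simp
      have sum_lt: "C * (real (card I) * \<eta>) < e - schwartz_seminorm k p (\<lambda>x. F f x - h x)"
      proof -
        have "C * (real (card I) * \<eta>) < (C * real (card I) + 1) * \<eta>" using \<eta> by (simp add: algebra_simps)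
        also have "\<dots> = e - schwartz_seminorm k p (\<lambda>x. F f x - h x)" unfolding \<eta>_def using den by simp
        finally show ?thesis .
      qed
      let ?T = "(\<Inter>\<kappa>\<in>I. ?B \<kappa> q f \<eta>) \<inter> topspace schwartz_topology"
      have "openin schwartz_topology ?T"
        by (intro openin_INT I(1) basic f \<eta>)
      moreover have "f \<in> ?T"
        unfolding topspace_schwartz_topology using f \<eta> by (simp add: schwartz_seminorm_0)
      moreover have "?T \<subseteq> F -` U \<inter> topspace schwartz_topology"
      proof
        fix g assume "g \<in> ?T"
        then have g: "g \<in> schwartz" and gI: "\<And>\<kappa>. \<kappa> \<in> I \<Longrightarrow> schwartz_seminorm \<kappa> q (\<lambda>x. g x - f x) < \<eta>"
          unfolding topspace_schwartz_topology by auto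
        have lin': "F (\<lambda>x. g x - f x) = (\<lambda>x. F g x - F f x)"
        proof -
          have "F (\<lambda>x. 1 * g x + (-1) * f x) = (\<lambda>x. 1 * F g x + (-1) * F f x)"
            using lin f g unfolding complex_linear_on_def by blast
          then show ?thesis by simp
        qed
        have "schwartz_seminorm k p (\<lambda>x. F g x - h x) = schwartz_seminorm k p (\<lambda>x. 1 * F (\<lambda>x. g x - f x) x + 1 * (F f x - h x))"
          unfolding lin' by simp
        also have "\<dots> \<le> cmod 1 * schwartz_seminorm k p (F (\<lambda>x. g x - f x)) + cmod 1 * schwartz_seminorm k p (\<lambda>x. F f x - h x)"
          by (intro schwartz_seminorm_triangle F schwartz_diff f g h)
        also have "schwartz_seminorm k p (F (\<lambda>x. g x - f x)) \<le> C * (\<Sum>\<kappa>\<in>I. schwartz_seminorm \<kappa> q (\<lambda>x. g x - f x))"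
          by (intro est' schwartz_diff f g)
        also have "(\<Sum>\<kappa>\<in>I. schwartz_seminorm \<kappa> q (\<lambda>x. g x - f x)) \<le> real (card I) * \<eta>"
          by (rule sum_bounded_above) (rule less_imp_le[OF gI])
        finally have "schwartz_seminorm k p (\<lambda>x. F g x - h x) < e"
          using sum_lt I(2) by (simp add: mult_left_mono)
        then show "g \<in> F -` U \<inter> topspace schwartz_topology"
          unfolding U topspace_schwartz_topology using g F by simp
      qed
      ultimately show "\<exists>T. openin schwartz_topology T \<and> f \<in> T \<and> T \<subseteq> F -` U \<inter> topspace schwartz_topology" by blast
    qed
  qed
  then show ?thesis unfolding schwartz_topology_def .
qed

lemma hankel_clifford_continuous:
  fixes z :: "complex ^ 'm" and \<nu> :: "real ^ 'm"
  assumes z: "z \<in> torus" and \<nu>: "\<forall>l. 0 \<le> \<nu> $ l"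
  shows "continuous_map schwartz_topology schwartz_topology
    (hankel_clifford z \<nu> :: ((real ^ 'm) \<times> (real ^ 'n) \<Rightarrow> complex) \<Rightarrow> (real ^ 'm) \<times> (real ^ 'n) \<Rightarrow> complex)"
proof (rule schwartz_continuous_map[OF hankel_clifford_schwartz[OF z \<nu>] hankel_clifford_linear[OF z \<nu>]])
  fix k p :: "(nat ^ 'm) \<times> (nat ^ 'n)"
  obtain I q C where I: "finite I" "0 \<le> C" and est: "\<And>f. f \<in> schwartz \<Longrightarrow>
     schwartz_seminorm k p (clifford_transform \<nu> (dilation z) f) \<le> C * (\<Sum>\<kappa>\<in>I. schwartz_seminorm \<kappa> q f)"
    using clifford_transform_seminorm_estimate[OF \<nu> dilation_pos[OF z], of k p] by blast
  have "schwartz_seminorm k p (hankel_clifford z \<nu> f) \<le> C * (\<Sum>\<kappa>\<in>I. schwartz_seminorm \<kappa> q f)" if f: "f \<in> schwartz" for f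
  proof -
    have T: "clifford_transform \<nu> (dilation z) f \<in> schwartz" by (rule clifford_transform_schwartz[OF f \<nu> dilation_pos[OF z]])
    have "schwartz_seminorm k p (hankel_clifford z \<nu> f) \<le> schwartz_seminorm k p (clifford_transform \<nu> (dilation z) f)"
      using schwartz_seminorm_triangle[OF T T, of k p "total_phase z \<nu>" 0]
      unfolding hankel_clifford_eq[OF z \<nu> f] cmod_total_phase[OF z] by simp
    also note est[OF f]
    finally show ?thesis .
  qed
  then show "\<exists>I q C. finite I \<and> 0 \<le> C \<and> (\<forall>f\<in>schwartz. schwartz_seminorm k p (hankel_clifford z \<nu> f) \<le> C * (\<Sum>\<kappa>\<in>I. schwartz_seminorm \<kappa> q f))"
    using I by blast
qed

lemma hankel_clifford_isomorphism:
  fixes z :: "complex ^ 'm" and \<nu> :: "real ^ 'm"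
  assumes z: "z \<in> torus" and \<nu>: "\<forall>l. 0 \<le> \<nu> $ l"
  shows "schwartz_isomorphism
    (hankel_clifford z \<nu> :: ((real ^ 'm) \<times> (real ^ 'n) \<Rightarrow> complex) \<Rightarrow> (real ^ 'm) \<times> (real ^ 'n) \<Rightarrow> complex)"
  unfolding schwartz_isomorphism_def homeomorphic_map_maps homeomorphic_maps_def topspace_schwartz_topology
  using hankel_clifford_inverse[OF z \<nu>] hankel_clifford_inverse[OF vcnj_torus[OF z] \<nu>] unfolding vcnj_vcnj
  by (intro conjI hankel_clifford_linear z \<nu> exI[of _ "hankel_clifford (vcnj z) \<nu>"] hankel_clifford_continuous vcnj_torus ballI) blast+

section \<open>The isometry\<close>

lemma hankel_clifford_dense_isometry:
  fixes z :: "complex ^ 'm" and \<gamma>' :: "real ^ 'm" and \<gamma>'' :: "real ^ 'n"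
  assumes z: "z \<in> torus" and \<gamma>': "\<forall>l. 0 \<le> \<gamma>' $ l" and \<gamma>'': "\<forall>l. 0 \<le> \<gamma>'' $ l"
  shows "dense_isometry (weighted_measure \<gamma>' \<gamma>'') schwartz (hankel_clifford z \<gamma>')"
  unfolding dense_isometry_def
proof (intro conjI ballI allI impI)
  let ?M = "weighted_measure \<gamma>' \<gamma>''"
  show "schwartz \<subseteq> L2 ?M" using schwartz_L2_weighted[OF _ \<gamma>' \<gamma>''] by blast
  fix f :: "(real ^ 'm) \<times> (real ^ 'n) \<Rightarrow> complex" assume f: "f \<in> schwartz"
  have J: "hankel_clifford z \<gamma>' f \<in> schwartz" by (rule hankel_clifford_schwartz[OF z \<gamma>' f])
  have "ennreal ((L2_norm ?M (hankel_clifford z \<gamma>' f))\<^sup>2) = ennreal ((L2_norm ?M f)\<^sup>2)"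
    unfolding L2_nn_integral[OF schwartz_L2_weighted[OF J \<gamma>' \<gamma>''], symmetric] L2_nn_integral[OF schwartz_L2_weighted[OF f \<gamma>' \<gamma>''], symmetric]
      nn_integral_weighted_schwartz[OF J] nn_integral_weighted_schwartz[OF f] clifford_transform_parseval[OF f \<gamma>' dilation_pos[OF z], symmetric]
    by (simp add: hankel_clifford_eq[OF z \<gamma>' f] norm_mult cmod_total_phase[OF z])
  then show "L2_norm ?M (hankel_clifford z \<gamma>' f) = L2_norm ?M f" by simp
qed (use schwartz_linear schwartz_dense[OF \<gamma>' \<gamma>''] hankel_clifford_schwartz[OF z \<gamma>'] hankel_clifford_linear[OF z \<gamma>'] in blast)+

section \<open>Weighted norms of derivatives\<close>

lemma vpow_half_power2: "(vpow x (\<chi> l. \<alpha> $ l / 2))\<^sup>2 = vpow x \<alpha>"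
  unfolding vpow_def power2_eq_square prod.distrib[symmetric] powr_add[symmetric] by simp

lemma weighted_schwartz_L2_orthant:
  fixes g :: "(real ^ 'm) \<times> (real ^ 'n) \<Rightarrow> complex"
  assumes g: "g \<in> schwartz" and \<alpha>: "\<forall>l. 0 \<le> \<alpha> $ l" and \<beta>: "\<forall>l. 0 \<le> \<beta> $ l"
    and F: "\<And>x. x \<in> orthant2 \<Longrightarrow> F x = of_real (vpow (fst x) (\<chi> l. \<alpha> $ l / 2) * vpow (snd x) (\<chi> l. \<beta> $ l / 2)) * g x"
  shows "F \<in> L2 orthant_measure"
    and "ennreal ((L2_norm orthant_measure F)\<^sup>2) = (\<integral>\<^sup>+x. ennreal ((cmod (g x))\<^sup>2 * (vpow (fst x) \<alpha> * vpow (snd x) \<beta>)) \<partial>lborel)"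
proof -
  let ?w = "\<lambda>x. vpow (fst x) (\<chi> l. \<alpha> $ l / 2) * vpow (snd x) (\<chi> l. \<beta> $ l / 2)"
  have sq: "(cmod (F x))\<^sup>2 = (cmod (g x))\<^sup>2 * (vpow (fst x) \<alpha> * vpow (snd x) \<beta>)" if "x \<in> orthant2" for x
    unfolding F[OF that] by (simp add: norm_mult power_mult_distrib vpow_half_power2)
  have nn: "(\<integral>\<^sup>+x. ennreal ((cmod (F x))\<^sup>2) \<partial>orthant_measure) = (\<integral>\<^sup>+x. ennreal ((cmod (g x))\<^sup>2 * (vpow (fst x) \<alpha> * vpow (snd x) \<beta>)) \<partial>lborel)"
    unfolding nn_integral_orthant_measure
  proof (rule nn_integral_cong)
    fix x
    show "ennreal ((cmod (F x))\<^sup>2) * indicator orthant2 x = ennreal ((cmod (g x))\<^sup>2 * (vpow (fst x) \<alpha> * vpow (snd x) \<beta>))"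
      using schwartz_outside[OF g, of x] sq[of x] by (cases "x \<in> orthant2") (simp_all only: indicator_simps mult_1_right norm_zero, simp_all)
  qed
  have "F \<in> borel_measurable orthant_measure \<longleftrightarrow> (\<lambda>x. of_real (?w x) * g x) \<in> borel_measurable orthant_measure"
    by (rule measurable_cong) (auto simp: orthant_measure_def space_restrict_space F)
  moreover have "(\<lambda>x. of_real (?w x) * g x) \<in> borel_measurable orthant_measure"
  proof (rule borel_measurable_orthant_measure)
    note [measurable] = schwartz_measurable[OF g]
    show "(\<lambda>x. of_real (?w x) * g x) \<in> borel_measurable borel" by measurable
  qed
  ultimately show FL: "F \<in> L2 orthant_measure"
    unfolding L2_iff nn using schwartz_square_weighted_finite[OF g \<alpha> \<beta>] by blast
  show "ennreal ((L2_norm orthant_measure F)\<^sup>2) = (\<integral>\<^sup>+x. ennreal ((cmod (g x))\<^sup>2 * (vpow (fst x) \<alpha> * vpow (snd x) \<beta>)) \<partial>lborel)"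
    using L2_nn_integral[OF FL] nn by simp
qed

text \<open>
  First the \<open>k'\<close> derivatives are absorbed into the order of the transform at the cost of
  \<open>(-a)\<^bsup>k'\<^esup>\<close>. Then \<open>p'\<close> integrations by parts move derivatives onto \<open>f\<close> at the cost of
  \<open>(-1/a)\<^bsup>p'\<^esup>\<close>. Both steps raise the order.
\<close>

lemma mdiff_hankel_clifford:
  fixes f :: "(real ^ 'm) \<times> (real ^ 'n) \<Rightarrow> complex" and p' k' :: "nat ^ 'm" and p'' :: "nat ^ 'n"
  assumes z: "z \<in> torus" and \<nu>: "\<forall>l. 0 \<le> \<nu> $ l" and f: "f \<in> schwartz"
  shows "\<exists>g\<in>schwartz. (\<forall>x\<in>orthant2. mdiff (p', p'') f x = g x) \<and>
    (\<exists>K. cmod K = (\<Prod>l\<in>UNIV. cmod (1 - z $ l) powi (int (p' $ l) - int (k' $ l))) \<and>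
      (\<forall>x\<in>orthant2. mdiff (k', p'') (hankel_clifford z \<nu> f) x = K * clifford_transform (\<chi> l. real (p' $ l) + real (k' $ l) + \<nu> $ l) (dilation z) g x))"
proof -
  let ?a = "dilation z"
  note a = dilation_pos[OF z]
  obtain ks where ks: "\<And>l. count_list ks l = k' $ l" using exists_list_count_vec by blast
  obtain ps where ps: "\<And>l. count_list ps l = p' $ l" using exists_list_count_vec by blast
  obtain js where js: "\<And>j. count_list js j = p'' $ j" using exists_list_count_vec by blast
  define g0 where "g0 = pdiffs0 (map Inr js) f"
  define g where "g = pdiffs0 (map Inl ps @ map Inr js) f"
  have g0: "g0 \<in> schwartz" unfolding g0_def by (rule schwartz_pdiffs0[OF f])
  have gS: "g \<in> schwartz" unfolding g_def by (rule schwartz_pdiffs0[OF f])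
  have g_eq: "mdiff (p', p'') f x = g x" if "x \<in> orthant2" for x
    unfolding g_def by (rule mdiff_eq_pdiffs0[OF schwartz_smooth0[OF f] that]) (simp_all only: count_list_map_Inl count_list_map_Inr ps js)
  define K where "K = total_phase z \<nu> * ((\<Prod>l\<in>UNIV. (- complex_of_real (?a $ l)) ^ count_list ks l) *
     (\<Prod>l\<in>UNIV. (- complex_of_real (inverse (?a $ l))) ^ count_list ps l))"
  have T: "clifford_transform \<nu> ?a f \<in> schwartz" by (rule clifford_transform_schwartz[OF f \<nu> a])
  have order: "\<nu> + count_vec ks + count_vec ps = (\<chi> l. real (p' $ l) + real (k' $ l) + \<nu> $ l)"
    by (simp add: vec_eq_iff count_vec_def ks ps)
  have "mdiff (k', p'') (hankel_clifford z \<nu> f) x = K * clifford_transform (\<chi> l. real (p' $ l) + real (k' $ l) + \<nu> $ l) ?a g x" if x: "x \<in> orthant2" for x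
  proof -
    have "mdiff (k', p'') (hankel_clifford z \<nu> f) x = pdiffs0 (map Inl ks @ map Inr js) (hankel_clifford z \<nu> f) x"
      by (rule mdiff_eq_pdiffs0[OF schwartz_smooth0[OF hankel_clifford_schwartz[OF z \<nu> f]] x]) (simp_all only: count_list_map_Inl count_list_map_Inr ks js)
    also have "\<dots> = total_phase z \<nu> * pdiffs0 (map Inl ks @ map Inr js) (clifford_transform \<nu> ?a f) x"
      unfolding hankel_clifford_eq[OF z \<nu> f]
      using pdiffs0_linear[OF schwartz_smooth0[OF T] schwartz_smooth0[OF T], of "map Inl ks @ map Inr js" "total_phase z \<nu>" 0] by simp
    also have "pdiffs0 (map Inl ks @ map Inr js) (clifford_transform \<nu> ?a f) x = (\<Prod>l\<in>UNIV. (- complex_of_real (?a $ l)) ^ count_list ks l) * clifford_transform (\<nu> + count_vec ks) ?a g0 x"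
      unfolding pdiffs0_append pdiffs0_Inr_clifford_transform[OF f \<nu>] g0_def[symmetric] pdiffs0_Inl_clifford_transform[OF g0 \<nu> a] ..
    also have "clifford_transform (\<nu> + count_vec ks) ?a g0 x = (\<Prod>l\<in>UNIV. (- complex_of_real (inverse (?a $ l))) ^ count_list ps l) *
        clifford_transform (\<nu> + count_vec ks + count_vec ps) ?a (pdiffs0 (map Inl ps) g0) x"
      by (rule clifford_transform_by_parts_iterated[OF g0 count_vec_nonneg[OF \<nu>] a])
    also have "pdiffs0 (map Inl ps) g0 = g" by (simp only: g_def g0_def pdiffs0_append)
    finally show ?thesis unfolding order K_def by (simp only: mult.assoc)
  qed
  moreover have "cmod K = (\<Prod>l\<in>UNIV. cmod (1 - z $ l) powi (int (p' $ l) - int (k' $ l)))"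
  proof -
    have "cmod K = (\<Prod>l\<in>UNIV. (inverse (cmod (1 - z $ l))) ^ (k' $ l) * cmod (1 - z $ l) ^ (p' $ l))"
      unfolding K_def norm_mult cmod_total_phase[OF z] prod_norm[symmetric] norm_power norm_minus_cancel norm_of_real prod.distrib[symmetric]
      by (simp add: dilation_def ks ps)
    also have "\<dots> = (\<Prod>l\<in>UNIV. cmod (1 - z $ l) powi (int (p' $ l) - int (k' $ l)))"
    proof (rule prod.cong[OF refl])
      fix l
      have "cmod (1 - z $ l) \<noteq> 0" using torusD(2)[OF z, of l] by simp
      then show "(inverse (cmod (1 - z $ l))) ^ (k' $ l) * cmod (1 - z $ l) ^ (p' $ l) = cmod (1 - z $ l) powi (int (p' $ l) - int (k' $ l))"
        by (simp add: power_int_diff divide_inverse power_inverse mult.commute)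
    qed
    finally show ?thesis .
  qed
  ultimately show ?thesis using gS g_eq by blast
qed

theorem proposition4p4:
  fixes z :: "complex ^ 'm" and \<gamma>' :: "real ^ 'm" and \<gamma>'' :: "real ^ 'n"
  assumes "\<forall>l. 0 \<le> \<gamma>' $ l" and "\<forall>l. 0 \<le> \<gamma>'' $ l" and "z \<in> torus"
  shows "schwartz_isomorphism
           (hankel_clifford z \<gamma>' ::
              ((real ^ 'm) \<times> (real ^ 'n) \<Rightarrow> complex) \<Rightarrow> (real ^ 'm) \<times> (real ^ 'n) \<Rightarrow> complex)
       \<and> (\<exists>U V.
            L2_isometry_onto (weighted_measure \<gamma>' \<gamma>'') U \<and>
            L2_extends (weighted_measure \<gamma>' \<gamma>'') schwartz (hankel_clifford z \<gamma>') U \<and>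
            L2_isometry_onto (weighted_measure \<gamma>' \<gamma>'') V \<and>
            L2_extends (weighted_measure \<gamma>' \<gamma>'') schwartz (hankel_clifford (vcnj z) \<gamma>') V \<and>
            L2_inverse (weighted_measure \<gamma>' \<gamma>'') U V)
       \<and> (\<forall>(p' :: nat ^ 'm) (p'' :: nat ^ 'n) (k' :: nat ^ 'm) (k'' :: nat ^ 'n).
            \<forall>f \<in> schwartz.
              let w = (\<lambda>t. vpow (fst t) (\<chi> l. (real (p' $ l) + real (k' $ l) + \<gamma>' $ l) / 2) *
                           vpow (snd t) (\<chi> l. (real (p'' $ l) + real (k'' $ l)) / 2));
                  F = (\<lambda>t. of_real (w t) * mdiff (p', p'') f t);
                  G = (\<lambda>t. of_real (w t) * mdiff (k', p'') (hankel_clifford z \<gamma>' f) t)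
              in F \<in> L2 orthant_measure \<and> G \<in> L2 orthant_measure \<and>
                 L2_norm orthant_measure F =
                   (\<Prod>l\<in>UNIV. cmod (1 - z $ l) powi (int (k' $ l) - int (p' $ l))) *
                   L2_norm orthant_measure G)"
proof (intro conjI allI ballI)
  note \<gamma>' = assms(1) and \<gamma>'' = assms(2) and z = assms(3)
  show "schwartz_isomorphism (hankel_clifford z \<gamma>' ::
              ((real ^ 'm) \<times> (real ^ 'n) \<Rightarrow> complex) \<Rightarrow> (real ^ 'm) \<times> (real ^ 'n) \<Rightarrow> complex)"
    by (rule hankel_clifford_isomorphism[OF z \<gamma>'])
  show "\<exists>U V.
            L2_isometry_onto (weighted_measure \<gamma>' \<gamma>'') U \<and>
            L2_extends (weighted_measure \<gamma>' \<gamma>'') schwartz (hankel_clifford z \<gamma>') U \<and>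
            L2_isometry_onto (weighted_measure \<gamma>' \<gamma>'') V \<and>
            L2_extends (weighted_measure \<gamma>' \<gamma>'') schwartz (hankel_clifford (vcnj z) \<gamma>') V \<and>
            L2_inverse (weighted_measure \<gamma>' \<gamma>'') U V"
    using hankel_clifford_inverse[OF z \<gamma>'] hankel_clifford_inverse[OF vcnj_torus[OF z] \<gamma>', unfolded vcnj_vcnj]
    by (intro dense_isometry_extension hankel_clifford_dense_isometry z vcnj_torus \<gamma>' \<gamma>'') blast+
  fix p' k' :: "nat ^ 'm" and p'' k'' :: "nat ^ 'n" and f :: "(real ^ 'm) \<times> (real ^ 'n) \<Rightarrow> complex"
  assume f: "f \<in> schwartz"
  define \<alpha> where "\<alpha> = (\<chi> l. real (p' $ l) + real (k' $ l) + \<gamma>' $ l)"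
  define \<beta> where "\<beta> = (\<chi> l. real (p'' $ l) + real (k'' $ l))"
  have \<alpha>: "\<forall>l. 0 \<le> \<alpha> $ l" using \<gamma>' by (simp add: \<alpha>_def)
  have \<beta>: "\<forall>l. 0 \<le> \<beta> $ l" by (simp add: \<beta>_def)
  define w where "w = (\<lambda>t. vpow (fst t) (\<chi> l. (real (p' $ l) + real (k' $ l) + \<gamma>' $ l) / 2) *
                           vpow (snd t) (\<chi> l. (real (p'' $ l) + real (k'' $ l)) / 2))"
  define F where "F = (\<lambda>t. of_real (w t) * mdiff (p', p'') f t)"
  define G where "G = (\<lambda>t. of_real (w t) * mdiff (k', p'') (hankel_clifford z \<gamma>' f) t)"
  have w: "w t = vpow (fst t) (\<chi> l. \<alpha> $ l / 2) * vpow (snd t) (\<chi> l. \<beta> $ l / 2)" for t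
    by (simp add: w_def \<alpha>_def \<beta>_def)
  obtain g K where g: "g \<in> schwartz" and Fg: "\<And>x. x \<in> orthant2 \<Longrightarrow> mdiff (p', p'') f x = g x"
    and K: "cmod K = (\<Prod>l\<in>UNIV. cmod (1 - z $ l) powi (int (p' $ l) - int (k' $ l)))"
    and Gg: "\<And>x. x \<in> orthant2 \<Longrightarrow> mdiff (k', p'') (hankel_clifford z \<gamma>' f) x = K * clifford_transform \<alpha> (dilation z) g x"
    using mdiff_hankel_clifford[OF z \<gamma>' f, of p' p'' k'] unfolding \<alpha>_def by blast
  define h where "h = clifford_transform \<alpha> (dilation z) g"
  have h: "h \<in> schwartz" unfolding h_def by (rule clifford_transform_schwartz[OF g \<alpha> dilation_pos[OF z]])
  have Kh: "(\<lambda>x. K * h x) \<in> schwartz" using schwartz_linear[OF h h, of K 0] by simp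
  note F' = weighted_schwartz_L2_orthant[OF g \<alpha> \<beta>, of F] and G' = weighted_schwartz_L2_orthant[OF Kh \<alpha> \<beta>, of G]
    and H' = weighted_schwartz_L2_orthant[OF h \<alpha> \<beta>, of "\<lambda>t. of_real (w t) * h t"]
  have FL: "F \<in> L2 orthant_measure" by (rule F'(1)) (simp only: F_def w Fg)
  have GL: "G \<in> L2 orthant_measure" by (rule G'(1)) (simp only: G_def w Gg h_def)
  have "ennreal ((L2_norm orthant_measure F)\<^sup>2) = ennreal ((L2_norm orthant_measure (\<lambda>t. of_real (w t) * h t))\<^sup>2)"
  proof -
    have "ennreal ((L2_norm orthant_measure F)\<^sup>2) = (\<integral>\<^sup>+x. ennreal ((cmod (g x))\<^sup>2 * (vpow (fst x) \<alpha> * vpow (snd x) \<beta>)) \<partial>lborel)"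
      by (rule F'(2)) (simp only: F_def w Fg)
    also have "\<dots> = (\<integral>\<^sup>+x. ennreal ((cmod (h x))\<^sup>2 * (vpow (fst x) \<alpha> * vpow (snd x) \<beta>)) \<partial>lborel)"
      unfolding h_def by (rule clifford_transform_parseval[OF g \<alpha> dilation_pos[OF z], symmetric])
    also have "\<dots> = ennreal ((L2_norm orthant_measure (\<lambda>t. of_real (w t) * h t))\<^sup>2)"
      by (rule H'(2)[symmetric]) (simp only: w)
    finally show ?thesis .
  qed
  then have FH: "L2_norm orthant_measure F = L2_norm orthant_measure (\<lambda>t. of_real (w t) * h t)" by simp
  have "L2_norm orthant_measure G = L2_norm orthant_measure (\<lambda>t. K * (of_real (w t) * h t))"
  proof (rule L2_norm_cong_AE)
    have "AE t in orthant_measure. t \<in> orthant2"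
      unfolding orthant_measure_def by (rule AE_I2) (simp add: space_restrict_space)
    then show "AE t in orthant_measure. G t = K * (of_real (w t) * h t)"
      by eventually_elim (simp only: G_def Gg h_def mult.left_commute)
    show "G \<in> borel_measurable orthant_measure" by (rule L2_measurable[OF GL])
    show "(\<lambda>t. K * (of_real (w t) * h t)) \<in> borel_measurable orthant_measure"
      by (intro L2_measurable L2_cmult H'(1)) (simp only: w)
  qed
  also have "\<dots> = cmod K * L2_norm orthant_measure F" unfolding FH by (rule L2_norm_cmult)
  finally have GF: "L2_norm orthant_measure G = cmod K * L2_norm orthant_measure F" .
  have "(\<Prod>l\<in>UNIV. cmod (1 - z $ l) powi (int (k' $ l) - int (p' $ l))) * cmod K = 1"
  proof -
    have "cmod (1 - z $ l) powi (int (k' $ l) - int (p' $ l)) * cmod (1 - z $ l) powi (int (p' $ l) - int (k' $ l)) = 1" for l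
    proof -
      have "cmod (1 - z $ l) \<noteq> 0" using torusD(2)[OF z, of l] by simp
      then show ?thesis by (simp add: power_int_diff)
    qed
    then show ?thesis unfolding K prod.distrib[symmetric] by simp
  qed
  then have "L2_norm orthant_measure F = (\<Prod>l\<in>UNIV. cmod (1 - z $ l) powi (int (k' $ l) - int (p' $ l))) * L2_norm orthant_measure G"
    unfolding GF by (simp add: mult.assoc[symmetric])
  then show "let w = (\<lambda>t. vpow (fst t) (\<chi> l. (real (p' $ l) + real (k' $ l) + \<gamma>' $ l) / 2) *
                           vpow (snd t) (\<chi> l. (real (p'' $ l) + real (k'' $ l)) / 2));
                  F = (\<lambda>t. of_real (w t) * mdiff (p', p'') f t);
                  G = (\<lambda>t. of_real (w t) * mdiff (k', p'') (hankel_clifford z \<gamma>' f) t)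
              in F \<in> L2 orthant_measure \<and> G \<in> L2 orthant_measure \<and>
                 L2_norm orthant_measure F =
                   (\<Prod>l\<in>UNIV. cmod (1 - z $ l) powi (int (k' $ l) - int (p' $ l))) *
                   L2_norm orthant_measure G"
    using FL GL unfolding Let_def F_def G_def w_def by blast
qed

end
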